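(* Let $X$ be a second countable locally compact Abelian group. The following two conditions are equivalent. (i) For every integer $n\ge 2$, all families of integers $\{a_j\}_{j=1}^n$ and $\{b_j\}_{j=1}^n$ that are admissible for $X$, and all $Q$-independent random variables $\xi_1,\dots,\xi_n$ with values in $X$ and distributions $\mu_1,\dots,\mu_n$ with non-vanishing characteristic functions: if the linear forms $L_1=a_1\xi_1+\dots+a_n\xi_n$ and $L_2=b_1\xi_1+\dots+b_n\xi_n$ are $Q$-independent, then $\mu_j\in\Gamma(X)$ for all $j=1,\dots,n$. (ii) Either $X$ is a torsion-free group, or $X^{(p)}=\{0\}$ for some prime number $p$. Moreover, if $X^{(p)}=\{0\}$ for a prime number $p$, then in the situation described in (i) (including the $Q$-independence of $L_1$ and $L_2$) all $\mu_j$ are degenerate distributions.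
   Context: The group $X$ is written additively. Let $Y$ be the character group (Pontryagin dual) of $X$, and let $(x,y)$ denote the value of the character $y\in Y$ at $x\in X$. For an integer $m$, $X^{(m)}=\{mx: x\in X\}$. A family of integers $\{a_j\}$ is called admissible for $X$ if $X^{(a_j)}\ne\{0\}$ for all $j$. "Torsion-free" means that $mx=0$ with $m\in\mathbb{Z}\setminus\{0\}$, $x\in X$, implies $x=0$. Random variables have values in $X$ with its Borel $\sigma$-algebra, and random variables considered jointly are defined on a common probability space. The characteristic function of a distribution $\mu$ on $X$ is $\widehat\mu(y)=\int_X (x,y)\,d\mu(x)$, $y\in Y$; $\mu_\xi$ denotes the distribution of a random variable $\xi$. A distribution is degenerate if it is concentrated at one point. Polynomials: for a function $f$ on an Abelian group $G$ and $h\in G$ put $\Delta_hf(y)=f(y+h)-f(y)$. A (complex-valued) function $f$ on $G$ is called a polynomial if for some non-negative integer $m$ one has $\Delta_h^{m+1}f(y)=0$ for all $y,h\in G$. $Q$-independence: random variables $\xi_1,\dots,\xi_n$ with values in $X$ are $Q$-independent if there is a continuous polynomial $q$ on the group $Y^n$ with $q(0,\dots,0)=0$ such that $$\mathbf{E}[(\xi_1,y_1)\cdots(\xi_n,y_n)]=\Big(\prod_{j=1}^n\widehat\mu_{\xi_j}(y_j)\Big)\exp\{q(y_1,\dots,y_n)\}\quad\text{for all } y_1,\dots,y_n\in Y.$$ Gaussian distributions: $\Gamma(X)$ is the set of probability distributions $\gamma$ on $X$ whose characteristic function has the form $\widehat\gamma(y)=(x,y)\exp\{-\varphi(y)\}$,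 $y\in Y$, where $x\in X$ and $\varphi$ is a continuous non-negative function on $Y$ satisfying $\varphi(u+v)+\varphi(u-v)=2[\varphi(u)+\varphi(v)]$ for all $u,v\in Y$. Degenerate distributions belong to $\Gamma(X)$. *)

theory Defs
  imports
    "HOL-Probability.Probability"
    "HOL-Library.Function_Algebras"
    "HOL-Computational_Algebra.Primes"
begin

definition zmult :: "int \<Rightarrow> 'a::ab_group_add \<Rightarrow> 'a" where
  "zmult m x = (if 0 \<le> m then (\<Sum>k<nat m. x) else - (\<Sum>k<nat (- m). x))"

definition multiples :: "int \<Rightarrow> 'a::ab_group_add set" where
  "multiples m = range (zmult m)"

definition torsion_free :: "'a::ab_group_add itself \<Rightarrow> bool" where
  "torsion_free _ \<longleftrightarrow> (\<forall>m (x::'a). m \<noteq> 0 \<and> zmult m x = 0 \<longrightarrow> x = 0)"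

definition admissible :: "'a::ab_group_add itself \<Rightarrow> 'i set \<Rightarrow> ('i \<Rightarrow> int) \<Rightarrow> bool" where
  "admissible _ I a \<longleftrightarrow> (\<forall>j\<in>I. multiples (a j) \<noteq> {0::'a})"

definition linear_form :: "'i set \<Rightarrow> ('i \<Rightarrow> int) \<Rightarrow> ('i \<Rightarrow> 'w \<Rightarrow> 'a::ab_group_add) \<Rightarrow> 'w \<Rightarrow> 'a" where
  "linear_form I a \<xi> = (\<lambda>\<omega>. \<Sum>j\<in>I. zmult (a j) (\<xi> j \<omega>))"

typedef (overloaded) ('a::topological_ab_group_add) character =
  "{f :: 'a \<Rightarrow> complex. continuous_on UNIV f \<and> (\<forall>x. norm (f x) = 1) \<and>
      (\<forall>x x'. f (x + x') = f x * f x')}"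
  morphisms char_app Abs_character
  by (rule exI[of _ "\<lambda>_. 1"]) simp

setup_lifting type_definition_character

text \<open>The group operation on characters is pointwise multiplication, written additively.\<close>

instantiation character :: (topological_ab_group_add) ab_group_add
begin

lift_definition zero_character :: "'a character" is "\<lambda>_. 1"
  by simp

lift_definition plus_character :: "'a character \<Rightarrow> 'a character \<Rightarrow> 'a character"
  is "\<lambda>f g x. f x * g x"
  by (auto intro!: continuous_intros simp: norm_mult)

lift_definition uminus_character :: "'a character \<Rightarrow> 'a character"
  is "\<lambda>f x. inverse (f x)"
  subgoal for f
    by (subgoal_tac "\<forall>x. f x \<noteq> 0")
      (auto intro!: continuous_intros simp: norm_inverse, metis norm_zero zero_neq_one)
  done

definition minus_character :: "'a character \<Rightarrow> 'a character \<Rightarrow> 'a character" where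
  "minus_character y z = y + (- z)"

instance
proof
  fix a b c :: "'a character"
  show "a + b + c = a + (b + c)" by transfer (simp add: mult.assoc)
  show "a + b = b + a" by transfer (simp add: mult.commute)
  show "0 + a = a" by transfer simp
  show "a - b = a + - b" by (rule minus_character_def)
  show "- a + a = 0"
  proof transfer
    fix f :: "'a \<Rightarrow> complex"
    assume "continuous_on UNIV f \<and> (\<forall>x. norm (f x) = 1) \<and>
      (\<forall>x x'. f (x + x') = f x * f x')"
    then have "f x \<noteq> 0" for x
      by (metis norm_zero zero_neq_one)
    then show "(\<lambda>x. inverse (f x) * f x) = (\<lambda>_. 1)" by simp
  qed
qed

end

text \<open>The compact-open topology.\<close>

instantiation character :: (topological_ab_group_add) topological_space
begin

definition open_character :: "'a character set \<Rightarrow> bool" where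
  "open_character = generate_topology
     {S. \<exists>K U. compact K \<and> open U \<and> S = {y. char_app y ` K \<subseteq> U}}"

instance
proof
  show "open (UNIV :: 'a character set)"
    unfolding open_character_def by (rule generate_topology.UNIV)
  show "open (S \<inter> T)" if "open S" "open T" for S T :: "'a character set"
    using that unfolding open_character_def by (rule generate_topology.Int)
  show "open (\<Union>K)" if "\<forall>S\<in>K. open S" for K :: "'a character set set"
    using that unfolding open_character_def by (intro generate_topology.UN) blast
qed

end

text \<open>
  The power of the dual group indexed by \<open>I\<close>, realised inside \<open>'i \<Rightarrow> 'a character\<close> (with pointwise
  addition and the product topology) as the subgroup of families vanishing outside \<open>I\<close>.
\<close>

definition dual_power :: "'i set \<Rightarrow> ('i \<Rightarrow> 'a::topological_ab_group_add character) set" where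
  "dual_power I = {y. \<forall>j. j \<notin> I \<longrightarrow> y j = 0}"

definition difference :: "'g::ab_group_add \<Rightarrow> ('g \<Rightarrow> complex) \<Rightarrow> 'g \<Rightarrow> complex" where
  "difference h f = (\<lambda>y. f (y + h) - f y)"

text \<open>Here \<open>G\<close> is meant to be (the carrier of) a subgroup of the type \<open>'g\<close>.\<close>

definition polynomial_on :: "'g::ab_group_add set \<Rightarrow> ('g \<Rightarrow> complex) \<Rightarrow> bool" where
  "polynomial_on G f \<longleftrightarrow> (\<exists>m. \<forall>y\<in>G. \<forall>h\<in>G. (difference h ^^ (m + 1)) f y = 0)"

definition char_fun :: "'a::topological_ab_group_add measure \<Rightarrow> 'a character \<Rightarrow> complex" where
  "char_fun \<mu> y = (\<integral>x. char_app y x \<partial>\<mu>)"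

definition distributions :: "'a::topological_space measure set" where
  "distributions = {\<mu>. prob_space \<mu> \<and> sets \<mu> = sets borel}"

definition degenerate :: "'a::topological_space measure set" where
  "degenerate = {\<mu> \<in> distributions. \<exists>x. measure \<mu> {x} = 1}"

definition gaussian :: "'a::topological_ab_group_add measure set" where
  "gaussian = {\<gamma> \<in> distributions. \<exists>x (\<phi> :: 'a character \<Rightarrow> real).
     continuous_on UNIV \<phi> \<and> (\<forall>y. 0 \<le> \<phi> y) \<and>
     (\<forall>u v. \<phi> (u + v) + \<phi> (u - v) = 2 * (\<phi> u + \<phi> v)) \<and>
     (\<forall>y. char_fun \<gamma> y = char_app y x * exp (- complex_of_real (\<phi> y)))}"

definition Q_independent ::
  "'w measure \<Rightarrow> 'i set \<Rightarrow> ('i \<Rightarrow> 'w \<Rightarrow> 'a::topological_ab_group_add) \<Rightarrow> bool" where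
  "Q_independent M I \<xi> \<longleftrightarrow>
     (\<forall>j\<in>I. \<xi> j \<in> M \<rightarrow>\<^sub>M borel) \<and>
     (\<exists>q. continuous_on (dual_power I) q \<and> polynomial_on (dual_power I) q \<and> q 0 = 0 \<and>
        (\<forall>y\<in>dual_power I.
           (\<integral>\<omega>. (\<Prod>j\<in>I. char_app (y j) (\<xi> j \<omega>)) \<partial>M) =
           (\<Prod>j\<in>I. char_fun (distr M borel (\<xi> j)) (y j)) * exp (q y)))"

text \<open>
  The common hypothesis: \<open>Q\<close>-independent random variables with non-vanishing characteristic
  functions and two \<open>Q\<close>-independent linear forms in them with admissible coefficients.
  The pair of forms is a family indexed by \<open>bool\<close>, as in the definition of \<open>prob_space.indep_var\<close>.
\<close>

definition Q_independent_forms ::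
  "'w measure \<Rightarrow> nat \<Rightarrow> (nat \<Rightarrow> int) \<Rightarrow> (nat \<Rightarrow> int) \<Rightarrow>
    (nat \<Rightarrow> 'w \<Rightarrow> 'a::topological_ab_group_add) \<Rightarrow> bool" where
  "Q_independent_forms M n a b \<xi> \<longleftrightarrow>
     prob_space M \<and> 2 \<le> n \<and>
     admissible TYPE('a) {1..n} a \<and> admissible TYPE('a) {1..n} b \<and>
     Q_independent M {1..n} \<xi> \<and>
     (\<forall>j\<in>{1..n}. \<forall>y. char_fun (distr M borel (\<xi> j)) y \<noteq> 0) \<and>
     Q_independent M UNIV (case_bool (linear_form {1..n} a \<xi>) (linear_form {1..n} b \<xi>))"

end

theory Submission
 imports Defs "HOL-Complex_Analysis.Complex_Analysis"
begin

text \<open>Write \<psi>_j = - ln |\<mu>_j^| for the distributions \<mu>_j of the \<xi>_j, and Y for the dual group of X. The two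
Q-independence conditions combine to \<Sum>_j \<psi>_j(a_j u + b_j v) = p(u) + q(v) + R(u,v) with a polynomial R
(\<open>Q_independent_forms_log_equation\<close>). Differences in suitable directions remove p, q, R and every \<psi>_j
whose pair (a_j, b_j) is not proportional to that of a given index j0; the sum G of the other
\<psi>_j(a_j L z) is therefore a polynomial on Y (\<open>elimination\<close>).

If p X = 0 for a prime p, then G is polynomial and periodic along each cyclic subgroup, so G = 0. All
its terms are nonnegative, so |\<mu>^| = 1 for \<mu> = \<mu>_j0, and \<mu> is degenerate.

Let X be torsion-free. Up to a change of scale, \<mu> is a convolution factor of a distribution with
characteristic function exp(- 2G). On the real line such a factor is Gaussian by the theorems of
Marcinkiewicz and Cramer (\<open>cramer_marcinkiewicz\<close>). The line is reached by division: the characters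
n y form a dense subset of Y in the L2 sense (\<open>separating_subgroup_dense_L2\<close>), so any y has
approximate n-th parts y' with n y' close to y. An even polynomial G makes n^2 G(y') bounded, so n
times the angle of y' is a tight family of real random variables, and its limits obey the theorem on
the line. This shows how \<mu>^ behaves on the multiples of y (\<open>gaussian_on_multiples\<close>). Dividing
once more by n linearises the angles and shows that \<phi> = - ln |\<mu>^| satisfies the parallelogram law and
that the direction \<mu>^ / |\<mu>^| is multiplicative (\<open>phi_parallelogram\<close>, \<open>dirn_add\<close>). That this direction is
evaluation at a point of X is not taken from Pontryagin duality but from the tightness of \<mu>: for
finitely many characters a random experiment produces the point in a fixed compact set
(\<open>ex_center_approx\<close>), and compactness does the rest.

Both the density theorem and the fact that characters separate points rest on an invariant integral
on X and on positivity arguments for it; they replace the duality theory of locally compact groups.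

If X is neither torsion-free nor of prime exponent, choose x0 of prime order p. For independent \<xi>_1, \<xi>_2
with values 0 and x0 the forms \<xi>_1 + p \<xi>_2 = \<xi>_1 and p \<xi>_1 + \<xi>_2 = \<xi>_2 are independent, with admissible
coefficients, and the \<xi>_j are not Gaussian.\<close>


section \<open>Compactly supported functions on a locally compact group\<close>

definition Cc :: "('a::topological_space => 'b::real_normed_vector) set" where
 "Cc = {f. continuous_on UNIV f \<and> (\<exists>K. compact K \<and> (\<forall>x. x \<notin> K \<longrightarrow> f x = 0))}"

lemma Cc_continuous: "f \<in> Cc ==> continuous_on S f"
 unfolding Cc_def using continuous_on_subset by blast

lemma Cc_support: assumes "f \<in> Cc" obtains K where "compact K" "\<And>x. x \<notin> K ==> f x = 0"
 using assms unfolding Cc_def by blast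

lemma CcI: "continuous_on UNIV f ==> compact K ==> (\<And>x. x \<notin> K ==> f x = 0) ==> f \<in> Cc"
 unfolding Cc_def by blast

lemma Cc_dominated:
 assumes "f \<in> Cc" "continuous_on UNIV g" "\<And>x. f x = 0 ==> g x = 0"
 shows "g \<in> Cc"
 using assms unfolding Cc_def by blast

lemma Cc_zero [simp]: "(%x. 0) \<in> Cc"
 unfolding Cc_def by (auto intro: exI[of _ "{}"])

lemma Cc_add: assumes "f \<in> Cc" "g \<in> Cc" shows "(%x. f x + g x) \<in> Cc"
proof -
 obtain K L where "compact K" "\<And>x. x \<notin> K ==> f x = 0" "compact L" "\<And>x. x \<notin> L ==> g x = 0"
  using assms by (metis Cc_support)
 thus ?thesis
  by (intro CcI[of _ "K \<union> L"] continuous_intros) (auto intro: Cc_continuous assms)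
qed

lemma Cc_minus: assumes "f \<in> Cc" shows "(%x. - f x) \<in> Cc"
 by (rule Cc_dominated[OF assms]) (auto intro!: continuous_intros Cc_continuous[OF assms])

lemma Cc_diff: assumes "f \<in> Cc" "g \<in> Cc" shows "(%x. f x - g x) \<in> Cc"
 using Cc_add[OF assms(1) Cc_minus[OF assms(2)]] by simp

lemma Cc_sum: assumes "\<And>i. i \<in> I ==> f i \<in> Cc" shows "(%x. \<Sum>i\<in>I. f i x) \<in> Cc"
 using assms by (induction I rule: infinite_finite_induct) (auto intro!: Cc_add)

lemma Cc_mult: fixes f :: "_ => 'b::real_normed_algebra"
 assumes "f \<in> Cc" "continuous_on UNIV g" shows "(%x. g x * f x) \<in> Cc" "(%x. f x * g x) \<in> Cc"
 by (rule Cc_dominated[OF assms(1)]; auto intro!: continuous_intros Cc_continuous[OF assms(1)] assms(2))+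

lemma Cc_cmult: "f \<in> Cc ==> (%x. (c::'b::real_normed_algebra) * f x) \<in> Cc"
 by (intro Cc_mult(1) continuous_on_const)

lemma Cc_of_real: assumes "f \<in> Cc" shows "(%x. of_real (f x)) \<in> Cc"
 by (rule Cc_dominated[OF assms]) (auto intro!: continuous_intros Cc_continuous[OF assms])

lemma Cc_Re: assumes "f \<in> Cc" shows "(%x. Re (f x)) \<in> Cc"
 by (rule Cc_dominated[OF assms]) (auto intro!: continuous_intros Cc_continuous[OF assms])

lemma Cc_Im: assumes "f \<in> Cc" shows "(%x. Im (f x)) \<in> Cc"
 by (rule Cc_dominated[OF assms]) (auto intro!: continuous_intros Cc_continuous[OF assms])

lemma Cc_cnj: assumes "f \<in> Cc" shows "(%x. cnj (f x)) \<in> Cc"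
 by (rule Cc_dominated[OF assms]) (auto intro!: continuous_intros Cc_continuous[OF assms])

lemma Cc_norm: assumes "f \<in> Cc" shows "(%x. norm (f x)) \<in> Cc"
 by (rule Cc_dominated[OF assms]) (auto intro!: continuous_intros Cc_continuous[OF assms])

lemma Cc_norm2: assumes "f \<in> Cc" shows "(%x. (norm (f x))^2) \<in> Cc"
 by (rule Cc_dominated[OF assms]) (auto intro!: continuous_intros Cc_continuous[OF assms])

lemma Cc_power2: fixes f :: "_ => real" assumes "f \<in> Cc" shows "(%x. (f x)^2) \<in> Cc"
 by (rule Cc_dominated[OF assms]) (auto intro!: continuous_intros Cc_continuous[OF assms])

lemma continuous_on_translate_comp:
 fixes f :: "'a::topological_ab_group_add => 'b::topological_space"
 assumes "continuous_on UNIV f"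
 shows "continuous_on UNIV (%x. f (x + t))" "continuous_on UNIV (%x. f (t + x))"
  "continuous_on UNIV (%x. f (x - t))" "continuous_on UNIV (%x. f (t - x))"
 by (rule continuous_on_compose2[OF assms], intro continuous_on_diff
   continuous_on_add continuous_on_const continuous_on_id, simp)+

lemma Cc_shift:
 fixes f :: "'a::topological_ab_group_add => 'b::real_normed_vector"
 assumes "f \<in> Cc"
 shows "(%x. f (x + t)) \<in> Cc"
proof -
 obtain K where K: "compact K" "\<And>x. x \<notin> K ==> f x = 0" using assms by (metis Cc_support)
 have c: "compact ((%x. x - t) ` K)"
  by (intro compact_continuous_image K continuous_on_diff continuous_on_id continuous_on_const)
 have "x \<notin> (%x. x - t) ` K ==> f (x + t) = 0" for x
  using K(2)[of "x + t"] by (force simp: image_iff)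
 thus ?thesis
  by (intro CcI[OF _ c] continuous_on_translate_comp(1)[OF Cc_continuous[OF assms]])
qed

lemma Cc_shift_diff:
 fixes f :: "'a::topological_ab_group_add => 'b::real_normed_vector"
 assumes "f \<in> Cc"
 shows "(%x. f (x - t)) \<in> Cc"
 using Cc_shift[OF assms, of "- t"] by simp

lemma Cc_reflect:
 fixes f :: "'a::topological_ab_group_add => 'b::real_normed_vector"
 assumes "f \<in> Cc"
 shows "(%x. f (t - x)) \<in> Cc"
proof -
 obtain K where K: "compact K" "\<And>x. x \<notin> K ==> f x = 0" using assms by (metis Cc_support)
 have c: "compact ((%x. t - x) ` K)"
  by (intro compact_continuous_image K continuous_on_diff continuous_on_id continuous_on_const)
 have "x \<notin> (%x. t - x) ` K ==> f (t - x) = 0" for x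
  using K(2)[of "t - x"] by (force simp: image_iff)
 thus ?thesis
  by (intro CcI[OF _ c] continuous_on_translate_comp(4)[OF Cc_continuous[OF assms]])
qed

lemma Cc_bounded:
 assumes "f \<in> Cc" obtains B where "0 < B" "\<And>x. norm (f x) <= B"
proof -
 obtain K where K: "compact K" "\<And>x. x \<notin> K ==> f x = 0" using assms by (metis Cc_support)
 have "bounded (f ` K)"
  by (intro compact_imp_bounded compact_continuous_image K Cc_continuous assms)
 then obtain B where "B > 0" "\<forall>x\<in>K. norm (f x) <= B" unfolding bounded_pos by auto
 thus ?thesis using that[of B] K(2) by (metis norm_zero less_imp_le)
qed

lemma open_translate:
 fixes U :: "'a::topological_ab_group_add set"
 assumes "open U" shows "open {x. x + t \<in> U}" "open {x. t - x \<in> U}" "open {x. x - t \<in> U}"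
proof -
 have *: "open {x. g x \<in> U}" if "continuous_on UNIV g" for g :: "'a => 'a"
  using open_vimage[OF assms that] by (simp add: vimage_def)
 show "open {x. x + t \<in> U}" "open {x. t - x \<in> U}" "open {x. x - t \<in> U}"
  by (rule *, intro continuous_on_diff continuous_on_add continuous_on_const continuous_on_id)+
qed

lemma half_nbhd:
 fixes U :: "'a::topological_ab_group_add set"
 assumes "open U" "0 \<in> U"
 obtains V where "open V" "0 \<in> V" "\<And>x y. x \<in> V ==> y \<in> V ==> x + y \<in> U"
  "\<And>x y. x \<in> V ==> y \<in> V ==> x - y \<in> U" "\<And>x. x \<in> V ==> - x \<in> V" "V \<subseteq> U"
proof -
 have "((%p. fst p + snd p) \<longlongrightarrow> (0::'a) + 0) (nhds 0 \<times>\<^sub>F nhds 0)"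
  by (intro tendsto_intros filterlim_fst filterlim_snd)
 hence "\<forall>\<^sub>F p in (nhds 0 \<times>\<^sub>F nhds 0). fst p + snd p \<in> U"
  using assms by (auto simp: tendsto_def)
 then obtain P Q where PQ: "eventually P (nhds (0::'a))" "eventually Q (nhds (0::'a))"
   "\<And>x y. P x ==> Q y ==> x + y \<in> U"
  unfolding eventually_prod_filter by auto
 then obtain A B where AB: "open A" "0 \<in> A" "\<And>x. x \<in> A ==> P x" "open B" "0 \<in> B" "\<And>x. x \<in> B ==> Q x"
  unfolding eventually_nhds by metis
 define V where "V = (A \<inter> B) \<inter> {x. 0 - x \<in> A \<inter> B}"
 have V: "open V" unfolding V_def by (intro open_Int AB open_translate)
 have "x + y \<in> U" if "x \<in> V" "y \<in> V" for x y
  using that PQ(3) AB unfolding V_def by auto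
 moreover have "x - y \<in> U" if "x \<in> V" "y \<in> V" for x y
  using that PQ(3)[of x "- y"] AB unfolding V_def by auto
 moreover have "V \<subseteq> U"
 proof
  fix x assume "x \<in> V"
  hence "x + 0 \<in> U" using AB unfolding V_def by (intro PQ(3)) auto
  thus "x \<in> U" by simp
 qed
 ultimately show ?thesis using that[of V] V AB unfolding V_def by auto
qed

lemma uniform_nbhd_on_compact:
 fixes f :: "'a::topological_ab_group_add => 'b::metric_space"
 assumes "continuous_on UNIV f" "compact K" "0 < e"
 obtains V where "open V" "0 \<in> V" "\<And>x t. x \<in> K ==> t \<in> V ==> dist (f (x + t)) (f x) < e"
proof -
 have "\<exists>W. open W \<and> 0 \<in> W \<and> (\<forall>s\<in>W. \<forall>t\<in>W. dist (f (x + s + t)) (f x) < e/2)" for x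
 proof -
  have "open ((%t. f (x + t)) -` ball (f x) (e/2))"
   using assms(1) continuous_on_translate_comp(2)[OF assms(1), of x]
   by (intro open_vimage) auto
  moreover have "0 \<in> ((%t. f (x + t)) -` ball (f x) (e/2))" using assms by auto
  ultimately obtain V where "open V" "0 \<in> V"
    "\<And>s t. s \<in> V ==> t \<in> V ==> s + t \<in> ((%t. f (x + t)) -` ball (f x) (e/2))"
   by (rule half_nbhd) blast
  hence "\<forall>s\<in>V. \<forall>t\<in>V. dist (f (x + s + t)) (f x) < e/2"
   by (auto simp: dist_commute add.assoc)
  thus ?thesis using `open V` `0 \<in> V` by blast
 qed
 hence "\<forall>x. \<exists>W. open W \<and> 0 \<in> W \<and> (\<forall>s\<in>W. \<forall>t\<in>W. dist (f (x + s + t)) (f x) < e/2)" by blast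
 from choice[OF this] obtain W where W: "\<And>x. open (W x)" "\<And>x. 0 \<in> W x"
   "\<And>x s t. s \<in> W x ==> t \<in> W x ==> dist (f (x + s + t)) (f x) < e/2" by blast
 have "K \<subseteq> (\<Union>x\<in>K. {z. z - x \<in> W x})" using W(2)
  by (intro subsetI UN_I) (assumption, simp)
 then obtain F where F: "F \<subseteq> K" "finite F" "K \<subseteq> (\<Union>x\<in>F. {z. z - x \<in> W x})"
  by (rule compactE_image[OF `compact K` open_translate(3)[OF W(1)]])
 show ?thesis
 proof (rule that[of "\<Inter>x\<in>F. W x"])
  show "open (\<Inter>x\<in>F. W x)" by (intro open_INT F ballI W(1))
  show "0 \<in> (\<Inter>x\<in>F. W x)" using W(2) by blast
  fix z t assume "z \<in> K" "t \<in> (\<Inter>x\<in>F. W x)"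
  then obtain x where x: "x \<in> F" "z - x \<in> W x" "t \<in> W x" using F(3) by blast
  have "dist (f (z + t)) (f x) < e/2" using W(3)[OF x(2,3)] by simp
  moreover have "dist (f z) (f x) < e/2" using W(3)[OF x(2) W(2)] by simp
  ultimately show "dist (f (z + t)) (f z) < e"
   by (rule dist_triangle_half_l)
 qed
qed

lemma Cc_uniform:
 fixes f :: "'a::topological_ab_group_add => 'b::real_normed_vector"
 assumes "f \<in> Cc" "0 < e"
 obtains V where "open V" "0 \<in> V" "\<And>x t. t \<in> V ==> norm (f (x + t) - f x) < e"
proof -
 obtain K where K: "compact K" "\<And>x. x \<notin> K ==> f x = 0" using assms by (metis Cc_support)
 obtain V where V: "open V" "0 \<in> V" "\<And>x t. x \<in> K ==> t \<in> V ==> dist (f (x + t)) (f x) < e"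
  using uniform_nbhd_on_compact[OF Cc_continuous[OF assms(1)] K(1) assms(2)] by blast
 obtain V' where V': "open V'" "0 \<in> V'" "\<And>x. x \<in> V' ==> - x \<in> V'" "V' \<subseteq> V"
  using half_nbhd[OF V(1,2)] by metis
 have "norm (f (x + t) - f x) < e" if "t \<in> V'" for x t
 proof (cases "x \<in> K")
  case True thus ?thesis using V(3) V' that by (auto simp: dist_norm)
 next
  case False
  show ?thesis
  proof (cases "x + t \<in> K")
   case True
   have "dist (f (x + t + - t)) (f (x + t)) < e" using V(3)[OF True] V' that by blast
   thus ?thesis by (simp add: dist_norm norm_minus_commute)
  next
   case False thus ?thesis using `x \<notin> K` K(2) assms by simp
  qed
 qed
 thus ?thesis using that[of V'] V' by blast
qed

lemma lc_compact_nbhd: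
 assumes "locally_compact_space (euclidean :: 'a::t2_space topology)"
 obtains U K where "open U" "(x::'a) \<in> U" "compact K" "U \<subseteq> K"
 using assms unfolding locally_compact_space_def by simp metis

lemma lc_compact_nbhds:
 assumes "locally_compact_space (euclidean :: 'a::t2_space topology)"
 obtains V L where "\<And>x. open (V x)" "\<And>x. x \<in> V x" "\<And>x. compact (L x)" "\<And>x::'a. V x \<subseteq> L x"
proof -
 have "\<forall>x::'a. \<exists>p. open (fst p) \<and> x \<in> fst p \<and> compact (snd p) \<and> fst p \<subseteq> snd p"
  using lc_compact_nbhd[OF assms] by (metis fst_conv snd_conv)
 from choice[OF this] obtain p where
  "\<forall>x::'a. open (fst (p x)) \<and> x \<in> fst (p x) \<and> compact (snd (p x)) \<and> fst (p x) \<subseteq> snd (p x)" ..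
 thus ?thesis using that[of "fst \<circ> p" "snd \<circ> p"] by auto
qed

text \<open>Locally compact Hausdorff groups are completely regular, which gives Urysohn functions; intersecting
U with a relatively compact neighbourhood of K makes the support compact.\<close>
lemma lc_cutoff:
 fixes K U :: "'a::t2_space set"
 assumes lc: "locally_compact_space (euclidean :: 'a topology)"
  and "compact K" "open U" "K \<subseteq> U"
 obtains g :: "'a => real" where "g \<in> Cc" "\<And>x. 0 <= g x" "\<And>x. g x <= 1" "\<And>x. x \<in> K ==> g x = 1"
  "\<And>x. x \<notin> U ==> g x = 0"
proof -
 obtain V L where VL: "\<And>x. open (V x)" "\<And>x. x \<in> V x" "\<And>x. compact (L x)" "\<And>x::'a. V x \<subseteq> L x"
  using lc_compact_nbhds[OF lc] by blast
 have "K \<subseteq> (\<Union>x\<in>K. V x)" using VL(2) by auto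
 then obtain F where F: "F \<subseteq> K" "finite F" "K \<subseteq> (\<Union>x\<in>F. V x)"
  by (rule compactE_image[OF `compact K` VL(1)])
 define U' where "U' = U \<inter> (\<Union>x\<in>F. V x)"
 have U': "open U'" "K \<subseteq> U'" "U' \<subseteq> U"
  using VL(1) F(3) assms(3,4) unfolding U'_def by (blast, blast, blast)
 have cr: "completely_regular_space (euclidean :: 'a topology)"
  by (rule locally_compact_regular_imp_completely_regular_space[OF lc])
   (simp add: Hausdorff_space_def disjnt_def, metis separation_t2)
 obtain g where g: "continuous_map euclidean (top_of_set {0..1::real}) g" "g ` (- U') \<subseteq> {0}" "g ` K \<subseteq> {1}"
 proof -
  have "closedin euclidean (- U')" using U'(1) by (simp add: closed_Compl)
  moreover have "compactin euclidean K" using `compact K` by simp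
  moreover have "disjnt (- U') K" using U'(2) unfolding disjnt_def by blast
  ultimately obtain h where h: "continuous_map (euclidean :: 'a topology) (top_of_set {0..1::real}) h"
    "h ` K \<subseteq> {0}" "h ` (- U') \<subseteq> {1}"
   by (rule Urysohn_completely_regular_closed_compact[OF zero_le_one cr])
  have "continuous_map euclidean (top_of_set {0..1::real}) (%x. 1 - h x)"
   using h(1) by (simp add: continuous_map_in_subtopology Pi_iff continuous_on_diff)
  thus ?thesis using h(2,3) by (intro that[of "%x. 1 - h x"]) auto
 qed
 have cont: "continuous_on UNIV g" and rng: "\<And>x. g x \<in> {0..1}"
  using g(1) by (auto simp: continuous_map_in_subtopology Pi_iff)
 have "compact (\<Union>x\<in>F. L x)" using F VL by auto
 moreover have "x \<notin> (\<Union>x\<in>F. L x) ==> g x = 0" for x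
  using g(2) VL(4) unfolding U'_def by blast
 ultimately have "g \<in> Cc" by (intro CcI cont)
 moreover have "g x = 1" if "x \<in> K" for x using g(3) that by auto
 moreover have "g x = 0" if "x \<notin> U" for x using g(2) U'(3) that by blast
 ultimately show ?thesis using that[of g] rng by simp
qed

lemma lc_exhaustion:
 fixes dummy :: "'a::{t2_space,second_countable_topology} itself"
 assumes lc: "locally_compact_space (euclidean :: 'a topology)"
 obtains K :: "nat => 'a set" where "\<And>n. compact (K n)" "incseq K" "(\<Union>n. K n) = UNIV"
proof -
 obtain V L where VL: "\<And>x. open (V x)" "\<And>x. x \<in> V x" "\<And>x. compact (L x)" "\<And>x::'a. V x \<subseteq> L x"
  using lc_compact_nbhds[OF lc] by blast
 obtain D where D: "D \<subseteq> range V" "countable D" "\<Union>D = \<Union>(range V)"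
  using Lindelof[of "range V"] VL(1) by blast
 then obtain C where C: "countable C" "D = V ` C"
  by (metis countable_subset_image)
 have cov: "(\<Union>x\<in>C. L x) = UNIV" 
 proof -
  have "x \<in> (\<Union>x\<in>C. L x)" for x
  proof -
   have "x \<in> \<Union>D" unfolding D(3) using VL(2) by blast
   then obtain c where "c \<in> C" "x \<in> V c" unfolding C(2) by blast
   thus ?thesis using VL(4) by blast
  qed
  thus ?thesis by blast
 qed
 hence "C \<noteq> {}" by auto
 hence e: "range (from_nat_into C) = C" by (rule range_from_nat_into[OF _ C(1)])
 define e where "e = from_nat_into C"
 note e = e[folded e_def]
 show ?thesis
 proof (rule that[of "%n. \<Union>i\<le>n. L (e i)"])
  show "compact (\<Union>i\<le>n. L (e i))" for n by (intro compact_UN VL(3)) simp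
  show "incseq (%n. \<Union>i\<le>n. L (e i))" by (rule incseq_SucI) (simp add: atMost_Suc)
  have "x \<in> (\<Union>n. \<Union>i\<le>n. L (e i))" for x
  proof -
   obtain i where "x \<in> L (e i)" using cov e by (metis UNIV_I UN_E rangeE)
   thus ?thesis by blast
  qed
  thus "(\<Union>n. \<Union>i\<le>n. L (e i)) = UNIV" by blast
 qed
qed

text \<open>Tychonoff: all compactness arguments for functionals and characters below take place in such sets.\<close>
lemma compact_pointwise_bounded:
 fixes B :: "'i => 'b::topological_space set"
 assumes "\<And>i. compact (B i)"
 shows "compact {f. \<forall>i. f i \<in> B i}"
proof -
 have "compactin (product_topology (%i. euclidean) UNIV) (PiE UNIV B)"
  using assms by (subst compactin_PiE) auto
 moreover have "PiE UNIV B = {f. \<forall>i. f i \<in> B i}" by (auto simp: PiE_def Pi_def)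
 ultimately show ?thesis by (simp add: euclidean_product_topology)
qed

lemma continuous_on_groupI:
 fixes f :: "'a::topological_ab_group_add => 'b::metric_space"
 assumes "\<And>x e. 0 < e ==> \<exists>V. open V \<and> 0 \<in> V \<and> (\<forall>t\<in>V. dist (f (x + t)) (f x) <= e)"
 shows "continuous_on UNIV f"
proof -
 have "(f \<longlongrightarrow> f x) (at x)" for x
  unfolding tendsto_iff
 proof (intro allI impI)
  fix e :: real assume "0 < e"
  then obtain V where V: "open V" "0 \<in> V" "\<And>t. t \<in> V ==> dist (f (x + t)) (f x) <= e/2"
   using assms[of "e/2" x] by auto
  have "\<forall>\<^sub>F z in nhds x. z - x \<in> V"
   unfolding eventually_nhds
   by (intro exI[of _ "{z. z - x \<in> V}"] conjI open_translate(3)[OF V(1)]) (simp_all add: V(2))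
  hence "\<forall>\<^sub>F z in nhds x. dist (f z) (f x) < e"
  proof eventually_elim
   case (elim z) thus ?case using V(3)[of "z - x"] `0 < e` by simp
  qed
  thus "\<forall>\<^sub>F z in at x. dist (f z) (f x) < e"
   unfolding eventually_at_filter by (rule eventually_mono) simp
 qed
 thus ?thesis by (simp add: continuous_on_def)
qed


section \<open>Integer multiples and characters\<close>

lemma zmult_0_left [simp]: "zmult 0 x = 0" by (simp add: zmult_def)
lemma zmult_1 [simp]: "zmult 1 x = x" by (simp add: zmult_def)

lemma zmult_succ: "zmult (m + 1) x = zmult m x + x"
proof (cases "0 <= m")
 case True
 hence "nat (m + 1) = Suc (nat m)" by simp
 thus ?thesis using True by (simp add: zmult_def)
next
 case False
 hence *: "nat (- m) = Suc (nat (- (m + 1)))" by simp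
 show ?thesis
 proof (cases "m = -1")
  case True thus ?thesis by (simp add: zmult_def)
 next
  case False
  with `\<not> 0 <= m` have "\<not> 0 <= m + 1" by simp
  thus ?thesis using `\<not> 0 <= m` unfolding zmult_def * by (simp add: algebra_simps)
 qed
qed

lemma zmult_add_left: "zmult (m + n) x = zmult m x + zmult n x"
proof (induction n rule: int_induct[of _ 0])
 case base thus ?case by simp
next
 case (step1 i)
 have "zmult (m + i + 1) x = zmult (m + i) x + x" by (rule zmult_succ)
 thus ?case using step1 zmult_succ[of i x] by (simp add: add.assoc)
next
 case (step2 i)
 have "zmult (m + (i - 1)) x + x = zmult (m + i) x"
  using zmult_succ[of "m + (i - 1)" x] by simp
 moreover have "zmult (i - 1) x + x = zmult i x" using zmult_succ[of "i - 1" x] by simp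
 ultimately show ?case using step2 by (metis add.assoc add_right_cancel)
qed

lemma zmult_minus_left: "zmult (- m) x = - zmult m x"
 using zmult_add_left[of "- m" m x] by (simp add: eq_neg_iff_add_eq_0)

lemma zmult_diff_left: "zmult (m - n) x = zmult m x - zmult n x"
 using zmult_add_left[of m "- n" x] by (simp add: zmult_minus_left)

lemma zmult_0_right [simp]: "zmult m 0 = 0" by (simp add: zmult_def)

lemma zmult_add_right: "zmult m (x + y) = zmult m x + zmult m y"
 by (simp add: zmult_def sum.distrib)

lemma zmult_minus_right: "zmult m (- x) = - zmult m x"
 by (simp add: zmult_def sum_negf)

lemma zmult_mult: "zmult (m * n) x = zmult m (zmult n x)"
proof (induction m rule: int_induct[of _ 0])
 case base thus ?case by simp
next
 case (step1 i)
 thus ?case by (simp add: zmult_succ distrib_right zmult_add_left)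
next
 case (step2 i)
 thus ?case by (simp add: zmult_diff_left left_diff_distrib)
qed

lemma zmult_2: "zmult 2 x = x + x"
 using zmult_add_left[of 1 1 x] by simp

lemma continuous_zmult: "continuous_on UNIV (zmult m :: 'a::topological_ab_group_add => 'a)"
proof -
 have "continuous_on UNIV (%x::'a. \<Sum>k<n. x)" for n :: nat
  by (induction n) (auto intro!: continuous_on_add continuous_on_const continuous_on_id)
 thus ?thesis
  by (cases "0 <= m") (auto simp: zmult_def[abs_def] intro!: continuous_on_minus)
qed

lemma char_norm [simp]: "norm (char_app y x) = 1"
 using char_app[of y] by auto

lemma char_cont: "continuous_on S (char_app y)"
 using char_app[of y] continuous_on_subset by auto

lemma char_add: "char_app y (x + x') = char_app y x * char_app y x'"
 using char_app[of y] by auto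

lemma char_nonzero [simp]: "char_app y x \<noteq> 0"
 by (metis char_norm norm_zero zero_neq_one)

lemma char_0_right [simp]: "char_app y 0 = 1"
 using char_add[of y 0 0] by simp

lemma char_cnj: "cnj (char_app y x) = inverse (char_app y x)"
 by (metis char_norm complex_cnj_inverse complex_cnj_cnj complex_cnj_divide divide_conv_cnj inverse_eq_divide mult_1)

lemma char_minus_right: "char_app y (- x) = cnj (char_app y x)"
proof -
 have "char_app y x * char_app y (- x) = 1" using char_add[of y x "- x"] by simp
 thus ?thesis by (simp add: char_cnj inverse_eq_iff_eq field_simps)
qed

lemma char_diff_right: "char_app y (x - x') = char_app y x * cnj (char_app y x')"
 using char_add[of y x "- x'"] by (simp add: char_minus_right)

lemma char_plus_left: "char_app (y + z) x = char_app y x * char_app z x"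
 by transfer simp

lemma char_0_left [simp]: "char_app 0 x = 1"
 by transfer simp

lemma char_minus_left: "char_app (- y) x = cnj (char_app y x)"
 unfolding char_cnj by transfer simp

lemma char_diff_left: "char_app (y - z) x = char_app y x * cnj (char_app z x)"
 by (simp add: diff_conv_add_uminus char_plus_left char_minus_left del: add_uminus_conv_diff)

lemma char_mult_cnj [simp]: "char_app y x * cnj (char_app y x) = 1" "cnj (char_app y x) * char_app y x = 1"
 by (auto simp: char_cnj)

lemma char_eqI: "(\<And>x. char_app y x = char_app z x) ==> y = z"
 by (metis char_app_inject ext)

lemma char_zmult_right: "char_app y (zmult m x) = char_app y x powi m"
proof (induction m rule: int_induct[of _ 0])
 case base thus ?case by simp
next
 case (step1 i)
 thus ?case by (simp add: zmult_succ char_add power_int_add)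
next
 case (step2 i)
 thus ?case by (simp add: zmult_diff_left char_diff_right char_cnj power_int_diff divide_inverse)
qed

lemma char_zmult_left: "char_app (zmult m y) x = char_app y x powi m"
proof (induction m rule: int_induct[of _ 0])
 case base thus ?case by simp
next
 case (step1 i)
 thus ?case by (simp add: zmult_succ char_plus_left power_int_add)
next
 case (step2 i)
 thus ?case by (simp add: zmult_diff_left char_diff_left char_cnj power_int_diff divide_inverse)
qed

lemma char_sum_left: "char_app (\<Sum>i\<in>A. f i) x = (\<Prod>i\<in>A. char_app (f i) x)"
 by (induction A rule: infinite_finite_induct) (auto simp: char_plus_left)

lemma char_sum_right: "char_app y (\<Sum>i\<in>A. f i) = (\<Prod>i\<in>A. char_app y (f i))"
 by (induction A rule: infinite_finite_induct) (auto simp: char_add)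


section \<open>An invariant integral\<close>

text \<open>A maximal U-separated set; maximality is what makes it relatively dense.\<close>
lemma ex_delone_set:
 fixes U :: "'a::topological_ab_group_add set"
 assumes "0 \<in> U" "\<And>x. x \<in> U ==> - x \<in> U"
 obtains D where "\<And>d e. d \<in> D ==> e \<in> D ==> d - e \<in> U ==> d = e" "\<And>x. \<exists>d\<in>D. d - x \<in> U"
proof -
 define A where "A = {D. \<forall>d\<in>D. \<forall>e\<in>D. d - e \<in> U \<longrightarrow> d = e}"
 have "\<exists>M\<in>A. \<forall>X\<in>A. M \<subseteq> X \<longrightarrow> X = M"
 proof (rule subset_Zorn_nonempty)
  show "A \<noteq> {}" unfolding A_def by blast
  fix C assume "C \<noteq> {}" and C: "subset.chain A C"
  show "\<Union>C \<in> A"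
   unfolding A_def
  proof (intro CollectI ballI impI)
   fix d e assume "d \<in> \<Union>C" "e \<in> \<Union>C" and U: "d - e \<in> U"
   then obtain X Y where XY: "X \<in> C" "d \<in> X" "Y \<in> C" "e \<in> Y" by blast
   hence "X \<subseteq> Y \<or> Y \<subseteq> X" using C unfolding subset.chain_def by blast
   then obtain Z where "Z \<in> C" "d \<in> Z" "e \<in> Z" using XY by blast
   thus "d = e" using C U unfolding subset.chain_def A_def by blast
  qed
 qed
 then obtain D where D: "D \<in> A" and max: "\<And>X. X \<in> A ==> D \<subseteq> X ==> X = D" by blast
 have "\<exists>d\<in>D. d - x \<in> U" for x
 proof (rule ccontr)
  assume *: "\<not> (\<exists>d\<in>D. d - x \<in> U)"
  have "x - d \<notin> U" if "d \<in> D" for d using * assms(2)[of "x - d"] that by auto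
  hence "insert x D \<in> A" using D * unfolding A_def by auto
  hence "x \<in> D" using max[of "insert x D"] by blast
  thus False using * assms(1) by force
 qed
 thus ?thesis using that[of D] D unfolding A_def by blast
qed

text \<open>Summation over a separated and relatively dense set D replaces the covering numbers in the classical
construction of Haar measure: it is additive on the nose, and only invariance has to be repaired.\<close>
locale delone =
 fixes D :: "'a::{topological_ab_group_add,t2_space} set"
 assumes locally_finite: "compact K ==> \<exists>C. \<forall>x. finite {d \<in> D. d + x \<in> K} \<and> card {d \<in> D. d + x \<in> K} <= C"
  and covering: "\<exists>K. compact K \<and> (\<forall>x. \<exists>d\<in>D. d + x \<in> K)"
begin

definition S :: "('a => real) => real" where
 "S f = (\<Sum>d\<in>{d \<in> D. f d \<noteq> 0}. f d)"

lemma finite_D: "compact K ==> finite {d \<in> D. d \<in> K}"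
 using locally_finite[of K] by (metis (no_types, lifting) add_0_right Collect_cong)

lemma S_eq: "compact K ==> (\<And>x. x \<notin> K ==> f x = 0) ==> S f = (\<Sum>d\<in>{d \<in> D. d \<in> K}. f d)"
 unfolding S_def by (rule sum.mono_neutral_left) (auto intro: finite_D)

lemma S_add:
 assumes "f \<in> Cc" "g \<in> Cc" shows "S (%x. f x + g x) = S f + S g"
proof -
 obtain K L where K: "compact K" "\<And>x. x \<notin> K ==> f x = 0" and L: "compact L" "\<And>x. x \<notin> L ==> g x = 0"
  using assms by (metis Cc_support)
 have KL: "compact (K \<union> L)" using K L by auto
 show ?thesis
  using K L by (subst (1 2 3) S_eq[OF KL]) (auto simp: sum.distrib)
qed

lemma S_scale: "S (%x. r * f x) = r * S f"
 unfolding S_def by (cases "r = 0") (auto simp: sum_distrib_left)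

lemma S_bounded:
 assumes "f \<in> Cc" obtains b where "\<And>x. \<bar>S (%z. f (z + x))\<bar> <= b"
proof -
 obtain K where K: "compact K" "\<And>x. x \<notin> K ==> f x = 0" using assms by (metis Cc_support)
 obtain C where C: "\<And>x. finite {d \<in> D. d + x \<in> K}" "\<And>x. card {d \<in> D. d + x \<in> K} <= C"
  using locally_finite[OF K(1)] by blast
 obtain B where B: "0 < B" "\<And>x. norm (f x) <= B" using Cc_bounded[OF assms] by blast
 have "\<bar>S (%z. f (z + x))\<bar> <= real C * B" for x
 proof -
  have "S (%z. f (z + x)) = (\<Sum>d\<in>{d \<in> D. d + x \<in> K}. f (d + x))"
   unfolding S_def by (rule sum.mono_neutral_left) (use K C in auto)
  also have "\<bar>...\<bar> <= (\<Sum>d\<in>{d \<in> D. d + x \<in> K}. B)"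
   using B(2) by (intro order_trans[OF sum_abs] sum_mono) auto
  also have "... <= real C * B"
   using C(2)[of x] B(1) by (simp add: mult_right_mono)
  finally show ?thesis .
 qed
 thus ?thesis by (rule that)
qed

text \<open>These functionals lie below every uniform bound on the translates of S, and this survives averaging
over translations. The bound is also what later yields strict positivity and \<open>I_convolution_le\<close>.\<close>
definition dominated :: "(('a => real) => real) set" where
 "dominated = {J. (\<forall>f\<in>Cc. \<forall>g\<in>Cc. J (%x. f x + g x) = J f + J g) \<and>
   (\<forall>f\<in>Cc. \<forall>r. J (%x. r * f x) = r * J f) \<and>
   (\<forall>f\<in>Cc. \<forall>b. (\<forall>x. S (%z. f (z + x)) <= b) \<longrightarrow> J f <= b)}"

lemma S_dominated: "S \<in> dominated"
 unfolding dominated_def using S_add S_scale by (auto dest: spec[of _ 0])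

lemma dominated_abs:
 assumes "J \<in> dominated" "f \<in> Cc" "\<And>x. \<bar>S (%z. f (z + x))\<bar> <= b"
 shows "\<bar>J f\<bar> <= b"
proof -
 have "J f <= b" using assms unfolding dominated_def by (auto simp: abs_le_iff)
 moreover have "J (%x. (-1) * f x) <= b"
 proof -
  have "(%x. (-1) * f x) \<in> Cc" using Cc_minus[OF assms(2)] by simp
  moreover have "S (%z. (-1) * f (z + x)) <= b" for x
   using assms(3)[of x] S_scale[of "-1" "%z. f (z + x)"] by (simp add: abs_le_iff)
  ultimately show ?thesis using assms(1) unfolding dominated_def mem_Collect_eq
   by (elim conjE) (drule (1) bspec[where P = "%f. \<forall>b. (\<forall>x. S (%z. f (z + x)) <= b) \<longrightarrow> J f <= b"], simp)
 qed
 moreover have "J (%x. (-1) * f x) = (-1) * J f" using assms(1,2) unfolding dominated_def by blast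
 ultimately show ?thesis by linarith
qed

definition average :: "'a => nat => (('a => real) => real) => ('a => real) => real" where
 "average t N J f = (\<Sum>k<N. J (%z. f (z + zmult (int k) t))) / real N"

lemma average_dominated:
 assumes J: "J \<in> dominated" and "0 < N" shows "average t N J \<in> dominated"
 unfolding dominated_def
proof (intro CollectI conjI ballI allI impI)
 have add: "J (%x. f x + g x) = J f + J g" if "f \<in> Cc" "g \<in> Cc" for f g
  using J that unfolding dominated_def by blast
 have scale: "J (%x. r * f x) = r * J f" if "f \<in> Cc" for f r
  using J that unfolding dominated_def by blast
 have dom: "J f <= b" if "f \<in> Cc" "\<And>x. S (%z. f (z + x)) <= b" for f b
  using J that unfolding dominated_def by blast
 fix f :: "'a => real" assume f: "f \<in> Cc"
 { fix g :: "'a => real" assume g: "g \<in> Cc"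
  have *: "J (%z. f (z + t) + g (z + t)) = J (%z. f (z + t)) + J (%z. g (z + t))" for t
   by (rule add) (intro Cc_shift f g)+
  show "average t N J (%x. f x + g x) = average t N J f + average t N J g"
   unfolding average_def * by (simp add: sum.distrib add_divide_distrib) }
 { fix r :: real
  have *: "J (%z. r * f (z + t)) = r * J (%z. f (z + t))" for t
   by (rule scale) (intro Cc_shift f)
  show "average t N J (%x. r * f x) = r * average t N J f"
   unfolding average_def * by (simp add: sum_distrib_left) }
 { fix b assume b: "\<forall>x. S (%z. f (z + x)) <= b"
  have "J (%z. f (z + t)) <= b" for t
  proof (rule dom)
   show "(%z. f (z + t)) \<in> Cc" by (intro Cc_shift f)
   show "S (%z. f (z + x + t)) <= b" for x using b[rule_format, of "x + t"] by (simp add: add.assoc)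
  qed
  hence "(\<Sum>k<N. J (%z. f (z + zmult (int k) t))) <= (\<Sum>k<N. b)" by (intro sum_mono)
  thus "average t N J f <= b" unfolding average_def using `0 < N` by (simp add: field_simps) }
qed

text \<open>Consecutive terms of an orbit average telescope, so a translation changes it only by its two ends.\<close>
lemma average_almost_invariant:
 assumes J: "J \<in> dominated" and "0 < N" "f \<in> Cc" "\<And>x. \<bar>S (%z. f (z + x))\<bar> <= b"
 shows "\<bar>average t N J (%z. f (z + t)) - average t N J f\<bar> <= 2 * b / N"
proof -
 define u where "u k = J (%z. f (z + zmult (int k) t))" for k
 have u: "\<bar>u k\<bar> <= b" for k unfolding u_def
 proof (rule dominated_abs[OF J])
  show "(%z. f (z + zmult (int k) t)) \<in> Cc" by (intro Cc_shift assms)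
  show "\<bar>S (%z. f (z + x + zmult (int k) t))\<bar> <= b" for x
   using assms(4)[of "x + zmult (int k) t"] by (simp add: add.assoc)
 qed
 have "J (%z. f (z + zmult (int k) t + t)) = u (Suc k)" for k
  unfolding u_def using zmult_succ[of "int k" t] by (simp add: add.assoc add.commute[of 1])
 hence "average t N J (%z. f (z + t)) - average t N J f = (\<Sum>k<N. u (Suc k) - u k) / N"
  unfolding average_def u_def[symmetric] by (simp add: sum_subtractf diff_divide_distrib)
 also have "... = (u N - u 0) / N" by (simp add: sum_lessThan_telescope)
 finally show ?thesis using u[of N] u[of 0] `0 < N`
  by (simp add: divide_right_mono)
qed

lemma ex_almost_invariant:
 assumes "finite F" "0 < N"
 shows "\<exists>J\<in>dominated. \<forall>t\<in>F. \<forall>f\<in>Cc. \<forall>b. (\<forall>x. \<bar>S (%z. f (z + x))\<bar> <= b) \<longrightarrow>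
  \<bar>J (%z. f (z + t)) - J f\<bar> <= 2 * b / real N"
 using assms(1)
proof (induction F)
 case empty
 thus ?case using S_dominated by blast
next
 case (insert s F)
 then obtain J where J: "J \<in> dominated" and
  inv: "\<And>t f b. t \<in> F ==> f \<in> Cc ==> (\<And>x. \<bar>S (%z. f (z + x))\<bar> <= b) ==> \<bar>J (%z. f (z + t)) - J f\<bar> <= 2 * b / real N"
  by blast
 show ?case
 proof (intro bexI[OF _ average_dominated[OF J `0 < N`]] ballI allI impI)
  fix t f b assume t: "t \<in> insert s F" and f: "f \<in> Cc" and b: "\<forall>x. \<bar>S (%z. f (z + x))\<bar> <= b"
  show "\<bar>average s N J (%z. f (z + t)) - average s N J f\<bar> <= 2 * b / real N"
  proof (cases "t = s")
   case True
   thus ?thesis using average_almost_invariant[OF J `0 < N` f, of b s] b by simp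
  next
   case False
   hence "t \<in> F" using t by simp
   define g where "g k = (%z. f (z + zmult (int k) s))" for k
   have g: "\<bar>J (%z. g k (z + t)) - J (g k)\<bar> <= 2 * b / real N" for k
   proof (rule inv[OF `t \<in> F`])
    show "g k \<in> Cc" unfolding g_def by (intro Cc_shift f)
    show "\<bar>S (%z. g k (z + x))\<bar> <= b" for x
     unfolding g_def using b[rule_format, of "x + zmult (int k) s"] by (simp add: add.assoc)
   qed
   have "average s N J (%z. f (z + t)) - average s N J f = (\<Sum>k<N. J (%z. g k (z + t)) - J (g k)) / N"
    unfolding average_def g_def by (simp add: sum_subtractf diff_divide_distrib add_ac)
   also have "\<bar>...\<bar> <= (\<Sum>k<N. 2 * b / N) / N"
    unfolding abs_divide abs_of_nat using g
    by (intro divide_right_mono order_trans[OF sum_abs] sum_mono) auto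
   finally show ?thesis using `0 < N` by simp
  qed
 qed
qed

text \<open>Averaging along finitely many translations gives almost invariant functionals. They live in a product
of compact intervals, so the finite intersection property produces an exactly invariant one.\<close>
lemma ex_invariant:
 "\<exists>I\<in>dominated. \<forall>f\<in>Cc. \<forall>t. I (%z. f (z + t)) = I f"
proof -
 define bnd where "bnd f = (if f \<in> Cc then (SOME b. \<forall>x. \<bar>S (%z. f (z + x))\<bar> <= b) else 0)" for f
 have bnd: "\<bar>S (%z. f (z + x))\<bar> <= bnd f" if "f \<in> Cc" for f x
 proof -
  have "\<exists>b. \<forall>x. \<bar>S (%z. f (z + x))\<bar> <= b" using S_bounded[OF that] by blast
  from someI_ex[OF this] show ?thesis unfolding bnd_def using that by simp
 qed
 define K where "K = {J. \<forall>f. J f \<in> {- bnd f..bnd f}}"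
 have K: "compact K" unfolding K_def by (rule compact_pointwise_bounded) simp
 define E where "E p = dominated \<inter> {J. \<forall>f\<in>Cc. \<forall>b. (\<forall>x. \<bar>S (%z. f (z + x))\<bar> <= b) \<longrightarrow>
  \<bar>J (%z. f (z + fst p)) - J f\<bar> <= 2 * b / real (Suc (snd p))}" for p :: "'a \<times> nat"
 have coord: "continuous_on UNIV (%J::('a => real) => real. J f)" for f
  by (rule continuous_on_product_coordinates)
 have "closed dominated"
  unfolding dominated_def Ball_def
  by (intro closed_Collect_conj closed_Collect_all closed_Collect_imp open_Collect_const
    closed_Collect_eq closed_Collect_le continuous_on_add continuous_on_mult continuous_on_const coord)
 moreover have "closed {J. \<forall>f\<in>Cc. \<forall>b. (\<forall>x. \<bar>S (%z. f (z + x))\<bar> <= b) \<longrightarrow>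
  \<bar>J (%z. f (z + t)) - J f\<bar> <= 2 * b / real (Suc n)}" for t n
  unfolding Ball_def
  by (intro closed_Collect_conj closed_Collect_all closed_Collect_imp open_Collect_const
    closed_Collect_le continuous_on_diff continuous_on_rabs continuous_on_const coord)
 ultimately have E: "closed (E p)" for p unfolding E_def by (intro closed_Int)
 have "K \<inter> (\<Inter>p\<in>UNIV. E p) \<noteq> {}"
 proof (rule compact_imp_fip_image[OF K])
  fix P :: "('a \<times> nat) set" assume P: "finite P"
  define N where "N = Suc (Max (insert 0 (snd ` P)))"
  obtain J where J: "J \<in> dominated" and inv: "\<And>t f b. t \<in> fst ` P ==> f \<in> Cc ==>
    (\<And>x. \<bar>S (%z. f (z + x))\<bar> <= b) ==> \<bar>J (%z. f (z + t)) - J f\<bar> <= 2 * b / real N"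
   using ex_almost_invariant[of "fst ` P" N] P unfolding N_def by blast
  define J' where "J' f = (if f \<in> Cc then J f else 0)" for f
  have J'_eq: "J' f = J f" if "f \<in> Cc" for f unfolding J'_def using that by simp
  note scale = Cc_cmult
  have J'd: "J' \<in> dominated"
   using J unfolding dominated_def by (simp add: J'_eq Cc_add scale)
  have "J' f \<in> {- bnd f..bnd f}" for f
   using dominated_abs[OF J'd, of f "bnd f"] bnd[of f]
   by (cases "f \<in> Cc") (auto simp: abs_le_iff bnd_def J'_def)
  hence "J' \<in> K" unfolding K_def by blast
  moreover have "J' \<in> E p" if p: "p \<in> P" for p
   unfolding E_def
  proof (intro IntI J'd CollectI ballI allI impI)
   fix f b assume f: "f \<in> Cc" and b: "\<forall>x. \<bar>S (%z. f (z + x))\<bar> <= b"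
   have "0 <= b" using b by (meson abs_ge_zero order_trans)
   have "snd p <= Max (insert 0 (snd ` P))" using p P by (intro Max_ge) auto
   hence le: "real (Suc (snd p)) <= real N" unfolding N_def by simp
   have "\<bar>J (%z. f (z + fst p)) - J f\<bar> <= 2 * b / real N"
    using p f b by (intro inv) auto
   also have "... <= 2 * b / real (Suc (snd p))"
    using le `0 <= b` by (intro divide_left_mono) auto
   finally show "\<bar>J' (%z. f (z + fst p)) - J' f\<bar> <= 2 * b / real (Suc (snd p))"
    using f Cc_shift[OF f] by (simp add: J'_eq)
  qed
  ultimately show "K \<inter> (\<Inter>p\<in>P. E p) \<noteq> {}" by blast
 qed (rule E)
 then obtain I where I: "\<And>p. I \<in> E p" by blast
 have "I (%z. f (z + t)) = I f" if f: "f \<in> Cc" for f t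
 proof -
  have "\<bar>I (%z. f (z + t)) - I f\<bar> <= 2 * bnd f / real (Suc n)" for n
   using I[of "(t, n)"] f bnd[OF f] unfolding E_def by auto
  moreover have "(%n. 2 * bnd f / real (Suc n)) \<longlonglongrightarrow> 0"
   using LIMSEQ_Suc[OF lim_const_over_n[of "2 * bnd f"]] by simp
  ultimately have "\<bar>I (%z. f (z + t)) - I f\<bar> <= 0"
   by (intro LIMSEQ_le_const) auto
  thus ?thesis by simp
 qed
 thus ?thesis using I[of undefined] unfolding E_def by blast
qed

end

text \<open>The last assumption stands in for Fubini: it bounds a convolution by a multiple of the integral of
one factor, and no exchange of the order of integration is needed later.\<close>
locale haar_integral =
 fixes I :: "('a::{topological_ab_group_add,t2_space} => real) => real"
 assumes I_add: "f \<in> Cc ==> g \<in> Cc ==> I (%x. f x + g x) = I f + I g"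
  and I_scale: "f \<in> Cc ==> I (%x. r * f x) = r * I f"
  and I_nonneg: "f \<in> Cc ==> (\<And>x. 0 <= f x) ==> 0 <= I f"
  and I_shift: "f \<in> Cc ==> I (%x. f (x + t)) = I f"
  and I_pos: "f \<in> Cc ==> (\<And>x. 0 <= f x) ==> 0 < f z ==> 0 < I f"
  and I_convolution_le: "k \<in> Cc ==> (\<And>x. 0 <= k x) ==>
    \<exists>C. \<forall>h\<in>Cc. (\<forall>x. 0 <= h x) \<longrightarrow> I (%z. I (%s. h s * k (s - z))) <= C * I h"
begin

lemma I_minus: "f \<in> Cc ==> I (%x. - f x) = - I f"
 using I_scale[of f "-1"] by simp

lemma I_diff: "f \<in> Cc ==> g \<in> Cc ==> I (%x. f x - g x) = I f - I g"
 using I_add[of f "%x. - g x"] by (simp add: I_minus Cc_minus)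

lemma I_zero: "I (%x. 0) = 0"
 using I_scale[of "%x. 0" 0] by simp

lemma I_sum: "(\<And>i. i \<in> A ==> f i \<in> Cc) ==> I (%x. \<Sum>i\<in>A. f i x) = (\<Sum>i\<in>A. I (f i))"
 by (induction A rule: infinite_finite_induct) (auto simp: I_zero I_add Cc_sum)

lemma I_mono: "f \<in> Cc ==> g \<in> Cc ==> (\<And>x. f x <= g x) ==> I f <= I g"
 using I_nonneg[of "%x. g x - f x"] by (simp add: I_diff Cc_diff)

end

text \<open>Only additivity, homogeneity and positivity of I are used, since the lemma is needed to verify
\<open>I_convolution_le\<close> before I is known to be an invariant integral.\<close>
lemma Cc_correlation:
 fixes h k :: "'a::topological_ab_group_add => real"
 assumes I: "\<And>f g. f \<in> Cc ==> g \<in> Cc ==> I (%x. f x + g x) = I f + I g"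
  "\<And>f r. f \<in> Cc ==> I (%x. r * f x) = r * I f"
  "\<And>f. f \<in> Cc ==> (\<And>x. 0 <= f x) ==> 0 <= I f"
  and h: "h \<in> Cc" and k: "k \<in> Cc"
 shows "(%z. I (%s. h s * k (s - z))) \<in> Cc"
proof -
 have zero: "I (%x. 0) = 0" using I(2)[of "%x. 0" 0] by simp
 have minus: "I (%x. - f x) = - I f" if "f \<in> Cc" for f using I(2)[OF that, of "-1"] by simp
 have mono: "I f <= I g" if "f \<in> Cc" "g \<in> Cc" "\<And>x. f x <= g x" for f g
  using I(3)[of "%x. g x + - f x"] I(1)[of g "%x. - f x"] that minus Cc_minus[of f] Cc_diff[of g f] by auto
 obtain K L where K: "compact K" "\<And>x. x \<notin> K ==> h x = 0" and L: "compact L" "\<And>x. x \<notin> L ==> k x = 0"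
  using assms by (metis Cc_support)
 have hk: "(%s. h s * k (s - z)) \<in> Cc" for z
  by (rule Cc_mult(2)[OF h]) (rule continuous_on_translate_comp(3)[OF Cc_continuous[OF k]])
 have ha: "(%s. \<bar>h s\<bar>) \<in> Cc" using Cc_norm[OF h] by simp
 have Iha: "0 <= I (%s. \<bar>h s\<bar>)" by (rule I(3)[OF ha]) simp
 have "continuous_on UNIV (%z. I (%s. h s * k (s - z)))"
 proof (rule continuous_on_groupI)
  fix z :: 'a and e :: real assume "0 < e"
  define e' where "e' = e / (I (%s. \<bar>h s\<bar>) + 1)"
  have "0 < e'" unfolding e'_def using `0 < e` Iha by simp
  then obtain V where V: "open V" "0 \<in> V" "\<And>x t. t \<in> V ==> norm (k (x + t) - k x) < e'"
   using Cc_uniform[OF k] by blast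
  obtain V' where V': "open V'" "0 \<in> V'" "\<And>x. x \<in> V' ==> - x \<in> V'" "V' \<subseteq> V"
   using half_nbhd[OF V(1,2)] by metis
  show "\<exists>V. open V \<and> 0 \<in> V \<and> (\<forall>t\<in>V. dist (I (%s. h s * k (s - (z + t)))) (I (%s. h s * k (s - z))) <= e)"
  proof (intro exI[of _ V'] conjI V' ballI)
   fix t assume "t \<in> V'"
   define u where "u s = h s * k (s - (z + t)) - h s * k (s - z)" for s
   have u: "u \<in> Cc" unfolding u_def by (intro Cc_diff hk)
   have eq: "I (%s. h s * k (s - (z + t))) - I (%s. h s * k (s - z)) = I u"
    using I(1)[OF hk[of "z + t"] Cc_minus[OF hk[of z]]] minus[OF hk[of z]] unfolding u_def by simp
   have b: "\<bar>u s\<bar> <= e' * \<bar>h s\<bar>" for s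
   proof -
    have "\<bar>k (s - z + - t) - k (s - z)\<bar> <= e'"
     using V(3)[of "- t" "s - z"] V' `t \<in> V'` by (simp add: less_imp_le subset_iff)
    hence "\<bar>h s\<bar> * \<bar>k (s - z + - t) - k (s - z)\<bar> <= \<bar>h s\<bar> * e'" by (rule mult_left_mono) simp
    thus ?thesis unfolding u_def by (simp add: abs_mult[symmetric] algebra_simps)
   qed
   have c: "(%s. e' * \<bar>h s\<bar>) \<in> Cc" by (rule Cc_mult(1)[OF ha]) (rule continuous_on_const)
   have "u s <= e' * \<bar>h s\<bar>" "- u s <= e' * \<bar>h s\<bar>" for s using b[of s] by linarith+
   hence "I u <= I (%s. e' * \<bar>h s\<bar>)" "I (%s. - u s) <= I (%s. e' * \<bar>h s\<bar>)"
    using u c Cc_minus[OF u] by (intro mono; simp)+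
   hence "\<bar>I u\<bar> <= e' * I (%s. \<bar>h s\<bar>)"
    using minus[OF u] I(2)[OF ha, of e'] by (simp add: abs_le_iff)
   also have "... <= e" unfolding e'_def using `0 < e` Iha by (simp add: field_simps)
   finally show "dist (I (%s. h s * k (s - (z + t)))) (I (%s. h s * k (s - z))) <= e"
    by (simp add: dist_real_def eq)
  qed
 qed
 moreover have "compact ((%p. fst p - snd p) ` (K \<times> L))"
  by (intro compact_continuous_image compact_Times K L continuous_on_diff continuous_on_fst
    continuous_on_snd continuous_on_id)
 moreover have "I (%s. h s * k (s - z)) = 0" if z: "z \<notin> (%p. fst p - snd p) ` (K \<times> L)" for z
 proof -
  have "h s * k (s - z) = 0" for s
  proof (rule ccontr)
   assume "h s * k (s - z) \<noteq> 0"
   hence "s \<in> K" "s - z \<in> L" using K(2) L(2) by auto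
   hence "z = fst (s, s - z) - snd (s, s - z)" "(s, s - z) \<in> K \<times> L" by auto
   thus False using z by blast
  qed
  hence "(%s. h s * k (s - z)) = (%s. 0)" by blast
  thus ?thesis using zero by simp
 qed
 ultimately show ?thesis by (rule CcI)
qed

context delone
begin

text \<open>For strict positivity, finitely many translates of f dominate a constant on a compact set that every
translate of D meets, so their sum has all S-values bounded below.\<close>
lemma ex_haar_integral: "\<exists>I :: ('a => real) => real. haar_integral I"
proof -
 obtain I where I: "I \<in> dominated" and inv: "\<And>f t. f \<in> Cc ==> I (%z. f (z + t)) = I f"
  using ex_invariant by blast
 have add: "I (%x. f x + g x) = I f + I g" if "f \<in> Cc" "g \<in> Cc" for f g
  using I that unfolding dominated_def by blast
 have scale: "I (%x. r * f x) = r * I f" if "f \<in> Cc" for f r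
  using I that unfolding dominated_def by blast
 have dom: "I f <= b" if "f \<in> Cc" "\<And>x. S (%z. f (z + x)) <= b" for f b
  using I that unfolding dominated_def by blast
 note scaleC = Cc_cmult
 have lower: "b <= I f" if "f \<in> Cc" "\<And>x. b <= S (%z. f (z + x))" for f b
  using dom[OF scaleC[OF that(1)], of "-1" "- b"] that S_scale[of "-1"] scale[OF that(1), of "-1"] by auto
 have S_nonneg: "0 <= S f" if "\<And>x. 0 <= f x" for f
  unfolding S_def using that by (intro sum_nonneg) auto
 have nonneg: "0 <= I f" if "f \<in> Cc" "\<And>x. 0 <= f x" for f
  by (rule lower[OF that(1)]) (rule S_nonneg, rule that)
 have Isum: "finite A ==> (\<And>i. i \<in> A ==> f i \<in> Cc) ==> I (%x. \<Sum>i\<in>A. f i x) = (\<Sum>i\<in>A. I (f i))"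
  for A :: "'a set" and f
 proof (induction A rule: finite_induct)
  case empty thus ?case using scale[of "%x. 0" 0] by simp
 next
  case (insert a A) thus ?case by (simp add: add Cc_sum)
 qed
 show ?thesis
 proof (rule exI[of _ I], rule haar_integral.intro)
  show "\<And>f g. f \<in> Cc ==> g \<in> Cc ==> I (%x. f x + g x) = I f + I g" by (rule add)
  show "\<And>f r. f \<in> Cc ==> I (%x. r * f x) = r * I f" by (rule scale)
  show "\<And>f. f \<in> Cc ==> (\<And>x. 0 <= f x) ==> 0 <= I f" by (rule nonneg)
  show "\<And>f t. f \<in> Cc ==> I (%x. f (x + t)) = I f" by (rule inv)
  fix f :: "'a => real" and z assume f: "f \<in> Cc" "\<And>x. 0 <= f x" "0 < f z"
  obtain K where K: "compact K" "\<And>x. \<exists>d\<in>D. d + x \<in> K" using covering by blast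
  define U where "U = {x. f z / 2 < f x}"
  have U: "open U" unfolding U_def
   by (intro open_Collect_less continuous_on_const Cc_continuous f)
  have "K \<subseteq> (\<Union>t\<in>K. {x. x + (z - t) \<in> U})" unfolding U_def using f(3) by auto
  then obtain F where F: "F \<subseteq> K" "finite F" "K \<subseteq> (\<Union>t\<in>F. {x. x + (z - t) \<in> U})"
   by (rule compactE_image[OF `compact K` open_translate(1)[OF U]])
  define g where "g x = (\<Sum>t\<in>F. f (x + (z - t)))" for x
  have g: "g \<in> Cc" unfolding g_def by (intro Cc_sum Cc_shift f)
  have gK: "f z / 2 <= g x" if xK: "x \<in> K" for x
  proof -
   obtain t where t: "t \<in> F" "x + (z - t) \<in> U" using F(3) xK by blast
   have "f (x + (z - t)) <= g x" unfolding g_def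
    by (rule member_le_sum[OF t(1) _ F(2)]) (use f in auto)
   thus ?thesis using t(2) unfolding U_def by simp
  qed
  have g0: "0 <= g x" for x unfolding g_def using f by (intro sum_nonneg) auto
  have "f z / 2 <= I g"
  proof (rule lower[OF g])
   fix x
   obtain d where d: "d \<in> D" "d + x \<in> K" using K by blast
   obtain L where L: "compact L" "\<And>y. y \<notin> L ==> g (y + x) = 0" using Cc_support[OF Cc_shift[OF g]] by metis
   have "d \<in> L" using L(2)[of d] gK[OF d(2)] f(3) by fastforce
   have "f z / 2 <= g (d + x)" by (rule gK[OF d(2)])
   also have "... <= S (%y. g (y + x))"
    unfolding S_eq[OF L, of "%y. y"]
    using `d \<in> L` d(1) finite_D[OF L(1)] g0
    by (subst S_eq[OF L]) (auto intro!: member_le_sum)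
   finally show "f z / 2 <= S (%y. g (y + x))" .
  qed
  also have "I g = (\<Sum>t\<in>F. I (%x. f (x + (z - t))))"
   unfolding g_def by (rule Isum[OF F(2)]) (intro Cc_shift f)
  also have "... = real (card F) * I f" by (simp add: inv[OF f(1)])
  finally show "0 < I f" using f(3) nonneg[OF f(1,2)] by (cases "I f = 0") auto
 next
  fix k :: "'a => real" assume k: "k \<in> Cc" "\<And>x. 0 <= k x"
  obtain C where C: "\<And>x. \<bar>S (%z. k (- z + x))\<bar> <= C"
  proof -
   obtain b where b: "\<And>x. \<bar>S (%z. k (0 - (z + x)))\<bar> <= b"
    using S_bounded[OF Cc_reflect[OF k(1), of 0]] by blast
   show ?thesis by (rule that[of b]) (use b[of "- x" for x] in simp)
  qed
  have "I (%z. I (%s. h s * k (s - z))) <= C * I h" if h: "h \<in> Cc" "\<And>x. 0 <= h x" for h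
  proof (rule dom)
   show corr: "(%z. I (%s. h s * k (s - z))) \<in> Cc"
    by (rule Cc_correlation[OF add scale nonneg h(1) k(1)])
   fix x
   obtain L where L: "compact L" "\<And>d. d \<notin> L ==> I (%s. h s * k (s - (d + x))) = 0"
    using Cc_support[OF Cc_shift[OF corr]] by metis
   have c: "(%s. h s * k (s - (d + x))) \<in> Cc" for d
    by (rule Cc_mult(2)[OF h(1)]) (rule continuous_on_translate_comp(3)[OF Cc_continuous[OF k(1)]])
   have "S (%z. I (%s. h s * k (s - (z + x)))) = (\<Sum>d\<in>{d \<in> D. d \<in> L}. I (%s. h s * k (s - (d + x))))"
    by (rule S_eq[OF L])
   also have "... = I (%s. \<Sum>d\<in>{d \<in> D. d \<in> L}. h s * k (s - (d + x)))"
    by (rule Isum[symmetric]) (auto intro: finite_D L c)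
   also have "... <= I (%s. C * h s)"
   proof -
    have le: "(\<Sum>d\<in>{d \<in> D. d \<in> L}. h s * k (s - (d + x))) <= C * h s" for s
    proof -
     define M where "M = (%z. k (- z + (s - x)))"
     have "M \<in> Cc" unfolding M_def using Cc_reflect[OF k(1), of "s - x"] by (simp add: add.commute)
     then obtain N where N: "compact N" "\<And>d. d \<notin> N ==> M d = 0" by (metis Cc_support)
     have "(\<Sum>d\<in>{d \<in> D. d \<in> L}. M d) <= (\<Sum>d\<in>{d \<in> D. d \<in> L \<union> N}. M d)"
      by (rule sum_mono2, rule finite_D[OF compact_Un[OF L(1) N(1)]]) (auto simp: M_def k)
     also have "... = S M"
      by (rule S_eq[symmetric, OF compact_Un[OF L(1) N(1)]]) (simp add: N(2))
     also have "... <= C" using C[of "s - x"] unfolding M_def by linarith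
     finally have "h s * (\<Sum>d\<in>{d \<in> D. d \<in> L}. M d) <= h s * C" using h(2) by (rule mult_left_mono)
     thus ?thesis unfolding M_def by (simp add: sum_distrib_left algebra_simps)
    qed
    define w where "w s = C * h s + - (\<Sum>d\<in>{d \<in> D. d \<in> L}. h s * k (s - (d + x)))" for s
    have c1: "(%s. \<Sum>d\<in>{d \<in> D. d \<in> L}. h s * k (s - (d + x))) \<in> Cc" by (intro Cc_sum c)
    have "0 <= I w" using le unfolding w_def
     by (intro nonneg Cc_add scaleC h Cc_minus c1) auto
    also have "I w = I (%s. C * h s) - I (%s. \<Sum>d\<in>{d \<in> D. d \<in> L}. h s * k (s - (d + x)))"
     unfolding w_def using add[OF scaleC[OF h(1)] Cc_minus[OF c1], of C] scale[OF c1, of "-1"] by simp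
    finally show ?thesis by simp
   qed
   also have "... = C * I h" by (rule scale[OF h(1)])
   finally show "S (%z. I (%s. h s * k (s - (z + x)))) <= C * I h" .
  qed
  thus "\<exists>C. \<forall>h\<in>Cc. (\<forall>x. 0 <= h x) \<longrightarrow> I (%z. I (%s. h s * k (s - z))) <= C * I h" by blast
 qed
qed

end

theorem ex_haar_integral:
 assumes "locally_compact_space (euclidean :: 'a::{topological_ab_group_add,t2_space} topology)"
 shows "\<exists>I :: ('a => real) => real. haar_integral I"
proof -
 obtain U L where U: "open U" "(0::'a) \<in> U" "compact L" "U \<subseteq> L" using lc_compact_nbhd[OF assms] by metis
 obtain W where W: "open W" "0 \<in> W" "\<And>x. x \<in> W ==> - x \<in> W" "W \<subseteq> U"
  using half_nbhd[OF U(1,2)] by metis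
 obtain V where V: "open V" "0 \<in> V" "\<And>x y. x \<in> V ==> y \<in> V ==> x - y \<in> W"
  using half_nbhd[OF W(1,2)] by metis
 obtain D where D: "\<And>d e. d \<in> D ==> e \<in> D ==> d - e \<in> W ==> d = e" "\<And>x. \<exists>d\<in>D. d - x \<in> W"
  using ex_delone_set[OF W(2,3)] by metis
 have "delone D"
 proof
  fix K :: "'a set" assume K: "compact K"
  have "K \<subseteq> (\<Union>t\<in>K. {z. z - t \<in> V})" using V(2) by (intro subsetI UN_I) (assumption, simp)
  then obtain F where F: "F \<subseteq> K" "finite F" "K \<subseteq> (\<Union>t\<in>F. {z. z - t \<in> V})"
   by (rule compactE_image[OF K open_translate(3)[OF V(1)]])
  have "finite {d \<in> D. d + x \<in> K} \<and> card {d \<in> D. d + x \<in> K} <= card F" for x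
  proof -
   have "\<forall>d\<in>{d \<in> D. d + x \<in> K}. \<exists>t. t \<in> F \<and> d + x - t \<in> V" using F(3) by blast
   from bchoice[OF this] obtain t where t: "\<And>d. d \<in> D ==> d + x \<in> K ==> t d \<in> F \<and> d + x - t d \<in> V" by blast
   have "inj_on t {d \<in> D. d + x \<in> K}"
   proof (rule inj_onI)
    fix d e assume d: "d \<in> {d \<in> D. d + x \<in> K}" and e: "e \<in> {d \<in> D. d + x \<in> K}" and "t d = t e"
    hence "(d + x - t d) - (e + x - t d) \<in> W" using t[of d] t[of e] by (intro V(3)) auto
    hence "d - e \<in> W" by (simp add: algebra_simps)
    thus "d = e" using D(1) d e by blast
   qed
   moreover have "t ` {d \<in> D. d + x \<in> K} \<subseteq> F" using t by blast
   ultimately show ?thesis using F(2) card_inj_on_le inj_on_finite by blast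
  qed
  thus "\<exists>C. \<forall>x. finite {d \<in> D. d + x \<in> K} \<and> card {d \<in> D. d + x \<in> K} <= C" by blast
 next
  have "\<exists>d\<in>D. d + x \<in> L" for x using D(2)[of "- x"] W(4) U(4)
   by (metis diff_minus_eq_add subsetD)
  thus "\<exists>K. compact K \<and> (\<forall>x. \<exists>d\<in>D. d + x \<in> K)" using U(3) by blast
 qed
 thus ?thesis by (rule delone.ex_haar_integral)
qed


section \<open>Characters separate points\<close>

lemma Cc_ComplexI:
 assumes "(%x. Re (f x)) \<in> Cc" "(%x. Im (f x)) \<in> Cc" shows "f \<in> Cc"
proof -
 have "(%x. of_real (Re (f x)) + \<i> * of_real (Im (f x))) \<in> Cc"
  by (intro Cc_add Cc_of_real assms Cc_mult(1) continuous_on_const)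
 thus ?thesis by (simp add: complex_eq[symmetric])
qed

lemma lc_cutoff_ex:
 fixes K :: "'a::t2_space set"
 assumes "locally_compact_space (euclidean :: 'a topology)" "compact K" "open U" "K \<subseteq> U"
 shows "\<exists>g :: 'a => real. g \<in> Cc \<and> (\<forall>x. 0 <= g x) \<and> (\<forall>x. g x <= 1) \<and> (\<forall>x. x \<in> K \<longrightarrow> g x = 1) \<and>
  (\<forall>x. x \<notin> U \<longrightarrow> g x = 0)"
proof (rule lc_cutoff[OF assms])
 fix g :: "'a => real"
 assume "g \<in> Cc" "\<And>x. 0 <= g x" "\<And>x. g x <= 1" "\<And>x. x \<in> K ==> g x = 1" "\<And>x. x \<notin> U ==> g x = 0"
 thus ?thesis by (intro exI[of _ g] conjI allI impI)
qed

lemma lc_bump: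
 fixes K :: "'a::t2_space set"
 assumes "locally_compact_space (euclidean :: 'a topology)" "compact K"
 shows "\<exists>g :: 'a => real. g \<in> Cc \<and> (\<forall>x. 0 <= g x) \<and> (\<forall>x. g x <= 1) \<and> (\<forall>x. x \<in> K \<longrightarrow> g x = 1)"
proof (rule lc_cutoff[OF assms open_UNIV subset_UNIV])
 fix g :: "'a => real"
 assume "g \<in> Cc" "\<And>x. 0 <= g x" "\<And>x. g x <= 1" "\<And>x. x \<in> K ==> g x = 1"
 thus ?thesis by (intro exI[of _ g] conjI allI impI)
qed

lemma quadratic_nonneg_discrim:
 fixes A B J :: real
 assumes "\<And>t. 0 <= A - 2 * t * J + t^2 * B" "0 <= B"
 shows "J^2 <= A * B"
proof (cases "B = 0")
 case True
 have "J = 0"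
 proof (rule ccontr)
  assume "J \<noteq> 0"
  thus False using assms(1)[of "(A + 1) / (2 * J)"] True by simp
 qed
 thus ?thesis using True by simp
next
 case False
 have "0 <= A - J^2 / B"
  using assms(1)[of "J / B"] False by (simp add: power2_eq_square field_simps)
 thus ?thesis using False assms(2) by (simp add: field_simps)
qed

lemma norm_add_sq_le: "(norm (a + b :: 'b::real_normed_vector))^2 <= 2 * (norm a)^2 + 2 * (norm b)^2"
proof -
 have "(norm (a + b))^2 <= (norm a + norm b)^2" by (rule power_mono[OF norm_triangle_ineq]) simp
 also have "... <= 2 * (norm a)^2 + 2 * (norm b)^2"
  using sum_squares_bound[of "norm a" "norm b"] by (simp add: power2_sum)
 finally show ?thesis .
qed

text \<open>Plancherel for the cyclic group of order N.\<close>
lemma parseval_roots_of_unity: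
 fixes a :: "nat => complex"
 assumes "0 < N"
 shows "(\<Sum>j<N. (norm (\<Sum>m<N. cnj (cis (2 * pi * real j / N)) ^ m * a m))^2) = N * (\<Sum>m<N. (norm (a m))^2)"
proof -
 define w where "w = cis (2 * pi / N)"
 have wj: "cis (2 * pi * real j / N) = w ^ j" for j
  unfolding w_def Complex.DeMoivre by (simp add: field_simps)
 have wc: "w * cnj w = 1" "cnj w * w = 1" unfolding w_def by (simp_all add: cis_cnj cis_mult)
 have orth: "(\<Sum>j<N. cnj (w ^ j) ^ m * (w ^ j) ^ n) = (if m = n then of_nat N else 0)"
  if "m < N" "n < N" for m n
 proof (cases "m = n")
  case True
  have "cnj (w ^ j) ^ n * (w ^ j) ^ n = (cnj w * w) ^ (j * n)" for j
   by (simp add: power_mult power_mult_distrib)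
  thus ?thesis using True wc by simp
 next
  case False
  define r where "r = cnj w ^ m * w ^ n"
  have r: "r = cis (2 * pi * (real n - real m) / N)"
   unfolding r_def w_def cis_cnj Complex.DeMoivre cis_mult by (rule arg_cong[where f = cis]) (simp add: diff_divide_distrib right_diff_distrib algebra_simps)
  have "r \<noteq> 1"
  proof
   assume "r = 1"
   hence "cos (2 * pi * (real n - real m) / N) = 1" unfolding r by (metis cis.sel(1) one_complex.sel(1))
   then obtain k :: int where k: "2 * pi * (real n - real m) / N = real_of_int k * 2 * pi"
    by (auto simp: cos_one_2pi_int)
   hence "2 * pi * (real n - real m) = 2 * pi * (real_of_int k * real N)"
    using `0 < N` by (simp add: field_simps)
   hence "real n - real m = real_of_int k * real N" by simp
   hence "int n - int m = k * int N" by (metis of_int_diff of_int_eq_iff of_int_mult of_int_of_nat_eq)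
   moreover have "\<bar>int n - int m\<bar> < int N" using that by linarith
   moreover have "int n - int m \<noteq> 0" using False by simp
   ultimately show False by (metis abs_of_nat dvd_imp_le_int dvd_triv_right not_le)
  qed
  moreover have "r ^ N = 1"
  proof -
   have "w ^ N = 1" unfolding w_def Complex.DeMoivre using `0 < N` by simp
   hence "cnj w ^ N = 1" by (metis complex_cnj_power complex_cnj_one)
   have "r ^ N = (cnj w ^ N) ^ m * (w ^ N) ^ n"
    unfolding r_def power_mult_distrib by (metis mult.commute power_mult)
   thus ?thesis using `w ^ N = 1` `cnj w ^ N = 1` by simp
  qed
  moreover have "cnj (w ^ j) ^ m * (w ^ j) ^ n = r ^ j" for j
   unfolding r_def power_mult_distrib by (metis complex_cnj_power mult.commute power_mult)
  ultimately show ?thesis using False by (simp add: sum_gp_strict)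
 qed
 have sq: "of_real ((norm z)^2) = z * cnj z" for z by (metis complex_norm_square)
 have "of_real (\<Sum>j<N. (norm (\<Sum>m<N. cnj (w ^ j) ^ m * a m))^2) =
   (\<Sum>j<N. \<Sum>m<N. \<Sum>n<N. (cnj (w ^ j) ^ m * a m) * ((w ^ j) ^ n * cnj (a n)))"
  unfolding of_real_sum sq cnj_sum sum_product by simp
 also have "... = (\<Sum>j<N. \<Sum>m<N. \<Sum>n<N. (cnj (w ^ j) ^ m * (w ^ j) ^ n) * (a m * cnj (a n)))"
  by (simp only: ac_simps)
 also have "... = (\<Sum>m<N. \<Sum>n<N. \<Sum>j<N. (cnj (w ^ j) ^ m * (w ^ j) ^ n) * (a m * cnj (a n)))"
  by (subst sum.swap, rule sum.cong[OF refl], rule sum.swap)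
 also have "... = (\<Sum>m<N. \<Sum>n<N. (if m = n then of_nat N else 0) * (a m * cnj (a n)))"
  by (intro sum.cong refl) (simp only: sum_distrib_right[symmetric] orth lessThan_iff)
 also have "... = (\<Sum>m<N. of_nat N * (a m * cnj (a m)))"
 proof (rule sum.cong[OF refl])
  fix m assume m: "m \<in> {..<N}"
  have "(\<Sum>n<N. (if m = n then of_nat N else 0) * (a m * cnj (a n))) =
    (\<Sum>n<N. if m = n then of_nat N * (a m * cnj (a n)) else 0)"
   by (rule sum.cong) auto
  also have "... = of_nat N * (a m * cnj (a m))" using m by simp
  finally show "(\<Sum>n<N. (if m = n then of_nat N else 0) * (a m * cnj (a n))) = of_nat N * (a m * cnj (a m))" .
 qed
 also have "... = of_real (N * (\<Sum>m<N. (norm (a m))^2))"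
  by (simp only: sum_distrib_left of_real_sum of_real_mult of_real_of_nat_eq sq)
 finally show ?thesis unfolding wj of_real_eq_iff .
qed

context haar_integral
begin

definition Ic :: "('a => complex) => complex" where
 "Ic f = Complex (I (%x. Re (f x))) (I (%x. Im (f x)))"

definition Q :: "('a => complex) => real" where
 "Q f = I (%x. (norm (f x))^2)"

lemma Ic_add: "f \<in> Cc ==> g \<in> Cc ==> Ic (%x. f x + g x) = Ic f + Ic g"
 unfolding Ic_def by (simp add: I_add Cc_Re Cc_Im complex_add)

lemma Ic_scale: "f \<in> Cc ==> Ic (%x. c * f x) = c * Ic f"
proof -
 assume f: "f \<in> Cc"
 have s: "(%x. r * Re (f x)) \<in> Cc" "(%x. r * Im (f x)) \<in> Cc" for r
  by (intro Cc_mult(1) Cc_Re Cc_Im f continuous_on_const)+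
 show ?thesis
  unfolding Ic_def by (simp add: I_add I_diff s I_scale Cc_Re Cc_Im f complex_eq_iff)
qed

lemma Ic_zero: "Ic (%x. 0) = 0"
 unfolding Ic_def by (simp add: I_zero complex_eq_iff)

lemma Ic_sum: "(\<And>i. i \<in> A ==> f i \<in> Cc) ==> Ic (%x. \<Sum>i\<in>A. f i x) = (\<Sum>i\<in>A. Ic (f i))"
 by (induction A rule: infinite_finite_induct) (auto simp: Ic_zero Ic_add Cc_sum)

lemma Ic_diff: "f \<in> Cc ==> g \<in> Cc ==> Ic (%x. f x - g x) = Ic f - Ic g"
 using Ic_add[of f "%x. (-1) * g x"] Ic_scale[of g "-1"] Cc_minus[of g] by simp

lemma Ic_shift: "f \<in> Cc ==> Ic (%x. f (x + t)) = Ic f"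
 unfolding Ic_def by (simp add: I_shift Cc_Re Cc_Im I_shift[of "%x. Re (f x)"] I_shift[of "%x. Im (f x)"])

lemma Ic_shift_diff: "f \<in> Cc ==> Ic (%x. f (x - t)) = Ic f"
 using Ic_shift[of f "- t"] by simp

lemma Ic_cnj: "f \<in> Cc ==> Ic (%x. cnj (f x)) = cnj (Ic f)"
 unfolding Ic_def by (simp add: I_minus Cc_Im complex_eq_iff)

lemma Ic_of_real: "Ic (%x. of_real (f x)) = of_real (I f)"
 unfolding Ic_def by (simp add: I_zero complex_eq_iff)

lemma Ic_norm_le: assumes "f \<in> Cc" shows "norm (Ic f) <= I (%x. norm (f x))"
proof -
 obtain w where w: "norm w = 1" "w * Ic f = of_real (norm (Ic f))"
 proof (cases "Ic f = 0")
  case True thus ?thesis using that[of 1] by simp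
 next
  case False
  show ?thesis
  proof (rule that[of "cnj (Ic f) / of_real (norm (Ic f))"])
   show "norm (cnj (Ic f) / of_real (norm (Ic f))) = 1" using False by (simp add: norm_divide)
   have "cnj (Ic f) * Ic f = of_real (norm (Ic f)) * of_real (norm (Ic f))"
    by (metis complex_norm_square mult.commute of_real_mult power2_eq_square)
   thus "cnj (Ic f) / of_real (norm (Ic f)) * Ic f = of_real (norm (Ic f))"
    using False by (simp add: field_simps)
  qed
 qed
 have c: "(%x. w * f x) \<in> Cc" by (intro Cc_mult(1) assms continuous_on_const)
 have "norm (Ic f) = Re (Ic (%x. w * f x))" using w(2) by (simp add: Ic_scale assms)
 also have "... = I (%x. Re (w * f x))" unfolding Ic_def by simp
 also have "... <= I (%x. norm (f x))"
  by (intro I_mono Cc_Re Cc_norm c assms order_trans[OF complex_Re_le_cmod]) (simp add: norm_mult w(1))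
 finally show ?thesis .
qed

lemma I_cauchy_schwarz:
 assumes "p \<in> Cc" "q \<in> Cc"
 shows "(I (%x. p x * q x))^2 <= I (%x. (p x)^2) * I (%x. (q x)^2)"
proof (rule quadratic_nonneg_discrim)
 fix t :: real
 have c: "(%x. p x * q x) \<in> Cc" by (intro Cc_mult(2) assms Cc_continuous)
 note s = Cc_cmult
 have eq: "(%x. (p x - t * q x)^2) = (%x. ((p x)^2 - (2 * t) * (p x * q x)) + t^2 * (q x)^2)"
  by (simp add: power2_eq_square algebra_simps)
 have "0 <= I (%x. (p x - t * q x)^2)"
  by (intro I_nonneg Cc_power2 Cc_diff assms s) simp
 also have "... = I (%x. (p x)^2) - 2 * t * I (%x. p x * q x) + t^2 * I (%x. (q x)^2)"
  unfolding eq by (simp add: I_add I_diff I_scale s c Cc_power2 Cc_diff assms)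
 finally show "0 <= I (%x. (p x)^2) - 2 * t * I (%x. p x * q x) + t^2 * I (%x. (q x)^2)" .
next
 show "0 <= I (%x. (q x)^2)" by (intro I_nonneg Cc_power2 assms) simp
qed

lemma Ic_cauchy_schwarz:
 assumes "a \<in> Cc" "b \<in> Cc"
 shows "(norm (Ic (%x. a x * of_real (b x))))^2 <= Q a * I (%x. (b x)^2)"
proof -
 have "(%x. a x * of_real (b x)) \<in> Cc"
  by (intro Cc_mult(2) assms Cc_continuous Cc_of_real)
 hence "norm (Ic (%x. a x * of_real (b x))) <= I (%x. norm (a x) * \<bar>b x\<bar>)"
  using Ic_norm_le by (fastforce simp: norm_mult)
 hence "(norm (Ic (%x. a x * of_real (b x))))^2 <= (I (%x. norm (a x) * \<bar>b x\<bar>))^2"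
  by (rule power_mono) simp
 also have "... <= I (%x. (norm (a x))^2) * I (%x. \<bar>b x\<bar>^2)"
  using I_cauchy_schwarz[OF Cc_norm[OF assms(1)], of "%x. \<bar>b x\<bar>"] Cc_norm[OF assms(2)] by simp
 finally show ?thesis unfolding Q_def by simp
qed

lemma Q_nonneg: "f \<in> Cc ==> 0 <= Q f"
 unfolding Q_def by (intro I_nonneg Cc_norm2) simp_all

lemma Q_scale: "f \<in> Cc ==> Q (%x. c * f x) = (norm c)^2 * Q f"
 unfolding Q_def by (simp add: norm_mult power_mult_distrib I_scale Cc_norm2)

lemma Q_shift: "f \<in> Cc ==> Q (%x. f (x + t)) = Q f"
 unfolding Q_def by (rule I_shift[OF Cc_norm2])

lemma Q_shift_diff: "f \<in> Cc ==> Q (%x. f (x - t)) = Q f"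
 using Q_shift[of f "- t"] by simp

lemma Q_add_le: assumes "f \<in> Cc" "g \<in> Cc" shows "Q (%x. f x + g x) <= 2 * Q f + 2 * Q g"
proof -
 note s = Cc_cmult
 have "Q (%x. f x + g x) <= I (%x. 2 * (norm (f x))^2 + 2 * (norm (g x))^2)"
  unfolding Q_def by (intro I_mono Cc_norm2 Cc_add s assms norm_add_sq_le)
 also have "... = 2 * Q f + 2 * Q g"
  unfolding Q_def by (simp add: I_add I_scale s Cc_norm2 assms)
 finally show ?thesis .
qed

lemma Q_minus: "Q (%x. - f x) = Q f"
 unfolding Q_def by simp

lemma Q_diff_le: assumes "f \<in> Cc" "g \<in> Cc" shows "Q (%x. f x - g x) <= 2 * Q f + 2 * Q g"
 using Q_add_le[OF assms(1) Cc_minus[OF assms(2)]] by (simp add: Q_minus)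

text \<open>An approximate projection on the part of v that translation by s multiplies by the j-th power of
exp(2 \<pi> i / N): exact in norm (Parseval), and an eigenvector up to O(1/N).\<close>
definition spectral_part :: "'a => nat => nat => ('a => complex) => 'a => complex" where
 "spectral_part s N j v = (%x. \<Sum>m<N. (cnj (cis (2 * pi * j / N)) ^ m / N) * v (x - zmult (int m) s))"

lemma spectral_part_Cc: "v \<in> Cc ==> spectral_part s N j v \<in> Cc"
 unfolding spectral_part_def by (intro Cc_sum Cc_cmult Cc_shift_diff)

lemma spectral_part_Parseval:
 assumes "v \<in> Cc" "0 < N"
 shows "(\<Sum>j<N. Q (spectral_part s N j v)) = Q v"
proof -
 note s = Cc_cmult
 have pw: "(\<Sum>j<N. (norm (spectral_part s N j v x))^2) = (\<Sum>m<N. (1 / N) * (norm (v (x - zmult (int m) s)))^2)" for x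
 proof -
  have "spectral_part s N j v x = (\<Sum>m<N. cnj (cis (2 * pi * j / N)) ^ m * v (x - zmult (int m) s)) / N" for j
   unfolding spectral_part_def by (simp add: sum_divide_distrib)
  hence "(norm (spectral_part s N j v x))^2 =
    (norm (\<Sum>m<N. cnj (cis (2 * pi * j / N)) ^ m * v (x - zmult (int m) s)))^2 / (real N)^2" for j
   by (simp only: norm_divide power_divide norm_of_nat)
  hence "(\<Sum>j<N. (norm (spectral_part s N j v x))^2) =
    (\<Sum>j<N. (norm (\<Sum>m<N. cnj (cis (2 * pi * real j / N)) ^ m * v (x - zmult (int m) s)))^2) / (real N)^2"
   by (simp only: sum_divide_distrib)
  also have "... = (\<Sum>m<N. (1 / N) * (norm (v (x - zmult (int m) s)))^2)"
   using assms(2)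
   by (subst parseval_roots_of_unity[of N "%m. v (x - zmult (int m) s)"])
    (simp_all add: power2_eq_square[of "real N"] sum_divide_distrib sum_distrib_left)
  finally show ?thesis .
 qed
 have "(\<Sum>j<N. Q (spectral_part s N j v)) = I (%x. \<Sum>j<N. (norm (spectral_part s N j v x))^2)"
  unfolding Q_def by (rule I_sum[symmetric]) (intro Cc_norm2 spectral_part_Cc assms)
 also have "... = (\<Sum>m<N. I (%x. (1 / N) * (norm (v (x - zmult (int m) s)))^2))"
  unfolding pw by (rule I_sum) (intro s Cc_norm2 Cc_shift_diff assms)
 also have "... = (\<Sum>m<N. (1 / N) * Q v)"
 proof (rule sum.cong[OF refl])
  fix m
  have "I (%x. (1 / N) * (norm (v (x - zmult (int m) s)))^2) = (1 / N) * Q (%x. v (x - zmult (int m) s))"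
   unfolding Q_def by (rule I_scale) (intro Cc_norm2 Cc_shift_diff assms)
  thus "I (%x. (1 / N) * (norm (v (x - zmult (int m) s)))^2) = (1 / N) * Q v"
   by (simp add: Q_shift_diff assms)
 qed
 finally show ?thesis using assms(2) by simp
qed

lemma spectral_part_eigen:
 assumes "v \<in> Cc" "0 < N"
 shows "Q (%x. spectral_part s N j v (x - s) - cis (2 * pi * real j / N) * spectral_part s N j v x) <= 4 * Q v / (real N)^2"
proof -
 define w where "w = cis (2 * pi * j / N)"
 have wN: "cnj w ^ N = 1"
 proof -
  have "w ^ N = 1" unfolding w_def Complex.DeMoivre using `0 < N` by simp
  thus ?thesis by (metis complex_cnj_power complex_cnj_one)
 qed
 have ww: "w * cnj w = 1" unfolding w_def by (simp add: cis_cnj cis_mult)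
 have "spectral_part s N j v (x - s) - w * spectral_part s N j v x = (w / N) * (v (x - zmult (int N) s) - v x)" for x
 proof -
  define u where "u m = cnj w ^ m * v (x - zmult (int m) s)" for m
  have "spectral_part s N j v (x - s) = (\<Sum>m<N. (w / N) * u (Suc m))"
   unfolding spectral_part_def w_def[symmetric]
  proof (rule sum.cong[OF refl])
   fix m
   have z: "x - s - zmult (int m) s = x - zmult (int (Suc m)) s"
    using zmult_succ[of "int m" s] by (simp add: algebra_simps)
   have "(w / N) * u (Suc m) = ((w * cnj w) * cnj w ^ m / N) * v (x - zmult (int (Suc m)) s)"
    unfolding u_def by (simp add: field_simps)
   thus "(cnj w ^ m / N) * v (x - s - zmult (int m) s) = (w / N) * u (Suc m)"
    unfolding z ww mult_1 by (rule sym)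
  qed
  moreover have "w * spectral_part s N j v x = (\<Sum>m<N. (w / N) * u m)"
   unfolding spectral_part_def w_def[symmetric] u_def by (simp add: sum_distrib_left)
  ultimately have "spectral_part s N j v (x - s) - w * spectral_part s N j v x = (w / N) * (\<Sum>m<N. u (Suc m) - u m)"
   by (simp add: sum_subtractf sum_distrib_left right_diff_distrib)
  also have "(\<Sum>m<N. u (Suc m) - u m) = u N - u 0" by (rule sum_lessThan_telescope)
  finally show ?thesis unfolding u_def using wN by simp
 qed
 hence "Q (%x. spectral_part s N j v (x - s) - w * spectral_part s N j v x) =
   Q (%x. (w / N) * (v (x - zmult (int N) s) - v x))" by simp
 also have "... = (norm (w / N))^2 * Q (%x. v (x - zmult (int N) s) - v x)"
  by (intro Q_scale Cc_diff Cc_shift_diff assms)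
 also have "... <= (norm (w / N))^2 * (2 * Q v + 2 * Q v)"
  using Q_diff_le[OF Cc_shift_diff[OF assms(1)] assms(1), of "zmult (int N) s"]
  by (intro mult_left_mono) (simp_all add: Q_shift_diff assms)
 also have "(norm (w / N))^2 = 1 / (real N)^2" unfolding w_def by (simp add: norm_divide power_divide)
 finally show ?thesis unfolding w_def by simp
qed

text \<open>Parseval splits the energy deficit c Q v - Q (C v), and the deviation from being an eigenvector of each
earlier translation, into the sum of those of the parts, so some part is no worse than average. The
deviation for the new translation s is O(1/N), and W times it is negligible.\<close>
lemma approximate_joint_eigenvector:
 fixes C :: "('a => complex) => 'a => complex"
 assumes C_Cc: "\<And>v. v \<in> Cc ==> C v \<in> Cc"
  and C_lin: "\<And>v c t (N :: nat). v \<in> Cc ==> C (%x. \<Sum>m<N. c m * v (x - t m)) = (%x. \<Sum>m<N. c m * C v (x - t m))"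
  and C_bd: "\<And>v. v \<in> Cc ==> Q (C v) <= B * Q v"
  and v0: "v0 \<in> Cc" "0 < Q v0" "c * Q v0 <= Q (C v0)"
  and "finite S" "0 <= W" "0 < d"
 shows "\<exists>v\<in>Cc. \<exists>\<eta>. 0 < Q v \<and> (\<forall>s. norm (\<eta> s) = 1) \<and>
  c * Q v - Q (C v) + W * (\<Sum>s\<in>S. Q (%x. v (x - s) - \<eta> s * v x)) <= d * Q v"
 using `finite S` `0 < d`
proof (induction S arbitrary: d)
 case empty
 have "c * Q v0 - Q (C v0) <= d * Q v0"
  using v0 mult_pos_pos[OF empty v0(2)] by linarith
 thus ?case using v0 by (intro bexI[of _ v0] exI[of _ "%_. 1"]) auto
next
 case (insert s S)
 obtain v \<eta> where v: "v \<in> Cc" "0 < Q v" "\<And>s. norm (\<eta> s) = 1"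
  "c * Q v - Q (C v) + W * (\<Sum>s\<in>S. Q (%x. v (x - s) - \<eta> s * v x)) <= (d/2) * Q v"
  using insert.IH[of "d/2"] insert.prems by auto
 \<comment> \<open>The new translation may use up d / 4 of the error.\<close>
 define N where "N = nat \<lceil>16 * W / d\<rceil> + 1"
 have N: "0 < N" "4 * W / N <= d / 4"
 proof -
  show "0 < N" unfolding N_def by simp
  have "16 * W / d <= real N" unfolding N_def by linarith
  thus "4 * W / N <= d / 4" using `0 < N` insert.prems by (simp add: field_simps)
 qed
 define u where "u j = spectral_part s N j v" for j
 have u: "u j \<in> Cc" for j unfolding u_def by (rule spectral_part_Cc[OF v(1)])
 define w where "w j = cis (2 * pi * real j / N)" for j :: nat
 define A where "A j = c * Q (u j) - Q (C (u j)) + W * (\<Sum>t\<in>S. Q (%x. u j (x - t) - \<eta> t * u j x))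
   + W * Q (%x. u j (x - s) - w j * u j x) - d * Q (u j)" for j
 have Qu: "(\<Sum>j<N. Q (u j)) = Q v" unfolding u_def by (rule spectral_part_Parseval[OF v(1) N(1)])
 have "C (u j) = spectral_part s N j (C v)" for j
  unfolding u_def spectral_part_def by (rule C_lin[OF v(1), of "%m. cnj (cis (2 * pi * real j / real N)) ^ m / of_nat N" "%m. zmult (int m) s"])
 hence QCu: "(\<Sum>j<N. Q (C (u j))) = Q (C v)"
  using spectral_part_Parseval[OF C_Cc[OF v(1)] N(1)] by simp
 have QDu: "(\<Sum>j<N. Q (%x. u j (x - t) - \<eta> t * u j x)) = Q (%x. v (x - t) - \<eta> t * v x)" for t
 proof -
  have "(%x. u j (x - t) - \<eta> t * u j x) = spectral_part s N j (%x. v (x - t) - \<eta> t * v x)" for j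
   unfolding u_def spectral_part_def
   by (simp add: sum_distrib_left sum_subtractf[symmetric] algebra_simps diff_diff_eq add.commute)
  moreover have "(%x. v (x - t) - \<eta> t * v x) \<in> Cc" by (intro Cc_diff Cc_shift_diff Cc_cmult v)
  ultimately show ?thesis using spectral_part_Parseval[OF _ N(1)] by simp
 qed
 have Qe: "(\<Sum>j<N. Q (%x. u j (x - s) - w j * u j x)) <= 4 * Q v / N"
 proof -
  have "(\<Sum>j<N. Q (%x. u j (x - s) - w j * u j x)) <= (\<Sum>j<N. 4 * Q v / (real N)^2)"
   unfolding u_def w_def by (intro sum_mono spectral_part_eigen v N)
  also have "... = 4 * Q v / N" using N(1) by (simp add: power2_eq_square)
  finally show ?thesis .
 qed
 have "(\<Sum>j<N. A j) = c * (\<Sum>j<N. Q (u j)) - (\<Sum>j<N. Q (C (u j))) +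
   W * (\<Sum>t\<in>S. \<Sum>j<N. Q (%x. u j (x - t) - \<eta> t * u j x)) +
   W * (\<Sum>j<N. Q (%x. u j (x - s) - w j * u j x)) - d * (\<Sum>j<N. Q (u j))"
  unfolding A_def sum.swap[of _ "{..<N}" S] by (simp add: sum.distrib sum_subtractf sum_distrib_left)
 also have "... <= (d/2) * Q v + W * (4 * Q v / N) - d * Q v"
  unfolding Qu QCu QDu using v(4) mult_left_mono[OF Qe `0 <= W`] by linarith
 also have "... = (d/2 + 4 * W / N - d) * Q v" by (simp add: algebra_simps)
 also have "... < 0" using N(2) v(2) insert.prems by (intro mult_neg_pos) auto
 finally have "\<exists>j<N. A j < 0" by (metis lessThan_iff not_le sum_nonneg)
 then obtain j where j: "A j < 0" by blast
 have pos: "0 < Q (u j)"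
 proof (rule ccontr)
  assume "\<not> 0 < Q (u j)"
  hence "Q (u j) = 0" using Q_nonneg[OF u] by (simp add: order_less_le)
  moreover have "Q (C (u j)) <= B * Q (u j)" by (rule C_bd[OF u])
  moreover have "0 <= W * (\<Sum>t\<in>S. Q (%x. u j (x - t) - \<eta> t * u j x))"
   using `0 <= W` by (intro mult_nonneg_nonneg sum_nonneg Q_nonneg Cc_diff Cc_shift_diff Cc_cmult u)
  moreover have "0 <= W * Q (%x. u j (x - s) - w j * u j x)"
   using `0 <= W` by (intro mult_nonneg_nonneg Q_nonneg Cc_diff Cc_shift_diff Cc_cmult u)
  ultimately show False using j unfolding A_def by simp
 qed
 have eq: "(\<Sum>t\<in>S. Q (%x. u j (x - t) - (\<eta>(s := w j)) t * u j x)) = (\<Sum>t\<in>S. Q (%x. u j (x - t) - \<eta> t * u j x))"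
  using insert.hyps(2) by (intro sum.cong refl) auto
 have "c * Q (u j) - Q (C (u j)) + W * (\<Sum>t\<in>insert s S. Q (%x. u j (x - t) - (\<eta>(s := w j)) t * u j x)) <= d * Q (u j)"
  unfolding sum.insert[OF insert.hyps] eq using j unfolding A_def by (simp add: algebra_simps)
 moreover have "norm ((\<eta>(s := w j)) t) = 1" for t using v(3) unfolding w_def by simp
 ultimately show ?case using pos u by blast
qed

text \<open>Convolution operators commute with translations and are equicontinuous in the L2 norm, so an
eigenvector of translations that is not annihilated by one has a continuous eigenvalue.\<close>
definition correlation :: "('a => real) => ('a => complex) => 'a => complex" where
 "correlation w v = (%z. Ic (%s. v s * of_real (w (s - z))))"

lemma correlation_integrand_Cc:
 fixes v :: "'a => complex" and w :: "'a => real"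
 assumes "v \<in> Cc" "w \<in> Cc" shows "(%s. v s * of_real (w (s - z))) \<in> Cc"
 by (intro Cc_mult(2)[OF assms(1)] Cc_continuous[OF Cc_of_real] Cc_shift_diff[OF assms(2)])

lemma real_correlation_Cc: "h \<in> Cc ==> k \<in> Cc ==> (%z. I (%s. h s * k (s - z))) \<in> Cc"
 by (rule Cc_correlation[of I h k]) (simp_all add: I_add I_scale I_nonneg)

lemma correlation_Cc:
 fixes v :: "'a => complex" and w :: "'a => real"
 assumes "v \<in> Cc" "w \<in> Cc" shows "correlation w v \<in> Cc"
proof (rule Cc_ComplexI)
 show "(%x. Re (correlation w v x)) \<in> Cc"
  unfolding correlation_def Ic_def
  using real_correlation_Cc[OF Cc_Re[OF assms(1)] assms(2)] by simp
 show "(%x. Im (correlation w v x)) \<in> Cc"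
  unfolding correlation_def Ic_def
  using real_correlation_Cc[OF Cc_Im[OF assms(1)] assms(2)] by simp
qed

lemma correlation_shift:
 fixes v :: "'a => complex" and w :: "'a => real"
 assumes "v \<in> Cc" "w \<in> Cc"
 shows "correlation w (%x. v (x - t)) = (%z. correlation w v (z - t))"
proof
 fix z
 have "correlation w v (z - t) = Ic (%s. v (s - t) * of_real (w (s - t - (z - t))))"
  unfolding correlation_def by (rule Ic_shift_diff[symmetric]) (rule correlation_integrand_Cc[OF assms])
 thus "correlation w (%x. v (x - t)) z = correlation w v (z - t)"
  unfolding correlation_def by simp
qed

lemma correlation_linear:
 fixes v :: "'a => complex" and w :: "'a => real"
 assumes "v \<in> Cc" "w \<in> Cc"
 shows "correlation w (%x. \<Sum>m<(N::nat). c m * v (x - t m)) = (%x. \<Sum>m<N. c m * correlation w v (x - t m))"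
proof
 fix z
 have c: "(%s. v (s - t m) * of_real (w (s - z))) \<in> Cc" for m
  by (rule correlation_integrand_Cc[OF Cc_shift_diff[OF assms(1)] assms(2)])
 have "correlation w (%x. \<Sum>m<N. c m * v (x - t m)) z =
   Ic (%s. \<Sum>m<N. c m * (v (s - t m) * of_real (w (s - z))))"
  unfolding correlation_def by (simp add: sum_distrib_right mult.assoc)
 also have "... = (\<Sum>m<N. c m * correlation w (%x. v (x - t m)) z)"
  unfolding correlation_def by (subst Ic_sum) (auto intro!: Cc_cmult c simp: Ic_scale[OF c])
 finally show "correlation w (%x. \<Sum>m<N. c m * v (x - t m)) z = (\<Sum>m<N. c m * correlation w v (z - t m))"
  by (simp add: correlation_shift[OF assms])
qed

lemma correlation_diff:
 fixes u v :: "'a => complex" and w :: "'a => real"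
 assumes "u \<in> Cc" "v \<in> Cc" "w \<in> Cc"
 shows "correlation w (%x. u x - v x) = (%z. correlation w u z - correlation w v z)"
 unfolding correlation_def
 by (simp add: left_diff_distrib Ic_diff correlation_integrand_Cc assms)

lemma correlation_cmult:
 fixes v :: "'a => complex" and w :: "'a => real"
 assumes "v \<in> Cc" "w \<in> Cc"
 shows "correlation w (%x. c * v x) = (%z. c * correlation w v z)"
 unfolding correlation_def
 by (simp add: mult.assoc Ic_scale correlation_integrand_Cc assms)

lemma correlation_bounded:
 assumes lc: "locally_compact_space (euclidean :: 'a topology)" and K: "compact K"
 shows "\<exists>B\<ge>0. \<forall>w\<in>Cc. (\<forall>x. x \<notin> K \<longrightarrow> w x = 0) \<longrightarrow>
  (\<forall>v\<in>Cc. Q (correlation w v) <= B * I (%x. (w x)^2) * Q v)"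
proof -
 obtain k :: "'a => real" where k': "k \<in> Cc" "\<And>x. 0 <= k x" "\<And>x. k x <= 1" "\<And>x. x \<in> K ==> k x = 1"
  using lc_bump[OF lc K] by blast
 note k = k'(1,4)
 obtain B where B: "\<And>h. h \<in> Cc ==> (\<And>x. 0 <= h x) ==> I (%z. I (%s. h s * (k (s - z))^2)) <= B * I h"
  using I_convolution_le[OF Cc_power2[OF k(1)]] by auto
 have "Q (correlation w v) <= \<bar>B\<bar> * I (%x. (w x)^2) * Q v"
  if w: "w \<in> Cc" "\<And>x. x \<notin> K ==> w x = 0" and v: "v \<in> Cc" for w v
 proof -
  have Iw: "0 <= I (%x. (w x)^2)" by (intro I_nonneg Cc_power2 w) simp
  have kz: "continuous_on UNIV (%s. k (s - z))" for z
   by (rule Cc_continuous[OF Cc_shift_diff[OF k(1)]])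
  have vk: "(%s. v s * of_real (k (s - z))) \<in> Cc" for z
   by (rule correlation_integrand_Cc[OF v k(1)])
  have pt: "(norm (correlation w v z))^2 <= I (%x. (w x)^2) * I (%s. (norm (v s))^2 * (k (s - z))^2)" for z
  proof -
   have "correlation w v z = Ic (%s. (v s * of_real (k (s - z))) * of_real (w (s - z)))"
    unfolding correlation_def
   proof (rule arg_cong[where f = Ic], rule ext)
    fix s show "v s * of_real (w (s - z)) = v s * of_real (k (s - z)) * of_real (w (s - z))"
     using k(2)[of "s - z"] w(2)[of "s - z"] by (cases "s - z \<in> K") auto
   qed
   hence "(norm (correlation w v z))^2 <= Q (%s. v s * of_real (k (s - z))) * I (%s. (w (s - z))^2)"
    using Ic_cauchy_schwarz[OF vk Cc_shift_diff[OF w(1)]] by simp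
   also have "I (%s. (w (s - z))^2) = I (%s. (w s)^2)"
    using I_shift[OF Cc_power2[OF w(1)], of "- z"] by simp
   finally show ?thesis unfolding Q_def by (simp add: norm_mult power_mult_distrib mult.commute)
  qed
  have "Q (correlation w v) <= I (%z. I (%x. (w x)^2) * I (%s. (norm (v s))^2 * (k (s - z))^2))"
   unfolding Q_def
   by (intro I_mono pt Cc_norm2 correlation_Cc v w Cc_mult(1) continuous_on_const
     real_correlation_Cc[OF Cc_norm2[OF v] Cc_power2[OF k(1)]])
  also have "... = I (%x. (w x)^2) * I (%z. I (%s. (norm (v s))^2 * (k (s - z))^2))"
   by (rule I_scale[OF real_correlation_Cc[OF Cc_norm2[OF v] Cc_power2[OF k(1)]]])
  also have "... <= I (%x. (w x)^2) * (\<bar>B\<bar> * Q v)"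
  proof (rule mult_left_mono[OF _ Iw])
   have "I (%z. I (%s. (norm (v s))^2 * (k (s - z))^2)) <= B * Q v"
    unfolding Q_def by (rule B[OF Cc_norm2[OF v]]) simp
   also have "... <= \<bar>B\<bar> * Q v" using Q_nonneg[OF v] by (intro mult_right_mono) auto
   finally show "I (%z. I (%s. (norm (v s))^2 * (k (s - z))^2)) <= \<bar>B\<bar> * Q v" .
  qed
  finally show ?thesis by (simp add: mult_ac)
 qed
 thus ?thesis by (intro exI[of _ "\<bar>B\<bar>"]) auto
qed

lemma correlation_equicontinuous:
 assumes lc: "locally_compact_space (euclidean :: 'a topology)" and w: "w \<in> Cc" and "0 < e"
 shows "\<exists>V. open V \<and> 0 \<in> V \<and> (\<forall>x\<in>V. \<forall>v\<in>Cc. Q (%z. correlation w v (z - x) - correlation w v z) <= e * Q v)"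
proof -
 obtain K where K: "compact K" "\<And>x. x \<notin> K ==> w x = 0" using w by (metis Cc_support)
 obtain U L where U: "open U" "(0::'a) \<in> U" "compact L" "U \<subseteq> L" using lc_compact_nbhd[OF lc] by metis
 define K' where "K' = K \<union> (%p. fst p - snd p) ` (K \<times> L)"
 have K': "compact K'" unfolding K'_def
  by (intro compact_Un compact_continuous_image compact_Times K U continuous_on_diff continuous_on_fst
    continuous_on_snd continuous_on_id)
 obtain B where B: "0 <= B" "\<And>w v. w \<in> Cc ==> (\<And>x. x \<notin> K' ==> w x = 0) ==> v \<in> Cc ==>
   Q (correlation w v) <= B * I (%x. (w x)^2) * Q v"
  using correlation_bounded[OF lc K'] by blast
 obtain k :: "'a => real" where k': "k \<in> Cc" "\<And>x. 0 <= k x" "\<And>x. k x <= 1" "\<And>x. x \<in> K' ==> k x = 1"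
  using lc_bump[OF lc K'] by blast
 note k = k'(1,2,4)
 have Ik: "0 <= I k" by (rule I_nonneg[OF k(1,2)])
 define d where "d = sqrt (e / (B * I k + 1))"
 have "0 < B * I k + 1" using B(1) Ik by (simp add: add_nonneg_pos)
 hence d: "0 < d" "d^2 = e / (B * I k + 1)" unfolding d_def using `0 < e` by simp_all
 obtain V where V: "open V" "0 \<in> V" "\<And>x t. t \<in> V ==> norm (w (x + t) - w x) < d"
  using Cc_uniform[OF w d(1)] by blast
 show ?thesis
 proof (intro exI[of _ "V \<inter> U"] conjI ballI open_Int V U IntI)
  fix x :: 'a and v :: "'a => complex" assume x: "x \<in> V \<inter> U" and v: "v \<in> Cc"
  define u where "u s = w (s + x) - w s" for s
  have u: "u \<in> Cc" unfolding u_def by (intro Cc_diff Cc_shift w)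
  have u0: "u s = 0" if "s \<notin> K'" for s
  proof -
   have "s \<notin> K" using that unfolding K'_def by blast
   moreover have "s + x \<notin> K"
   proof
    assume "s + x \<in> K"
    hence "(s + x, x) \<in> K \<times> L" using x U by auto
    hence "fst (s + x, x) - snd (s + x, x) \<in> K'" unfolding K'_def by blast
    thus False using that by simp
   qed
   ultimately show ?thesis unfolding u_def using K by simp
  qed
  have "correlation w v (z - x) - correlation w v z = correlation u v z" for z
  proof -
   have "correlation w v (z - x) - correlation w v z =
     Ic (%s. v s * of_real (w (s - (z - x))) - v s * of_real (w (s - z)))"
    unfolding correlation_def by (rule Ic_diff[symmetric]) (rule correlation_integrand_Cc[OF v w])+
   thus ?thesis unfolding correlation_def u_def
    by (simp add: right_diff_distrib algebra_simps)
  qed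
  hence "Q (%z. correlation w v (z - x) - correlation w v z) = Q (correlation u v)" by simp
  also have "... <= B * I (%x. (u x)^2) * Q v" by (rule B(2)[OF u u0 v])
  also have "... <= B * (d^2 * I k) * Q v"
  proof -
   have "I (%x. (u x)^2) <= I (%x. d^2 * k x)"
   proof (rule I_mono)
    show "(%x. (u x)^2) \<in> Cc" by (intro Cc_power2 u)
    show "(%x. d^2 * k x) \<in> Cc" by (intro Cc_mult(1) k continuous_on_const)
    fix s
    have "\<bar>u s\<bar> <= d" unfolding u_def using V(3)[of x s] x by simp
    hence "(u s)^2 <= d^2" by (metis abs_ge_zero power2_abs power_mono)
    thus "(u s)^2 <= d^2 * k s" using k(3)[of s] u0[of s] k(2)[of s] by (cases "s \<in> K'") auto
   qed
   hence "I (%x. (u x)^2) <= d^2 * I k" by (simp add: I_scale k)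
   thus ?thesis by (intro mult_right_mono mult_left_mono B Q_nonneg v)
  qed
  also have "... <= e * Q v"
  proof (rule mult_right_mono[OF _ Q_nonneg[OF v]])
   show "B * (d^2 * I k) <= e"
    unfolding d(2) using B(1) Ik `0 < e` by (simp add: field_simps add_pos_nonneg)
  qed
  finally show "Q (%z. correlation w v (z - x) - correlation w v z) <= e * Q v" .
 qed
qed

text \<open>The kernel g - T g, with T the translation by x0, annihilates T-invariant functions; since it does not
annihilate itself, the joint eigenvectors that it sees have an eigenvalue at x0 away from 1. The limit
of approximate eigenvalues over all finite sets of translations is a character, continuous because of
the equicontinuity of the kernel operator.\<close>
lemma ex_character_nontrivial:
 fixes g :: "'a => real"
 assumes lc: "locally_compact_space (euclidean :: 'a topology)" and g: "g \<in> Cc"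
  and nz: "g z0 \<noteq> g (z0 - x0)"
 shows "\<exists>y :: 'a character. char_app y x0 \<noteq> 1"
proof -
 define g' where "g' x = g x - g (x - x0)" for x
 have g': "g' \<in> Cc" unfolding g'_def by (intro Cc_diff Cc_shift_diff g)
 define C where "C = correlation g'"
 define v0 where "v0 x = complex_of_real (g' x)" for x
 have v0: "v0 \<in> Cc" unfolding v0_def by (rule Cc_of_real[OF g'])
 have C_Cc: "C v \<in> Cc" if "v \<in> Cc" for v unfolding C_def by (rule correlation_Cc[OF that g'])
 obtain K where K: "compact K" "\<And>x. x \<notin> K ==> g' x = 0" using g' by (metis Cc_support)
 obtain L where L: "compact L" "\<And>x. x \<notin> L ==> g x = 0" using g by (metis Cc_support)
 obtain B1 where B1: "0 <= B1" "\<And>v. v \<in> Cc ==> Q (C v) <= B1 * Q v"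
 proof -
  obtain B where B: "0 <= B" "\<And>v. v \<in> Cc ==> Q (correlation g' v) <= B * I (%x. (g' x)^2) * Q v"
   using correlation_bounded[OF lc K(1)] g' K(2) by blast
  moreover have "0 <= I (%x. (g' x)^2)" by (intro I_nonneg Cc_power2 g') simp
  ultimately show ?thesis using that unfolding C_def by (meson mult_nonneg_nonneg)
 qed
 obtain B2 where B2: "0 <= B2" "\<And>v. v \<in> Cc ==> Q (correlation g v) <= B2 * Q v"
 proof -
  obtain B where B: "0 <= B" "\<And>v. v \<in> Cc ==> Q (correlation g v) <= B * I (%x. (g x)^2) * Q v"
   using correlation_bounded[OF lc L(1)] g L(2) by blast
  moreover have "0 <= I (%x. (g x)^2)" by (intro I_nonneg Cc_power2 g) simp
  ultimately show ?thesis using that by (meson mult_nonneg_nonneg)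
 qed
 define M where "M = B1 + B2"
 have M: "0 <= M" "B1 <= M" "B2 <= M" using B1 B2 unfolding M_def by auto
 have CM: "Q (C v) <= M * Q v" if "v \<in> Cc" for v
  using B1(2)[OF that] mult_right_mono[OF M(2) Q_nonneg[OF that]] by linarith
 have CD: "Q (C v) <= M * Q (%x. v (x - x0) - v x)" if v: "v \<in> Cc" for v
 proof -
  have sh: "(%x. v (x + x0)) \<in> Cc" by (rule Cc_shift[OF v])
  have "C v z = correlation g (%x. v x - v (x + x0)) z" for z
  proof -
   have "C v z = Ic (%s. v s * complex_of_real (g (s - z)) - v s * complex_of_real (g (s - (z + x0))))"
    unfolding C_def correlation_def g'_def by (simp add: right_diff_distrib diff_diff_eq add.commute)
   also have "... = correlation g v z - correlation g v (z - - x0)"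
    unfolding correlation_def by (simp add: Ic_diff correlation_integrand_Cc v g)
   also have "... = correlation g v z - correlation g (%x. v (x - - x0)) z"
    unfolding correlation_shift[OF v g] ..
   also have "... = correlation g (%x. v x - v (x + x0)) z"
    using correlation_diff[OF v sh g] by simp
   finally show ?thesis .
  qed
  hence "Q (C v) = Q (correlation g (%x. v x - v (x + x0)))" by presburger
  also have "... <= B2 * Q (%x. v x - v (x + x0))" by (rule B2(2)[OF Cc_diff[OF v sh]])
  also have "Q (%x. v x - v (x + x0)) = Q (%x. v (x - x0) - v x)"
   using Q_shift_diff[OF Cc_diff[OF v sh], of x0] by simp
  also have "B2 * ... <= M * ..."
   by (intro mult_right_mono M Q_nonneg Cc_diff Cc_shift_diff v)
  finally show ?thesis .
 qed
 have eqc: "\<exists>V. open V \<and> 0 \<in> V \<and> (\<forall>x\<in>V. \<forall>v\<in>Cc. Q (%z. C v (z - x) - C v z) <= e * Q v)" if "0 < e" for e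
  unfolding C_def by (rule correlation_equicontinuous[OF lc g' that])
 have Qv0: "0 < Q v0"
  unfolding Q_def v0_def using nz by (intro I_pos[where z = z0] Cc_norm2 Cc_of_real g') (auto simp: g'_def)
 have "0 < Q (C v0)"
 proof -
  have "C v0 0 = complex_of_real (I (%x. (g' x)^2))"
   unfolding C_def correlation_def v0_def by (simp add: Ic_of_real power2_eq_square flip: of_real_mult)
  moreover have "0 < I (%x. (g' x)^2)"
   using nz by (intro I_pos[where z = z0] Cc_power2 g') (auto simp: g'_def)
  ultimately show ?thesis
   unfolding Q_def by (intro I_pos[where z = 0] Cc_norm2 C_Cc v0) auto
 qed
 define c where "c = Q (C v0) / Q v0"
 have c: "0 < c" "c * Q v0 = Q (C v0)" unfolding c_def using Qv0 `0 < Q (C v0)` by auto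
 have c_le: "c <= M" using CM[OF v0] c(2) Qv0 by (metis mult_le_cancel_right_pos)
 define P where "P x e \<longleftrightarrow> (\<forall>v\<in>Cc. Q (%z. C v (z - x) - C v z) <= e * Q v)" for x e
 \<comment> \<open>P s e bounds how much C moves under s; c |\<eta> s - 1|^2 \<le> 2 e transfers it to the eigenvalue.\<close>
 define E where "E p = (case p of (s, t, n::nat) => {\<eta> :: 'a => complex.
   norm (\<eta> (s + t) - \<eta> s * \<eta> t) <= 1 / Suc n \<and>
   (\<forall>e. P s e \<longrightarrow> c * (norm (\<eta> s - 1))^2 <= 2 * e + 1 / Suc n) \<and>
   c <= 2 * M * (norm (\<eta> x0 - 1))^2 + 1 / Suc n})" for p
 define T where "T = {\<eta> :: 'a => complex. \<forall>x. \<eta> x \<in> sphere 0 1}"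
 have T: "compact T" unfolding T_def by (rule compact_pointwise_bounded) simp
 have coord: "continuous_on UNIV (%\<eta>::'a => complex. \<eta> x)" for x
  by (rule continuous_on_product_coordinates)
 have E: "closed (E p)" for p
 proof -
  obtain s t n where stn: "p = (s, t, n)" by (metis prod_cases3)
  have nrm: "continuous_on UNIV (%\<eta>::'a => complex. (norm (\<eta> x - 1))^2)" for x
   by (intro continuous_on_power continuous_on_norm continuous_on_diff coord continuous_on_const)
  have "continuous_on UNIV (%\<eta>::'a => complex. norm (\<eta> (s + t) - \<eta> s * \<eta> t))"
   by (intro continuous_on_norm continuous_on_diff continuous_on_mult coord)
  hence 1: "closed {\<eta> :: 'a => complex. norm (\<eta> (s + t) - \<eta> s * \<eta> t) <= 1 / Suc n}"
   by (intro closed_Collect_le continuous_on_const)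
  have "closed {\<eta> :: 'a => complex. c * (norm (\<eta> s - 1))^2 <= 2 * e + 1 / Suc n}" for e
   by (rule closed_Collect_le[OF continuous_on_mult_left[OF nrm] continuous_on_const])
  hence 2: "closed {\<eta> :: 'a => complex. \<forall>e. P s e \<longrightarrow> c * (norm (\<eta> s - 1))^2 <= 2 * e + 1 / Suc n}"
   by (intro closed_Collect_all closed_Collect_imp open_Collect_const)
  have 3: "closed {\<eta> :: 'a => complex. c <= 2 * M * (norm (\<eta> x0 - 1))^2 + 1 / Suc n}"
   by (rule closed_Collect_le[OF continuous_on_const
     continuous_on_add[OF continuous_on_mult_left[OF nrm] continuous_on_const]])
  show ?thesis unfolding E_def stn prod.case by (intro closed_Collect_conj 1 2 3)
 qed
 have "T \<inter> (\<Inter>p\<in>UNIV. E p) \<noteq> {}"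
 proof (rule compact_imp_fip_image[OF T E])
  fix J :: "('a \<times> 'a \<times> nat) set" assume J: "finite J"
  define S where "S = insert x0 (\<Union>(s, t, n)\<in>J. {s, t, s + t})"
  have S: "finite S" unfolding S_def using J by auto
  define m where "m = Max (insert 0 ((%(s, t, n). n) ` J))"
  have m: "n <= m" if "(s, t, n) \<in> J" for s t n
   unfolding m_def using J that by (intro Max_ge) force+
  define \<epsilon> where "\<epsilon> = 1 / ((real (Suc m))^2 * (2 * M + 10))"
  have e0: "0 < \<epsilon>" unfolding \<epsilon>_def using M by simp
  have e3: "(2 * M + 10) * \<epsilon> = (1 / Suc m)^2"
   unfolding \<epsilon>_def using M(1) by (simp add: power_divide)
  have e1: "10 * \<epsilon> <= (1 / Suc m)^2"
   unfolding e3[symmetric] using M(1) e0 by (intro mult_right_mono) auto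
  have e2: "(2 * M + 4) * \<epsilon> <= 1 / Suc m"
  proof -
   have "(2 * M + 4) * \<epsilon> <= (2 * M + 10) * \<epsilon>" using e0 by (intro mult_right_mono) auto
   also have "... = 1 / (real (Suc m))^2" unfolding e3 by (simp add: power_divide)
   also have "... <= 1 / Suc m" by (intro divide_left_mono) (auto simp: power2_eq_square)
   finally show ?thesis .
  qed
  \<comment> \<open>With this weight each deviation Q (D s) is at most \<epsilon> Q v.\<close>
  define W where "W = (\<epsilon> + M) / \<epsilon>"
  have W: "0 <= W" "0 < W" unfolding W_def using e0 M by (simp_all add: add_pos_nonneg)
  obtain v \<eta> where v: "v \<in> Cc" "0 < Q v" and \<eta>: "\<And>s. norm (\<eta> s) = 1"
   and key: "c * Q v - Q (C v) + W * (\<Sum>s\<in>S. Q (%x. v (x - s) - \<eta> s * v x)) <= \<epsilon> * Q v"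
   using approximate_joint_eigenvector[OF C_Cc _ CM v0 Qv0 eq_refl[OF c(2)] S W(1) e0]
    correlation_linear[OF _ g'] unfolding C_def by blast
  define D where "D s = (%x. v (x - s) - \<eta> s * v x)" for s
  have D: "D s \<in> Cc" for s unfolding D_def by (intro Cc_diff Cc_shift_diff Cc_cmult v)
  have QD: "Q (D s) <= \<epsilon> * Q v" if "s \<in> S" for s
  proof -
   have "Q (D s) <= (\<Sum>s\<in>S. Q (D s))" by (rule member_le_sum[OF that _ S]) (rule Q_nonneg[OF D])
   hence "W * Q (D s) <= W * (\<Sum>s\<in>S. Q (D s))" using W by (intro mult_left_mono)
   also have "... <= \<epsilon> * Q v + M * Q v"
    using key CM[OF v(1)] mult_nonneg_nonneg[OF less_imp_le[OF c(1)] Q_nonneg[OF v(1)]]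
    unfolding D_def by linarith
   finally have "W * Q (D s) <= (\<epsilon> + M) * Q v" by (simp add: algebra_simps)
   hence "(\<epsilon> + M) * Q (D s) <= (\<epsilon> + M) * (\<epsilon> * Q v)" unfolding W_def using e0 by (simp add: field_simps)
   thus ?thesis using e0 M(1) by (simp add: mult_le_cancel_left_pos add_pos_nonneg)
  qed
  have low: "(c - \<epsilon>) * Q v <= Q (C v)"
  proof -
   have "0 <= W * (\<Sum>s\<in>S. Q (%x. v (x - s) - \<eta> s * v x))"
    by (intro mult_nonneg_nonneg W sum_nonneg Q_nonneg D[unfolded D_def])
   thus ?thesis using key by (simp add: algebra_simps)
  qed
  have n4: "(norm (\<eta> s - 1))^2 <= 4" for s
  proof -
   have "norm (\<eta> s - 1) <= 2" using norm_triangle_ineq4[of "\<eta> s" 1] \<eta>[of s] by simp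
   thus ?thesis using power_mono[of "norm (\<eta> s - 1)" 2 2] by simp
  qed
  have hom: "(norm (\<eta> (s + t) - \<eta> s * \<eta> t))^2 <= 10 * \<epsilon>" if "s \<in> S" "t \<in> S" "s + t \<in> S" for s t
  proof -
   have eq: "(%x. (\<eta> (s + t) - \<eta> s * \<eta> t) * v x) = (%x. (D t (x - s) + \<eta> t * D s x) - D (s + t) x)"
    unfolding D_def by (simp add: algebra_simps diff_diff_eq)
   have c1: "(%x. D t (x - s)) \<in> Cc" "(%x. \<eta> t * D s x) \<in> Cc" by (intro Cc_shift_diff Cc_cmult D)+
   have "(norm (\<eta> (s + t) - \<eta> s * \<eta> t))^2 * Q v = Q (%x. (D t (x - s) + \<eta> t * D s x) - D (s + t) x)"
    unfolding eq[symmetric] by (rule Q_scale[OF v(1), symmetric])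
   also have "... <= 2 * Q (%x. D t (x - s) + \<eta> t * D s x) + 2 * Q (D (s + t))"
    by (rule Q_diff_le[OF Cc_add[OF c1] D])
   also have "... <= 2 * (2 * Q (D t) + 2 * Q (D s)) + 2 * Q (D (s + t))"
    using Q_add_le[OF c1] by (simp add: Q_shift_diff D Q_scale \<eta>)
   finally have *: "(norm (\<eta> (s + t) - \<eta> s * \<eta> t))^2 * Q v <= 2 * (2 * Q (D t) + 2 * Q (D s)) + 2 * Q (D (s + t))" .
   have arith: "x <= 10 * e" if "x <= 2 * (2 * b + 2 * a) + 2 * c" "a <= e" "b <= e" "c <= e" for x a b c e :: real
    using that by simp
   have "(norm (\<eta> (s + t) - \<eta> s * \<eta> t))^2 * Q v <= 10 * (\<epsilon> * Q v)"
    by (rule arith[OF * QD[OF that(1)] QD[OF that(2)] QD[OF that(3)]])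
   hence "(norm (\<eta> (s + t) - \<eta> s * \<eta> t))^2 * Q v <= (10 * \<epsilon>) * Q v"
    by (simp only: mult.assoc)
   thus ?thesis using v(2) by (simp add: mult_le_cancel_right_pos)
  qed
  have cont: "c * (norm (\<eta> s - 1))^2 <= 2 * e + (2 * M + 4) * \<epsilon>" if "s \<in> S" "P s e" for s e
  proof -
   have CD': "C (D s) = (%z. C v (z - s) - \<eta> s * C v z)"
    unfolding C_def D_def correlation_diff[OF Cc_shift_diff[OF v(1)] Cc_cmult[OF v(1)] g']
     correlation_shift[OF v(1) g'] correlation_cmult[OF v(1) g'] ..
   have c1: "(%z. C v (z - s) - C v z) \<in> Cc" by (intro Cc_diff Cc_shift_diff C_Cc v)
   have "(norm (\<eta> s - 1))^2 * Q (C v) = Q (%z. (\<eta> s - 1) * C v z)"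
    by (rule Q_scale[OF C_Cc[OF v(1)], symmetric])
   also have "... = Q (%z. (C v (z - s) - C v z) - C (D s) z)"
    unfolding CD' by (simp add: algebra_simps)
   also have "... <= 2 * Q (%z. C v (z - s) - C v z) + 2 * Q (C (D s))"
    by (rule Q_diff_le[OF c1 C_Cc[OF D]])
   also have "... <= 2 * (e * Q v) + 2 * (M * (\<epsilon> * Q v))"
    using that(2) v(1) CM[OF D, of s] mult_left_mono[OF QD[OF that(1)] M(1)] unfolding P_def
    by (intro add_mono mult_left_mono) auto
   finally have *: "(norm (\<eta> s - 1))^2 * Q (C v) <= (2 * e + 2 * M * \<epsilon>) * Q v" by (simp add: algebra_simps)
   have "(norm (\<eta> s - 1))^2 * ((c - \<epsilon>) * Q v) <= (norm (\<eta> s - 1))^2 * Q (C v)"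
    using low by (intro mult_left_mono) auto
   with * have "((norm (\<eta> s - 1))^2 * (c - \<epsilon>)) * Q v <= (2 * e + 2 * M * \<epsilon>) * Q v" by (simp add: mult_ac)
   hence "(norm (\<eta> s - 1))^2 * (c - \<epsilon>) <= 2 * e + 2 * M * \<epsilon>" using v(2) by (simp add: mult_le_cancel_right_pos)
   moreover have "(norm (\<eta> s - 1))^2 * \<epsilon> <= 4 * \<epsilon>" using n4 e0 by (intro mult_right_mono) auto
   ultimately show ?thesis by (simp add: algebra_simps)
  qed
  have nontriv: "c <= 2 * M * (norm (\<eta> x0 - 1))^2 + (2 * M + 4) * \<epsilon>"
  proof -
   have x0: "x0 \<in> S" unfolding S_def by simp
   have "(c - \<epsilon>) * Q v <= M * Q (%x. v (x - x0) - v x)" using low CD[OF v(1)] by linarith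
   also have "(%x. v (x - x0) - v x) = (%x. D x0 x + (\<eta> x0 - 1) * v x)"
    unfolding D_def by (simp add: algebra_simps)
   also have "M * Q ... <= M * (2 * (\<epsilon> * Q v) + 2 * ((norm (\<eta> x0 - 1))^2 * Q v))"
    using Q_add_le[OF D Cc_cmult[OF v(1)], of x0 "\<eta> x0 - 1"] QD[OF x0] Q_scale[OF v(1), of "\<eta> x0 - 1"]
    by (intro mult_left_mono M) linarith
   also have "... = (2 * M * \<epsilon> + 2 * M * (norm (\<eta> x0 - 1))^2) * Q v" by (simp add: algebra_simps)
   finally have "c - \<epsilon> <= 2 * M * \<epsilon> + 2 * M * (norm (\<eta> x0 - 1))^2"
    using v(2) by (simp add: mult_le_cancel_right_pos)
   moreover have "\<epsilon> <= 4 * \<epsilon>" using e0 by simp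
   ultimately show ?thesis by (simp add: algebra_simps)
  qed
  have "\<eta> \<in> E p" if p: "p \<in> J" for p
  proof -
   obtain s t n where stn: "p = (s, t, n)" by (metis prod_cases3)
   have in_S: "s \<in> S" "t \<in> S" "s + t \<in> S" using p unfolding S_def stn by force+
   have le: "1 / real (Suc m) <= 1 / real (Suc n)" using m[of s t n] p stn by (intro divide_left_mono) auto
   have "(norm (\<eta> (s + t) - \<eta> s * \<eta> t))^2 <= (1 / Suc m)^2" using hom[OF in_S] e1 by linarith
   hence "norm (\<eta> (s + t) - \<eta> s * \<eta> t) <= 1 / Suc m" by (rule power2_le_imp_le) simp
   moreover have "c * (norm (\<eta> s - 1))^2 <= 2 * e + 1 / Suc n" if "P s e" for e
    using cont[OF in_S(1) that] e2 le by linarith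
   ultimately show ?thesis unfolding E_def stn using le nontriv e2 by auto
  qed
  moreover have "\<eta> \<in> T" unfolding T_def using \<eta> by simp
  ultimately show "T \<inter> (\<Inter>p\<in>J. E p) \<noteq> {}" by blast
 qed
 then obtain ch where ch: "ch \<in> T" "\<And>s t n. ch \<in> E (s, t, n)" by blast
 have lim: "a <= b" if "\<And>n. a <= b + 1 / real (Suc n)" for a b :: real
 proof (rule field_le_epsilon)
  fix e :: real assume "0 < e"
  then obtain n where "1 / real (Suc n) < e" using nat_approx_posE by blast
  thus "a <= b + e" using that[of n] by linarith
 qed
 have norm: "norm (ch x) = 1" for x using ch(1) unfolding T_def by simp
 have add: "ch (s + t) = ch s * ch t" for s t
 proof -
  have "norm (ch (s + t) - ch s * ch t) <= 0" by (rule lim) (use ch(2)[of s t] in \<open>auto simp: E_def\<close>)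
  thus ?thesis by simp
 qed
 have cont0: "c * (norm (ch s - 1))^2 <= 2 * e" if "P s e" for s e
  by (rule lim) (use ch(2)[of s 0] that in \<open>auto simp: E_def\<close>)
 have "c <= 2 * M * (norm (ch x0 - 1))^2"
  by (rule lim) (use ch(2)[of 0 0] in \<open>auto simp: E_def\<close>)
 hence nt: "ch x0 \<noteq> 1" using c(1) by auto
 have "continuous_on UNIV ch"
 proof (rule continuous_on_groupI)
  fix x :: 'a and e :: real assume "0 < e"
  define e' where "e' = c * e^2 / 2"
  have "0 < e'" unfolding e'_def using c(1) `0 < e` by simp
  from eqc[OF this, folded P_def] obtain V where V: "open V" "0 \<in> V" "\<And>x. x \<in> V ==> P x e'" by blast
  show "\<exists>V. open V \<and> 0 \<in> V \<and> (\<forall>t\<in>V. dist (ch (x + t)) (ch x) <= e)"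
  proof (intro exI[of _ V] conjI V ballI)
   fix t assume "t \<in> V"
   hence "c * (norm (ch t - 1))^2 <= c * e^2" using cont0[OF V(3)[of t]] unfolding e'_def by simp
   hence "(norm (ch t - 1))^2 <= e^2" using c(1) by simp
   hence "norm (ch t - 1) <= e" by (rule power2_le_imp_le) (use `0 < e` in simp)
   moreover have "ch (x + t) - ch x = ch x * (ch t - 1)" unfolding add right_diff_distrib by simp
   ultimately show "dist (ch (x + t)) (ch x) <= e" by (simp add: dist_norm norm_mult norm)
  qed
 qed
 hence "ch \<in> {f. continuous_on UNIV f \<and> (\<forall>x. norm (f x) = 1) \<and> (\<forall>x x'. f (x + x') = f x * f x')}"
  by (intro CollectI conjI allI norm add)
 hence "char_app (Abs_character ch) = ch" by (rule Abs_character_inverse)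
 hence "char_app (Abs_character ch) x0 \<noteq> 1" using nt by simp
 thus ?thesis by blast
qed

end

theorem characters_separate:
 fixes x0 :: "'a::{topological_ab_group_add,t2_space}"
 assumes lc: "locally_compact_space (euclidean :: 'a topology)" and "x0 \<noteq> 0"
 obtains y where "char_app y x0 \<noteq> 1"
proof -
 obtain I where "haar_integral (I :: ('a => real) => real)" using ex_haar_integral[OF lc] by blast
 then interpret haar_integral I .
 have K: "compact {0::'a}" and U: "open (- {- x0})" "{0} \<subseteq> - {- x0}" using assms(2) by auto
 show ?thesis
 proof (rule lc_cutoff[OF lc K U])
  fix g :: "'a => real"
  assume g: "g \<in> Cc" "\<And>x. x \<in> {0} ==> g x = 1" "\<And>x. x \<notin> - {- x0} ==> g x = 0"
  have "g 0 \<noteq> g (0 - x0)" using g(2,3) by simp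
  from ex_character_nontrivial[OF lc g(1) this] show ?thesis using that by blast
 qed
qed


section \<open>Separating subgroups of the dual: peak functions and Folner functions\<close>

text \<open>Nonnegative coefficients make the associated quadratic form on Fourier coefficients positive.\<close>
definition nonneg_trig :: "'a::topological_ab_group_add character set => ('a => real) => bool" where
 "nonneg_trig H w \<longleftrightarrow> (\<exists>n c h. (\<forall>i<n. 0 <= c i \<and> h i \<in> H) \<and>
   (\<forall>x. of_real (w x) = (\<Sum>i<(n::nat). of_real (c i) * char_app (h i) x)))"

lemma nonneg_trigI:
 assumes "\<forall>p\<in>set xs. 0 <= fst p \<and> snd p \<in> H"
  "\<And>x. of_real (w x) = (\<Sum>p\<leftarrow>xs. of_real (fst p) * char_app (snd p) x)"
 shows "nonneg_trig H w"
 unfolding nonneg_trig_def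
proof (intro exI conjI allI impI)
 show "0 <= fst (xs ! i)" "snd (xs ! i) \<in> H" if "i < length xs" for i using assms(1) that by auto
 show "of_real (w x) = (\<Sum>i<length xs. of_real (fst (xs ! i)) * char_app (snd (xs ! i)) x)" for x
  unfolding assms(2) by (simp add: sum_list_sum_nth atLeast0LessThan)
qed

lemma nonneg_trigE:
 assumes "nonneg_trig H w"
 obtains xs where "\<forall>p\<in>set xs. 0 <= fst p \<and> snd p \<in> H"
  "\<And>x. of_real (w x) = (\<Sum>p\<leftarrow>xs. of_real (fst p) * char_app (snd p) x)"
proof -
 obtain n c h where *: "\<forall>i<n. 0 <= c i \<and> h i \<in> H"
   "\<And>x. of_real (w x) = (\<Sum>i<(n::nat). of_real (c i) * char_app (h i) x)"
  using assms unfolding nonneg_trig_def by auto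
 show ?thesis
  by (rule that[of "map (%i. (c i, h i)) [0..<n]"])
   (use * in \<open>auto simp: sum_list_sum_nth atLeast0LessThan\<close>)
qed

lemma nonneg_trig_const: assumes "0 \<in> H" "0 <= c" shows "nonneg_trig H (%x. c)"
 by (rule nonneg_trigI[of "[(c, 0)]"]) (use assms in auto)

lemma nonneg_trig_Re: assumes "h \<in> H" "- h \<in> H" shows "nonneg_trig H (%x. Re (char_app h x))"
proof (rule nonneg_trigI[of "[(1/2, h), (1/2, - h)]"])
 show "of_real (Re (char_app h x)) =
   (\<Sum>p\<leftarrow>[(1/2, h), (1/2, - h)]. of_real (fst p) * char_app (snd p) x)" for x
  using complex_add_cnj[of "char_app h x"] by (simp add: char_minus_left field_simps)
qed (use assms in auto)

lemma nonneg_trig_add: assumes "nonneg_trig H v" "nonneg_trig H w" shows "nonneg_trig H (%x. v x + w x)"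
proof -
 obtain xs ys where xs: "\<forall>p\<in>set xs. 0 <= fst p \<and> snd p \<in> H"
  "\<And>x. of_real (v x) = (\<Sum>p\<leftarrow>xs. of_real (fst p) * char_app (snd p) x)"
  and ys: "\<forall>p\<in>set ys. 0 <= fst p \<and> snd p \<in> H"
  "\<And>x. of_real (w x) = (\<Sum>p\<leftarrow>ys. of_real (fst p) * char_app (snd p) x)"
  using assms by (elim nonneg_trigE) blast
 show ?thesis by (rule nonneg_trigI[of "xs @ ys"]) (use xs ys in auto)
qed

lemma sum_list_product:
 fixes f g :: "_ => 'b::comm_semiring_0"
 shows "(\<Sum>p\<leftarrow>xs. f p) * (\<Sum>q\<leftarrow>ys. g q) = (\<Sum>r\<leftarrow>List.product xs ys. f (fst r) * g (snd r))"
 by (induction xs) (auto simp: distrib_right sum_list_const_mult o_def)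

lemma nonneg_trig_mult:
 assumes "nonneg_trig H v" "nonneg_trig H w" "\<And>g h. g \<in> H ==> h \<in> H ==> g + h \<in> H"
 shows "nonneg_trig H (%x. v x * w x)"
proof -
 obtain xs ys where xs: "\<forall>p\<in>set xs. 0 <= fst p \<and> snd p \<in> H"
  "\<And>x. of_real (v x) = (\<Sum>p\<leftarrow>xs. of_real (fst p) * char_app (snd p) x)"
  and ys: "\<forall>p\<in>set ys. 0 <= fst p \<and> snd p \<in> H"
  "\<And>x. of_real (w x) = (\<Sum>p\<leftarrow>ys. of_real (fst p) * char_app (snd p) x)"
  using assms(1,2) by (elim nonneg_trigE) blast
 define zs where "zs = map (%r. (fst (fst r) * fst (snd r), snd (fst r) + snd (snd r))) (List.product xs ys)"
 show ?thesis
 proof (rule nonneg_trigI[of zs])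
  show "\<forall>p\<in>set zs. 0 <= fst p \<and> snd p \<in> H"
   unfolding zs_def using xs(1) ys(1) assms(3) by fastforce
  fix x
  have "of_real (v x * w x) = (\<Sum>r\<leftarrow>List.product xs ys.
    (of_real (fst (fst r)) * char_app (snd (fst r)) x) * (of_real (fst (snd r)) * char_app (snd (snd r)) x))"
   unfolding of_real_mult xs(2) ys(2) by (rule sum_list_product)
  also have "... = (\<Sum>p\<leftarrow>zs. of_real (fst p) * char_app (snd p) x)"
   unfolding zs_def by (simp add: o_def char_plus_left mult_ac)
  finally show "of_real (v x * w x) = (\<Sum>p\<leftarrow>zs. of_real (fst p) * char_app (snd p) x)" .
 qed
qed

lemma nonneg_trig_sum:
 assumes "0 \<in> H" "\<And>i. i \<in> A ==> nonneg_trig H (f i)" shows "nonneg_trig H (%x. \<Sum>i\<in>A. f i x)"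
 using assms(2) by (induction A rule: infinite_finite_induct)
  (simp_all add: nonneg_trig_add nonneg_trig_const[OF assms(1)])

lemma nonneg_trig_power:
 assumes "0 \<in> H" "\<And>g h. g \<in> H ==> h \<in> H ==> g + h \<in> H" "nonneg_trig H w"
 shows "nonneg_trig H (%x. w x ^ n)"
 by (induction n) (simp_all add: nonneg_trig_mult[OF assms(3) _ assms(2)] nonneg_trig_const[OF assms(1)])

definition separating_subgroup :: "'a::topological_ab_group_add character set => bool" where
 "separating_subgroup H \<longleftrightarrow> 0 \<in> H \<and> (\<forall>h\<in>H. - h \<in> H) \<and> (\<forall>g\<in>H. \<forall>h\<in>H. g + h \<in> H) \<and>
   (\<forall>x. x \<noteq> 0 \<longrightarrow> (\<exists>h\<in>H. char_app h x \<noteq> 1))"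

lemma separating_subgroupD:
 assumes "separating_subgroup H"
 shows "0 \<in> H" "\<And>h. h \<in> H ==> - h \<in> H" "\<And>g h. g \<in> H ==> h \<in> H ==> g + h \<in> H"
  "\<And>x. x \<noteq> 0 ==> \<exists>h\<in>H. char_app h x \<noteq> 1"
 using assms unfolding separating_subgroup_def by simp_all

text \<open>An average of the functions (1 + Re h) / 2 over finitely many h that separate B - U from 0.\<close>
lemma ex_peak_function:
 fixes H :: "'a::{topological_ab_group_add,t2_space} character set"
 assumes sepH: "separating_subgroup H"
  and B: "compact B" and U: "open U" "0 \<in> U"
 shows "\<exists>v d. nonneg_trig H v \<and> continuous_on UNIV v \<and> (\<forall>x. 0 <= v x) \<and> (\<forall>x. v x <= 1) \<and> v 0 = 1 \<and>
  0 < d \<and> d < 1 \<and> (\<forall>x. x \<in> B \<longrightarrow> x \<notin> U \<longrightarrow> v x <= 1 - d)"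
proof -
 note H = separating_subgroupD(1-3)[OF sepH] and sep = separating_subgroupD(4)[OF sepH]
 have cBU: "compact (B - U)" using B U(1) by (rule compact_diff)
 have op: "open {x. char_app h x \<noteq> 1}" for h :: "'a character"
  by (intro open_Collect_neq char_cont continuous_on_const)
 have "B - U \<subseteq> (\<Union>h\<in>H. {x. char_app h x \<noteq> 1})"
 proof
  fix x assume "x \<in> B - U"
  hence "x \<noteq> 0" using U(2) by auto
  from sep[OF this] show "x \<in> (\<Union>h\<in>H. {x. char_app h x \<noteq> 1})" by auto
 qed
 then obtain T where T: "T \<subseteq> H" "finite T" "B - U \<subseteq> (\<Union>h\<in>T. {x. char_app h x \<noteq> 1})"
  by (rule compactE_image[OF cBU op])
 define T' where "T' = insert 0 T"
 have T': "T' \<subseteq> H" "finite T'" "0 < card T'" unfolding T'_def using T H by (auto simp: card_gt_0_iff)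
 define v where "v x = (\<Sum>h\<in>T'. (1 / (2 * card T')) * (1 + Re (char_app h x)))" for x
 have re: "\<bar>Re (char_app h x)\<bar> <= 1" for h and x :: 'a
  using abs_Re_le_cmod[of "char_app h x"] by simp
 have re': "0 <= 1 + Re (char_app h x)" "1 + Re (char_app h x) <= 2" for h and x :: 'a
  using re[of h x] by linarith+
 have tr: "nonneg_trig H v"
  unfolding v_def
 proof (intro nonneg_trig_sum[OF H(1)] nonneg_trig_mult nonneg_trig_const[OF H(1)] nonneg_trig_add H(3))
  show "nonneg_trig H (%x. Re (char_app h x))" if "h \<in> T'" for h
   using that T'(1) by (intro nonneg_trig_Re H(2)) auto
 qed simp_all
 have cont: "continuous_on UNIV v" unfolding v_def
  by (intro continuous_on_sum continuous_on_mult continuous_on_add continuous_on_Re continuous_on_const char_cont)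
 have nn: "0 <= v x" for x
  unfolding v_def by (intro sum_nonneg mult_nonneg_nonneg re') simp
 have le: "v x <= 1" for x
 proof -
  have "v x <= (\<Sum>h\<in>T'. (1 / (2 * card T')) * 2)"
   unfolding v_def by (intro sum_mono mult_left_mono re') simp
  thus ?thesis using T'(3) by simp
 qed
 have v0: "v 0 = 1" unfolding v_def using T'(3) by simp
 have lt: "v x < 1" if x: "x \<in> B - U" for x
 proof -
  obtain h where h: "h \<in> T'" "char_app h x \<noteq> 1" 
  proof -
   from x T(3) obtain h where "h \<in> T" "x \<in> {x. char_app h x \<noteq> 1}" by (meson UN_E subsetD)
   thus ?thesis by (intro that[of h]) (simp_all add: T'_def)
  qed
  have "Re (char_app h x) \<noteq> 1"
  proof
   assume r: "Re (char_app h x) = 1"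
   have "(Re (char_app h x))^2 + (Im (char_app h x))^2 = 1" using cmod_power2[of "char_app h x"] by simp
   hence "Im (char_app h x) = 0" using r by simp
   thus False using r h(2) by (simp add: complex_eq_iff)
  qed
  hence "Re (char_app h x) < 1" using re[of h x] by linarith
  have "v x < (\<Sum>h\<in>T'. (1 / (2 * card T')) * 2)"
   unfolding v_def
  proof (rule sum_strict_mono_ex1)
   show "\<forall>h\<in>T'. 1 / real (2 * card T') * (1 + Re (char_app h x)) <= 1 / real (2 * card T') * 2"
    by (intro ballI mult_left_mono re') simp
   show "\<exists>h\<in>T'. 1 / real (2 * card T') * (1 + Re (char_app h x)) < 1 / real (2 * card T') * 2"
    using `Re (char_app h x) < 1` T'(3)
    by (intro bexI[OF _ h(1)] mult_strict_left_mono) simp_all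
  qed (rule T'(2))
  thus ?thesis using T'(3) by simp
 qed
 obtain d where d: "0 < d" "d < 1" "\<And>x. x \<in> B - U ==> v x <= 1 - d"
 proof (cases "B - U = {}")
  case True thus ?thesis using that[of "1/2"] by auto
 next
  case False
  obtain z where z: "z \<in> B - U" "\<And>x. x \<in> B - U ==> v x <= v z"
   using continuous_attains_sup[OF cBU False continuous_on_subset[OF cont]] by blast
  show ?thesis
  proof (rule that[of "(1 - v z) / 2"])
   show "0 < (1 - v z) / 2" using lt[OF z(1)] by simp
   show "(1 - v z) / 2 < 1" using nn[of z] by simp
   show "v x <= 1 - (1 - v z) / 2" if "x \<in> B - U" for x
    using z(2)[OF that] lt[OF z(1)] by (simp add: field_simps)
  qed
 qed
 show ?thesis by (intro exI[of _ v] exI[of _ d] conjI allI impI tr cont nn le v0 d) simp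
qed

context haar_integral
begin

lemma I_abs_shift_continuous:
 assumes lc: "locally_compact_space (euclidean :: 'a topology)" and g: "g \<in> Cc" and "0 < e"
 shows "\<exists>V. open V \<and> 0 \<in> V \<and> (\<forall>x\<in>V. I (%s. \<bar>g (s - x) - g s\<bar>) <= e)"
proof -
 obtain K where K: "compact K" "\<And>x. x \<notin> K ==> g x = 0" using g by (metis Cc_support)
 obtain U L where U: "open U" "(0::'a) \<in> U" "compact L" "U \<subseteq> L" using lc_compact_nbhd[OF lc] by metis
 define K' where "K' = K \<union> (%p. fst p + snd p) ` (K \<times> L)"
 have K': "compact K'" unfolding K'_def
  by (intro compact_Un compact_continuous_image compact_Times K U continuous_on_add continuous_on_fst
    continuous_on_snd continuous_on_id)
 obtain k :: "'a => real" where k': "k \<in> Cc" "\<And>x. 0 <= k x" "\<And>x. k x <= 1" "\<And>x. x \<in> K' ==> k x = 1"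
  using lc_bump[OF lc K'] by blast
 note k = k'(1,2,4)
 have Ik: "0 <= I k" by (rule I_nonneg[OF k(1,2)])
 define d where "d = e / (I k + 1)"
 have d: "0 < d" unfolding d_def using `0 < e` Ik by simp
 obtain V where V: "open V" "0 \<in> V" "\<And>x t. t \<in> V ==> norm (g (x + t) - g x) < d"
  using Cc_uniform[OF g d] by blast
 obtain V' where V': "open V'" "0 \<in> V'" "\<And>x. x \<in> V' ==> - x \<in> V'" "V' \<subseteq> V"
  using half_nbhd[OF V(1,2)] by metis
 show ?thesis
 proof (intro exI[of _ "V' \<inter> U"] conjI ballI open_Int V' U IntI)
  fix x :: 'a assume x: "x \<in> V' \<inter> U"
  have "I (%s. \<bar>g (s - x) - g s\<bar>) <= I (%s. d * k s)"
  proof (rule I_mono)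
   show "(%s. \<bar>g (s - x) - g s\<bar>) \<in> Cc" using Cc_norm[OF Cc_diff[OF Cc_shift_diff[OF g] g]] by simp
   show "(%s. d * k s) \<in> Cc" by (intro Cc_mult(1) k continuous_on_const)
   fix s
   show "\<bar>g (s - x) - g s\<bar> <= d * k s"
   proof (cases "s \<in> K'")
    case True
    have "- x \<in> V" using V' x by blast
    thus ?thesis using V(3)[of "- x" s] k(3)[OF True] by simp
   next
    case False
    hence "s \<notin> K" unfolding K'_def by blast
    moreover have "s - x \<notin> K"
    proof
     assume "s - x \<in> K"
     hence "(s - x, x) \<in> K \<times> L" using x U by auto
     hence "fst (s - x, x) + snd (s - x, x) \<in> K'" unfolding K'_def by blast
     thus False using False by simp
    qed
    ultimately show ?thesis using K k(2)[of s] d by simp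
   qed
  qed
  also have "... = d * I k" by (rule I_scale[OF k(1)])
  also have "... <= e" unfolding d_def using `0 < e` Ik by (simp add: field_simps)
  finally show "I (%s. \<bar>g (s - x) - g s\<bar>) <= e" .
 qed
qed

lemma Cc_abs_shift: "(g :: 'a => real) \<in> Cc ==> (%s. \<bar>g (s - x) - g s\<bar>) \<in> Cc"
 using Cc_norm[OF Cc_diff[OF Cc_shift_diff[of g x]]] by simp

text \<open>Averaging g along the multiples of t makes it almost t-invariant and does not spoil the invariance
under other translations, since translations commute.\<close>
lemma ex_Folner_finite:
 fixes g :: "'a => real" and N :: nat
 assumes "finite S" "0 < N" and g: "g \<in> Cc" "\<And>x. 0 <= g x" "0 < I g"
 shows "\<exists>F\<in>Cc. (\<forall>x. 0 <= F x) \<and> 0 < I F \<and>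
  (\<forall>s\<in>S. I (%z. \<bar>F (z - s) - F z\<bar>) <= (2 / N) * I F) \<and>
  (\<forall>x. I (%z. \<bar>F (z - x) - F z\<bar>) <= (I (%z. \<bar>g (z - x) - g z\<bar>) / I g) * I F)"
 using assms(1)
proof (induction S)
 case empty
 thus ?case using g by (intro bexI[of _ g]) auto
next
 case (insert t S)
 then obtain F where F: "F \<in> Cc" "\<And>x. 0 <= F x" "0 < I F"
  "\<And>s. s \<in> S ==> I (%z. \<bar>F (z - s) - F z\<bar>) <= (2 / N) * I F"
  "\<And>x. I (%z. \<bar>F (z - x) - F z\<bar>) <= (I (%z. \<bar>g (z - x) - g z\<bar>) / I g) * I F" by blast
 define G where "G z = (\<Sum>k<N. F (z - zmult (int k) t))" for z
 have G: "G \<in> Cc" unfolding G_def by (intro Cc_sum Cc_shift_diff F)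
 have shift: "I (%z. f (z - a)) = I f" if "f \<in> Cc" for f a
  using I_shift[OF that, of "- a"] by simp
 have IG: "I G = N * I F"
  unfolding G_def by (subst I_sum) (auto simp: shift F(1) intro!: Cc_shift_diff F)
 have gen: "I (%z. \<bar>G (z - x) - G z\<bar>) <= N * I (%z. \<bar>F (z - x) - F z\<bar>)" for x
 proof -
  have c: "(%z. \<bar>F (z - zmult (int k) t - x) - F (z - zmult (int k) t)\<bar>) \<in> Cc" for k
   using Cc_shift_diff[OF Cc_abs_shift[OF F(1), of x], of "zmult (int k) t"] by simp
  have "I (%z. \<bar>G (z - x) - G z\<bar>) <= I (%z. \<Sum>k<N. \<bar>F (z - zmult (int k) t - x) - F (z - zmult (int k) t)\<bar>)"
  proof (rule I_mono[OF Cc_abs_shift[OF G] Cc_sum[OF c]])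
   fix z
   have "G (z - x) - G z = (\<Sum>k<N. F (z - zmult (int k) t - x) - F (z - zmult (int k) t))"
    unfolding G_def by (simp add: sum_subtractf diff_diff_eq add.commute)
   thus "\<bar>G (z - x) - G z\<bar> <= (\<Sum>k<N. \<bar>F (z - zmult (int k) t - x) - F (z - zmult (int k) t)\<bar>)"
    by simp
  qed
  also have "... = (\<Sum>k<N. I (%z. \<bar>F (z - zmult (int k) t - x) - F (z - zmult (int k) t)\<bar>))"
   by (rule I_sum[OF c])
  also have "... = (\<Sum>k<N. I (%z. \<bar>F (z - x) - F z\<bar>))"
   using shift[OF Cc_abs_shift[OF F(1), of x]] by simp
  finally show ?thesis by simp
 qed
 show ?case
 proof (intro bexI[of _ G] conjI allI ballI G)
  show "0 <= G x" for x unfolding G_def by (intro sum_nonneg F)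
  show "0 < I G" unfolding IG using F(3) `0 < N` by simp
  show "I (%z. \<bar>G (z - x) - G z\<bar>) <= I (%z. \<bar>g (z - x) - g z\<bar>) / I g * I G" for x
   using order_trans[OF gen[of x] mult_left_mono[OF F(5)[of x], of "real N"]] unfolding IG
   by (simp add: mult_ac)
  fix s assume s: "s \<in> insert t S"
  show "I (%z. \<bar>G (z - s) - G z\<bar>) <= (2 / N) * I G"
  proof (cases "s = t")
   case False
   thus ?thesis
    using s order_trans[OF gen[of s] mult_left_mono[OF F(4)[of s], of "real N"]] unfolding IG
    by (simp add: mult_ac)
  next
   case True
   have tel: "G (z - t) - G z = F (z - zmult (int N) t) - F z" for z
   proof -
    have "G (z - t) - G z = (\<Sum>k<N. F (z - zmult (int (Suc k)) t) - F (z - zmult (int k) t))"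
     unfolding G_def using zmult_succ[of "int _" t]
     by (simp add: sum_subtractf diff_diff_eq add.commute[of 1] add.commute[of t])
    also have "... = F (z - zmult (int N) t) - F (z - zmult (int 0) t)" by (rule sum_lessThan_telescope)
    finally show ?thesis by simp
   qed
   have "I (%z. \<bar>F (z - zmult (int N) t) - F z\<bar>) <= I (%z. F (z - zmult (int N) t) + F z)"
   proof (rule I_mono[OF Cc_abs_shift[OF F(1)] Cc_add[OF Cc_shift_diff[OF F(1)] F(1)]])
    show "\<bar>F (x - zmult (int N) t) - F x\<bar> <= F (x - zmult (int N) t) + F x" for x
     using F(2)[of x] F(2)[of "x - zmult (int N) t"] by linarith
   qed
   also have "... = 2 * I F" by (simp add: I_add Cc_shift_diff F(1) shift)
   also have "... = (2 / N) * I G" unfolding IG using `0 < N` by simp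
   finally show ?thesis unfolding True tel .
  qed
 qed
qed

text \<open>Invariance on a finite net of K suffices, because every averaged function inherits the modulus of
continuity of g. The square root turns L1 invariance into L2 invariance.\<close>
lemma ex_Folner:
 assumes lc: "locally_compact_space (euclidean :: 'a topology)" and K: "compact K" and "0 < e"
 shows "\<exists>f :: 'a => real. f \<in> Cc \<and> (\<forall>x. 0 <= f x) \<and> 0 < I (%x. (f x)^2) \<and>
  (\<forall>x. x \<in> K \<longrightarrow> I (%s. (f (s - x) - f s)^2) <= e * I (%x. (f x)^2))"
proof -
 have c0: "compact {0::'a}" by simp
 obtain g :: "'a => real" where g': "g \<in> Cc" "\<And>x. 0 <= g x" "\<And>x. g x <= 1" "\<And>x. x \<in> {0} ==> g x = 1"
  using lc_bump[OF lc c0] by blast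
 note g = g'(1,2,4)
 have Ig: "0 < I g" by (rule I_pos[OF g(1,2), of 0]) (simp add: g(3))
 have "0 < e / 2 * I g" using Ig `0 < e` by simp
 from I_abs_shift_continuous[OF lc g(1) this] obtain V where
  V: "open V" "0 \<in> V" "\<And>x. x \<in> V ==> I (%s. \<bar>g (s - x) - g s\<bar>) <= e / 2 * I g" by blast
 have "K \<subseteq> (\<Union>t\<in>K. {z. z - t \<in> V})" using V(2) by (intro subsetI UN_I) (assumption, simp)
 then obtain S where S: "S \<subseteq> K" "finite S" "K \<subseteq> (\<Union>t\<in>S. {z. z - t \<in> V})"
  by (rule compactE_image[OF K open_translate(3)[OF V(1)]])
 define N where "N = nat \<lceil>4 / e\<rceil> + 1"
 have N: "0 < N" "2 / N <= e / 2"
 proof -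
  show "0 < N" unfolding N_def by simp
  have "4 / e <= real N" unfolding N_def by linarith
  thus "2 / N <= e / 2" using `0 < N` `0 < e` by (simp add: field_simps)
 qed
 obtain F where F: "F \<in> Cc" "\<And>x. 0 <= F x" "0 < I F"
  "\<And>s. s \<in> S ==> I (%z. \<bar>F (z - s) - F z\<bar>) <= (2 / N) * I F"
  "\<And>x. I (%z. \<bar>F (z - x) - F z\<bar>) <= (I (%z. \<bar>g (z - x) - g z\<bar>) / I g) * I F"
  using ex_Folner_finite[OF S(2) N(1) g(1,2) Ig] by blast
 have shift: "I (%z. f (z - a)) = I f" if "f \<in> Cc" for f a
  using I_shift[OF that, of "- a"] by simp
 have FK: "I (%z. \<bar>F (z - x) - F z\<bar>) <= e * I F" if xK: "x \<in> K" for x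
 proof -
  obtain s where s: "s \<in> S" "x - s \<in> V" using S(3) xK by blast
  have c: "(%z. \<bar>F (z - s - (x - s)) - F (z - s)\<bar>) \<in> Cc"
   by (rule Cc_shift_diff[OF Cc_abs_shift[OF F(1)]])
  have "I (%z. \<bar>F (z - x) - F z\<bar>) <= I (%z. \<bar>F (z - s - (x - s)) - F (z - s)\<bar> + \<bar>F (z - s) - F z\<bar>)"
  proof (rule I_mono[OF Cc_abs_shift[OF F(1)] Cc_add[OF c Cc_abs_shift[OF F(1)]]])
   show "\<bar>F (z - x) - F z\<bar> <= \<bar>F (z - s - (x - s)) - F (z - s)\<bar> + \<bar>F (z - s) - F z\<bar>" for z
    by (simp add: diff_diff_eq)
  qed
  also have "... = I (%z. \<bar>F (z - (x - s)) - F z\<bar>) + I (%z. \<bar>F (z - s) - F z\<bar>)"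
   by (subst I_add[OF c Cc_abs_shift[OF F(1)]])
    (simp only: shift[OF Cc_abs_shift[OF F(1), of "x - s"], of s])
  also have "... <= (e / 2) * I F + (e / 2) * I F"
  proof (rule add_mono)
   have "I (%z. \<bar>g (z - (x - s)) - g z\<bar>) / I g <= e / 2"
    using V(3)[OF s(2)] Ig by (simp add: pos_divide_le_eq)
   thus "I (%z. \<bar>F (z - (x - s)) - F z\<bar>) <= (e / 2) * I F"
    by (intro order_trans[OF F(5)[of "x - s"]] mult_right_mono less_imp_le[OF F(3)])
   show "I (%z. \<bar>F (z - s) - F z\<bar>) <= (e / 2) * I F"
    by (intro order_trans[OF F(4)[OF s(1)]] mult_right_mono less_imp_le[OF F(3)] N(2))
  qed
  finally show ?thesis by simp
 qed
 have sq: "(%x. (sqrt (F x))^2) = F" using F(2) by simp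
 show ?thesis
 proof (intro exI[of _ "%x. sqrt (F x)"] conjI allI impI)
  show c: "(%x. sqrt (F x)) \<in> Cc"
   by (rule Cc_dominated[OF F(1)]) (auto intro!: continuous_intros Cc_continuous[OF F(1)])
  show "0 <= sqrt (F x)" for x using F(2) by simp
  show "0 < I (%x. (sqrt (F x))^2)" unfolding sq by (rule F(3))
  fix x assume x: "x \<in> K"
  have "I (%s. (sqrt (F (s - x)) - sqrt (F s))^2) <= I (%s. \<bar>F (s - x) - F s\<bar>)"
  proof (rule I_mono[OF _ Cc_abs_shift[OF F(1)]])
   show "(%s. (sqrt (F (s - x)) - sqrt (F s))^2) \<in> Cc"
    by (intro Cc_power2 Cc_diff c Cc_shift_diff[OF c])
   fix s
   define a b where "a = sqrt (F (s - x))" and "b = sqrt (F s)"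
   have ab: "0 <= a" "0 <= b" "F (s - x) = a^2" "F s = b^2" 
    unfolding a_def b_def by (simp_all add: F(2))
   have "(a - b)^2 = \<bar>a - b\<bar> * \<bar>a - b\<bar>" by (simp add: power2_eq_square)
   also have "... <= \<bar>a - b\<bar> * (a + b)" using ab by (intro mult_left_mono) auto
   also have "... = \<bar>(a - b) * (a + b)\<bar>" using ab by (simp add: abs_mult)
   also have "(a - b) * (a + b) = a^2 - b^2" by (simp add: power2_eq_square algebra_simps)
   finally show "(sqrt (F (s - x)) - sqrt (F s))^2 <= \<bar>F (s - x) - F s\<bar>"
    unfolding a_def[symmetric] b_def[symmetric] unfolding ab(3,4) .
  qed
  also have "... <= e * I F" by (rule FK[OF x])
  finally show "I (%s. (sqrt (F (s - x)) - sqrt (F s))^2) <= e * I (%x. (sqrt (F x))^2)" unfolding sq .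
 qed
qed

end


section \<open>Separating subgroups are dense\<close>

lemma distribution_tight:
 assumes lc: "locally_compact_space (euclidean :: 'a::{t2_space,second_countable_topology} topology)"
  and mu: "\<mu> \<in> distributions" and "0 < r"
 shows "\<exists>K::'a set. compact K \<and> measure \<mu> (- K) <= r"
proof -
 obtain K :: "nat => 'a set" where K: "\<And>n. compact (K n)" "incseq K" "(\<Union>n. K n) = UNIV"
  using lc_exhaustion[OF lc] by blast
 interpret prob_space \<mu> using mu unfolding distributions_def by blast
 have s: "sets \<mu> = sets borel" using mu unfolding distributions_def by blast
 hence sp: "space \<mu> = UNIV" using sets_eq_imp_space_eq[of \<mu> borel] by simp
 have Km: "K n \<in> sets \<mu>" for n unfolding s using compact_imp_closed[OF K(1)] by (rule borel_closed)
 have "(%n. measure \<mu> (K n)) \<longlonglongrightarrow> measure \<mu> (\<Union>n. K n)"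
  by (rule finite_Lim_measure_incseq) (use Km K(2) in auto)
 hence "(%n. measure \<mu> (K n)) \<longlonglongrightarrow> 1" unfolding K(3) using prob_space sp by simp
 hence "\<forall>\<^sub>F n in sequentially. 1 - r < measure \<mu> (K n)"
  using `0 < r` by (intro order_tendstoD) auto
 then obtain n where "1 - r < measure \<mu> (K n)" by (auto simp: eventually_sequentially)
 moreover have "measure \<mu> (- K n) = 1 - measure \<mu> (K n)"
  using prob_compl[OF Km, of n] sp by (simp add: Compl_eq_Diff_UNIV)
 ultimately show ?thesis using K(1) by (intro exI[of _ "K n"]) auto
qed

lemma finite_family_tight:
 fixes \<mu> :: "'i => 'a::{t2_space,second_countable_topology} measure"
 assumes lc: "locally_compact_space (euclidean :: 'a topology)"
  and J: "finite J" "\<And>j. j \<in> J ==> \<mu> j \<in> distributions" and "0 < r"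
 shows "\<exists>K. compact K \<and> (\<forall>j\<in>J. measure (\<mu> j) (- K) <= r)"
proof -
 have "\<forall>j\<in>J. \<exists>K. compact K \<and> measure (\<mu> j) (- K) <= r"
 proof
  fix j assume "j \<in> J"
  show "\<exists>K. compact K \<and> measure (\<mu> j) (- K) <= r"
   by (rule distribution_tight[OF lc J(2)[OF `j \<in> J`] `0 < r`])
 qed
 from bchoice[OF this] obtain K where K: "\<And>j. j \<in> J ==> compact (K j) \<and> measure (\<mu> j) (- K j) <= r" by blast
 show ?thesis
 proof (intro exI[of _ "\<Union>j\<in>J. K j"] conjI ballI)
  show "compact (\<Union>j\<in>J. K j)" using K J(1) by (intro compact_UN) auto
  fix j assume j: "j \<in> J"
  interpret prob_space "\<mu> j" using J(2)[OF j] unfolding distributions_def by blast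
  have s: "sets (\<mu> j) = sets borel" using J(2)[OF j] unfolding distributions_def by blast
  have "measure (\<mu> j) (- (\<Union>j\<in>J. K j)) <= measure (\<mu> j) (- K j)"
   using j K[OF j] compact_imp_closed by (intro finite_measure_mono) (auto simp: s intro!: borel_open)
  thus "measure (\<mu> j) (- (\<Union>j\<in>J. K j)) <= r" using K[OF j] by linarith
 qed
qed

context haar_integral
begin

abbreviation fourier :: "('a => complex) => 'a character => complex" where
 "fourier u y \<equiv> Ic (%s. u s * cnj (char_app y s))"

text \<open>Expanding w into characters turns the double integral of u(s) conj(u(t)) w(s - t) into a weighted sum
of squared Fourier coefficients.\<close>
lemma trig_form:
 assumes u: "u \<in> Cc" and w: "\<And>x. of_real (w x) = (\<Sum>i<(n::nat). of_real (c i) * char_app (h i) x)"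
 shows "of_real (\<Sum>i<n. c i * (norm (fourier u (h i)))^2) =
  Ic (%s. cnj (u s) * Ic (%t. u t * of_real (w (s - t))))"
proof -
 define a where "a i = fourier u (h i)" for i
 have cu: "(%s. u s * cnj (char_app (h i) s)) \<in> Cc" for i
  by (intro Cc_mult(2) u continuous_on_cnj char_cont)
 have inner: "Ic (%t. u t * of_real (w (s - t))) = (\<Sum>i<n. of_real (c i) * char_app (h i) s * a i)" for s
 proof -
  have "(%t. u t * of_real (w (s - t))) =
    (%t. \<Sum>i<n. (of_real (c i) * char_app (h i) s) * (u t * cnj (char_app (h i) t)))"
   unfolding w by (simp add: char_diff_right sum_distrib_left mult_ac)
  thus ?thesis unfolding a_def by (simp only: Ic_sum[OF Cc_cmult[OF cu]] Ic_scale[OF cu])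
 qed
 have cu': "(%s. cnj (u s) * char_app (h i) s) \<in> Cc" for i
  using Cc_cnj[OF cu[of i]] by simp
 have Icu': "Ic (%s. cnj (u s) * char_app (h i) s) = cnj (a i)" for i
  using Ic_cnj[OF cu[of i]] unfolding a_def by simp
 have "Ic (%s. cnj (u s) * Ic (%t. u t * of_real (w (s - t)))) =
   Ic (%s. \<Sum>i<n. (of_real (c i) * a i) * (cnj (u s) * char_app (h i) s))"
  unfolding inner by (simp add: sum_distrib_left mult_ac)
 also have "... = (\<Sum>i<n. (of_real (c i) * a i) * cnj (a i))"
  by (simp only: Ic_sum[OF Cc_cmult[OF cu']] Ic_scale[OF cu'] Icu')
 also have "... = of_real (\<Sum>i<n. c i * (norm (a i))^2)"
  by (simp only: of_real_sum of_real_mult complex_norm_square mult.assoc)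
 finally show ?thesis unfolding a_def by simp
qed

text \<open>A high power w of a peak function acts as a multiple C of an approximate identity, so its quadratic
form is close to C times the squared L2 norm. The factor k cuts w off outside A - A, which the form
does not see, and keeps it integrable.\<close>
lemma trig_form_concentrates:
 assumes lc: "locally_compact_space (euclidean :: 'a topology)"
  and H: "separating_subgroup (H :: 'a character set)"
  and A: "compact A" and U: "open U" "0 \<in> U" and "0 < e" "0 <= b"
 shows "\<exists>(n::nat) c h C. (\<forall>i<n. 0 <= c i \<and> h i \<in> H) \<and> 0 < C \<and>
  (\<forall>u\<in>Cc. (\<forall>x. x \<notin> A \<longrightarrow> u x = 0) \<longrightarrow> (\<forall>x. norm (u x) <= b) \<longrightarrow>
   (\<forall>s t. s - t \<in> U \<longrightarrow> norm (u t - u s) <= e) \<longrightarrow>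
   \<bar>(\<Sum>i<n. c i * (norm (fourier u (h i)))^2) - C * Q u\<bar> <= 2 * e * C * I (%x. norm (u x)))"
proof -
 define B0 where "B0 = insert 0 ((%p. fst p - snd p) ` (A \<times> A))"
 have B0: "compact B0" unfolding B0_def
  by (intro compact_insert compact_continuous_image compact_Times A continuous_on_diff continuous_on_fst
    continuous_on_snd continuous_on_id)
 obtain k :: "'a => real" where k: "k \<in> Cc" "\<And>x. 0 <= k x" "\<And>x. k x <= 1" "\<And>x. x \<in> B0 ==> k x = 1"
  using lc_bump[OF lc B0] by blast
 obtain B where B: "compact B" "\<And>x. x \<notin> B ==> k x = 0" using k(1) by (metis Cc_support)
 obtain v d where v: "nonneg_trig H v" "continuous_on UNIV v" "\<And>x. 0 <= v x" "\<And>x. v x <= 1" "v 0 = 1"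
  and d: "0 < d" "d < 1" "\<And>x. x \<in> B ==> x \<notin> U ==> v x <= 1 - d"
  using ex_peak_function[OF H B(1) U] by blast
 define kr where "kr x = k (- x)" for x
 have kr: "kr \<in> Cc" unfolding kr_def using Cc_reflect[OF k(1), of 0] by simp
 have Ikr: "0 <= I kr" by (rule I_nonneg[OF kr]) (simp add: kr_def k)
 define O' where "O' = {x. 1 - d / 2 < v (- x)} \<inter> {x. 1 / 2 < k (- x)}"
 have cm: "continuous_on UNIV (%x. f (- x))" if "continuous_on UNIV f" for f :: "'a => real"
  using continuous_on_translate_comp(4)[OF that, of 0] by simp
 have O': "open O'" "{0} \<subseteq> O'"
 proof -
  show "open O'" unfolding O'_def
   by (intro open_Int open_Collect_less continuous_on_const cm[OF v(2)] cm[OF Cc_continuous[OF k(1)]])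
  show "{0} \<subseteq> O'" unfolding O'_def using v(5) d(1) k(4)[of 0] by (simp add: B0_def)
 qed
 obtain l :: "'a => real" where l: "l \<in> Cc" "\<And>x. 0 <= l x" "\<And>x. l x <= 1" "l 0 = 1" "\<And>x. x \<notin> O' ==> l x = 0"
 proof -
  have "compact {0::'a}" by simp
  from lc_cutoff_ex[OF lc this O'] obtain l :: "'a => real" where
   "l \<in> Cc" "\<forall>x. 0 <= l x" "\<forall>x. l x <= 1" "\<forall>x. x \<in> {0} \<longrightarrow> l x = 1" "\<forall>x. x \<notin> O' \<longrightarrow> l x = 0" by blast
  thus ?thesis by (intro that[of l]) simp_all
 qed
 have Il: "0 < I l" by (rule I_pos[OF l(1,2), of 0]) (simp add: l)
 \<comment> \<open>Outside U the power w decays faster, by the factor q^N, than near 0.\<close>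
 define q where "q = (1 - d) / (1 - d / 2)"
 have q: "0 <= q" "q < 1" unfolding q_def using d by (auto simp: field_simps)
 have "(%N. (4 * b * I kr) * q ^ N) \<longlonglongrightarrow> (4 * b * I kr) * 0"
  by (intro tendsto_mult_left LIMSEQ_power_zero) (use q in auto)
 moreover have "0 < e * I l" using `0 < e` Il by simp
 ultimately have "\<forall>\<^sub>F N in sequentially. (4 * b * I kr) * q ^ N < e * I l"
  by (intro order_tendstoD) auto
 then obtain N where N: "(4 * b * I kr) * q ^ N < e * I l" by (auto simp: eventually_sequentially)
 define w where "w x = v x ^ N" for x
 have wc: "continuous_on UNIV w" unfolding w_def by (intro continuous_on_power v)
 have w0: "0 <= w x" for x unfolding w_def by (intro zero_le_power v)
 have wU: "w x <= (1 - d) ^ N" if "x \<in> B" "x \<notin> U" for x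
  unfolding w_def by (intro power_mono d v that)
 have "nonneg_trig H w" unfolding w_def by (rule nonneg_trig_power[OF separating_subgroupD(1,3)[OF H] v(1)])
 then obtain n c h where ch: "\<forall>i<n. 0 <= c i \<and> h i \<in> H"
  "\<And>x. complex_of_real (w x) = (\<Sum>i<(n::nat). complex_of_real (c i) * char_app (h i) x)"
  unfolding nonneg_trig_def by auto
 define kw where "kw r = k (- r) * w (- r)" for r
 have kw: "kw \<in> Cc" unfolding kw_def by (rule Cc_mult(2)[OF kr[unfolded kr_def[abs_def]] cm[OF wc]])
 define C where "C = I kw"
 have C_lower: "(1 / 2) * (1 - d / 2) ^ N * I l <= C"
 proof -
  have "I (%r. ((1 / 2) * (1 - d / 2) ^ N) * l r) <= C"
   unfolding C_def
  proof (rule I_mono[OF _ kw])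
   show "(%r. ((1 / 2) * (1 - d / 2) ^ N) * l r) \<in> Cc" by (intro Cc_mult(1) l continuous_on_const)
   fix r
   show "((1 / 2) * (1 - d / 2) ^ N) * l r <= kw r"
   proof (cases "r \<in> O'")
    case True
    hence 1: "1 / 2 <= k (- r)" "1 - d / 2 <= v (- r)" unfolding O'_def by auto
    have "(1 - d / 2) ^ N <= w (- r)" unfolding w_def using 1(2) d by (intro power_mono) auto
    hence "(1 / 2) * (1 - d / 2) ^ N <= kw r"
     unfolding kw_def using 1(1) d by (intro mult_mono k) auto
    moreover have "((1 / 2) * (1 - d / 2) ^ N) * l r <= ((1 / 2) * (1 - d / 2) ^ N) * 1"
     using l(3) d by (intro mult_left_mono) auto
    ultimately show ?thesis by simp
   next
    case False
    thus ?thesis using l(5)[OF False] k(2) w0 unfolding kw_def by simp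
   qed
  qed
  thus ?thesis by (simp only: I_scale[OF l(1)])
 qed
 have "0 < (1 / 2) * (1 - d / 2) ^ N * I l" using Il d by simp
 hence C: "0 < C" using C_lower by linarith
 have small: "2 * b * (1 - d) ^ N * I kr <= e * C"
 proof -
  have "(1 - d) ^ N = q ^ N * (1 - d / 2) ^ N"
   unfolding q_def power_mult_distrib[symmetric] using d by simp
  hence "2 * b * (1 - d) ^ N * I kr = (1 / 2) * (1 - d / 2) ^ N * ((4 * b * I kr) * q ^ N)"
   by simp
  also have "... <= (1 / 2) * (1 - d / 2) ^ N * (e * I l)"
   using N d by (intro mult_left_mono) auto
  also have "... = e * ((1 / 2) * (1 - d / 2) ^ N * I l)" by simp
  also have "... <= e * C" using C_lower `0 < e` by (intro mult_left_mono) auto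
  finally show ?thesis .
 qed
 show ?thesis
 proof (intro exI[of _ n] exI[of _ c] exI[of _ h] exI[of _ C] conjI ch C ballI impI)
  fix u :: "'a => complex"
  assume u: "u \<in> Cc" and uA: "\<forall>x. x \<notin> A \<longrightarrow> u x = 0" and ub: "\<forall>x. norm (u x) <= b"
   and uU: "\<forall>s t. s - t \<in> U \<longrightarrow> norm (u t - u s) <= e"
  define G where "G s = Ic (%t. u t * complex_of_real (w (s - t)))" for s
  have kws: "(%t. kw (t - s)) \<in> Cc" for s by (rule Cc_shift_diff[OF kw])
  have key: "norm (G s - u s * complex_of_real C) <= 2 * e * C" if s: "s \<in> A" for s
  proof -
   have c1: "(%t. u t * complex_of_real (kw (t - s))) \<in> Cc"
    by (intro Cc_mult(1) Cc_of_real kws Cc_continuous[OF u])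
   have c2: "(%t. u s * complex_of_real (kw (t - s))) \<in> Cc"
    by (intro Cc_mult(1) Cc_of_real kws continuous_on_const)
   have "u t * complex_of_real (w (s - t)) = u t * complex_of_real (kw (t - s))" for t
   proof (cases "t \<in> A")
    case True
    hence "(s, t) \<in> A \<times> A" using s by simp
    hence "fst (s, t) - snd (s, t) \<in> B0" unfolding B0_def by blast
    thus ?thesis unfolding kw_def using k(4)[of "s - t"] by simp
   next
    case False
    thus ?thesis using uA by simp
   qed
   hence G: "G s = Ic (%t. u t * complex_of_real (kw (t - s)))" unfolding G_def by presburger
   have "Ic (%t. u s * complex_of_real (kw (t - s))) = u s * complex_of_real C"
    unfolding C_def using I_shift[OF kw, of "- s"]
    by (simp add: Ic_scale[OF Cc_of_real[OF kws]] Ic_of_real)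
   hence "G s - u s * complex_of_real C = Ic (%t. u t * complex_of_real (kw (t - s)) - u s * complex_of_real (kw (t - s)))"
    unfolding G by (simp add: Ic_diff c1 c2)
   hence "norm (G s - u s * complex_of_real C) <= I (%t. norm (u t * complex_of_real (kw (t - s)) - u s * complex_of_real (kw (t - s))))"
    using Ic_norm_le[OF Cc_diff[OF c1 c2]] by simp
   also have "... <= I (%t. e * kw (t - s) + (2 * b * (1 - d) ^ N) * kr (t - s))"
   proof (rule I_mono[OF Cc_norm[OF Cc_diff[OF c1 c2]]])
    show "(%t. e * kw (t - s) + (2 * b * (1 - d) ^ N) * kr (t - s)) \<in> Cc"
     by (intro Cc_add Cc_mult(1) kws Cc_shift_diff[OF kr] continuous_on_const)
    fix t
    have kw0: "0 <= kw (t - s)" unfolding kw_def using k(2) w0 by simp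
    have kr0: "0 <= (2 * b * (1 - d) ^ N) * kr (t - s)"
     unfolding kr_def using k(2) `0 <= b` d by simp
    have "norm (u t * complex_of_real (kw (t - s)) - u s * complex_of_real (kw (t - s))) =
      norm (u t - u s) * kw (t - s)"
     unfolding left_diff_distrib[symmetric] norm_mult norm_of_real using kw0 by simp
    also have "... <= e * kw (t - s) + (2 * b * (1 - d) ^ N) * kr (t - s)"
    proof (cases "s - t \<in> U")
     case True
     hence "norm (u t - u s) * kw (t - s) <= e * kw (t - s)"
      using uU kw0 by (intro mult_right_mono) auto
     thus ?thesis using kr0 by linarith
    next
     case False
     have "kw (t - s) <= (1 - d) ^ N * kr (t - s)"
     proof (cases "s - t \<in> B")
      case True
      hence "k (s - t) * w (s - t) <= k (s - t) * (1 - d) ^ N"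
       using wU[OF True False] k(2) by (intro mult_left_mono) auto
      thus ?thesis unfolding kw_def kr_def by (simp add: mult.commute)
     next
      case False
      thus ?thesis unfolding kw_def kr_def using B(2)[OF False] by simp
     qed
     moreover have "norm (u t - u s) <= 2 * b"
      using norm_triangle_ineq4[of "u t" "u s"] ub[rule_format, of t] ub[rule_format, of s] by linarith
     ultimately have "norm (u t - u s) * kw (t - s) <= (2 * b) * ((1 - d) ^ N * kr (t - s))"
      using kw0 `0 <= b` by (intro mult_mono) auto
     moreover have "0 <= e * kw (t - s)" using kw0 `0 < e` by simp
     ultimately show ?thesis by (simp add: mult_ac)
    qed
    finally show "norm (u t * complex_of_real (kw (t - s)) - u s * complex_of_real (kw (t - s)))
      <= e * kw (t - s) + (2 * b * (1 - d) ^ N) * kr (t - s)" .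
   qed
   also have "... = e * C + (2 * b * (1 - d) ^ N) * I kr"
   proof -
    have c3: "(%t. e * kw (t - s)) \<in> Cc" "(%t. (2 * b * (1 - d) ^ N) * kr (t - s)) \<in> Cc"
     by (intro Cc_mult(1) kws Cc_shift_diff[OF kr] continuous_on_const)+
    show ?thesis
     using I_shift[OF kw, of "- s"] I_shift[OF kr, of "- s"]
     unfolding C_def I_add[OF c3] I_scale[OF kws] I_scale[OF Cc_shift_diff[OF kr]] by simp
   qed
   also have "... <= 2 * e * C" using small by linarith
   finally show ?thesis .
  qed
  have Gc: "continuous_on UNIV G"
   unfolding G_def
  proof -
   have "(%s. Ic (%t. u t * complex_of_real (w (s - t)))) =
     (%s. \<Sum>i<n. complex_of_real (c i) * char_app (h i) s * fourier u (h i))"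
   proof
    fix s
    have cu: "(%s. u s * cnj (char_app (h i) s)) \<in> Cc" for i
     by (intro Cc_mult(2) u continuous_on_cnj char_cont)
    have "(%t. u t * complex_of_real (w (s - t))) =
      (%t. \<Sum>i<n. (complex_of_real (c i) * char_app (h i) s) * (u t * cnj (char_app (h i) t)))"
     unfolding ch(2) by (simp add: char_diff_right sum_distrib_left mult_ac)
    thus "Ic (%t. u t * complex_of_real (w (s - t))) =
     (\<Sum>i<n. complex_of_real (c i) * char_app (h i) s * fourier u (h i))"
     by (simp only: Ic_sum[OF Cc_cmult[OF cu]] Ic_scale[OF cu])
   qed
   thus "continuous_on UNIV (%s. Ic (%t. u t * complex_of_real (w (s - t))))"
    by (simp only:) (intro continuous_on_sum continuous_on_mult continuous_on_const char_cont)
  qed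
  have c1: "(%s. cnj (u s) * G s) \<in> Cc" by (intro Cc_mult(2) Cc_cnj u Gc)
  have c2: "(%s. complex_of_real C * complex_of_real ((norm (u s))^2)) \<in> Cc"
   by (intro Cc_mult(1) Cc_of_real Cc_norm2 u continuous_on_const)
  have "Ic (%s. complex_of_real C * complex_of_real ((norm (u s))^2)) = complex_of_real (C * Q u)"
   unfolding Q_def Ic_scale[OF Cc_of_real[OF Cc_norm2[OF u]]] Ic_of_real by simp
  hence "complex_of_real ((\<Sum>i<n. c i * (norm (fourier u (h i)))^2) - C * Q u) =
    Ic (%s. cnj (u s) * G s - complex_of_real C * complex_of_real ((norm (u s))^2))"
   unfolding Ic_diff[OF c1 c2] of_real_diff trig_form[OF u ch(2)] G_def[symmetric] by simp
  from arg_cong[OF this, of norm]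
  have "\<bar>(\<Sum>i<n. c i * (norm (fourier u (h i)))^2) - C * Q u\<bar> =
    norm (Ic (%s. cnj (u s) * G s - complex_of_real C * complex_of_real ((norm (u s))^2)))"
   unfolding norm_of_real .
  also have "... <= I (%s. norm (cnj (u s) * G s - complex_of_real C * complex_of_real ((norm (u s))^2)))"
   by (rule Ic_norm_le[OF Cc_diff[OF c1 c2]])
  also have "... <= I (%s. (2 * e * C) * norm (u s))"
  proof (rule I_mono[OF Cc_norm[OF Cc_diff[OF c1 c2]]])
   show "(%s. (2 * e * C) * norm (u s)) \<in> Cc" by (intro Cc_mult(1) Cc_norm u continuous_on_const)
   fix s
   have "cnj (u s) * G s - complex_of_real C * complex_of_real ((norm (u s))^2) = cnj (u s) * (G s - u s * complex_of_real C)"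
    unfolding complex_norm_square by (simp add: algebra_simps)
   hence "norm (cnj (u s) * G s - complex_of_real C * complex_of_real ((norm (u s))^2)) =
     norm (u s) * norm (G s - u s * complex_of_real C)" by (simp add: norm_mult)
   also have "... <= norm (u s) * (2 * e * C)"
   proof (cases "s \<in> A")
    case True thus ?thesis by (intro mult_left_mono key) auto
   next
    case False thus ?thesis using uA by simp
   qed
   finally show "norm (cnj (u s) * G s - complex_of_real C * complex_of_real ((norm (u s))^2)) <= (2 * e * C) * norm (u s)"
    by (simp add: mult.commute)
  qed
  also have "... = 2 * e * C * I (%s. norm (u s))" by (rule I_scale[OF Cc_norm[OF u]])
  finally show "\<bar>(\<Sum>i<n. c i * (norm (fourier u (h i)))^2) - C * Q u\<bar> <= 2 * e * C * I (%x. norm (u x))" .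
 qed
qed

text \<open>Let f be almost invariant under K. The Fourier coefficients of y (T_x f) at h are those of y f times a
unimodular factor, so the quadratic form of the difference is a weighted sum of |h(x) - y(x)|^2. It is
close to the squared L2 norm of T_x f - f, hence small for x in K. Averaging over x shows that some h
with positive weight is close to y in the mean.\<close>
lemma separating_subgroup_dense:
 fixes \<mu> :: "'i => 'a measure"
 assumes lc: "locally_compact_space (euclidean :: 'a topology)"
  and H: "separating_subgroup (H :: 'a character set)"
  and J: "finite J" "\<And>j. j \<in> J ==> prob_space (\<mu> j)" "\<And>j. j \<in> J ==> sets (\<mu> j) = sets borel"
  and K: "compact K" "\<And>j. j \<in> J ==> measure (\<mu> j) (- K) <= r"
  and "0 < r"
 shows "\<exists>h\<in>H. (\<Sum>j\<in>J. LINT x|(\<mu> j). (norm (char_app h x - char_app y x))^2) <= 8 * r * (card J + 1)"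
proof -
 define r' where "r' = min r (1 / 2)"
 have r': "0 < r'" "r' <= r" "r' <= 1 / 2" unfolding r'_def using `0 < r` by auto
 obtain f :: "'a => real" where f: "f \<in> Cc" "\<And>x. 0 <= f x" "0 < I (%x. (f x)^2)"
  "\<And>x. x \<in> K ==> I (%s. (f (s - x) - f s)^2) <= r' * I (%x. (f x)^2)"
  using ex_Folner[OF lc K(1) r'(1)] by blast
 define q where "q = I (%x. (f x)^2)"
 obtain A0 where A0: "compact A0" "\<And>x. x \<notin> A0 ==> f x = 0" using f(1) by (metis Cc_support)
 define A where "A = A0 \<union> (%p. fst p + snd p) ` (A0 \<times> K)"
 have A: "compact A" unfolding A_def
  by (intro compact_Un compact_continuous_image compact_Times A0 K continuous_on_add continuous_on_fst
    continuous_on_snd continuous_on_id)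
 obtain b0 where b0: "0 < b0" "\<And>x. norm (f x) <= b0" using Cc_bounded[OF f(1)] by blast
 define b where "b = 2 * b0"
 have b: "0 < b" unfolding b_def using b0 by simp
 obtain k :: "'a => real" where k: "k \<in> Cc" "\<And>x. 0 <= k x" "\<And>x. x \<in> A ==> k x = 1"
  using lc_bump[OF lc A] by blast
 have Ik: "0 <= I k" by (rule I_nonneg[OF k(1,2)])
 define e where "e = r' * q / (2 * (b * I k + 1))"
 have e: "0 < e" "2 * e * (b * I k) <= r' * q"
 proof -
  have p: "0 < b * I k + 1" using b Ik by (simp add: add_nonneg_pos)
  have q: "0 < r' * q" unfolding q_def using r' f(3) by simp
  show "0 < e" unfolding e_def using p q by simp
  have "2 * e * (b * I k) = r' * q * ((b * I k) / (b * I k + 1))" 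
  proof -
   have "2 * (r' * q / (2 * P)) * x = r' * q * (x / P)" for P x :: real by simp
   thus ?thesis unfolding e_def .
  qed
  also have "... <= r' * q * 1" using p q b Ik by (intro mult_left_mono) auto
  finally show "2 * e * (b * I k) <= r' * q" by simp
 qed
 have "0 < e / 4" using e by simp
 then obtain V1 where V1: "open V1" "0 \<in> V1" "\<And>x t. t \<in> V1 ==> norm (f (x + t) - f x) < e / 4"
  using Cc_uniform[OF f(1)] by blast
 obtain V2 where V2: "open V2" "0 \<in> V2" "\<And>t. t \<in> V2 ==> norm (char_app y t - 1) < e / (4 * b)"
 proof -
  have "open ((%t. char_app y t) -` ball 1 (e / (4 * b)))" by (intro open_vimage char_cont) simp
  moreover have "0 \<in> (%t. char_app y t) -` ball 1 (e / (4 * b))" using e b by simp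
  ultimately show ?thesis by (intro that) (auto simp: dist_norm norm_minus_commute)
 qed
 obtain U where U: "open U" "0 \<in> U" "\<And>x. x \<in> U ==> - x \<in> U" "U \<subseteq> V1 \<inter> V2"
  using half_nbhd[of "V1 \<inter> V2"] V1 V2 by (metis IntI open_Int)
 from trig_form_concentrates[OF lc H A U(1,2) e(1) less_imp_le[OF b]]
 obtain n c h C where ch': "\<forall>i<(n::nat). 0 <= c i \<and> h i \<in> H" and C: "0 < C"
  and form0: "\<forall>u\<in>Cc. (\<forall>x. x \<notin> A \<longrightarrow> u x = 0) \<longrightarrow> (\<forall>x. norm (u x) <= b) \<longrightarrow>
   (\<forall>s t. s - t \<in> U \<longrightarrow> norm (u t - u s) <= e) \<longrightarrow>
   \<bar>(\<Sum>i<n. c i * (norm (fourier u (h i)))^2) - C * Q u\<bar> <= 2 * e * C * I (%x. norm (u x))"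
  by (elim exE conjE) (rule that; assumption)
 have ch: "0 <= c i \<and> h i \<in> H" if "i < n" for i using ch' that by simp
 have form: "\<bar>(\<Sum>i<n. c i * (norm (fourier u (h i)))^2) - C * Q u\<bar> <= 2 * e * C * I (%x. norm (u x))"
  if "u \<in> Cc" "\<And>x. x \<notin> A ==> u x = 0" "\<And>x. norm (u x) <= b" "\<And>s t. s - t \<in> U ==> norm (u t - u s) <= e" for u
  using form0[rule_format, OF that(1)] that(2-) by blast
 define NW where "NW u = (\<Sum>i<n. c i * (norm (fourier u (h i)))^2)" for u
 have form': "\<bar>NW u - C * Q u\<bar> <= C * (r' * q)"
  if u: "u \<in> Cc" "\<And>x. x \<notin> A ==> u x = 0" "\<And>x. norm (u x) <= b" "\<And>s t. s - t \<in> U ==> norm (u t - u s) <= e" for u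
 proof -
  have "I (%x. norm (u x)) <= I (%x. b * k x)"
  proof (rule I_mono[OF Cc_norm[OF u(1)]])
   show "(%x. b * k x) \<in> Cc" by (intro Cc_mult(1) k continuous_on_const)
   show "norm (u x) <= b * k x" for x
    using u(2,3)[of x] k(2,3)[of x] b by (cases "x \<in> A") auto
  qed
  also have "... = b * I k" by (rule I_scale[OF k(1)])
  finally have "2 * e * C * I (%x. norm (u x)) <= 2 * e * C * (b * I k)"
   using e C by (intro mult_left_mono) auto
  also have "... = C * (2 * e * (b * I k))" by simp
  also have "... <= C * (r' * q)" using e(2) C by (intro mult_left_mono) auto
  finally show ?thesis using form[OF u] unfolding NW_def by linarith
 qed
 define u0 where "u0 s = char_app y s * of_real (f s)" for s
 define u where "u x s = char_app y s * of_real (f (s - x)) - u0 s" for x s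
 have u0: "u0 \<in> Cc" unfolding u0_def by (intro Cc_mult(1) Cc_of_real f char_cont)
 have ux: "(%s. char_app y s * of_real (f (s - x))) \<in> Cc" for x
  by (intro Cc_mult(1) Cc_of_real Cc_shift_diff f char_cont)
 have u: "u x \<in> Cc" for x unfolding u_def by (intro Cc_diff u0 ux)
 have fb: "\<bar>f x\<bar> <= b0" for x using b0(2)[of x] by simp
 have osc: "norm (char_app y t * of_real (f (t - x)) - char_app y s * of_real (f (s - x))) <= e / 2"
  if st: "s - t \<in> U" for s t x
 proof -
  have ts: "t - s \<in> U" using U(3)[OF st] by simp
  have 1: "norm (f (s - x + (t - s)) - f (s - x)) < e / 4" using U(4) ts by (intro V1(3)) auto
  have 2: "norm (char_app y (t - s) - 1) < e / (4 * b)" using U(4) ts by (intro V2(3)) auto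
  have y: "char_app y t = char_app y (t - s) * char_app y s" using char_add[of y "t - s" s] by simp
  have "char_app y t * of_real (f (t - x)) - char_app y s * of_real (f (s - x)) =
    char_app y t * of_real (f (t - x) - f (s - x)) +
    (char_app y (t - s) - 1) * (char_app y s * of_real (f (s - x)))"
   unfolding y by (simp add: algebra_simps)
  also have "norm ... <= norm (char_app y t * of_real (f (t - x) - f (s - x))) +
    norm ((char_app y (t - s) - 1) * (char_app y s * of_real (f (s - x))))" by (rule norm_triangle_ineq)
  also have "... = \<bar>f (t - x) - f (s - x)\<bar> + norm (char_app y (t - s) - 1) * \<bar>f (s - x)\<bar>"
   by (simp only: norm_mult norm_of_real char_norm mult_1)
  also have "... <= e / 4 + e / (4 * b) * b"
  proof (intro add_mono mult_mono)
   show "\<bar>f (t - x) - f (s - x)\<bar> <= e / 4" using 1 by simp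
   show "\<bar>f (s - x)\<bar> <= b" using fb[of "s - x"] b0(1) unfolding b_def by linarith
  qed (use 2 e b in auto)
  also have "... = e / 2" using b by simp
  finally show ?thesis .
 qed
 have N0: "\<bar>NW u0 - C * q\<bar> <= C * (r' * q)"
 proof -
  have "Q u0 = q" unfolding Q_def u0_def q_def by (simp add: norm_mult)
  moreover have "\<bar>NW u0 - C * Q u0\<bar> <= C * (r' * q)"
  proof (rule form'[OF u0])
   show "u0 x = 0" if "x \<notin> A" for x unfolding u0_def using A0(2)[of x] that unfolding A_def by simp
   show "norm (u0 x) <= b" for x unfolding u0_def b_def using fb[of x] b0(1) by (simp add: norm_mult)
   show "norm (u0 t - u0 s) <= e" if "s - t \<in> U" for s t
    using osc[OF that, of 0] e(1) unfolding u0_def by simp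
  qed
  ultimately show ?thesis by simp
 qed
 have q0: "0 < q" unfolding q_def by (rule f(3))
 have NW0: "C * q <= 2 * NW u0"
 proof -
  have "C * (r' * q) <= C * ((1 / 2) * q)" using r' C q0 by (intro mult_left_mono mult_right_mono) auto
  thus ?thesis using N0 by (simp add: abs_le_iff)
 qed
 have NWK: "NW (u x) <= 4 * r * NW u0" if x: "x \<in> K" for x
 proof -
  have "norm (u x s) = norm (char_app y s * of_real (f (s - x) - f s))" for s
   unfolding u_def u0_def by (simp add: right_diff_distrib)
  hence Qu: "Q (u x) = I (%s. (f (s - x) - f s)^2)"
   unfolding Q_def by (simp only: norm_mult char_norm norm_of_real mult_1 power2_abs)
  have "\<bar>NW (u x) - C * Q (u x)\<bar> <= C * (r' * q)"
  proof (rule form'[OF u])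
   fix s assume s: "s \<notin> A"
   have "s - x \<notin> A0"
   proof
    assume "s - x \<in> A0"
    hence "(s - x, x) \<in> A0 \<times> K" using x by simp
    hence "fst (s - x, x) + snd (s - x, x) \<in> A" unfolding A_def by blast
    thus False using s by simp
   qed
   moreover have "s \<notin> A0" using s unfolding A_def by blast
   ultimately show "u x s = 0" unfolding u_def u0_def using A0(2) by simp
  next
   fix s
   have "u x s = char_app y s * of_real (f (s - x) - f s)"
    unfolding u_def u0_def by (simp add: right_diff_distrib)
   hence "norm (u x s) = \<bar>f (s - x) - f s\<bar>" by (simp only: norm_mult char_norm norm_of_real mult_1)
   also have "... <= b" using fb[of "s - x"] fb[of s] unfolding b_def by linarith
   finally show "norm (u x s) <= b" .
  next
   fix s t assume st: "s - t \<in> U"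
   have "u x t - u x s = (char_app y t * of_real (f (t - x)) - char_app y s * of_real (f (s - x)))
     - (char_app y t * of_real (f (t - 0)) - char_app y s * of_real (f (s - 0)))"
    unfolding u_def u0_def by simp
   hence "norm (u x t - u x s) <= e / 2 + e / 2"
    using norm_triangle_le_diff[OF add_mono[OF osc[OF st, of x] osc[OF st, of 0]]] by simp
   thus "norm (u x t - u x s) <= e" by simp
  qed
  hence "NW (u x) <= C * Q (u x) + C * (r' * q)" by (simp add: abs_le_iff)
  also have "... <= C * (r' * q) + C * (r' * q)"
   using f(4)[OF x] C unfolding Qu q_def by (intro add_right_mono mult_left_mono) auto
  also have "... = 2 * r' * (C * q)" by simp
  also have "... <= 2 * r * (2 * NW u0)"
   by (rule mult_mono) (use r' NW0 C q0 `0 < r` in simp_all)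
  finally show ?thesis by simp
 qed
 define a where "a i = c i * (norm (fourier u0 (h i)))^2" for i
 have a0: "0 <= a i" if "i < n" for i unfolding a_def using ch[OF that] by simp
 have NWu0: "NW u0 = (\<Sum>i<n. a i)" unfolding NW_def a_def ..
 have NWu: "NW (u x) = (\<Sum>i<n. a i * (norm (char_app (h i) x - char_app y x))^2)" for x
  unfolding NW_def a_def
 proof (rule sum.cong[OF refl])
  fix i
  have c0: "(%s. u0 s * cnj (char_app (h i) s)) \<in> Cc" by (intro Cc_mult(2) u0 continuous_on_cnj char_cont)
  have c1: "(%s. u0 (s - x) * cnj (char_app (h i) (s - x))) \<in> Cc" by (rule Cc_shift_diff[OF c0])
  define z where "z = char_app y x * cnj (char_app (h i) x)"
  have "u x s * cnj (char_app (h i) s) =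
    z * (u0 (s - x) * cnj (char_app (h i) (s - x))) - u0 s * cnj (char_app (h i) s)" for s
  proof -
   have "char_app y s = char_app y x * char_app y (s - x)" "char_app (h i) s = char_app (h i) x * char_app (h i) (s - x)"
    using char_add[of y x "s - x"] char_add[of "h i" x "s - x"] by simp_all
   hence "char_app y s * of_real (f (s - x)) * cnj (char_app (h i) s) = z * (u0 (s - x) * cnj (char_app (h i) (s - x)))"
    unfolding z_def u0_def by (simp add: mult_ac)
   thus ?thesis unfolding u_def by (simp add: left_diff_distrib)
  qed
  hence "fourier (u x) (h i) =
    Ic (%s. z * (u0 (s - x) * cnj (char_app (h i) (s - x))) - u0 s * cnj (char_app (h i) s))" by presburger
  also have "... = (z - 1) * fourier u0 (h i)"
   unfolding Ic_diff[OF Cc_cmult[OF c1] c0] Ic_scale[OF c1] Ic_shift_diff[OF c0, of x] by (simp add: left_diff_distrib)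
  finally have "norm (fourier (u x) (h i)) = norm (z - 1) * norm (fourier u0 (h i))"
   by (simp add: norm_mult)
  moreover have "norm (z - 1) = norm (char_app (h i) x - char_app y x)"
  proof -
   have "z - 1 = cnj (char_app (h i) x) * (char_app y x - char_app (h i) x)"
    unfolding z_def by (simp add: right_diff_distrib mult.commute)
   thus ?thesis by (simp add: norm_mult norm_minus_commute)
  qed
  ultimately show "c i * (norm (fourier (u x) (h i)))^2 =
   c i * (norm (fourier u0 (h i)))^2 * (norm (char_app (h i) x - char_app y x))^2"
   by (simp add: power_mult_distrib mult_ac)
 qed
 have diff4: "(norm (char_app g x - char_app y x))^2 <= 4" for g x
 proof -
  have "norm (char_app g x - char_app y x) <= 2" using norm_triangle_ineq4[of "char_app g x" "char_app y x"] by simp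
  thus ?thesis using power_mono[of "norm (char_app g x - char_app y x)" 2 2] by simp
 qed
 have NW4: "NW (u x) <= 4 * NW u0" for x
 proof -
  have "NW (u x) <= (\<Sum>i<n. a i * 4)" unfolding NWu using a0 diff4 by (intro sum_mono mult_left_mono) auto
  thus ?thesis unfolding NWu0 by (simp add: sum_distrib_right[symmetric])
 qed
 define E where "E g = (\<Sum>j\<in>J. LINT x|(\<mu> j). (norm (char_app g x - char_app y x))^2)" for g
 have meas: "(%x. (norm (char_app g x - char_app y x))^2) \<in> borel_measurable borel" for g
  by (intro borel_measurable_continuous_onI continuous_on_power continuous_on_norm continuous_on_diff char_cont)
 have bound: "(\<Sum>i<n. a i * E (h i)) <= 8 * r * card J * NW u0"
 proof -
  have 1: "(\<Sum>i<n. a i * (LINT x|(\<mu> j). (norm (char_app (h i) x - char_app y x))^2)) <= 8 * r * NW u0" if j: "j \<in> J" for j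
  proof -
   interpret prob_space "\<mu> j" by (rule J(2)[OF j])
   have sj: "sets (\<mu> j) = sets borel" by (rule J(3)[OF j])
   have Km: "- K \<in> sets (\<mu> j)" unfolding sj using compact_imp_closed[OF K(1)] by (intro borel_open) auto
   have int: "integrable (\<mu> j) (%x. (norm (char_app g x - char_app y x))^2)" for g
    by (rule integrable_const_bound[where B = 4])
     (use diff4 meas sj in \<open>auto simp: measurable_cong_sets[OF sj refl]\<close>)
   have "(\<Sum>i<n. a i * (LINT x|(\<mu> j). (norm (char_app (h i) x - char_app y x))^2)) = (LINT x|(\<mu> j). NW (u x))"
    unfolding NWu by (simp add: int)
   also have "... <= (LINT x|(\<mu> j). 4 * r * NW u0 + 4 * NW u0 * indicator (- K) x)"
   proof (rule integral_mono)
    show "integrable (\<mu> j) (%x. NW (u x))" unfolding NWu by (intro Bochner_Integration.integrable_sum integrable_mult_right int)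
    show "integrable (\<mu> j) (%x. 4 * r * NW u0 + 4 * NW u0 * indicator (- K) x)"
     by (intro Bochner_Integration.integrable_add integrable_mult_right integrable_const)
      (use Km in \<open>simp add: integrable_indicator_iff emeasure_eq_measure\<close>)
    fix x
    have "0 <= NW u0" using NW0 mult_pos_pos[OF C q0] by linarith
    thus "NW (u x) <= 4 * r * NW u0 + 4 * NW u0 * indicator (- K) x"
     using NWK[of x] NW4[of x] `0 < r` by (cases "x \<in> K") (auto intro: order_trans)
   qed
   also have "... = 4 * r * NW u0 + 4 * NW u0 * measure (\<mu> j) (- K)"
    using Km by (simp add: prob_space integrable_indicator_iff emeasure_eq_measure)
   also have "... <= 4 * r * NW u0 + 4 * NW u0 * r"
    using K(2)[OF j] NW0 mult_pos_pos[OF C q0] by (intro add_left_mono mult_left_mono) linarith+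
   finally show ?thesis by simp
  qed
  have "(\<Sum>i<n. a i * E (h i)) = (\<Sum>j\<in>J. \<Sum>i<n. a i * (LINT x|(\<mu> j). (norm (char_app (h i) x - char_app y x))^2))"
   unfolding E_def sum_distrib_left by (rule sum.swap)
  also have "... <= (\<Sum>j\<in>J. 8 * r * NW u0)" by (intro sum_mono 1)
  finally show ?thesis by (simp add: mult_ac)
 qed
 have "\<exists>i<n. E (h i) <= 8 * r * (card J + 1)"
 proof (rule ccontr)
  assume "\<not> (\<exists>i<n. E (h i) <= 8 * r * (card J + 1))"
  hence "(\<Sum>i<n. a i * (8 * r * (card J + 1))) <= (\<Sum>i<n. a i * E (h i))"
   using a0 by (intro sum_mono mult_left_mono) (auto simp: not_le less_imp_le)
  hence "NW u0 * (8 * r * (card J + 1)) <= 8 * r * card J * NW u0"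
   using bound unfolding NWu0 by (simp add: sum_distrib_right)
  hence "8 * r * NW u0 <= 0" by (simp add: algebra_simps)
  moreover have "0 < NW u0" using NW0 mult_pos_pos[OF C q0] by linarith
  ultimately show False using `0 < r` by (simp add: mult_le_0_iff)
 qed
 thus ?thesis using ch unfolding E_def by blast
qed

end

theorem separating_subgroup_dense_L2:
 fixes \<mu> :: "'i => 'a::{topological_ab_group_add,t2_space,second_countable_topology} measure"
 assumes lc: "locally_compact_space (euclidean :: 'a topology)"
  and H: "separating_subgroup (H :: 'a character set)"
  and J: "finite J" "\<And>j. j \<in> J ==> \<mu> j \<in> distributions" and "0 < e"
 shows "\<exists>h\<in>H. (\<Sum>j\<in>J. LINT x|(\<mu> j). (norm (char_app h x - char_app y x))^2) <= e"
proof -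
 define r where "r = e / (8 * (real (card J) + 1))"
 have r: "0 < r" "8 * r * (card J + 1) = e" 
 proof -
  have p: "0 < real (card J) + 1" by (simp add: add_nonneg_pos)
  show "0 < r" unfolding r_def using `0 < e` p by simp
  show "8 * r * (card J + 1) = e" unfolding r_def using p by (simp add: field_simps)
 qed
 have "\<exists>K. compact K \<and> (\<forall>j\<in>J. measure (\<mu> j) (- K) <= r)"
  by (rule finite_family_tight[OF lc J(1) _ r(1)]) (rule J(2))
 then obtain K where K: "compact K" "\<forall>j\<in>J. measure (\<mu> j) (- K) <= r" by blast
 obtain I where "haar_integral (I :: ('a => real) => real)" using ex_haar_integral[OF lc] by blast
 then interpret haar_integral I .
 have "\<exists>h\<in>H. (\<Sum>j\<in>J. LINT x|(\<mu> j). (norm (char_app h x - char_app y x))^2) <= 8 * r * (card J + 1)"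
  by (rule separating_subgroup_dense[OF lc H J(1) _ _ K(1) _ r(1)])
   (use J(2) K(2) in \<open>simp_all add: distributions_def\<close>)
 thus ?thesis unfolding r(2) .
qed


section \<open>Real line: moments of a law with entire characteristic function\<close>


abbreviation exp_moment :: "real measure => real => ennreal" where
 "exp_moment M y \<equiv> \<integral>\<^sup>+x. ennreal (exp (y * x)) \<partial>M"
text \<open>Cauchy estimate, one factor at a time: a step h costs at most |h|/e times the bound on a disc larger by e.\<close>
lemma iterated_difference_bound:
 fixes f :: "complex => complex"
 assumes "f holomorphic_on UNIV" "0 < e" "\<And>z. norm z <= r + real n * (e + norm h) ==> norm (f z) <= M"
  "norm z <= r"
 shows "norm ((difference h ^^ n) f z) <= M * (norm h / e) ^ n"
 using assms
proof (induction n arbitrary: f M)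
 case 0
 thus ?case by simp
next
 case (Suc n)
 have hol: "difference h f holomorphic_on UNIV"
  unfolding difference_def using Suc.prems(1)
  by (intro holomorphic_intros holomorphic_on_compose_gen[of "%z. z + h" UNIV f UNIV, unfolded o_def]) auto
 have bd: "norm (difference h f z) <= (M * (norm h / e))" if z: "norm z <= r + real n * (e + norm h)" for z
 proof -
  have der: "norm (deriv f w) <= M / e" if w: "w \<in> cball z (norm h)" for w
  proof -
   have "norm ((deriv ^^ 1) f w) <= fact 1 * M / e ^ 1"
   proof (rule Cauchy_inequality)
    show "f holomorphic_on ball w e" using Suc.prems(1) by (rule holomorphic_on_subset) simp
    show "continuous_on (cball w e) f"
     by (intro holomorphic_on_imp_continuous_on holomorphic_on_subset[OF Suc.prems(1)]) simp
    fix x assume x: "norm (w - x) = e"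
    have "norm x <= norm z + norm (w - z) + norm (x - w)"
     using norm_triangle_ineq[of "z + (w - z)" "x - w"] norm_triangle_ineq[of z "w - z"] by simp
    also have "... <= (r + real n * (e + norm h)) + norm h + e"
     using z w x by (simp add: dist_norm norm_minus_commute)
    finally show "norm (f x) <= M" by (intro Suc.prems(3)) (simp add: algebra_simps)
   qed (rule Suc.prems(2))
   thus ?thesis by simp
  qed
  have "norm (f (z + h) - f z) <= (M / e) * norm ((z + h) - z)"
  proof (rule field_differentiable_bound[of "cball z (norm h)"])
   show "(f has_field_derivative deriv f w) (at w within cball z (norm h))" for w
    using holomorphic_derivI[OF Suc.prems(1) open_UNIV] by simp
  qed (auto intro: der simp: dist_norm)
  thus ?thesis unfolding difference_def by (simp add: mult_ac)
 qed
 have "norm ((difference h ^^ n) (difference h f) z) <= (M * (norm h / e)) * (norm h / e) ^ n"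
  by (rule Suc.IH[OF hol Suc.prems(2) bd Suc.prems(4)])
 thus ?case by (simp add: funpow_swap1 mult_ac)
qed

context real_distribution
begin

lemma difference_char:
 assumes F: "\<And>t. char M t = F (of_real t)"
 shows "(difference (of_real h) ^^ n) F (of_real t) =
  (CLINT x|M. exp (\<i> * of_real (t * x)) * (exp (\<i> * of_real (h * x)) - 1) ^ n)"
proof (induction n arbitrary: t)
 case 0
 show ?case unfolding char_def[symmetric] using F[of t] by (simp add: char_def)
next
 case (Suc n)
 have int: "complex_integrable M (%x. exp (\<i> * of_real (t * x)) * (exp (\<i> * of_real (h * x)) - 1) ^ n)" for t
 proof (rule integrable_const_bound[where B = "2 ^ n"])
  show "AE x in M. norm (exp (\<i> * of_real (t * x)) * (exp (\<i> * of_real (h * x)) - 1) ^ n) <= 2 ^ n"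
  proof (rule AE_I2)
   fix x
   have "norm (exp (\<i> * of_real (h * x)) - 1) <= 2"
    using norm_triangle_ineq4[of "exp (\<i> * of_real (h * x))" 1] by simp
   hence "norm (exp (\<i> * of_real (h * x)) - 1) ^ n <= 2 ^ n" by (rule power_mono) simp
   thus "norm (exp (\<i> * of_real (t * x)) * (exp (\<i> * of_real (h * x)) - 1) ^ n) <= 2 ^ n"
    unfolding norm_mult norm_exp_i_times mult_1 norm_power .
  qed
 qed measurable
 have "(difference (of_real h) ^^ Suc n) F (of_real t) =
   (difference (of_real h) ^^ n) F (of_real (t + h)) - (difference (of_real h) ^^ n) F (of_real t)"
  by (simp add: difference_def)
 also have "... = (CLINT x|M. exp (\<i> * of_real ((t + h) * x)) * (exp (\<i> * of_real (h * x)) - 1) ^ n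
   - exp (\<i> * of_real (t * x)) * (exp (\<i> * of_real (h * x)) - 1) ^ n)"
  unfolding Suc.IH by (rule Bochner_Integration.integral_diff[OF int int, symmetric])
 also have "... = (CLINT x|M. exp (\<i> * of_real (t * x)) * (exp (\<i> * of_real (h * x)) - 1) ^ Suc n)"
 proof (rule Bochner_Integration.integral_cong[OF refl])
  fix x
  have "exp (\<i> * of_real ((t + h) * x)) = exp (\<i> * of_real (t * x)) * exp (\<i> * of_real (h * x))"
   by (simp add: exp_add[symmetric] distrib_left distrib_right)
  thus "exp (\<i> * of_real ((t + h) * x)) * (exp (\<i> * of_real (h * x)) - 1) ^ n
    - exp (\<i> * of_real (t * x)) * (exp (\<i> * of_real (h * x)) - 1) ^ n =
    exp (\<i> * of_real (t * x)) * (exp (\<i> * of_real (h * x)) - 1) ^ Suc n"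
   by (simp add: algebra_simps)
 qed
 finally show ?case .
qed

text \<open>Symmetric differences of a characteristic function are integrals of powers of 2 sin(h x / 2): this
makes them nonnegative without any assumption on moments.\<close>
lemma symmetric_difference_char:
 assumes F: "\<And>t. char M t = F (complex_of_real t)"
 shows "norm ((difference (complex_of_real h) ^^ (2 * k)) F (complex_of_real (- (real k * h)))) =
  (LINT x|M. (2 * sin (h * x / 2)) ^ (2 * k))"
proof -
 have pw: "exp (\<i> * complex_of_real (- (real k * h) * x)) * (exp (\<i> * complex_of_real (h * x)) - 1) ^ (2 * k) =
   complex_of_real ((- 1) ^ k * (2 * sin (h * x / 2)) ^ (2 * k))" for x
 proof -
  define u where "u = exp (\<i> * complex_of_real (h * x / 2))"
  have u0: "u \<noteq> 0" unfolding u_def by simp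
  have e1: "exp (\<i> * complex_of_real (h * x)) = u * u" unfolding u_def by (simp add: exp_add[symmetric])
  have e2: "exp (\<i> * complex_of_real (- (real k * h) * x)) = inverse u ^ (2 * k)"
   unfolding u_def exp_minus[symmetric] exp_of_nat_mult[symmetric] by (simp add: field_simps)
  have s: "u - inverse u = 2 * \<i> * complex_of_real (sin (h * x / 2))"
  proof -
   have "u = cis (h * x / 2)" unfolding u_def by (simp add: cis_conv_exp)
   thus ?thesis by (simp add: complex_eq_iff)
  qed
  have "inverse u * (u * u - 1) = u - inverse u" using u0 by (simp add: right_diff_distrib)
  hence "inverse u ^ (2 * k) * (u * u - 1) ^ (2 * k) = (2 * \<i> * complex_of_real (sin (h * x / 2))) ^ (2 * k)"
   unfolding power_mult_distrib[symmetric] s[symmetric] by simp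
  also have "... = ((2 * \<i> * complex_of_real (sin (h * x / 2)))^2) ^ k" by (rule power_mult)
  also have "(2 * \<i> * complex_of_real (sin (h * x / 2)))^2 = (- 1) * complex_of_real ((2 * sin (h * x / 2))^2)"
   by (simp add: power_mult_distrib)
  also have "... ^ k = (- 1) ^ k * complex_of_real ((2 * sin (h * x / 2)) ^ (2 * k))"
   unfolding power_mult_distrib[of "- 1"] power_mult of_real_power ..
  finally show ?thesis unfolding e1 e2 by simp
 qed
 have "(difference (complex_of_real h) ^^ (2 * k)) F (complex_of_real (- (real k * h))) =
   (CLINT x|M. complex_of_real ((- 1) ^ k * (2 * sin (h * x / 2)) ^ (2 * k)))"
  unfolding difference_char[OF F] pw ..
 also have "... = complex_of_real ((- 1) ^ k * (LINT x|M. (2 * sin (h * x / 2)) ^ (2 * k)))"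
  unfolding integral_complex_of_real by simp
 finally have "norm ((difference (complex_of_real h) ^^ (2 * k)) F (complex_of_real (- (real k * h)))) =
   \<bar>(- 1) ^ k * (LINT x|M. (2 * sin (h * x / 2)) ^ (2 * k))\<bar>" by (simp only: norm_of_real)
 also have "... = \<bar>LINT x|M. (2 * sin (h * x / 2)) ^ (2 * k)\<bar>" by (simp add: abs_mult)
 also have "... = (LINT x|M. (2 * sin (h * x / 2)) ^ (2 * k))"
  by (intro abs_of_nonneg integral_nonneg) (simp add: power_mult)
 finally show ?thesis .
qed

text \<open>Fatou applied to symmetric differences with step tending to 0.\<close>
lemma moment_bound:
 assumes F: "\<And>t. char M t = F (complex_of_real t)" and hol: "F holomorphic_on UNIV"
  and R: "0 < R" "\<And>z. norm z <= R ==> norm (F z) <= B" and k: "0 < k"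
 shows "(\<integral>\<^sup>+x. ennreal (x ^ (2 * k)) \<partial>M) <= ennreal (B * (2 * real (2 * k) / R) ^ (2 * k))"
proof -
 define e where "e = R / (4 * real k)"
 have e: "0 < e" unfolding e_def using R(1) k by simp
 \<comment> \<open>The discs swept by 2k steps of radius e and length h stay inside the disc of radius R.\<close>
 define h where "h m = R / (6 * real k * (real m + 1))" for m :: nat
 have h: "0 < h m" "3 * real k * h m <= R / 2" for m
 proof -
  show "0 < h m" unfolding h_def using R(1) k by simp
  have "3 * real k * h m = (R / 2) / (real m + 1)" 
  proof -
   have "3 * K * (R / (6 * K * P)) = (R / 2) / P" if "K \<noteq> 0" for K P :: real using that by simp
   from this[of "real k" "real m + 1"] show ?thesis unfolding h_def using k by linarith
  qed
  also have "... <= R / 2" using R(1) by (simp add: field_simps)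
  finally show "3 * real k * h m <= R / 2" .
 qed
 have h0: "h \<longlonglongrightarrow> 0"
 proof -
  have "(%m. (R / (6 * real k)) * inverse (real (Suc m))) \<longlonglongrightarrow> (R / (6 * real k)) * 0"
   by (intro tendsto_mult_left LIMSEQ_inverse_real_of_nat)
  moreover have "(%m. (R / (6 * real k)) * inverse (real (Suc m))) = h"
   unfolding h_def by (simp add: field_simps)
  ultimately show ?thesis by simp
 qed
 have B0: "0 <= B" using order_trans[OF norm_ge_zero R(2)[of 0]] R(1) by simp
 have each: "(\<integral>\<^sup>+x. ennreal ((2 * sin (h m * x / 2) / h m) ^ (2 * k)) \<partial>M) <= ennreal (B * (1 / e) ^ (2 * k))" for m
 proof -
  have "norm ((difference (complex_of_real (h m)) ^^ (2 * k)) F (complex_of_real (- (real k * h m)))) <= B * (norm (complex_of_real (h m)) / e) ^ (2 * k)"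
  proof (rule iterated_difference_bound[OF hol e])
   show "norm (complex_of_real (- (real k * h m))) <= real k * h m"
    using h(1)[of m] by (simp add: norm_mult)
   fix z :: complex
   assume z: "norm z <= real k * h m + real (2 * k) * (e + norm (complex_of_real (h m)))"
   also have "... = 3 * real k * h m + R / 2"
    using h(1)[of m] k unfolding e_def by (simp add: field_simps)
   also have "... <= R" using h(2)[of m] by simp
   finally show "norm (F z) <= B" by (rule R(2))
  qed
  hence le: "(LINT x|M. (2 * sin (h m * x / 2)) ^ (2 * k)) <= B * (h m / e) ^ (2 * k)"
   unfolding symmetric_difference_char[OF F] using h(1)[of m] by simp
  have int: "integrable M (%x. (2 * sin (h m * x / 2)) ^ (2 * k))"
  proof (rule integrable_const_bound[where B = "2 ^ (2 * k)"])
   show "AE x in M. norm ((2 * sin (h m * x / 2)) ^ (2 * k)) <= 2 ^ (2 * k)"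
   proof (rule AE_I2)
    fix x
    have "\<bar>2 * sin (h m * x / 2)\<bar> <= 2" by (simp add: abs_mult)
    thus "norm ((2 * sin (h m * x / 2)) ^ (2 * k)) <= 2 ^ (2 * k)"
     unfolding real_norm_def power_abs by (rule power_mono) simp
   qed
  qed measurable
  have "(\<integral>\<^sup>+x. ennreal ((2 * sin (h m * x / 2) / h m) ^ (2 * k)) \<partial>M) =
    (\<integral>\<^sup>+x. ennreal ((1 / h m) ^ (2 * k) * (2 * sin (h m * x / 2)) ^ (2 * k)) \<partial>M)"
   by (simp add: power_divide)
  also have "... = ennreal (LINT x|M. (1 / h m) ^ (2 * k) * (2 * sin (h m * x / 2)) ^ (2 * k))"
   by (intro nn_integral_eq_integral integrable_mult_right int AE_I2) (simp add: power_mult)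
  also have "... <= ennreal (B * (1 / e) ^ (2 * k))"
  proof (rule ennreal_leI)
   have "(LINT x|M. (1 / h m) ^ (2 * k) * (2 * sin (h m * x / 2)) ^ (2 * k)) <= (1 / h m) ^ (2 * k) * (B * (h m / e) ^ (2 * k))"
    using le by (simp add: mult_left_mono)
   also have "... = B * ((1 / h m) * (h m / e)) ^ (2 * k)" unfolding power_mult_distrib by simp
   also have "(1 / h m) * (h m / e) = 1 / e" using h(1)[of m] by simp
   finally show "(LINT x|M. (1 / h m) ^ (2 * k) * (2 * sin (h m * x / 2)) ^ (2 * k)) <= B * (1 / e) ^ (2 * k)" .
  qed
  finally show ?thesis .
 qed
 have lim: "(%m. ennreal ((2 * sin (h m * x / 2) / h m) ^ (2 * k))) \<longlonglongrightarrow> ennreal (x ^ (2 * k))" for x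
 proof (intro tendsto_ennrealI tendsto_power)
  show "(%m. 2 * sin (h m * x / 2) / h m) \<longlonglongrightarrow> x"
  proof (cases "x = 0")
   case True thus ?thesis by simp
  next
   case False
   have "((%t::real. sin t / t) \<longlongrightarrow> 1) (at 0)"
    using DERIV_sin[of 0] unfolding DERIV_def by simp
   moreover have "filterlim (%m. h m * x / 2) (at 0) sequentially"
    unfolding filterlim_at using False h(1)
    by (auto intro!: tendsto_eq_intros h0 simp: less_imp_neq[THEN not_sym])
   ultimately have "(%m. sin (h m * x / 2) / (h m * x / 2)) \<longlonglongrightarrow> 1" by (rule filterlim_compose)
   hence "(%m. x * (sin (h m * x / 2) / (h m * x / 2))) \<longlonglongrightarrow> x * 1" by (rule tendsto_mult_left)
   moreover have "x * (sin (h m * x / 2) / (h m * x / 2)) = 2 * sin (h m * x / 2) / h m" for m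
    using False h(1)[of m] by (simp add: field_simps)
   ultimately show ?thesis by simp
  qed
 qed
 have "(\<integral>\<^sup>+x. ennreal (x ^ (2 * k)) \<partial>M) = (\<integral>\<^sup>+x. liminf (%m. ennreal ((2 * sin (h m * x / 2) / h m) ^ (2 * k))) \<partial>M)"
  by (intro nn_integral_cong) (simp only: lim_imp_Liminf[OF _ lim, OF trivial_limit_sequentially])
 also have "... <= liminf (%m. \<integral>\<^sup>+x. ennreal ((2 * sin (h m * x / 2) / h m) ^ (2 * k)) \<partial>M)"
  by (rule nn_integral_liminf) measurable
 also have "... <= liminf (%m::nat. ennreal (B * (1 / e) ^ (2 * k)))"
  by (intro Liminf_mono always_eventually allI each)
 also have "... = ennreal (B * (1 / e) ^ (2 * k))" by (rule Liminf_const) simp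
 also have "1 / e = 2 * real (2 * k) / R" unfolding e_def using k R(1) by simp
 finally show ?thesis .
qed

text \<open>The even moments are at most B (4k/R)^(2k), which is summable against 1/(2k)! for R = 12 (|y| + 1).\<close>
lemma cosh_moment_bound:
 assumes F: "\<And>t. char M t = F (of_real t)" and hol: "F holomorphic_on UNIV"
  and B: "\<And>z. norm z <= 12 * (\<bar>y\<bar> + 1) ==> norm (F z) <= B"
 shows "(\<integral>\<^sup>+x. ennreal (cosh (y * x)) \<partial>M) <= ennreal (2 * B)"
proof -
 define R where "R = 12 * (\<bar>y\<bar> + 1)"
 have R: "0 < R" unfolding R_def by simp
 have B1: "1 <= B" using B[of 0] F[of 0] char_zero by (simp del: char_zero)
 define c where "c n x = (if even n then (y * x) ^ n / fact n else 0)" for n x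
 have c0: "0 <= c n x" for n x unfolding c_def by (auto simp: zero_le_even_power)
 have cs: "(%n. c n x) sums cosh (y * x)" for x
 proof -
  have eq: "(y * x) ^ n / fact n = (y * x) ^ n /\<^sub>R fact n" for n
   by (simp add: divide_inverse mult.commute)
  show ?thesis unfolding c_def eq by (rule cosh_converges)
 qed
 have cosh: "ennreal (cosh (y * x)) = (\<Sum>n. ennreal (c n x))" for x
  unfolding sums_unique[OF cs[of x]] by (rule suminf_ennreal2[OF c0 sums_summable[OF cs[of x]], symmetric])
 have each_term: "(\<integral>\<^sup>+x. ennreal (c n x) \<partial>M) <= ennreal (B * (1 / 2) ^ n)" for n
 proof (cases "even n")
  case False
  thus ?thesis unfolding c_def by simp
 next
  case True
  then obtain k where n: "n = 2 * k" by (elim evenE)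
  show ?thesis
  proof (cases "k = 0")
   case True
   have "(\<integral>\<^sup>+x. ennreal (c n x) \<partial>M) = 1" unfolding c_def n True using emeasure_space_1 by simp
   thus ?thesis unfolding n True using B1 by simp
  next
   case False
   define a where "a = y ^ n / fact n"
   have a0: "0 <= a" unfolding a_def n by (simp add: power_mult)
   have "(\<integral>\<^sup>+x. ennreal (c n x) \<partial>M) = (\<integral>\<^sup>+x. ennreal a * ennreal (x ^ n) \<partial>M)"
    using True a0 unfolding c_def a_def by (intro nn_integral_cong) (simp add: ennreal_mult[symmetric] zero_le_even_power power_mult_distrib)
   also have "... = ennreal a * (\<integral>\<^sup>+x. ennreal (x ^ n) \<partial>M)" by (rule nn_integral_cmult) measurable
   also have "... <= ennreal a * ennreal (B * (2 * real n / R) ^ n)"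
    using moment_bound[OF F hol R, of B k] B False unfolding n R_def by (intro mult_left_mono) auto
   also have "... = ennreal (a * (B * (2 * real n / R) ^ n))"
    using a0 B1 R by (simp add: ennreal_mult)
   also have "... <= ennreal (B * (1 / 2) ^ n)"
   proof (rule ennreal_leI)
    have fe: "real n ^ n / fact n <= 3 ^ n"
    proof -
     have "real n ^ n / fact n <= exp (real n)"
     proof -
      have "(\<Sum>i\<in>{n}. real n ^ i /\<^sub>R fact i) <= (\<Sum>i. real n ^ i /\<^sub>R fact i)"
       by (rule sum_le_suminf[OF summable_exp_generic]) auto
      thus ?thesis unfolding exp_def by (simp add: divide_inverse mult.commute)
     qed
     also have "... = exp 1 ^ n" by (simp add: exp_of_nat_mult[symmetric])
     also have "... <= 3 ^ n" by (intro power_mono exp_le) simp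
     finally show ?thesis .
    qed
    have "a * (B * (2 * real n / R) ^ n) = B * ((2 * y / R) ^ n * (real n ^ n / fact n))"
     unfolding a_def by (simp add: power_mult_distrib power_divide mult_ac)
    also have "... <= B * ((2 * y / R) ^ n * 3 ^ n)"
     using fe B1 True by (intro mult_left_mono) (auto simp: zero_le_even_power)
    also have "... = B * (6 * y / R) ^ n" by (simp add: power_mult_distrib[symmetric])
    also have "... = B * \<bar>6 * y / R\<bar> ^ n" by (simp only: power_even_abs[OF True])
    also have "... <= B * (1 / 2) ^ n"
    proof (intro mult_left_mono power_mono)
     show "\<bar>6 * y / R\<bar> <= 1 / 2" unfolding R_def by (simp add: abs_mult field_simps)
    qed (use B1 in auto)
    finally show "a * (B * (2 * real n / R) ^ n) <= B * (1 / 2) ^ n" .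
   qed
   finally show ?thesis .
  qed
 qed
 have "(\<integral>\<^sup>+x. ennreal (cosh (y * x)) \<partial>M) = (\<Sum>n. \<integral>\<^sup>+x. ennreal (c n x) \<partial>M)"
  unfolding cosh c_def by (rule nn_integral_suminf) measurable
 also have "... <= (\<Sum>n. ennreal (B * (1 / 2) ^ n))" by (intro suminf_le each_term) auto
 also have "... = ennreal (2 * B)"
 proof -
  have "(%n. B * (1 / 2) ^ n) sums (B * (1 / (1 - 1 / 2)))" by (intro sums_mult geometric_sums) simp
  thus ?thesis using B1 by (subst suminf_ennreal2) (auto simp: sums_iff mult.commute)
 qed
 finally show ?thesis .
qed

end


section \<open>Real line: entire functions of finite order and the ridge property\<close>

lemma poly_growth:
 fixes p :: "complex poly"
 shows "\<exists>C\<ge>0. \<forall>z. norm (poly p z) <= C * (1 + norm z) ^ degree p"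
proof (intro exI conjI allI)
 show "0 <= (\<Sum>i\<le>degree p. norm (coeff p i))" by (intro sum_nonneg) simp
 fix z
 have "norm (poly p z) <= (\<Sum>i\<le>degree p. norm (coeff p i * z ^ i))"
  unfolding poly_altdef by (rule norm_sum)
 also have "... <= (\<Sum>i\<le>degree p. norm (coeff p i) * (1 + norm z) ^ degree p)"
 proof (rule sum_mono)
  fix i assume i: "i \<in> {..degree p}"
  have "norm z ^ i <= (1 + norm z) ^ i" by (rule power_mono) auto
  also have "... <= (1 + norm z) ^ degree p" using i by (intro power_increasing) auto
  finally show "norm (coeff p i * z ^ i) <= norm (coeff p i) * (1 + norm z) ^ degree p"
   by (simp add: norm_mult norm_power mult_left_mono)
 qed
 finally show "norm (poly p z) <= (\<Sum>i\<le>degree p. norm (coeff p i)) * (1 + norm z) ^ degree p"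
  by (simp add: sum_distrib_right)
qed

text \<open>Schwarz lemma for g / (4A - g): the map w / (4A - w) sends the half-plane Re w \<le> A into the unit disc.\<close>
lemma borel_caratheodory:
 assumes g: "g holomorphic_on UNIV" and g0: "g 0 = 0" and A: "0 < A" "0 < r"
  and re: "\<And>z. norm z <= 2 * r ==> Re (g z) <= A" and z: "norm z <= r"
 shows "norm (g z) <= 4 * A"
proof -
 define B where "B = 4 * A"
 have ne: "B - g w \<noteq> 0" if "norm w <= 2 * r" for w
 proof
  assume "B - g w = 0"
  hence "Re (complex_of_real B - g w) = 0" by simp
  thus False using re[OF that] A unfolding B_def by simp
 qed
 define f where "f w = g (2 * complex_of_real r * w) / (B - g (2 * complex_of_real r * w))" for w
 have in2r: "norm (2 * complex_of_real r * w) <= 2 * r" if "norm w < 1" for w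
 proof -
  have "norm (2 * complex_of_real r * w) = 2 * r * norm w" using A by (simp add: norm_mult)
  also have "... <= 2 * r * 1" using that A by (intro mult_left_mono) auto
  finally show ?thesis by simp
 qed
 have hol: "f holomorphic_on ball 0 1"
  unfolding f_def
 proof (intro holomorphic_intros)
  show "(%w. g (2 * complex_of_real r * w)) holomorphic_on ball 0 1"
   using holomorphic_on_compose_gen[of "%w. 2 * complex_of_real r * w" "ball 0 1" g UNIV] g
   by (auto simp: o_def intro!: holomorphic_intros)
  thus "(%w. g (2 * complex_of_real r * w)) holomorphic_on ball 0 1" .
  show "complex_of_real B - g (2 * complex_of_real r * w) \<noteq> 0" if "w \<in> ball 0 1" for w
   using that in2r[of w] by (intro ne) simp
 qed
 have f0: "f 0 = 0" unfolding f_def using g0 by simp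
 have lt: "norm (f w) < 1" if w: "norm w < 1" for w
 proof -
  define u where "u = g (2 * complex_of_real r * w)"
  have "Re u <= A" unfolding u_def by (rule re[OF in2r[OF w]])
  hence "(Re u)^2 < (B - Re u)^2" using A unfolding B_def by (simp add: power2_eq_square algebra_simps)
  hence "(norm u)^2 < (norm (complex_of_real B - u))^2" by (simp add: cmod_power2)
  hence "norm u < norm (complex_of_real B - u)" by (rule power2_less_imp_less) simp
  thus ?thesis unfolding f_def u_def[symmetric] by (simp add: norm_divide divide_less_eq)
 qed
 define w where "w = z / (2 * complex_of_real r)"
 have w: "norm w <= 1 / 2" "2 * complex_of_real r * w = z"
  unfolding w_def using z A by (simp_all add: norm_divide norm_mult field_simps)
 have "norm (f w) <= norm w" by (rule Schwarz_Lemma(1)[OF hol f0 lt]) (use w in auto)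
 hence "norm (f w) <= 1 / 2" using w by linarith
 moreover have "f w = g z / (B - g z)" unfolding f_def using w(2) by simp
 ultimately have "norm (g z) / norm (complex_of_real B - g z) <= 1 / 2" by (simp add: norm_divide)
 moreover have "0 < norm (complex_of_real B - g z)" using ne[of z] z A by simp
 ultimately have "norm (g z) <= norm (complex_of_real B - g z) / 2" by (simp add: field_simps)
 also have "... <= (B + norm (g z)) / 2"
  using norm_triangle_ineq4[of "complex_of_real B" "g z"] A unfolding B_def by simp
 finally show ?thesis unfolding B_def using A by simp
qed

lemma entire_real_part_growth:
 assumes g: "g holomorphic_on UNIV" and C: "0 <= C" and re: "\<And>z. Re (g z) <= C * (1 + norm z) ^ n"
 shows "\<exists>q. \<forall>z. g z = poly q z"
proof -
 define h where "h z = g z - g 0" for z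
 have h: "h holomorphic_on UNIV" unfolding h_def using g by (intro holomorphic_intros)
 define D where "D = C + norm (g 0) + 1"
 have D: "0 < D" unfolding D_def using C norm_ge_zero[of "g 0"] by linarith
 have "norm (h z) <= (4 * D * 4 ^ n) * norm z ^ n" if z: "1 <= norm z" for z
 proof -
  have z0: "0 < norm z" using z by linarith
  have 1: "1 <= (4 * norm z) ^ n" using z by (intro one_le_power) simp
  have "norm (h z) <= 4 * (D * (4 * norm z) ^ n)"
  proof (rule borel_caratheodory[OF h, of _ "norm z"])
   show "h 0 = 0" unfolding h_def by simp
   show "0 < D * (4 * norm z) ^ n" using D z0 by simp
   show "0 < norm z" by (rule z0)
   fix w :: complex assume w: "norm w <= 2 * norm z"
   have "Re (h w) <= C * (1 + norm w) ^ n + norm (g 0)"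
    unfolding h_def using re[of w] abs_Re_le_cmod[of "g 0"] by simp
   also have "... <= C * (4 * norm z) ^ n + (norm (g 0) + 1) * (4 * norm z) ^ n"
   proof (rule add_mono)
    show "C * (1 + norm w) ^ n <= C * (4 * norm z) ^ n"
     using w z C by (intro mult_left_mono power_mono) auto
    have "norm (g 0) * 1 <= (norm (g 0) + 1) * (4 * norm z) ^ n" using 1 by (intro mult_mono) auto
    thus "norm (g 0) <= (norm (g 0) + 1) * (4 * norm z) ^ n" by simp
   qed
   also have "... = D * (4 * norm z) ^ n" unfolding D_def by (simp add: algebra_simps)
   finally show "Re (h w) <= D * (4 * norm z) ^ n" .
  qed simp
  thus ?thesis by (simp add: power_mult_distrib mult_ac)
 qed
 hence L: "h z = (\<Sum>k\<le>n. (deriv ^^ k) h 0 / fact k * z ^ k)" for z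
  using Liouville_polynomial[OF h] by blast
 define q where "q = [:g 0:] + (\<Sum>k\<le>n. monom ((deriv ^^ k) h 0 / fact k) k)"
 have "g z = poly q z" for z
  using L[of z] unfolding q_def h_def by (simp add: poly_sum poly_monom algebra_simps)
 thus ?thesis by blast
qed

lemma poly_leading_limit:
 fixes q :: "complex poly"
 shows "((%r. poly q (complex_of_real r * w) / complex_of_real r ^ degree q) \<longlongrightarrow> lead_coeff q * w ^ degree q) at_top"
proof -
 have "((%r. \<Sum>i\<le>degree q. coeff q i * w ^ i * (complex_of_real r ^ i / complex_of_real r ^ degree q)) \<longlongrightarrow>
   (\<Sum>i\<le>degree q. coeff q i * w ^ i * (if i = degree q then 1 else 0))) at_top"
 proof (intro tendsto_sum tendsto_mult_left)
  fix i assume i: "i \<in> {..degree q}"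
  show "((%r. complex_of_real r ^ i / complex_of_real r ^ degree q) \<longlongrightarrow> (if i = degree q then 1 else 0)) at_top"
  proof (cases "i = degree q")
   case True
   have "\<forall>\<^sub>F r in at_top. 1 = complex_of_real r ^ i / complex_of_real r ^ degree q"
    using eventually_gt_at_top[of 0] by eventually_elim (use True in simp)
   thus ?thesis using True by (simp add: tendsto_eventually eventually_mono tendsto_cong)
  next
   case False
   then obtain j where j: "degree q = i + Suc j" using i less_imp_Suc_add[of i "degree q"] by auto
   have "((%r. complex_of_real (inverse r)) \<longlongrightarrow> complex_of_real 0) at_top"
    by (intro tendsto_of_real tendsto_inverse_0_at_top filterlim_ident)
   hence "((%r. complex_of_real (inverse r) ^ Suc j) \<longlongrightarrow> complex_of_real 0 ^ Suc j) at_top"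
    by (rule tendsto_power)
   moreover have "\<forall>\<^sub>F r in at_top. complex_of_real (inverse r) ^ Suc j = complex_of_real r ^ i / complex_of_real r ^ degree q"
    using eventually_gt_at_top[of 0] by eventually_elim (simp add: j power_add field_simps)
   ultimately show ?thesis using False by (simp add: tendsto_cong)
  qed
 qed
 moreover have "(\<Sum>i\<le>degree q. coeff q i * w ^ i * (if i = degree q then 1 else 0)) = lead_coeff q * w ^ degree q"
  by (simp add: sum.delta' if_distrib cong: if_cong)
 moreover have "(%r. \<Sum>i\<le>degree q. coeff q i * w ^ i * (complex_of_real r ^ i / complex_of_real r ^ degree q)) =
   (%r. poly q (complex_of_real r * w) / complex_of_real r ^ degree q)"
  by (simp add: poly_altdef sum_divide_distrib power_mult_distrib mult_ac)
 ultimately show ?thesis by simp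
qed

text \<open>On a large circle the leading term c z^m dominates. For m > 2 some root w of w^m = |c|/c is off the
imaginary axis; there Re (c w^m) = |c| exceeds the value at i Im w, which has smaller modulus.\<close>
lemma ridge_polynomial_degree:
 fixes q :: "complex poly"
 assumes ridge: "\<And>z. Re (poly q z) <= Re (poly q (\<i> * of_real (Im z)))"
 shows "degree q <= 2"
proof (rule ccontr)
 assume "\<not> degree q <= 2"
 define m where "m = degree q"
 have m: "3 <= m" unfolding m_def using `\<not> degree q <= 2` by simp
 define c where "c = lead_coeff q"
 have c: "c \<noteq> 0" unfolding c_def using m unfolding m_def by auto
 define u where "u = of_real (norm c) / c"
 have u: "u \<noteq> 0" "norm u = 1" unfolding u_def using c by (simp_all add: norm_divide)
 have "card {w. w ^ m = u} = m" using u(1) m by (intro card_nth_roots) auto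
 hence "\<not> {w. w ^ m = u} \<subseteq> {\<i>, - \<i>}"
  using card_mono[of "{\<i>, - \<i>}" "{w. w ^ m = u}"] m by (auto simp: card_insert_if)
 then obtain w where w: "w ^ m = u" "w \<noteq> \<i>" "w \<noteq> - \<i>" by blast
 have nw: "norm w = 1"
 proof -
  have "norm w ^ m = 1" using w(1) u(2) by (metis norm_power)
  thus ?thesis using m power_eq_imp_eq_base[of "norm w" m 1] by simp
 qed
 have im: "\<bar>Im w\<bar> < 1"
 proof (rule ccontr)
  assume "\<not> \<bar>Im w\<bar> < 1"
  hence "1 <= (Im w)^2" by (metis abs_le_square_iff abs_one not_le one_power2)
  moreover have "(Re w)^2 + (Im w)^2 = 1" using nw cmod_power2[of w] by simp
  ultimately have "(Re w)^2 = 0" "(Im w)^2 = 1" using zero_le_power2[of "Re w"] by linarith+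
  hence "Re w = 0" "(Im w)^2 = 1" by simp_all
  hence "w = \<i> \<or> w = - \<i>" by (auto simp: complex_eq_iff power2_eq_1_iff)
  thus False using w by blast
 qed
 define v where "v = \<i> * of_real (Im w)"
 have l1: "((%r. Re (poly q (of_real r * w) / of_real r ^ m)) \<longlongrightarrow> Re (c * w ^ m)) at_top"
  unfolding m_def c_def by (intro tendsto_Re poly_leading_limit)
 have l2: "((%r. Re (poly q (of_real r * v) / of_real r ^ m)) \<longlongrightarrow> Re (c * v ^ m)) at_top"
  unfolding m_def c_def by (intro tendsto_Re poly_leading_limit)
 have "Re (c * w ^ m) <= Re (c * v ^ m)"
 proof (rule tendsto_le[OF _ l2 l1])
  show "\<forall>\<^sub>F r in at_top. Re (poly q (of_real r * w) / of_real r ^ m) <=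
    Re (poly q (of_real r * v) / of_real r ^ m)"
   using eventually_gt_at_top[of 0]
  proof eventually_elim
   case (elim r)
   have eq: "\<i> * of_real (Im (of_real r * w)) = of_real r * v" unfolding v_def by simp
   have "Re (poly q (of_real r * w)) <= Re (poly q (of_real r * v))"
    using ridge[of "of_real r * w"] unfolding eq .
   thus ?case using elim by (simp add: divide_right_mono flip: of_real_power)
  qed
 qed simp
 also have "Re (c * v ^ m) <= norm c * \<bar>Im w\<bar> ^ m"
  using complex_Re_le_cmod[of "c * v ^ m"] unfolding v_def by (simp add: norm_mult norm_power)
 also have "... < norm c * 1"
  using im c m by (intro mult_strict_left_mono power_less_one_iff[THEN iffD2]) auto
 also have "norm c * 1 = Re (c * w ^ m)" unfolding w(1) u_def using c by simp
 finally show False by simp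
qed


section \<open>Real line: the theorems of Marcinkiewicz and Cramer\<close>

lemma zero_islimpt_reals: "(0::complex) islimpt range complex_of_real"
 unfolding islimpt_approachable
proof (intro allI impI)
 fix e :: real assume "0 < e"
 thus "\<exists>x'\<in>range complex_of_real. x' \<noteq> 0 \<and> dist x' 0 < e"
  by (intro bexI[OF _ rangeI[of complex_of_real "e / 2"]]) (simp add: norm_divide)
qed

lemma entire_eq_on_reals:
 assumes "f holomorphic_on UNIV" "g holomorphic_on UNIV" "\<And>t. f (of_real t) = g (of_real t)"
 shows "f z = g z"
proof -
 have "f z - g z = 0"
  by (rule analytic_continuation[of "%z. f z - g z" UNIV "range of_real" 0])
   (use assms zero_islimpt_reals in \<open>auto intro!: holomorphic_intros\<close>)
 thus ?thesis by simp
qed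

context real_distribution
begin

text \<open>The characteristic function at complex arguments.\<close>
definition laplace :: "complex => complex" where
 "laplace z = (CLINT x|M. exp (\<i> * z * of_real x))"

lemma laplace_real: "laplace (of_real t) = char M t"
 unfolding laplace_def char_def by (simp add: mult.assoc)

context
 assumes fin: "\<And>y. exp_moment M y < \<infinity>"
begin

lemma exp_integrable: "integrable M (%x. exp (y * x))"
 using fin[of y] by (intro integrableI_bounded) auto

lemma exp_abs_integrable: "integrable M (%x. exp (\<bar>y * x\<bar>))"
proof (rule Bochner_Integration.integrable_bound)
 show "integrable M (%x. exp (y * x) + exp (- y * x))"
  by (intro Bochner_Integration.integrable_add exp_integrable)
 show "AE x in M. norm (exp \<bar>y * x\<bar>) <= norm (exp (y * x) + exp (- y * x))"
 proof (rule AE_I2)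
  fix x
  have "exp \<bar>t\<bar> <= \<bar>exp t + exp (- t)\<bar>" for t :: real
   by (cases "0 <= t") (simp_all add: abs_of_pos add_pos_pos)
  from this[of "y * x"] show "norm (exp \<bar>y * x\<bar>) <= norm (exp (y * x) + exp (- y * x))" by simp
 qed
qed measurable

lemma laplace_entire: "laplace holomorphic_on UNIV"
proof -
 define a where "a n = (CLINT x|M. (\<i> * of_real x) ^ n / fact n)" for n
 have sums: "(%n. a n * (w - 0) ^ n) sums laplace w" for w
 proof -
  define f where "f n x = (\<i> * w * of_real x) ^ n / fact n" for n and x :: real
  have nf: "norm (f n x) = \<bar>norm w * x\<bar> ^ n / fact n" for n x
   unfolding f_def by (simp add: norm_divide norm_power norm_mult abs_mult)
  have sm: "(%n. \<bar>norm w * x\<bar> ^ n / fact n) sums exp \<bar>norm w * x\<bar>" for x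
   using exp_converges[of "\<bar>norm w * x\<bar>"] by (simp add: divide_inverse mult.commute)
  have le: "norm (f n x) <= exp \<bar>norm w * x\<bar>" for n x
  proof -
   have "(\<Sum>i\<in>{n}. \<bar>norm w * x\<bar> ^ i / fact i) <= exp \<bar>norm w * x\<bar>"
    unfolding sums_unique[OF sm[of x]] by (rule sum_le_suminf[OF sums_summable[OF sm]]) auto
   thus ?thesis unfolding nf by simp
  qed
  have meas: "f n \<in> borel_measurable M" for n unfolding f_def by measurable
  have int: "integrable M (f n)" for n
   by (rule Bochner_Integration.integrable_bound[OF exp_abs_integrable[of "norm w"] meas])
    (use le in simp)
  have "(\<Sum>n. ennreal (LINT x|M. norm (f n x))) = (\<Sum>n. \<integral>\<^sup>+x. ennreal (norm (f n x)) \<partial>M)"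
   by (intro suminf_cong nn_integral_eq_integral[symmetric] integrable_norm int) simp
  also have "... = (\<integral>\<^sup>+x. (\<Sum>n. ennreal (norm (f n x))) \<partial>M)"
   by (rule nn_integral_suminf[symmetric]) (use meas in measurable)
  also have "... = (\<integral>\<^sup>+x. ennreal (exp \<bar>norm w * x\<bar>) \<partial>M)"
  proof (rule nn_integral_cong)
   fix x
   show "(\<Sum>n. ennreal (norm (f n x))) = ennreal (exp \<bar>norm w * x\<bar>)"
    unfolding nf sums_unique[OF sm[of x]] by (rule suminf_ennreal2[OF _ sums_summable[OF sm]]) simp
  qed
  also have "... < \<infinity>" using exp_abs_integrable[of "norm w"] by (simp add: integrable_iff_bounded)
  finally have summ: "summable (%n. LINT x|M. norm (f n x))"
   by (intro summable_suminf_not_top) auto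
  have pw: "summable (%n. norm (f n x))" for x unfolding nf by (rule sums_summable[OF sm])
  have "(%n. integral\<^sup>L M (f n)) sums (LINT x|M. (\<Sum>n. f n x))"
   by (rule sums_integral[OF int _ summ]) (simp add: pw)
  moreover have "(\<Sum>n. f n x) = exp (\<i> * w * of_real x)" for x
   using exp_converges[of "\<i> * w * of_real x"] unfolding f_def
   by (simp add: sums_iff scaleR_conv_of_real divide_inverse mult.commute)
  moreover have "integral\<^sup>L M (f n) = a n * (w - 0) ^ n" for n
  proof -
   have "integral\<^sup>L M (f n) = (CLINT x|M. (\<i> * of_real x) ^ n / fact n * w ^ n)"
    unfolding f_def by (simp add: power_mult_distrib mult_ac)
   thus ?thesis unfolding a_def by simp
  qed
  ultimately show ?thesis unfolding laplace_def by simp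
 qed
 have "laplace holomorphic_on ball 0 r" for r
  by (rule power_series_holomorphic) (rule sums)
 hence "laplace field_differentiable at z" for z
  by (rule holomorphic_on_imp_differentiable_at[of _ "ball 0 (norm z + 1)"]) auto
 thus ?thesis by (simp add: holomorphic_on_open field_differentiable_def)
qed

lemma laplace_ridge: "norm (laplace z) <= Re (laplace (\<i> * complex_of_real (Im z)))"
 and laplace_imag: "Re (laplace (\<i> * complex_of_real y)) = (LINT x|M. exp (- y * x))"
proof -
 have *: "laplace (\<i> * complex_of_real y) = complex_of_real (LINT x|M. exp (- y * x))" for y
 proof -
  have "exp (\<i> * (\<i> * complex_of_real y) * complex_of_real x) = complex_of_real (exp (- y * x))" for x
   by (simp add: exp_of_real[symmetric] mult.assoc[symmetric])
  thus ?thesis unfolding laplace_def by (simp only: integral_complex_of_real)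
 qed
 show "Re (laplace (\<i> * complex_of_real y)) = (LINT x|M. exp (- y * x))" unfolding * by simp
 have "norm (exp (\<i> * z * complex_of_real x)) = exp (- Im z * x)" for x
  by (simp add: norm_exp_eq_Re)
 hence "norm (laplace z) <= (LINT x|M. exp (- Im z * x))"
  unfolding laplace_def using integral_norm_bound[of M "%x. exp (\<i> * z * complex_of_real x)"] by simp
 thus "norm (laplace z) <= Re (laplace (\<i> * complex_of_real (Im z)))" unfolding * by simp
qed

end

lemma ex_half_mass: "\<exists>r\<ge>0. 1 / 2 <= measure M {- r..r}"
proof -
 have "(%n. measure M {- real n..real n}) \<longlonglongrightarrow> measure M (\<Union>n. {- real n..real n})"
  by (rule finite_Lim_measure_incseq) (auto simp: incseq_def)
 also have "(\<Union>n. {- real n..real n}) = UNIV"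
 proof -
  have "\<exists>n. x \<in> {- real n..real n}" for x
   using real_arch_simple[of "\<bar>x\<bar>"] by (auto simp: abs_le_iff intro: minus_le_iff[THEN iffD1])
  thus ?thesis by blast
 qed
 finally have "(%n. measure M {- real n..real n}) \<longlonglongrightarrow> 1" using prob_space by simp
 hence "\<forall>\<^sub>F n in sequentially. 1 / 2 < measure M {- real n..real n}" by (rule order_tendstoD) simp
 then obtain n where "1 / 2 < measure M {- real n..real n}" by (auto simp: eventually_sequentially)
 thus ?thesis by (intro exI[of _ "real n"]) auto
qed

end

lemma exp_le_two_cosh: "exp x <= 2 * cosh (x::real)"
 unfolding cosh_def by simp

text \<open>If Q gives mass 1/2 to [-r, r], then exp(-|y| r)/2 times the moment of P is at most that of P * Q.
The moments of P * Q are bounded through its entire characteristic function.\<close>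
lemma laplace_bound_of_factor:
 assumes P: "real_distribution P" and Q: "real_distribution Q"
  and pq: "\<And>t. char P t * char Q t = exp (- poly p (of_real t))"
 shows "\<exists>K\<ge>0. \<exists>N. \<forall>y. exp_moment P y <= ennreal (exp (K * (1 + \<bar>y\<bar>) ^ N))"
proof -
 interpret P: real_distribution P by fact
 interpret Q: real_distribution Q by fact
 interpret PQ: pair_prob_space P Q ..
 define S where "S = distr (P \<Otimes>\<^sub>M Q) borel (%z. fst z + snd z)"
 interpret S: real_distribution S
  unfolding S_def by (rule PQ.real_distribution_distr) measurable
 have charS: "char S t = exp (- poly p (of_real t))" for t
 proof -
  have "char S t = (CLINT z|P \<Otimes>\<^sub>M Q. iexp (t * fst z) * iexp (t * snd z))"
   unfolding char_def S_def by (subst integral_distr) (auto simp: distrib_left exp_add)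
  also have "... = (CLINT x|P. CLINT y|Q. iexp (t * x) * iexp (t * y))"
  proof -
   have "complex_integrable (P \<Otimes>\<^sub>M Q) (%z. iexp (t * fst z) * iexp (t * snd z))"
    by (rule PQ.integrable_const_bound[where B = 1]) (auto simp: norm_mult)
   from PQ.integral_fst'[OF this] show ?thesis by simp
  qed
  also have "... = char P t * char Q t" unfolding char_def by simp
  finally show ?thesis using pq by simp
 qed
 obtain C where C: "0 <= C" "\<And>z. norm (poly p z) <= C * (1 + norm z) ^ degree p"
  using poly_growth by blast
 define d where "d = degree p"
 define B where "B y = exp (C * (1 + 12 * (\<bar>y\<bar> + 1)) ^ d)" for y :: real
 have cosh: "(\<integral>\<^sup>+x. ennreal (cosh (y * x)) \<partial>S) <= ennreal (2 * B y)" for y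
 proof (rule S.cosh_moment_bound[OF charS])
  show "(%z. exp (- poly p z)) holomorphic_on UNIV" by (intro holomorphic_intros)
  fix z :: complex assume z: "norm z <= 12 * (\<bar>y\<bar> + 1)"
  have "norm (exp (- poly p z)) <= exp (norm (- poly p z))" by (rule norm_exp)
  also have "... <= B y"
   unfolding B_def using C(2)[of z] z C(1) unfolding d_def
   by (auto intro!: order_trans[OF C(2)] mult_left_mono power_mono)
  finally show "norm (exp (- poly p z)) <= B y" .
 qed
 obtain r where r: "0 <= r" "1 / 2 <= measure Q {- r..r}" using Q.ex_half_mass by blast
 define K where "K = 3 + r + C * 13 ^ d"
 have K: "0 <= K" unfolding K_def using r C(1) by simp
 have "exp_moment P y <= ennreal (exp (K * (1 + \<bar>y\<bar>) ^ (d + 1)))" for y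
 proof -
  have low: "ennreal (exp (- (\<bar>y\<bar> * r)) / 2) <= exp_moment Q y"
  proof -
   have "ennreal (exp (- (\<bar>y\<bar> * r)) / 2) <= ennreal (exp (- (\<bar>y\<bar> * r))) * ennreal (measure Q {- r..r})"
    using r by (subst ennreal_mult[symmetric]) (auto intro!: ennreal_leI)
   also have "... = (\<integral>\<^sup>+x. ennreal (exp (- (\<bar>y\<bar> * r))) * indicator {- r..r} x \<partial>Q)"
    by (simp add: nn_integral_cmult_indicator Q.emeasure_eq_measure)
   also have "... <= exp_moment Q y"
   proof (rule nn_integral_mono)
    fix x
    show "ennreal (exp (- (\<bar>y\<bar> * r))) * indicator {- r..r} x <= ennreal (exp (y * x))"
    proof (cases "x \<in> {- r..r}")
     case True
     have "\<bar>y * x\<bar> <= \<bar>y\<bar> * r" unfolding abs_mult using True by (intro mult_left_mono) auto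
     thus ?thesis using True by (auto intro!: ennreal_leI)
    qed simp
   qed
   finally show ?thesis .
  qed
  have prod: "exp_moment P y * exp_moment Q y = exp_moment S y"
  proof -
   have "exp_moment S y = (\<integral>\<^sup>+z. ennreal (exp (y * fst z)) * ennreal (exp (y * snd z)) \<partial>(P \<Otimes>\<^sub>M Q))"
    unfolding S_def by (subst nn_integral_distr) (auto simp: distrib_left exp_add ennreal_mult)
   also have "... = (\<integral>\<^sup>+x. \<integral>\<^sup>+v. ennreal (exp (y * x)) * ennreal (exp (y * v)) \<partial>Q \<partial>P)"
    by (subst Q.nn_integral_fst[symmetric]) auto
   also have "... = (\<integral>\<^sup>+x. ennreal (exp (y * x)) * exp_moment Q y \<partial>P)"
    by (simp add: nn_integral_cmult)
   also have "... = exp_moment P y * exp_moment Q y"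
    by (rule nn_integral_multc) measurable
   finally show ?thesis by simp
  qed
  have "exp_moment S y <= (\<integral>\<^sup>+x. 2 * ennreal (cosh (y * x)) \<partial>S)"
  proof (rule nn_integral_mono)
   fix x show "ennreal (exp (y * x)) <= 2 * ennreal (cosh (y * x))"
    using exp_le_two_cosh[of "y * x"] cosh_real_nonneg[of "y * x"]
    by (metis ennreal_leI ennreal_mult'' ennreal_numeral)
  qed
  also have "... = 2 * (\<integral>\<^sup>+x. ennreal (cosh (y * x)) \<partial>S)" 
   by (rule nn_integral_cmult) (simp add: cosh_def)
  also have "... <= 2 * ennreal (2 * B y)" by (intro mult_left_mono cosh) simp
  finally have "exp_moment P y * ennreal (exp (- (\<bar>y\<bar> * r)) / 2) <= 2 * ennreal (2 * B y)"
   unfolding prod[symmetric] using low by (meson mult_left_mono order_trans zero_le)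
  hence "exp_moment P y * ennreal (exp (- (\<bar>y\<bar> * r)) / 2) * ennreal (2 * exp (\<bar>y\<bar> * r))
    <= 2 * ennreal (2 * B y) * ennreal (2 * exp (\<bar>y\<bar> * r))" by (intro mult_right_mono) auto
  moreover have "ennreal (exp (- (\<bar>y\<bar> * r)) / 2) * ennreal (2 * exp (\<bar>y\<bar> * r)) = 1"
   by (subst ennreal_mult[symmetric]) (auto simp: exp_minus)
  moreover have "2 * ennreal (2 * B y) * ennreal (2 * exp (\<bar>y\<bar> * r)) = ennreal (8 * B y * exp (\<bar>y\<bar> * r))"
  proof -
   have B0: "0 <= B y" unfolding B_def by simp
   have two: "(2::ennreal) = ennreal 2" by simp
   show ?thesis unfolding two using B0 by (simp add: ennreal_mult[symmetric] mult_ac del: ennreal_numeral)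
  qed
  ultimately have "exp_moment P y <= ennreal (8 * B y * exp (\<bar>y\<bar> * r))"
   by (simp add: mult.assoc)
  also have "... <= ennreal (exp (K * (1 + \<bar>y\<bar>) ^ (d + 1)))"
  proof (rule ennreal_leI)
   have e8: "(8::real) <= exp 3"
   proof -
    have "(2::real) ^ 3 <= exp 1 ^ 3" using exp_ge_add_one_self[of 1] by (intro power_mono) auto
    thus ?thesis by (simp add: exp_of_nat_mult[symmetric])
   qed
   have one: "1 <= (1 + \<bar>y\<bar>) ^ (d + 1)" by (intro one_le_power) simp
   have y1: "\<bar>y\<bar> <= (1 + \<bar>y\<bar>) ^ (d + 1)"
    using self_le_power[of "1 + \<bar>y\<bar>" "d + 1"] by simp
   have dd: "(1 + 12 * (\<bar>y\<bar> + 1)) ^ d <= 13 ^ d * (1 + \<bar>y\<bar>) ^ (d + 1)"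
   proof -
    have "(1 + 12 * (\<bar>y\<bar> + 1)) ^ d <= (13 * (1 + \<bar>y\<bar>)) ^ d" by (intro power_mono) auto
    also have "... = 13 ^ d * (1 + \<bar>y\<bar>) ^ d" by (rule power_mult_distrib)
    also have "... <= 13 ^ d * (1 + \<bar>y\<bar>) ^ (d + 1)" by (intro mult_left_mono power_increasing) auto
    finally show ?thesis .
   qed
   have "8 * B y * exp (\<bar>y\<bar> * r) <= exp 3 * B y * exp (\<bar>y\<bar> * r)"
    unfolding B_def using e8 by (intro mult_right_mono) auto
   also have "... = exp (3 + C * (1 + 12 * (\<bar>y\<bar> + 1)) ^ d + \<bar>y\<bar> * r)" unfolding B_def by (simp add: exp_add)
   also have "... <= exp (3 * (1 + \<bar>y\<bar>) ^ (d + 1) + C * (13 ^ d * (1 + \<bar>y\<bar>) ^ (d + 1)) + (1 + \<bar>y\<bar>) ^ (d + 1) * r)"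
    using one mult_left_mono[OF dd C(1)] mult_right_mono[OF y1 r(1)] unfolding exp_le_cancel_iff by linarith
   also have "... = exp (K * (1 + \<bar>y\<bar>) ^ (d + 1))" unfolding K_def by (simp add: algebra_simps)
   finally show "8 * B y * exp (\<bar>y\<bar> * r) <= exp (K * (1 + \<bar>y\<bar>) ^ (d + 1))" .
  qed
  finally show ?thesis .
 qed
 thus ?thesis using K by blast
qed

text \<open>P has an entire characteristic function without zeros, so it equals exp g; the moment bound gives g
polynomial growth, and |char P(z)| \<le> char P(i Im z) is the ridge property, so deg g \<le> 2.\<close>
theorem cramer_marcinkiewicz:
 assumes P: "real_distribution P" and Q: "real_distribution Q"
  and pq: "\<And>t. char P t * char Q t = exp (- poly p (of_real t))"
 shows "\<exists>b s::real. \<forall>t. char P t = exp (\<i> * of_real (b * t) - of_real (s * t^2))"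
proof -
 interpret P: real_distribution P by fact
 interpret Q: real_distribution Q by fact
 obtain K N where K: "0 <= K" "\<And>y. exp_moment P y <= ennreal (exp (K * (1 + \<bar>y\<bar>) ^ N))"
  using laplace_bound_of_factor[OF P Q pq] by blast
 have qp: "char Q t * char P t = exp (- poly p (of_real t))" for t using pq[of t] by (simp add: mult.commute)
 obtain K' N' where K': "\<And>y. exp_moment Q y <= ennreal (exp (K' * (1 + \<bar>y\<bar>) ^ N'))"
  using laplace_bound_of_factor[OF Q P qp] by blast
 have finP: "exp_moment P y < \<infinity>" for y
  by (rule order_le_less_trans[OF K(2)]) simp
 have finQ: "exp_moment Q y < \<infinity>" for y
  by (rule order_le_less_trans[OF K']) simp
 note LP = P.laplace_entire[OF finP] and LQ = Q.laplace_entire[OF finQ]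
 have "P.laplace z * Q.laplace z = exp (- poly p z)" for z
  by (rule entire_eq_on_reals[of "%z. P.laplace z * Q.laplace z" "%z. exp (- poly p z)"])
   (auto intro!: holomorphic_intros LP LQ simp: P.laplace_real Q.laplace_real pq)
 hence nz: "P.laplace z \<noteq> 0" for z by (metis exp_not_eq_zero mult_zero_left)
 obtain g0 where g0: "g0 holomorphic_on UNIV" "\<And>z. P.laplace z = exp (g0 z)"
  using contractible_imp_holomorphic_log[OF LP convex_imp_contractible[OF convex_UNIV]] nz by (metis UNIV_I)
 define g where "g z = g0 z - g0 0" for z
 have g: "g holomorphic_on UNIV" unfolding g_def by (intro holomorphic_intros g0)
 have "exp (g0 0) = 1" using g0(2)[of 0] P.laplace_real[of 0] P.char_zero by simp
 hence Lg: "P.laplace z = exp (g z)" for z unfolding g_def exp_diff g0(2) by simp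
 have bound: "Re (P.laplace (\<i> * of_real y)) <= exp (K * (1 + \<bar>y\<bar>) ^ N)" for y
 proof -
  have "ennreal (LINT x|P. exp (- y * x)) = (\<integral>\<^sup>+x. ennreal (exp (- y * x)) \<partial>P)"
   by (rule nn_integral_eq_integral[symmetric, OF P.exp_integrable[OF finP]]) simp
  also have "... <= ennreal (exp (K * (1 + \<bar>y\<bar>) ^ N))" using K(2)[of "- y"] by simp
  finally show ?thesis unfolding P.laplace_imag[OF finP] by (simp add: ennreal_le_iff)
 qed
 have ridge: "Re (g z) <= Re (g (\<i> * of_real (Im z)))" for z
 proof -
  have "exp (Re (g z)) = norm (P.laplace z)" unfolding Lg norm_exp_eq_Re ..
  also have "... <= Re (P.laplace (\<i> * of_real (Im z)))" by (rule P.laplace_ridge[OF finP])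
  also have "... <= norm (P.laplace (\<i> * of_real (Im z)))" by (rule complex_Re_le_cmod)
  also have "... = exp (Re (g (\<i> * of_real (Im z))))" unfolding Lg norm_exp_eq_Re ..
  finally show ?thesis by simp
 qed
 have growth: "Re (g z) <= K * (1 + norm z) ^ N" for z
 proof -
  have "exp (Re (g z)) = norm (P.laplace z)" unfolding Lg norm_exp_eq_Re ..
  also have "... <= Re (P.laplace (\<i> * of_real (Im z)))" by (rule P.laplace_ridge[OF finP])
  also have "... <= exp (K * (1 + \<bar>Im z\<bar>) ^ N)" by (rule bound)
  also have "... <= exp (K * (1 + norm z) ^ N)"
   using K(1) abs_Im_le_cmod[of z] by (auto intro!: mult_left_mono power_mono)
  finally show ?thesis by simp
 qed
 obtain q where q: "\<And>z. g z = poly q z" using entire_real_part_growth[OF g K(1) growth] by blast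
 have deg: "degree q <= 2" by (rule ridge_polynomial_degree) (use ridge q in simp)
 define a1 a2 where "a1 = coeff q 1" and "a2 = coeff q 2"
 have "poly q 0 = 0" using q[of 0] unfolding g_def by simp
 hence c0: "coeff q 0 = 0" by (simp add: poly_0_coeff_0)
 have pq2: "poly q z = a1 * z + a2 * z^2" for z
 proof -
  have "poly q z = (\<Sum>i\<le>2. coeff q i * z ^ i)"
   unfolding poly_altdef by (rule sum.mono_neutral_left) (use deg in \<open>auto simp: coeff_eq_0\<close>)
  thus ?thesis using c0 unfolding a1_def a2_def by (simp add: eval_nat_numeral)
 qed
 have cP: "char P t = exp (a1 * of_real t + a2 * of_real (t^2))" for t
  unfolding P.laplace_real[symmetric] Lg q pq2 by simp
 have conj: "char P (- t) = cnj (char P t)" for t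
  unfolding char_def Bochner_Integration.integral_cnj[symmetric]
  by (rule Bochner_Integration.integral_cong) (auto simp: exp_cnj)
 have re1: "Re a1 = 0"
 proof -
  have "norm (char P (- 1)) = norm (char P 1)" using conj[of 1] by simp
  thus ?thesis unfolding cP norm_exp_eq_Re by simp
 qed
 \<comment> \<open>Otherwise char P(-t) = cnj (char P t) fails where Im a2 t^2 is an odd multiple of \<pi>/2.\<close>
 have im2: "Im a2 = 0"
 proof (rule ccontr)
  assume n: "Im a2 \<noteq> 0"
  define t where "t = sqrt (pi / (2 * \<bar>Im a2\<bar>))"
  have t2: "t^2 = pi / (2 * \<bar>Im a2\<bar>)" unfolding t_def by simp
  define e where "e = exp (\<i> * of_real (Im a2 * t^2))"
  have 1: "char P t = exp (a1 * of_real t + of_real (Re a2 * t^2)) * e"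
   unfolding cP e_def exp_add[symmetric] by (rule arg_cong[where f = exp]) (simp add: complex_eq_iff)
  have 2: "char P (- t) = cnj (exp (a1 * of_real t + of_real (Re a2 * t^2))) * e"
   unfolding cP e_def exp_cnj exp_add[symmetric]
   by (rule arg_cong[where f = exp]) (simp add: complex_eq_iff re1)
  have "e = cnj e" using conj[of t] unfolding 1 2 by simp
  hence "sin (Im a2 * t^2) = 0" unfolding e_def by (simp add: complex_eq_iff Im_exp)
  moreover have "Im a2 * t^2 = pi / 2 \<or> Im a2 * t^2 = - (pi / 2)"
   unfolding t2 using n by (cases "0 < Im a2") (auto simp: field_simps)
  ultimately show False by (elim disjE; simp only:) simp_all
 qed
 have "char P t = exp (\<i> * of_real (Im a1 * t) - of_real ((- Re a2) * t^2))" for t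
  unfolding cP by (rule arg_cong[where f = exp]) (simp add: complex_eq_iff re1 im2)
 thus ?thesis by blast
qed


section \<open>Characteristic functions and the L2 distance of characters\<close>

lemma distributionsD:
 assumes "\<mu> \<in> distributions"
 shows "prob_space \<mu>" "sets \<mu> = sets borel" "space \<mu> = UNIV"
 using assms sets_eq_imp_space_eq[of \<mu> borel] by (auto simp: distributions_def)

lemma char_measurable [measurable]: "char_app y \<in> borel_measurable borel"
 by (rule borel_measurable_continuous_onI) (rule char_cont)

lemma char_measurable':
 assumes "\<mu> \<in> distributions"
 shows "char_app y \<in> borel_measurable \<mu>"
 using measurable_cong_sets[OF distributionsD(2)[OF assms] refl] char_measurable by blast

lemma integrable_bounded_by:
 fixes f :: "_ => 'b::{banach,second_countable_topology}"
 assumes "\<mu> \<in> distributions" "f \<in> borel_measurable borel" "\<And>x. norm (f x) <= B"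
 shows "integrable \<mu> f"
proof -
 interpret prob_space \<mu> by (rule distributionsD(1)[OF assms(1)])
 have "f \<in> borel_measurable \<mu>"
  using measurable_cong_sets[OF distributionsD(2)[OF assms(1)] refl] assms(2) by blast
 thus ?thesis using assms(3) by (intro integrable_const_bound[where B = B]) auto
qed

lemma char_integrable:
 assumes "\<mu> \<in> distributions" shows "integrable \<mu> (char_app y)"
 by (rule integrable_bounded_by[OF assms, where B = 1]) auto

lemma char_fun_0: assumes "\<mu> \<in> distributions" shows "char_fun \<mu> 0 = 1"
proof -
 interpret prob_space \<mu> by (rule distributionsD(1)[OF assms(1)])
 show ?thesis by (simp add: char_fun_def prob_space)
qed

lemma char_fun_norm_le: assumes "\<mu> \<in> distributions" shows "norm (char_fun \<mu> y) <= 1"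
proof -
 interpret prob_space \<mu> by (rule distributionsD(1)[OF assms(1)])
 have "norm (char_fun \<mu> y) <= (LINT x|\<mu>. norm (char_app y x))"
  unfolding char_fun_def by (rule integral_norm_bound)
 thus ?thesis by (simp add: prob_space)
qed

lemma char_fun_minus: "char_fun \<mu> (- y) = cnj (char_fun \<mu> y)"
proof -
 have "char_app (- y) = (%x. cnj (char_app y x))" by (rule ext) (rule char_minus_left)
 thus ?thesis unfolding char_fun_def by (simp only: Bochner_Integration.integral_cnj)
qed

lemma norm_diff_sq_unit:
 fixes w c :: complex
 assumes "norm w = 1" "norm c = 1"
 shows "(norm (w - c))^2 = 2 - 2 * Re (cnj c * w)"
proof -
 have "(norm (w - c))^2 = (norm w)^2 + (norm c)^2 - 2 * Re (cnj c * w)"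
  by (simp only: cmod_power2) (simp add: power2_eq_square algebra_simps)
 thus ?thesis using assms by simp
qed

text \<open>The metric in which characters are approximated; in contrast to the compact-open topology it can be
estimated by characteristic functions.\<close>
definition char_dist2 :: "'a::topological_ab_group_add measure => 'a character => 'a character => real" where
 "char_dist2 \<mu> y z = (LINT x|\<mu>. (norm (char_app y x - char_app z x))^2)"

lemma char_dist2_nonneg: "0 <= char_dist2 \<mu> y z"
 unfolding char_dist2_def by simp

lemma char_dist2_integrable:
 fixes f g :: "_ => complex"
 assumes "\<mu> \<in> distributions" "f \<in> borel_measurable borel" "g \<in> borel_measurable borel"
  "\<And>x. norm (f x) <= 1" "\<And>x. norm (g x) <= 1"
 shows "integrable \<mu> (%x. (norm (f x - g x))^2)"
proof (rule integrable_bounded_by[OF assms(1), where B = 4])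
 show "(%x. (norm (f x - g x))^2) \<in> borel_measurable borel" using assms(2,3) by measurable
 fix x
 have "norm (f x - g x) <= 2" using norm_triangle_ineq4[of "f x" "g x"] assms(4,5)[of x] by simp
 thus "norm ((norm (f x - g x))^2) <= 4" using power_mono[of "norm (f x - g x)" 2 2] by simp
qed

lemma integral_char_minus_const:
 assumes "\<mu> \<in> distributions" "norm c = 1"
 shows "(LINT x|\<mu>. (norm (char_app y x - c))^2) = 2 - 2 * Re (cnj c * char_fun \<mu> y)"
proof -
 interpret prob_space \<mu> by (rule distributionsD(1)[OF assms(1)])
 have i: "integrable \<mu> (%x. cnj c * char_app y x)" using char_integrable[OF assms(1)] by simp
 have "(LINT x|\<mu>. (norm (char_app y x - c))^2) = (LINT x|\<mu>. 2 - 2 * Re (cnj c * char_app y x))"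
  using assms(2) by (simp add: norm_diff_sq_unit)
 also have "... = 2 - 2 * (LINT x|\<mu>. Re (cnj c * char_app y x))"
  using integrable_mult_right[of 2, OF integrable_Re[OF i]]
  by (subst Bochner_Integration.integral_diff) (simp_all only: integral_mult_right_zero, simp_all add: prob_space)
 also have "(LINT x|\<mu>. Re (cnj c * char_app y x)) = Re (LINT x|\<mu>. cnj c * char_app y x)"
  using i by (rule integral_Re)
 finally show ?thesis by (simp add: char_fun_def)
qed

lemma char_fun_lipschitz:
 assumes "\<mu> \<in> distributions"
 shows "(norm (char_fun \<mu> y - char_fun \<mu> z))^2 <= char_dist2 \<mu> y z"
proof -
 interpret prob_space \<mu> by (rule distributionsD(1)[OF assms(1)])
 let ?g = "%x. norm (char_app y x - char_app z x)"
 have m: "?g \<in> borel_measurable borel" by measurable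
 have g2: "?g x <= 2" for x using norm_triangle_ineq4[of "char_app y x" "char_app z x"] by simp
 have i: "integrable \<mu> ?g" by (rule integrable_bounded_by[OF assms m, where B = 2]) (simp add: g2)
 have i2: "integrable \<mu> (%x. (?g x)^2)" by (rule char_dist2_integrable[OF assms]) auto
 have "char_fun \<mu> y - char_fun \<mu> z = (LINT x|\<mu>. char_app y x - char_app z x)"
  unfolding char_fun_def by (simp add: char_integrable[OF assms])
 hence "norm (char_fun \<mu> y - char_fun \<mu> z) <= (LINT x|\<mu>. ?g x)" by simp
 hence "(norm (char_fun \<mu> y - char_fun \<mu> z))^2 <= (LINT x|\<mu>. ?g x)^2" by (intro power_mono) auto
 also have "... <= (LINT x|\<mu>. (?g x)^2)"
  using variance_positive[of ?g] variance_eq[OF i i2] by simp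
 finally show ?thesis unfolding char_dist2_def .
qed

lemma norm_power_int_diff_le:
 fixes w c :: complex
 assumes "norm w = 1" "norm c = 1"
 shows "norm (w powi m - c powi m) <= \<bar>real_of_int m\<bar> * norm (w - c)"
proof -
 have nz: "w \<noteq> 0" "c \<noteq> 0" using assms by auto
 have P: "norm (w ^ n - c ^ n) <= real n * norm (w - c)" if "norm w = 1" "norm c = 1" for n :: nat and w c :: complex
  using norm_power_diff[of w c n] that by simp
 have inv: "norm (inverse w - inverse c) = norm (w - c)"
 proof -
  have "inverse w - inverse c = (c - w) / (w * c)" using nz by (simp add: field_simps)
  thus ?thesis using assms by (simp add: norm_divide norm_mult norm_minus_commute)
 qed
 show ?thesis
 proof (cases "0 <= m")
  case True
  thus ?thesis using P[OF assms, of "nat m"] by (simp add: power_int_def)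
 next
  case False
  have "norm (inverse w) = 1" "norm (inverse c) = 1" using assms by (auto simp: norm_inverse)
  from P[OF this, of "nat (- m)"] show ?thesis using False by (simp add: power_int_def inv)
 qed
qed

lemma char_dist2_zmult_le:
 assumes "\<mu> \<in> distributions"
 shows "char_dist2 \<mu> (zmult m y) (zmult m z) <= (real_of_int m)^2 * char_dist2 \<mu> y z"
proof -
 have "char_dist2 \<mu> (zmult m y) (zmult m z) <= (LINT x|\<mu>. (real_of_int m)^2 * (norm (char_app y x - char_app z x))^2)"
  unfolding char_dist2_def
 proof (rule integral_mono)
  show "integrable \<mu> (%x. (norm (char_app (zmult m y) x - char_app (zmult m z) x))^2)"
   by (rule char_dist2_integrable[OF assms]) auto
  show "integrable \<mu> (%x. (real_of_int m)^2 * (norm (char_app y x - char_app z x))^2)"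
   by (intro integrable_mult_right char_dist2_integrable[OF assms]) auto
  fix x
  have "norm (char_app (zmult m y) x - char_app (zmult m z) x) <= \<bar>real_of_int m\<bar> * norm (char_app y x - char_app z x)"
   by (simp add: char_zmult_left norm_power_int_diff_le)
  from power_mono[OF this, of 2]
  show "(norm (char_app (zmult m y) x - char_app (zmult m z) x))^2 <= (real_of_int m)^2 * (norm (char_app y x - char_app z x))^2"
   by (simp add: power_mult_distrib)
 qed
 also have "... = (real_of_int m)^2 * char_dist2 \<mu> y z" by (simp add: char_dist2_def)
 finally show ?thesis .
qed

lemma char_dist2_add_le:
 assumes "\<mu> \<in> distributions"
 shows "char_dist2 \<mu> (y + y') (z + z') <= 2 * char_dist2 \<mu> y z + 2 * char_dist2 \<mu> y' z'"
proof -
 have ig: "integrable \<mu> (%x. (norm (char_app y x - char_app z x))^2)" for y z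
  by (rule char_dist2_integrable[OF assms]) auto
 have "char_dist2 \<mu> (y + y') (z + z') <= (LINT x|\<mu>. 2 * (norm (char_app y x - char_app z x))^2 + 2 * (norm (char_app y' x - char_app z' x))^2)"
  unfolding char_dist2_def
 proof (rule integral_mono)
  fix x
  let ?a = "char_app y x" and ?b = "char_app y' x" and ?c = "char_app z x" and ?d = "char_app z' x"
  have "?a * ?b - ?c * ?d = (?a - ?c) * ?b + ?c * (?b - ?d)" by (simp add: algebra_simps)
  hence "norm (?a * ?b - ?c * ?d) <= norm (?a - ?c) + norm (?b - ?d)"
   using norm_triangle_ineq[of "(?a - ?c) * ?b" "?c * (?b - ?d)"] by (simp add: norm_mult)
  hence "(norm (?a * ?b - ?c * ?d))^2 <= (norm (?a - ?c) + norm (?b - ?d))^2" by (intro power_mono) auto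
  also have "... <= 2 * (norm (?a - ?c))^2 + 2 * (norm (?b - ?d))^2"
   using sum_squares_bound[of "norm (?a - ?c)" "norm (?b - ?d)"] by (simp add: power2_sum)
  finally show "(norm (char_app (y + y') x - char_app (z + z') x))^2 <= 2 * (norm (?a - ?c))^2 + 2 * (norm (?b - ?d))^2"
   by (simp add: char_plus_left)
 next
  show "integrable \<mu> (%x. 2 * (norm (char_app y x - char_app z x))^2 + 2 * (norm (char_app y' x - char_app z' x))^2)"
   by (intro Bochner_Integration.integrable_add integrable_mult_right ig)
 qed (rule ig)
 also have "... = 2 * char_dist2 \<mu> y z + 2 * char_dist2 \<mu> y' z'"
  using ig by (simp add: char_dist2_def)
 finally show ?thesis .
qed

lemma char_dist2_minus: "char_dist2 \<mu> (- y) (- z) = char_dist2 \<mu> y z"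
proof -
 have "norm (cnj a - cnj b) = norm (a - b)" for a b by (metis complex_cnj_diff complex_mod_cnj)
 thus ?thesis by (simp add: char_dist2_def char_minus_left)
qed


section \<open>Convolutions, and polynomials along multiples\<close>

lemma distr_zmult:
 fixes \<mu> :: "'a::topological_ab_group_add measure"
 assumes "\<mu> \<in> distributions"
 shows "distr \<mu> borel (zmult m) \<in> distributions"
  and "char_fun (distr \<mu> borel (zmult m)) y = char_fun \<mu> (zmult m y)"
proof -
 interpret prob_space \<mu> by (rule distributionsD(1)[OF assms])
 have "zmult m \<in> borel_measurable (borel :: 'a measure)"
  by (rule borel_measurable_continuous_onI) (rule continuous_zmult)
 hence m: "zmult m \<in> \<mu> \<rightarrow>\<^sub>M borel"
  using measurable_cong_sets[OF distributionsD(2)[OF assms] refl] by blast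
 show "distr \<mu> borel (zmult m) \<in> distributions"
  unfolding distributions_def by (auto intro: prob_space_distr[OF m])
 show "char_fun (distr \<mu> borel (zmult m)) y = char_fun \<mu> (zmult m y)"
  unfolding char_fun_def char_zmult_left[abs_def] by (subst integral_distr[OF m]) (auto simp: char_zmult_right char_zmult_left)
qed

lemma distr_uminus:
 fixes \<mu> :: "'a::topological_ab_group_add measure"
 assumes "\<mu> \<in> distributions"
 shows "\<exists>\<nu>\<in>distributions. \<forall>y. char_fun \<nu> y = cnj (char_fun \<mu> y)"
proof (rule bexI[OF _ distr_zmult(1)[OF assms, of "-1"]], intro allI)
 fix y :: "'a character"
 show "char_fun (distr \<mu> borel (zmult (- 1))) y = cnj (char_fun \<mu> y)"
  using distr_zmult(2)[OF assms, of "-1" y] zmult_minus_left[of 1 y] by (simp add: char_fun_minus)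
qed

lemma continuous_measurable_distribution:
 assumes "\<mu> \<in> distributions" "continuous_on UNIV f" shows "f \<in> borel_measurable \<mu>"
proof -
 have "sets \<mu> = sets borel" using assms(1) by (simp add: distributions_def)
 thus ?thesis using measurable_cong_sets[OF _ refl] borel_measurable_continuous_onI[OF assms(2)] by blast
qed

lemma bounded_integrable:
 fixes f :: "'a::topological_space => 'b::{banach,second_countable_topology}"
 assumes "\<mu> \<in> distributions" "continuous_on UNIV f" "\<And>x. norm (f x) <= B"
 shows "integrable \<mu> f"
proof -
 interpret prob_space \<mu> using assms(1) by (simp add: distributions_def)
 show ?thesis
  using assms(3) continuous_measurable_distribution[OF assms(1,2)]
  by (intro integrable_const_bound[where B = B]) auto
qed

lemma pair_distribution:
 fixes \<alpha> :: "'a::second_countable_topology measure" and \<beta> :: "'b::second_countable_topology measure"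
 assumes "\<alpha> \<in> distributions" "\<beta> \<in> distributions"
 shows "\<alpha> \<Otimes>\<^sub>M \<beta> \<in> distributions"
proof -
 interpret A: prob_space \<alpha> using assms(1) by (simp add: distributions_def)
 interpret B: prob_space \<beta> using assms(2) by (simp add: distributions_def)
 interpret pair_prob_space \<alpha> \<beta> ..
 have "sets (\<alpha> \<Otimes>\<^sub>M \<beta>) = sets (borel \<Otimes>\<^sub>M borel)"
  by (rule sets_pair_measure_cong) (use assms in \<open>auto simp: distributions_def\<close>)
 also have "... = sets borel" by (simp only: borel_prod)
 finally show ?thesis unfolding distributions_def using prob_space_axioms by blast
qed

lemma convolution_distribution:
 fixes \<alpha> \<beta> :: "'a::{topological_ab_group_add,second_countable_topology} measure"
 assumes "\<alpha> \<in> distributions" "\<beta> \<in> distributions"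
 shows "\<exists>\<nu>\<in>distributions. \<forall>y. char_fun \<nu> y = char_fun \<alpha> y * char_fun \<beta> y"
proof -
 interpret A: prob_space \<alpha> by (rule distributionsD(1)[OF assms(1)])
 interpret B: prob_space \<beta> by (rule distributionsD(1)[OF assms(2)])
 interpret pair_prob_space \<alpha> \<beta> ..
 let ?s = "%z::'a \<times> 'a. fst z + snd z"
 have m: "?s \<in> borel_measurable (\<alpha> \<Otimes>\<^sub>M \<beta>)"
  by (rule continuous_measurable_distribution[OF pair_distribution[OF assms]]) (intro continuous_intros)
 have "distr (\<alpha> \<Otimes>\<^sub>M \<beta>) borel ?s \<in> distributions"
  unfolding distributions_def by (auto intro: prob_space_distr[OF m])
 moreover have "char_fun (distr (\<alpha> \<Otimes>\<^sub>M \<beta>) borel ?s) y = char_fun \<alpha> y * char_fun \<beta> y" for y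
 proof -
  have c: "continuous_on UNIV (%z::'a \<times> 'a. char_app y (fst z) * char_app y (snd z))"
   by (intro continuous_intros continuous_on_compose2[OF char_cont[of UNIV y]]) auto
  have i: "integrable (\<alpha> \<Otimes>\<^sub>M \<beta>) (%z. char_app y (fst z) * char_app y (snd z))"
   by (rule bounded_integrable[OF pair_distribution[OF assms] c, where B = 1]) (simp add: norm_mult)
  have "char_fun (distr (\<alpha> \<Otimes>\<^sub>M \<beta>) borel ?s) y = (LINT z|(\<alpha> \<Otimes>\<^sub>M \<beta>). char_app y (fst z) * char_app y (snd z))"
   unfolding char_fun_def by (subst integral_distr[OF m]) (auto simp: char_add)
  also have "... = (\<integral>x. \<integral>v. char_app y x * char_app y v \<partial>\<beta> \<partial>\<alpha>)"
   using integral_fst'[OF i] by simp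
  also have "... = char_fun \<alpha> y * char_fun \<beta> y"
   unfolding char_fun_def by simp
  finally show ?thesis .
 qed
 ultimately show ?thesis by blast
qed

lemma convolution_distribution_family:
 fixes \<mu> :: "'i => 'a::{topological_ab_group_add,second_countable_topology} measure"
 assumes "finite A" "\<And>i. i \<in> A ==> \<exists>\<nu>\<in>distributions. \<forall>y. char_fun \<nu> y = f i y"
  and "\<exists>\<nu>\<in>distributions. \<forall>y. char_fun (\<nu> :: 'a measure) y = g y"
 shows "\<exists>\<nu>\<in>distributions. \<forall>y. char_fun (\<nu> :: 'a measure) y = g y * (\<Prod>i\<in>A. f i y)"
 using assms(1,2)
proof (induction A rule: finite_induct)
 case empty
 thus ?case using assms(3) by simp
next
 case (insert i A)
 obtain \<nu> where n: "\<nu> \<in> distributions" "\<And>y. char_fun \<nu> y = g y * (\<Prod>i\<in>A. f i y)" using insert by blast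
 obtain \<nu>' where n': "\<nu>' \<in> distributions" "\<And>y. char_fun \<nu>' y = f i y" using insert by blast
 obtain \<rho> where r: "\<rho> \<in> distributions" "\<And>y. char_fun \<rho> y = char_fun \<nu> y * char_fun \<nu>' y"
  using convolution_distribution[OF n(1) n'(1)] by blast
 show ?case using insert(1,2) by (intro bexI[OF _ r(1)]) (simp add: r(2) n(2) n'(2) mult.assoc mult.left_commute mult.commute)
qed

lemma int_eqI_difference:
 fixes u v :: "int => complex"
 assumes "u 0 = v 0" "\<And>k. u (k + 1) - u k = v (k + 1) - v k"
 shows "u k = v k"
proof (induction k rule: int_induct[of _ 0])
 case base thus ?case using assms by simp
next
 case (step1 i) thus ?case using assms(2)[of i] by simp
next
 case (step2 i) thus ?case using assms(2)[of "i - 1"] by simp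
qed

lemma difference_swap_funpow: "(difference h ^^ n) (difference h f) = difference h ((difference h ^^ n) f)"
 by (induction n) auto

lemma newton_interpolation:
 fixes u :: "int => complex"
 assumes "\<And>k. (difference 1 ^^ r) u k = 0"
 shows "u k = (\<Sum>i<r. (of_int k gchoose i) * (difference 1 ^^ i) u 0)"
 using assms
proof (induction r arbitrary: u k)
 case 0 thus ?case by simp
next
 case (Suc r)
 let ?v = "%k. \<Sum>i<Suc r. (of_int k gchoose i) * (difference 1 ^^ i) u 0"
 have IH: "difference 1 u k = (\<Sum>i<r. (of_int k gchoose i) * (difference 1 ^^ (Suc i)) u 0)" for k
  using Suc.IH[of "difference 1 u" k] Suc.prems by (simp add: difference_swap_funpow)
 show ?case
 proof (rule int_eqI_difference[of u ?v])
  show "u 0 = ?v 0"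
   by (subst sum.lessThan_Suc_shift) simp
  fix k
  have g: "(of_int (k + 1) gchoose Suc i) - (of_int k gchoose Suc i) = (of_int k gchoose i :: complex)" for i
   using gbinomial_Suc_Suc[of "of_int k :: complex" i] by (simp add: add.commute)
  have "?v (k + 1) - ?v k = (\<Sum>i<Suc r. ((of_int (k + 1) gchoose i) - (of_int k gchoose i)) * (difference 1 ^^ i) u 0)"
   by (simp only: sum_subtractf[symmetric] left_diff_distrib)
  also have "... = (\<Sum>i<r. (of_int k gchoose i) * (difference 1 ^^ (Suc i)) u 0)"
   by (subst sum.lessThan_Suc_shift) (simp only: g, simp)
  also have "... = u (k + 1) - u k" using IH[of k] by (simp add: difference_def)
  finally show "u (k + 1) - u k = ?v (k + 1) - ?v k" by simp
 qed
qed

lemma ex_gchoose_poly: "\<exists>p::complex poly. degree p <= i \<and> (\<forall>x. poly p x = x gchoose i)"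
proof (intro exI conjI allI)
 let ?p = "smult (1 / fact i) (\<Prod>j<i. [:- of_nat j, 1:]) :: complex poly"
 show "degree ?p <= i"
 proof -
  have "degree (\<Prod>j<i. [:- of_nat j, 1:] :: complex poly) <= (\<Sum>j<i. 1)"
   by (rule order_trans[OF degree_prod_sum_le]) auto
  thus ?thesis using degree_smult_le order_trans by fastforce
 qed
 show "poly ?p x = x gchoose i" for x
  by (simp add: poly_prod gbinomial_prod_rev lessThan_atLeast0)
qed

lemma difference_along_multiples:
 fixes G :: "'g::ab_group_add => complex"
 shows "(difference 1 ^^ i) (%k. G (zmult k h)) k = (difference h ^^ i) G (zmult k h)"
proof (induction i arbitrary: k)
 case 0 thus ?case by simp
next
 case (Suc i)
 thus ?case by (simp add: difference_def zmult_succ)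
qed

text \<open>Newton's formula; integer arguments of both signs are needed to exploit evenness.\<close>
lemma polynomial_along_multiples:
 fixes G :: "'g::ab_group_add => complex"
 assumes "\<And>z. (difference h ^^ r) G z = 0"
 shows "\<exists>p. degree p <= r \<and> (\<forall>k. poly p (of_int k) = G (zmult k h))"
proof -
 obtain b where b: "\<And>i. degree (b i :: complex poly) <= i" "\<And>i x. poly (b i) x = x gchoose i"
  using ex_gchoose_poly by metis
 let ?u = "%k. G (zmult k h)"
 let ?p = "\<Sum>i<r. smult ((difference 1 ^^ i) ?u 0) (b i)"
 have "degree ?p <= r"
  by (intro degree_sum_le) (auto intro: order_trans[OF degree_smult_le] order_trans[OF b(1)])
 moreover have "poly ?p (of_int k) = G (zmult k h)" for k
  using newton_interpolation[of r ?u k] assms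
  by (simp add: poly_sum b(2) difference_along_multiples mult.commute)
 ultimately show ?thesis by blast
qed

definition lagrange_basis :: "nat => nat => complex poly" where
 "lagrange_basis r i = (\<Prod>j\<in>{..r} - {i}. smult (1 / (of_nat i - of_nat j)) [:- of_nat j, 1:])"

lemma lagrange_basis_degree: assumes "i <= r" shows "degree (lagrange_basis r i) <= r"
proof -
 have "degree (lagrange_basis r i) <= (\<Sum>j\<in>{..r} - {i}. 1)"
  unfolding lagrange_basis_def by (rule order_trans[OF degree_prod_sum_le]) (auto intro!: sum_mono order_trans[OF degree_smult_le])
 thus ?thesis using assms by simp
qed

lemma poly_lagrange_basis:
 assumes "i <= r" "m <= r" shows "poly (lagrange_basis r i) (of_nat m) = (if i = m then 1 else 0)"
 using assms
 by (auto simp: lagrange_basis_def poly_prod diff_divide_distrib[symmetric] intro!: prod.neutral)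

lemma lagrange_interpolation:
 assumes "degree p <= r"
 shows "p = (\<Sum>i\<le>r. smult (poly p (of_nat i)) (lagrange_basis r i))"
proof (rule poly_eqI_degree[of "of_nat ` {..r}"])
 let ?q = "(\<Sum>i\<le>r. smult (poly p (of_nat i)) (lagrange_basis r i))"
 have c: "card (of_nat ` {..r} :: complex set) = Suc r" by (simp add: card_image inj_on_def)
 have "degree ?q <= r"
  by (intro degree_sum_le) (auto intro: order_trans[OF degree_smult_le] lagrange_basis_degree)
 thus "degree ?q < card (of_nat ` {..r} :: complex set)" using c by simp
 show "degree p < card (of_nat ` {..r} :: complex set)" using c assms by simp
 fix x :: complex assume "x \<in> of_nat ` {..r}"
 then obtain m where m: "x = of_nat m" "m <= r" by blast
 have "poly ?q x = (\<Sum>i\<le>r. if i = m then poly p (of_nat i) else 0)"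
  unfolding poly_sum m(1) by (rule sum.cong) (auto simp: poly_lagrange_basis m(2))
 thus "poly p x = poly ?q x" using m by simp
qed

text \<open>Lagrange interpolation expresses the coefficients by finitely many values.\<close>
lemma coeff_tendsto_of_values:
 fixes W :: "nat => complex poly"
 assumes deg: "\<And>n. degree (W n) <= r" and lim: "\<And>m. (%n. poly (W n) (of_nat m)) \<longlonglongrightarrow> w m"
 shows "\<exists>V. degree V <= r \<and> (\<forall>k. (%n. coeff (W n) k) \<longlonglongrightarrow> coeff V k)"
proof (intro exI conjI allI)
 let ?V = "\<Sum>i\<le>r. smult (w i) (lagrange_basis r i)"
 show "degree ?V <= r"
  by (intro degree_sum_le) (auto intro: order_trans[OF degree_smult_le] lagrange_basis_degree)
 fix k
 have "coeff (W n) k = (\<Sum>i\<le>r. poly (W n) (of_nat i) * coeff (lagrange_basis r i) k)" for n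
  by (subst lagrange_interpolation[OF deg[of n]]) (simp add: coeff_sum)
 hence "(%n. coeff (W n) k) = (%n. \<Sum>i\<le>r. poly (W n) (of_nat i) * coeff (lagrange_basis r i) k)" by (rule ext)
 moreover have "(%n. \<Sum>i\<le>r. poly (W n) (of_nat i) * coeff (lagrange_basis r i) k) \<longlonglongrightarrow> (\<Sum>i\<le>r. w i * coeff (lagrange_basis r i) k)"
  by (intro tendsto_intros lim)
 ultimately show "(%n. coeff (W n) k) \<longlonglongrightarrow> coeff ?V k" by (simp add: coeff_sum)
qed


section \<open>Rescaled even polynomials\<close>

lemma poly_tendsto_of_coeff:
 fixes W :: "nat => complex poly"
 assumes "\<And>n. degree (W n) <= r" "degree V <= r" "\<And>k. (%n. coeff (W n) k) \<longlonglongrightarrow> coeff V k"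
 shows "(%n. poly (W n) x) \<longlonglongrightarrow> poly V x"
proof -
 have e: "poly p x = (\<Sum>k\<le>r. coeff p k * x ^ k)" if "degree p <= r" for p :: "complex poly"
  unfolding poly_altdef using that
  by (intro sum.mono_neutral_left) (auto simp: coeff_eq_0)
 show ?thesis
  unfolding e[OF assms(1)] e[OF assms(2)] by (intro tendsto_intros assms(3))
qed

lemma even_poly_coeff_1:
 fixes p :: "complex poly"
 assumes "\<And>k. poly p (of_int k) = poly p (of_int (- k))"
 shows "coeff p 1 = 0"
proof -
 let ?q = "pcompose p [:0, -1:]"
 have "p = ?q"
 proof (rule ccontr)
  assume "p \<noteq> ?q"
  hence "finite {x. poly (p - ?q) x = 0}" by (intro poly_roots_finite) simp
  moreover have "range (of_int :: int => complex) \<subseteq> {x. poly (p - ?q) x = 0}"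
   using assms by (auto simp: poly_pcompose)
  ultimately have "finite (range (of_int :: int => complex))" using finite_subset by blast
  thus False using finite_imageD[of "of_int :: int => complex" UNIV] by (simp add: inj_def infinite_UNIV_int)
 qed
 hence "coeff p 1 = coeff ?q 1" by simp
 thus ?thesis by (simp add: coeff_pcompose_linear)
qed

text \<open>The polynomials W n take the value G(k y) at k / N, so their values at integers converge and with them
all coefficients. Evenness and G 0 = 0 kill the coefficients of order 0 and 1, which leaves a factor
1 / N^2 at the argument 1 / N.\<close>
lemma even_polynomial_scaling_limit:
 fixes G :: "'g::ab_group_add => complex" and N :: "nat => nat"
 assumes D: "\<And>h z. (difference h ^^ r) G z = 0"
  and G: "\<And>z. G (- z) = G z" "G 0 = 0" and N: "\<And>n. 1 <= N n"
  and lim: "\<And>m::nat. (%n. G (zmult (int m * int (N n)) (y n))) \<longlonglongrightarrow> w m"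
 shows "\<exists>W V C. (\<forall>n k. poly (W n) (of_int k / of_nat (N n)) = G (zmult k (y n))) \<and>
  (\<forall>x. (%n. poly (W n) x) \<longlonglongrightarrow> poly V x) \<and> (\<forall>n. norm (G (y n)) <= C / (real (N n))^2)"
proof -
 have "\<forall>n. \<exists>p. degree p <= r \<and> (\<forall>k. poly p (of_int k) = G (zmult k (y n)))"
  using polynomial_along_multiples[OF D] by blast
 then obtain p where p: "\<And>n. degree (p n) <= r" "\<And>n k. poly (p n) (of_int k) = G (zmult k (y n))"
  by metis
 define W where "W n = pcompose (p n) [:0, of_nat (N n):]" for n
 have W: "poly (W n) (of_int k / of_nat (N n)) = G (zmult k (y n))" for n k
  using N[of n] p(2)[of n k] by (simp add: W_def poly_pcompose)
 have dW: "degree (W n) <= r" for n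
  unfolding W_def using p(1)[of n] degree_pcompose_le[of "p n" "[:0, of_nat (N n):]"]
  by (auto split: if_splits)
 have lW: "(%n. poly (W n) (of_nat m)) \<longlonglongrightarrow> w m" for m
 proof -
  have "poly (W n) (of_nat m) = G (zmult (int m * int (N n)) (y n))" for n
   using W[of n "int m * int (N n)"] N[of n] by simp
  thus ?thesis using lim[of m] by simp
 qed
 have "\<exists>V. degree V <= r \<and> (\<forall>k. (%n. coeff (W n) k) \<longlonglongrightarrow> coeff V k)"
  by (rule coeff_tendsto_of_values) (rule dW, rule lW)
 then obtain V where V: "degree V <= r" "\<forall>k. (%n. coeff (W n) k) \<longlonglongrightarrow> coeff V k" by (elim exE conjE)
 have "\<forall>k. \<exists>B. \<forall>n. norm (coeff (W n) k) <= B"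
 proof
  fix k
  have "Bseq (%n. coeff (W n) k)" using V(2) by (intro convergent_imp_Bseq) (auto simp: convergent_def)
  thus "\<exists>B. \<forall>n. norm (coeff (W n) k) <= B" unfolding Bseq_def by auto
 qed
 then obtain B where B: "\<And>k n. norm (coeff (W n) k) <= B k" by metis
 have c1: "coeff (W n) 1 = 0" for n
 proof -
  have "coeff (p n) 1 = 0"
   by (rule even_poly_coeff_1) (simp only: p(2) zmult_minus_left G(1))
  thus ?thesis by (simp add: W_def coeff_pcompose_linear)
 qed
 have c0: "coeff (W n) 0 = 0" for n
  using W[of n 0] G(2) by (simp add: poly_0_coeff_0)
 have "norm (G (y n)) <= (\<Sum>k\<le>r. B k) / (real (N n))^2" for n
 proof -
  define x :: complex where "x = 1 / of_nat (N n)"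
  have nx: "norm x = 1 / real (N n)" by (simp add: x_def norm_divide)
  have x1: "norm x <= 1" using N[of n] by (simp add: nx)
  have "G (y n) = poly (W n) x" using W[of n 1] by (simp add: x_def)
  also have "... = (\<Sum>k\<le>r. coeff (W n) k * x ^ k)"
   unfolding poly_altdef using dW by (intro sum.mono_neutral_left) (auto simp: coeff_eq_0)
  finally have "norm (G (y n)) <= (\<Sum>k\<le>r. norm (coeff (W n) k * x ^ k))" by (simp add: norm_sum)
  also have "... <= (\<Sum>k\<le>r. B k * (norm x)^2)"
  proof (rule sum_mono)
   fix k
   have B0: "0 <= B k" using B[of n k] norm_ge_zero order_trans by blast
   show "norm (coeff (W n) k * x ^ k) <= B k * (norm x)^2"
   proof (cases "k = 0 \<or> k = 1")
    case True thus ?thesis using c0 c1 B0 by auto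
   next
    case False
    hence "norm x ^ k <= norm x ^ 2" using x1 by (intro power_decreasing) auto
    thus ?thesis unfolding norm_mult norm_power by (intro mult_mono B B0) auto
   qed
  qed
  also have "... = (\<Sum>k\<le>r. B k) / (real (N n))^2" by (simp add: sum_distrib_right[symmetric] sum_divide_distrib[symmetric] nx power_divide)
  finally show ?thesis .
 qed
 moreover have "(%n. poly (W n) x) \<longlonglongrightarrow> poly V x" for x
  by (rule poly_tendsto_of_coeff[OF dW V(1)]) (use V(2) in blast)
 ultimately show ?thesis using W by blast
qed


section \<open>Approximate division of characters\<close>

text \<open>The argument in [- \<pi>, \<pi>]; the clipping makes it measurable on the whole plane.\<close>
definition angle :: "complex => real" where
 "angle w = (if 0 <= Im w then 1 else -1) * arccos (max (-1) (min 1 (Re w)))"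

lemma angle_measurable [measurable]: "angle \<in> borel_measurable borel"
proof -
 have "continuous_on UNIV (%w. arccos (max (-1) (min 1 (Re w))))"
  by (intro continuous_intros) auto
 hence [measurable]: "(%w. arccos (max (-1) (min 1 (Re w)))) \<in> borel_measurable borel"
  by (rule borel_measurable_continuous_onI)
 show ?thesis unfolding angle_def by measurable
qed

lemma angle_unit:
 assumes "norm w = 1"
 shows "exp (\<i> * of_real (angle w)) = w" "(angle w)^2 <= 4 * (norm (w - 1))^2"
proof -
 have r: "\<bar>Re w\<bar> <= 1" using abs_Re_le_cmod[of w] assms by simp
 have sq: "(Re w)^2 + (Im w)^2 = 1" using assms by (simp add: cmod_power2[symmetric])
 define a where "a = arccos (Re w)"
 have a: "0 <= a" "a <= pi" "cos a = Re w"
  using r arccos[of "Re w"] by (auto simp: a_def)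
 have sa: "sin a = \<bar>Im w\<bar>"
 proof -
  have "sin a = sqrt (1 - (Re w)^2)" unfolding a_def using r by (intro sin_arccos_abs) auto
  also have "1 - (Re w)^2 = (Im w)^2" using sq by simp
  finally show ?thesis by simp
 qed
 have an: "angle w = (if 0 <= Im w then a else - a)"
  using r by (auto simp: angle_def a_def max_def min_def)
 have "cis (angle w) = w" using a(3) sa an by (auto simp: complex_eq_iff)
 thus "exp (\<i> * of_real (angle w)) = w" by (simp add: cis_conv_exp)
 have p: "0 <= a / 2" "a / 2 <= 8/5" using a pi_less_4 pi_approx by auto
 have "\<bar>sin (a/2) - (\<Sum>k<3. sin_coeff k * (a/2) ^ k)\<bar> <= inverse (fact 3) * \<bar>a/2\<bar> ^ 3"
  by (rule Maclaurin_sin_bound)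
 moreover have "(\<Sum>k<3. sin_coeff k * (a/2) ^ k) = a / 2"
  by (simp add: sin_coeff_def eval_nat_numeral)
 ultimately have *: "\<bar>sin (a/2) - a/2\<bar> <= inverse (fact 3) * \<bar>a/2\<bar> ^ 3" by (simp only:)
 hence b: "sin (a/2) \<ge> a/2 - (a/2)^3 / 6"
 proof -
  have "a/2 - sin (a/2) <= \<bar>sin (a/2) - a/2\<bar>" by linarith
  also have "... <= (a/2)^3 / 6" using * p(1) by (simp add: fact_numeral)
  finally show ?thesis by linarith
 qed
 have "(a/2)^2 <= (8/5)^2" using p by (intro power_mono) auto
 hence "(a/2) * (a/2)^2 <= (a/2) * 3" using p(1) by (intro mult_left_mono) (auto simp: power2_eq_square)
 hence "(a/2)^3 / 6 <= a/4" by (simp add: power3_eq_cube power2_eq_square)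
 hence "a/4 <= sin (a/2)" using b by simp
 hence "(a/4)^2 <= (sin (a/2))^2" using a(1) by (intro power_mono) auto
 moreover have "cos a = 1 - 2 * (sin (a/2))^2" using cos_double_sin[of "a/2"] by simp
 moreover have "(norm (w - 1))^2 = 2 - 2 * cos a" using norm_diff_sq_unit[OF assms, of 1] a(3) by simp
 ultimately have "a^2 <= 4 * (norm (w - 1))^2" by (simp add: power_divide)
 thus "(angle w)^2 <= 4 * (norm (w - 1))^2" using an by auto
qed

text \<open>This is where torsion-freeness is used.\<close>
lemma multiples_separating:
 fixes N :: int
 assumes lc: "locally_compact_space (euclidean :: 'a::{topological_ab_group_add,t2_space} topology)"
  and tf: "torsion_free TYPE('a)" and "N \<noteq> 0"
 shows "separating_subgroup (range (zmult N :: 'a character => 'a character))"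
 unfolding separating_subgroup_def
proof (intro conjI ballI allI impI)
 show "0 \<in> range (zmult N :: 'a character => 'a character)" by (rule range_eqI[of _ _ 0]) simp
 fix h :: "'a character" assume "h \<in> range (zmult N)"
 thus "- h \<in> range (zmult N)" by (auto simp: zmult_minus_right[symmetric])
next
 fix g h :: "'a character" assume "g \<in> range (zmult N)" "h \<in> range (zmult N)"
 thus "g + h \<in> range (zmult N)" by (auto simp: zmult_add_right[symmetric])
next
 fix x :: 'a assume "x \<noteq> 0"
 hence "zmult N x \<noteq> 0" using tf `N \<noteq> 0` by (auto simp: torsion_free_def)
 from characters_separate[OF lc this] obtain z where "char_app z (zmult N x) \<noteq> 1" .
 hence "char_app (zmult N z) x \<noteq> 1" by (simp add: char_zmult_left char_zmult_right)
 thus "\<exists>h\<in>range (zmult N). char_app h x \<noteq> 1" by blast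
qed

lemma multiples_dense_L2:
 fixes N :: int and \<mu> :: "'i => 'a::{topological_ab_group_add,t2_space,second_countable_topology} measure"
 assumes lc: "locally_compact_space (euclidean :: 'a topology)"
  and tf: "torsion_free TYPE('a)" and "N \<noteq> 0"
  and J: "finite J" "\<And>j. j \<in> J ==> \<mu> j \<in> distributions" and "0 < e"
 shows "\<exists>z. \<forall>j\<in>J. char_dist2 (\<mu> j) (zmult N z) y <= e"
proof -
 obtain z where z: "(\<Sum>j\<in>J. LINT x|(\<mu> j). (norm (char_app (zmult N z) x - char_app y x))^2) <= e"
  using separating_subgroup_dense_L2[OF lc multiples_separating[OF lc tf `N \<noteq> 0`] J(1) _ `0 < e`, where y = y and \<mu> = \<mu>] J(2) by blast
 have "char_dist2 (\<mu> j) (zmult N z) y <= e" if "j \<in> J" for j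
 proof -
  have "char_dist2 (\<mu> j) (zmult N z) y <= (\<Sum>j\<in>J. char_dist2 (\<mu> j) (zmult N z) y)"
   using J(1) that char_dist2_nonneg by (intro member_le_sum) auto
  thus ?thesis using z by (simp add: char_dist2_def)
 qed
 thus ?thesis by blast
qed

lemma L2_limit:
 fixes \<mu> :: "'a::topological_ab_group_add measure"
 assumes "\<mu> \<in> distributions" "(%n. char_dist2 \<mu> (z n) y) \<longlonglongrightarrow> 0"
 shows "(%n. char_fun \<mu> (z n)) \<longlonglongrightarrow> char_fun \<mu> y"
proof (rule LIM_zero_cancel, rule tendsto_norm_zero_cancel, rule tendsto_sandwich[OF _ _ tendsto_const])
 show "\<forall>\<^sub>F n in sequentially. norm (char_fun \<mu> (z n) - char_fun \<mu> y) <= sqrt (char_dist2 \<mu> (z n) y)"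
  by (intro always_eventually allI real_le_rsqrt char_fun_lipschitz[OF assms(1)])
 show "(%n. sqrt (char_dist2 \<mu> (z n) y)) \<longlonglongrightarrow> 0" using tendsto_real_sqrt[OF assms(2)] by simp
qed auto

lemma L2_limit_zmult:
 fixes \<mu> :: "'a::topological_ab_group_add measure"
 assumes mu: "\<mu> \<in> distributions" and lim: "(%n. char_dist2 \<mu> (z n) y) \<longlonglongrightarrow> 0"
 shows "(%n. char_fun \<mu> (zmult m (z n))) \<longlonglongrightarrow> char_fun \<mu> (zmult m y)"
proof (rule L2_limit[OF mu], rule tendsto_sandwich[OF _ _ tendsto_const])
 show "\<forall>\<^sub>F n in sequentially. char_dist2 \<mu> (zmult m (z n)) (zmult m y) <= (real_of_int m)^2 * char_dist2 \<mu> (z n) y"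
  by (intro always_eventually allI char_dist2_zmult_le mu)
 show "(%n. (real_of_int m)^2 * char_dist2 \<mu> (z n) y) \<longlonglongrightarrow> 0" using tendsto_mult_right_zero[OF lim] by simp
qed (simp add: char_dist2_nonneg)

lemma dense_L2_sequences:
 fixes \<mu> :: "'i => 'a::{topological_ab_group_add,t2_space,second_countable_topology} measure" and N :: "nat => int"
 assumes lc: "locally_compact_space (euclidean :: 'a topology)" and tf: "torsion_free TYPE('a)"
  and J: "finite J" "\<And>j. j \<in> J ==> \<mu> j \<in> distributions" and N: "\<And>n. N n \<noteq> 0"
 shows "\<exists>z. \<forall>j\<in>J. (%n. char_dist2 (\<mu> j) (zmult (N n) (z n)) y) \<longlonglongrightarrow> 0"
proof -
 have "\<exists>z. \<forall>j\<in>J. char_dist2 (\<mu> j) (zmult (N n) z) y <= 1 / real (Suc n)" for n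
  by (rule multiples_dense_L2[OF lc tf N J(1)]) (use J(2) in auto)
 hence "\<forall>n. \<exists>z. \<forall>j\<in>J. char_dist2 (\<mu> j) (zmult (N n) z) y <= 1 / real (Suc n)" by blast
 then obtain z where z: "\<forall>n. \<forall>j\<in>J. char_dist2 (\<mu> j) (zmult (N n) (z n)) y <= 1 / real (Suc n)" by metis
 have "(%n. char_dist2 (\<mu> j) (zmult (N n) (z n)) y) \<longlonglongrightarrow> 0" if "j \<in> J" for j
  by (rule tendsto_sandwich[OF _ _ tendsto_const LIMSEQ_Suc[OF lim_1_over_n]])
   (use z that in \<open>auto simp: char_dist2_nonneg\<close>)
 thus ?thesis by blast
qed

lemma dense_L2_sequence:
 fixes \<mu> :: "'a::{topological_ab_group_add,t2_space,second_countable_topology} measure" and N :: "nat => int"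
 assumes "locally_compact_space (euclidean :: 'a topology)" "torsion_free TYPE('a)"
  and "\<mu> \<in> distributions" "\<And>n. N n \<noteq> 0"
 shows "\<exists>z. (%n. char_dist2 \<mu> (zmult (N n) (z n)) y) \<longlonglongrightarrow> 0"
 using dense_L2_sequences[OF assms(1,2), of "{()}" "%_. \<mu>" N y] assms(3,4) by auto

lemma tight_of_second_moments:
 assumes rd: "\<And>n. real_distribution (P n)" and "0 <= B"
  and tail: "\<And>n R. 0 < R ==> measure (P n) {u. R <= \<bar>u\<bar>} <= B / R^2"
 shows "tight P"
 unfolding tight_def
proof (intro conjI allI impI rd)
 fix e :: real assume "0 < e"
 define R where "R = sqrt ((B + 1) / e) + 1"
 have s: "0 < (B + 1) / e" using `0 < e` `0 <= B` by simp
 have R: "0 < R" using s by (simp add: R_def add_pos_pos)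
 have "(B + 1) / e < R^2" using s by (simp add: R_def power2_sum add_pos_pos)
 hence BR: "B / R^2 < e" using `0 < e` R `0 <= B` by (simp add: field_simps)
 have "1 - e < measure (P n) {- R<..R}" for n
 proof -
  interpret real_distribution "P n" by (rule rd)
  have "{u. R <= \<bar>u\<bar>} \<in> events" by measurable
  hence "measure (P n) (- {u. R <= \<bar>u\<bar>}) = 1 - measure (P n) {u. R <= \<bar>u\<bar>}"
   using prob_compl[of "{u. R <= \<bar>u\<bar>}"] by (simp add: Compl_eq_Diff_UNIV)
  moreover have "measure (P n) (- {u. R <= \<bar>u\<bar>}) <= measure (P n) {- R<..R}"
   by (rule finite_measure_mono) auto
  ultimately show ?thesis using tail[OF R, of n] BR by linarith
 qed
 thus "\<exists>a b. a < b \<and> (\<forall>n. 1 - e < measure (P n) {a<..b})"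
  using R by (intro exI[of _ "- R"] exI[of _ R]) auto
qed

text \<open>The characteristic function of the law at k / N is computed by \<alpha>^ at k y. The second moment is at most
4 N^2 times the mean of |y - c|^2, which is the left-hand side of the last assumption.\<close>
lemma angle_law:
 fixes \<alpha> :: "'a::topological_ab_group_add measure" and N :: nat
 assumes A: "\<alpha> \<in> distributions" and c: "norm c = 1" and "1 <= N"
  and bd: "2 - 2 * Re (cnj c * char_fun \<alpha> y) <= B / (real N)^2"
 shows "\<exists>P. real_distribution P \<and>
  (\<forall>k. char P (real_of_int k / real N) = (cnj c) powi k * char_fun \<alpha> (zmult k y)) \<and>
  (\<forall>R>0. measure P {u. R <= \<bar>u\<bar>} <= 4 * B / R^2)"
proof -
 interpret prob_space \<alpha> by (rule distributionsD(1)[OF A])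
 let ?U = "%x. real N * angle (char_app y x * cnj c)"
 have nw: "norm (char_app y x * cnj c) = 1" for x using c by (simp add: norm_mult)
 have "?U \<in> borel_measurable borel" by measurable
 hence U: "?U \<in> \<alpha> \<rightarrow>\<^sub>M borel" using measurable_cong_sets[OF distributionsD(2)[OF A] refl] by blast
 let ?P = "distr \<alpha> borel ?U"
 have rd: "real_distribution ?P" by (rule real_distribution_distr[OF U])
 have "char ?P (real_of_int k / real N) = (cnj c) powi k * char_fun \<alpha> (zmult k y)" for k
 proof -
  have e: "iexp (real_of_int k / real N * ?U x) = (cnj c) powi k * char_app (zmult k y) x" for x
  proof -
   have "iexp (real_of_int k / real N * ?U x) = exp (\<i> * of_real (angle (char_app y x * cnj c))) powi k"
    using `1 <= N` unfolding exp_power_int by (simp add: field_simps)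
   also have "... = (char_app y x * cnj c) powi k" by (simp only: angle_unit(1)[OF nw])
   finally show ?thesis by (simp add: power_int_mult_distrib char_zmult_left mult.commute)
  qed
  have "char ?P (real_of_int k / real N) = (LINT x|\<alpha>. iexp (real_of_int k / real N * ?U x))"
   unfolding char_def by (subst integral_distr[OF U]) auto
  also have "... = (LINT x|\<alpha>. (cnj c) powi k * char_app (zmult k y) x)" by (simp only: e)
  finally show ?thesis by (simp add: char_fun_def)
 qed
 moreover have "measure ?P {u. R <= \<bar>u\<bar>} <= 4 * B / R^2" if "0 < R" for R
 proof -
  let ?f = "%x. (norm (char_app y x - c))^2"
  have U2: "(?U x)^2 <= 4 * (real N)^2 * ?f x" for x
  proof -
   have "char_app y x * cnj c - 1 = (char_app y x - c) * cnj c"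
    using c by (simp add: algebra_simps complex_norm_square[symmetric])
   hence "norm (char_app y x * cnj c - 1) = norm (char_app y x - c)" using c by (simp add: norm_mult)
   hence "(angle (char_app y x * cnj c))^2 <= 4 * ?f x" using angle_unit(2)[OF nw[of x]] by simp
   from mult_left_mono[OF this, of "(real N)^2"] show ?thesis by (simp add: power_mult_distrib)
  qed
  have if2: "integrable \<alpha> ?f" by (rule char_dist2_integrable[OF A]) (use c in auto)
  have "measure ?P {u. R <= \<bar>u\<bar>} = measure \<alpha> {x\<in>space \<alpha>. R <= \<bar>?U x\<bar>}"
   by (subst measure_distr[OF U]) (auto simp: vimage_def Int_def conj_commute)
  also have "... <= measure \<alpha> {x\<in>space \<alpha>. R^2 / (4 * (real N)^2) <= ?f x}"
  proof (rule finite_measure_mono)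
   show "{x\<in>space \<alpha>. R <= \<bar>?U x\<bar>} \<subseteq> {x\<in>space \<alpha>. R^2 / (4 * (real N)^2) <= ?f x}"
   proof clarify
    fix x assume "R <= \<bar>?U x\<bar>"
    from power_mono[OF this, of 2] have "R^2 <= (?U x)^2" using that by (simp only: power2_abs)
    also have "... <= 4 * (real N)^2 * ?f x" by (rule U2)
    finally show "R^2 / (4 * (real N)^2) <= ?f x" using `1 <= N` by (simp add: field_simps)
   qed
   show "{x\<in>space \<alpha>. R^2 / (4 * (real N)^2) <= ?f x} \<in> sets \<alpha>"
    using if2 by measurable
  qed
  also have "... <= (LINT x|\<alpha>. ?f x) / (R^2 / (4 * (real N)^2))"
   by (rule integral_Markov_inequality_measure[OF if2, where A = "{}"]) (use that `1 <= N` in auto)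
  also have "... <= (B / (real N)^2) / (R^2 / (4 * (real N)^2))"
   using bd by (intro divide_right_mono) (simp_all add: integral_char_minus_const[OF A c])
  also have "... = 4 * B / R^2" using `1 <= N` that by (simp add: field_simps)
  finally show ?thesis .
 qed
 ultimately show ?thesis using rd by blast
qed


section \<open>Convolution factors along the multiples of a character\<close>

lemma angle_laws:
 fixes \<alpha> :: "'a::topological_ab_group_add measure" and N :: "nat => nat"
 assumes "\<alpha> \<in> distributions" "\<And>n. norm (c n) = 1" "\<And>n. 1 <= N n"
  and "\<And>n. 2 - 2 * Re (cnj (c n) * char_fun \<alpha> (z n)) <= B / (real (N n))^2" "0 <= B"
 shows "\<exists>P. (\<forall>n. real_distribution (P n)) \<and> tight P \<and>
  (\<forall>n k. char (P n) (real_of_int k / real (N n)) = (cnj (c n)) powi k * char_fun \<alpha> (zmult k (z n)))"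
proof -
 have "\<forall>n. \<exists>P. real_distribution P \<and>
  (\<forall>k. char P (real_of_int k / real (N n)) = (cnj (c n)) powi k * char_fun \<alpha> (zmult k (z n))) \<and>
  (\<forall>R>0. measure P {u. R <= \<bar>u\<bar>} <= 4 * B / R^2)"
  using angle_law[OF assms(1-4)] by blast
 then obtain P where P: "\<And>n. real_distribution (P n)"
  "\<And>n k. char (P n) (real_of_int k / real (N n)) = (cnj (c n)) powi k * char_fun \<alpha> (zmult k (z n))"
  "\<And>n R. 0 < R ==> measure (P n) {u. R <= \<bar>u\<bar>} <= 4 * B / R^2" by metis
 have "tight P" by (rule tight_of_second_moments[where B = "4 * B"]) (use P assms(5) in auto)
 thus ?thesis using P(1,2) by blast
qed

lemma rational_eventually_multiple:
 assumes "t \<in> \<rat>"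
 shows "\<forall>\<^sub>F n in sequentially. \<exists>k. t = real_of_int k / real (fact n)"
proof -
 obtain a b where ab: "b > 0" "t = real_of_int a / real_of_int b"
  using assms by (metis Rats_cases' of_int_eq_iff)
 define q where "q = nat b"
 have q: "0 < q" "t = real_of_int a / real q" using ab by (auto simp: q_def)
 have "\<exists>k. t = real_of_int k / real (fact n)" if "q <= n" for n
 proof -
  have "q dvd fact n" using q that by (intro dvd_fact) auto
  then obtain c where c: "fact n = q * c" by blast
  have "c \<noteq> 0" using c by (metis fact_nonzero mult_0_right)
  hence "t = real_of_int (a * int c) / real (fact n)" using q by (simp only: c) simp
  thus ?thesis by blast
 qed
 thus ?thesis unfolding eventually_sequentially by blast
qed

lemma continuous_eq_on_rationals:
 fixes f h :: "real => complex"
 assumes "continuous_on UNIV f" "continuous_on UNIV h" "\<And>t. t \<in> \<rat> ==> f t = h t"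
 shows "f t = h t"
proof -
 have "closed {t. f t = h t}" by (rule closed_Collect_eq) (use assms in auto)
 moreover have "\<rat> \<subseteq> {t. f t = h t}" using assms(3) by blast
 ultimately have "closure \<rat> \<subseteq> {t. f t = h t}" by (rule closure_minimal[rotated])
 thus ?thesis unfolding Rats_closure_real by blast
qed

text \<open>With n! y'_n close to y, centre the angle of y'_n under \<alpha> by the direction c of \<alpha>^(y'_n), and under \<beta> by
its conjugate: since \<alpha>^ \<beta>^ is positive, this is the direction of \<beta>^. Boundedness of n!^2 G(y'_n) makes
both rescaled angles tight. The product of the limiting characteristic functions is exp of a polynomial
at every rational t, because n! t is an integer for large n.\<close>
theorem gaussian_on_multiples:
 fixes \<alpha> \<beta> :: "'a::{topological_ab_group_add,t2_space,second_countable_topology} measure"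
  and y :: "'a character"
 assumes lc: "locally_compact_space (euclidean :: 'a topology)" and tf: "torsion_free TYPE('a)"
  and A: "\<alpha> \<in> distributions" and B: "\<beta> \<in> distributions"
  and prod: "\<And>y. char_fun \<alpha> y * char_fun \<beta> y = exp (- complex_of_real (g y))"
  and D: "\<And>h z. (difference h ^^ r) (%y. complex_of_real (g y)) z = 0"
 shows "\<exists>l s. norm l = 1 \<and> (\<forall>m::nat. char_fun \<alpha> (zmult (int m) y) = l ^ m * exp (- complex_of_real (s * (real m)^2)))"
proof -
 have gln: "g y = - ln (norm (char_fun \<alpha> y * char_fun \<beta> y))" for y
  unfolding prod by simp
 have ngpos: "0 < norm (char_fun \<alpha> y * char_fun \<beta> y)" for y
  unfolding prod by simp
 have g0: "0 <= g y" for y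
 proof -
  have "norm (char_fun \<alpha> y * char_fun \<beta> y) <= 1"
   unfolding norm_mult by (intro mult_le_one char_fun_norm_le A B norm_ge_zero)
  thus ?thesis using ngpos[of y] by (simp only: gln ln_le_zero_iff neg_0_le_iff_le)
 qed
 have geven: "g (- y) = g y" for y unfolding gln by (simp add: char_fun_minus norm_mult)
 have gz: "g 0 = 0" unfolding gln by (simp add: char_fun_0 A B)
 let ?N = "%n. fact n :: nat"
 have N1: "1 <= ?N n" for n by simp
 have "\<exists>z. \<forall>j\<in>UNIV. (%n. char_dist2 (if j then \<alpha> else \<beta>) (zmult (int (?N n)) (z n)) y) \<longlonglongrightarrow> 0"
  by (rule dense_L2_sequences[OF lc tf]) (simp_all add: A B)
 then obtain z where z: "\<forall>j. (%n. char_dist2 (if j then \<alpha> else \<beta>) (zmult (int (?N n)) (z n)) y) \<longlonglongrightarrow> 0" by blast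
 have za: "(%n. char_fun \<alpha> (zmult (m * int (?N n)) (z n))) \<longlonglongrightarrow> char_fun \<alpha> (zmult m y)" for m
  unfolding zmult_mult using z[rule_format, of True] by (intro L2_limit_zmult A) simp
 have zb: "(%n. char_fun \<beta> (zmult (m * int (?N n)) (z n))) \<longlonglongrightarrow> char_fun \<beta> (zmult m y)" for m
  unfolding zmult_mult using z[rule_format, of False] by (intro L2_limit_zmult B) simp
 have glim: "(%n. complex_of_real (g (zmult (m * int (?N n)) (z n)))) \<longlonglongrightarrow> complex_of_real (g (zmult m y))" for m
  unfolding gln using ngpos by (intro tendsto_of_real tendsto_intros za zb) (metis less_irrefl norm_eq_zero)
 have "\<exists>W V C. (\<forall>n k. poly (W n) (of_int k / of_nat (?N n)) = complex_of_real (g (zmult k (z n)))) \<and>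
  (\<forall>x. (%n. poly (W n) x) \<longlonglongrightarrow> poly V x) \<and> (\<forall>n. norm (complex_of_real (g (z n))) <= C / (real (?N n))^2)"
 proof (rule even_polynomial_scaling_limit[where N = ?N])
  show "(difference h ^^ r) (%y. complex_of_real (g y)) z = 0" for h z by (rule D)
  show "(%n. complex_of_real (g (zmult (int m * int (?N n)) (z n)))) \<longlonglongrightarrow> complex_of_real (g (zmult (int m) y))" for m
   by (rule glim)
 qed (simp_all add: geven gz)
 then obtain W V C where
  W: "\<And>n k. poly (W n) (of_int k / of_nat (?N n)) = complex_of_real (g (zmult k (z n)))" and
  V: "\<And>x. (%n. poly (W n) x) \<longlonglongrightarrow> poly V x" and
  C: "\<And>n. norm (complex_of_real (g (z n))) <= C / (real (?N n))^2"
  by (elim exE conjE) (rule that, auto)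
 have C0: "0 <= C" using C[of 0] norm_ge_zero order_trans by fastforce
 \<comment> \<open>c n is the common centre: the direction of \<alpha>^, and the conjugate of that of \<beta>^.\<close>
 define c where "c n = sgn (char_fun \<alpha> (z n))" for n
 have anz: "char_fun \<alpha> y \<noteq> 0" for y using ngpos[of y] by auto
 have c1: "norm (c n) = 1" for n using anz[of "z n"] by (simp add: c_def norm_sgn)
 have c1': "norm (cnj (c n)) = 1" for n using c1[of n] by simp
 have rho: "1 - C / (real (?N n))^2 <= norm (char_fun \<alpha> (z n) * char_fun \<beta> (z n))" for n
 proof -
  have "g (z n) <= C / (real (?N n))^2" using C[of n] by simp
  moreover have "1 - g (z n) <= exp (- g (z n))" using exp_ge_add_one_self[of "- g (z n)"] by simp
  moreover have "norm (char_fun \<alpha> (z n) * char_fun \<beta> (z n)) = exp (- g (z n))" unfolding prod by simp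
  ultimately show ?thesis by linarith
 qed
 have a_le: "norm (char_fun \<alpha> (z n) * char_fun \<beta> (z n)) <= norm (char_fun \<alpha> (z n))" for n
  using char_fun_norm_le[OF B, of "z n"] by (simp add: norm_mult mult_left_le)
 have ca: "cnj (c n) * char_fun \<alpha> (z n) = complex_of_real (norm (char_fun \<alpha> (z n)))" for n
 proof -
  have "cnj w * w = complex_of_real ((norm w)^2)" for w using complex_norm_square[of w] by (simp add: mult.commute)
  from this[of "char_fun \<alpha> (z n)"] show ?thesis
   using anz[of "z n"] by (simp add: c_def sgn_div_norm scaleR_conv_of_real power2_eq_square mult.assoc)
 qed
 have bda: "2 - 2 * Re (cnj (c n) * char_fun \<alpha> (z n)) <= (2 * C) / (real (?N n))^2" for n
  using rho[of n] a_le[of n] unfolding ca by simp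
 have bdb: "2 - 2 * Re (cnj (cnj (c n)) * char_fun \<beta> (z n)) <= (2 * C) / (real (?N n))^2" for n
 proof -
  have "cnj (cnj (c n)) * char_fun \<beta> (z n) = (char_fun \<alpha> (z n) * char_fun \<beta> (z n)) / complex_of_real (norm (char_fun \<alpha> (z n)))"
   by (simp add: c_def sgn_div_norm scaleR_conv_of_real divide_inverse)
  also have "... = complex_of_real (exp (- g (z n)) / norm (char_fun \<alpha> (z n)))"
   unfolding prod by (simp flip: exp_of_real)
  finally have "Re (cnj (cnj (c n)) * char_fun \<beta> (z n)) = exp (- g (z n)) / norm (char_fun \<alpha> (z n))" by simp
  moreover have "exp (- g (z n)) <= exp (- g (z n)) / norm (char_fun \<alpha> (z n))"
   using char_fun_norm_le[OF A, of "z n"] anz[of "z n"] by (simp add: le_divide_eq mult_left_le)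
  moreover have "norm (char_fun \<alpha> (z n) * char_fun \<beta> (z n)) = exp (- g (z n))" unfolding prod by simp
  ultimately show ?thesis using rho[of n] by simp
 qed
 obtain P where P: "\<And>n. real_distribution (P n)" "tight P"
  "\<And>n k. char (P n) (real_of_int k / real (?N n)) = (cnj (c n)) powi k * char_fun \<alpha> (zmult k (z n))"
  using angle_laws[where c = c and N = ?N and z = z, OF A c1 N1 bda] C0 by auto
 obtain Q where Q: "\<And>n. real_distribution (Q n)" "tight Q"
  "\<And>n k. char (Q n) (real_of_int k / real (?N n)) = (cnj (cnj (c n))) powi k * char_fun \<beta> (zmult k (z n))"
  using angle_laws[where c = "%n. cnj (c n)" and N = ?N and z = z, OF B c1' N1 bdb] C0 by auto
 obtain r1 P' where r1: "strict_mono (r1 :: nat => nat)" "real_distribution P'" "weak_conv_m (P \<circ> id \<circ> r1) P'"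
  using tight_imp_convergent_subsubsequence[OF P(2) strict_mono_id] by blast
 obtain r2 Q' where r2: "strict_mono (r2 :: nat => nat)" "real_distribution Q'" "weak_conv_m (Q \<circ> r1 \<circ> r2) Q'"
  using tight_imp_convergent_subsubsequence[OF Q(2) r1(1)] by blast
 define d where "d n = cnj (c n) ^ ?N n" for n
 have "compact (sphere (0::complex) 1)" by simp
 moreover have "\<forall>n. (d \<circ> r1 \<circ> r2) n \<in> sphere 0 1" using c1 by (simp add: d_def norm_power)
 ultimately obtain w r3 where r3: "w \<in> sphere 0 1" "strict_mono r3" "(d \<circ> r1 \<circ> r2 \<circ> r3) \<longlonglongrightarrow> w"
  unfolding compact_def by blast
 define \<sigma> where "\<sigma> = r1 \<circ> r2 \<circ> r3"
 have s: "strict_mono \<sigma>" unfolding \<sigma>_def using r1(1) r2(1) r3(2) by (intro strict_mono_o)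
 have wl: "(%n. d (\<sigma> n)) \<longlonglongrightarrow> w" using r3(3) by (simp add: \<sigma>_def o_def)
 have cP: "(%n. char (P (\<sigma> n)) t) \<longlonglongrightarrow> char P' t" for t
 proof -
  have "(%n. char ((P \<circ> id \<circ> r1) n) t) \<longlonglongrightarrow> char P' t"
   by (rule levy_continuity1[OF _ r1(2,3)]) (simp add: P(1))
  from LIMSEQ_subseq_LIMSEQ[OF this, of "r2 \<circ> r3"] show ?thesis
   using strict_mono_o[OF r2(1) r3(2)] by (simp add: \<sigma>_def o_def)
 qed
 have cQ: "(%n. char (Q (\<sigma> n)) t) \<longlonglongrightarrow> char Q' t" for t
 proof -
  have "(%n. char ((Q \<circ> r1 \<circ> r2) n) t) \<longlonglongrightarrow> char Q' t"
   by (rule levy_continuity1[OF _ r2(2,3)]) (simp add: Q(1))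
  from LIMSEQ_subseq_LIMSEQ[OF this, of r3] show ?thesis
   using r3(2) by (simp add: \<sigma>_def o_def)
 qed
 have rat: "char P' t * char Q' t = exp (- poly V (complex_of_real t))" if "t \<in> \<rat>" for t
 proof (rule LIMSEQ_unique)
  show "(%n. char (P (\<sigma> n)) t * char (Q (\<sigma> n)) t) \<longlonglongrightarrow> char P' t * char Q' t"
   by (intro tendsto_mult cP cQ)
  have "(%n. exp (- poly (W (\<sigma> n)) (complex_of_real t))) \<longlonglongrightarrow> exp (- poly V (complex_of_real t))"
   by (intro tendsto_exp tendsto_minus) (use LIMSEQ_subseq_LIMSEQ[OF V s] in \<open>simp add: o_def\<close>)
  moreover have "\<forall>\<^sub>F n in sequentially. exp (- poly (W (\<sigma> n)) (complex_of_real t)) = char (P (\<sigma> n)) t * char (Q (\<sigma> n)) t"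
  proof -
   have "exp (- poly (W n) (complex_of_real t)) = char (P n) t * char (Q n) t" if "t = real_of_int k / real (?N n)" for n k
   proof -
    have "char (P n) t * char (Q n) t = (cnj (c n) * cnj (cnj (c n))) powi k * (char_fun \<alpha> (zmult k (z n)) * char_fun \<beta> (zmult k (z n)))"
     unfolding that P(3) Q(3) by (simp add: power_int_mult_distrib)
    also have "cnj (c n) * cnj (cnj (c n)) = 1" using c1[of n] complex_norm_square[of "cnj (c n)"] by simp
    also have "1 powi k * (char_fun \<alpha> (zmult k (z n)) * char_fun \<beta> (zmult k (z n))) = exp (- complex_of_real (g (zmult k (z n))))"
     by (simp add: prod)
    also have "... = exp (- poly (W n) (complex_of_real t))" using W[of n k] that by simp
    finally show ?thesis by simp
   qed
   hence "\<forall>\<^sub>F n in sequentially. exp (- poly (W n) (complex_of_real t)) = char (P n) t * char (Q n) t"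
    using rational_eventually_multiple[OF that] by (auto elim!: eventually_mono)
   from filterlim_subseq[OF s, unfolded filterlim_iff, rule_format, OF this] show ?thesis .
  qed
  ultimately show "(%n. char (P (\<sigma> n)) t * char (Q (\<sigma> n)) t) \<longlonglongrightarrow> exp (- poly V (complex_of_real t))"
   by (rule Lim_transform_eventually)
 qed
 have real: "char P' t * char Q' t = exp (- poly V (complex_of_real t))" for t
 proof (rule continuous_eq_on_rationals[of "%t. char P' t * char Q' t" "%t. exp (- poly V (complex_of_real t))"])
  show "continuous_on UNIV (%t. char P' t * char Q' t)"
   using real_distribution.isCont_char[OF r1(2)] real_distribution.isCont_char[OF r2(2)]
   by (intro continuous_on_mult continuous_at_imp_continuous_on) auto
  show "continuous_on UNIV (%t. exp (- poly V (complex_of_real t)))" by (intro continuous_intros)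
 qed (rule rat)
 from cramer_marcinkiewicz[OF r1(2) r2(2) real] obtain b s' where
  bs: "\<And>t. char P' t = exp (\<i> * complex_of_real (b * t) - complex_of_real (s' * t^2))" by blast
 have fin: "char_fun \<alpha> (zmult (int m) y) = (cnj w * exp (\<i> * complex_of_real b)) ^ m * exp (- complex_of_real (s' * (real m)^2))" for m
 proof -
  have wm: "w ^ m * cnj w ^ m = 1"
   using r3(1) complex_norm_square[of w] by (simp flip: power_mult_distrib)
  have "char (P n) (real m) = d n ^ m * char_fun \<alpha> (zmult (int m * int (?N n)) (z n))" for n
  proof -
   have "cnj (c n) powi (int m * int (?N n)) = cnj (c n) ^ (m * ?N n)"
    by (metis of_nat_mult power_int_of_nat)
   also have "... = d n ^ m" by (simp only: d_def power_mult[symmetric] mult.commute)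
   finally have e: "cnj (c n) powi (int m * int (?N n)) = d n ^ m" .
   have "real_of_int (int m * int (?N n)) / real (?N n) = real m" by simp
   thus ?thesis using P(3)[of n "int m * int (?N n)"] unfolding e by (simp only:)
  qed
  hence "(%n. char (P (\<sigma> n)) (real m)) \<longlonglongrightarrow> w ^ m * char_fun \<alpha> (zmult (int m) y)"
   using LIMSEQ_subseq_LIMSEQ[OF za s, of "int m"] by (simp add: o_def tendsto_mult[OF tendsto_power[OF wl]])
  hence "char P' (real m) = w ^ m * char_fun \<alpha> (zmult (int m) y)" using cP LIMSEQ_unique by blast
  hence "cnj w ^ m * char P' (real m) = char_fun \<alpha> (zmult (int m) y)"
   using wm by (simp add: mult.assoc[symmetric] mult.commute)
  hence "char_fun \<alpha> (zmult (int m) y) = cnj w ^ m * exp (\<i> * complex_of_real (b * real m) - complex_of_real (s' * (real m)^2))"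
   by (simp only: bs)
  also have "exp (\<i> * complex_of_real (b * real m) - complex_of_real (s' * (real m)^2)) =
   exp (\<i> * complex_of_real b) ^ m * exp (- complex_of_real (s' * (real m)^2))"
   by (simp only: exp_of_nat_mult[symmetric] exp_add[symmetric]) (simp add: algebra_simps)
  finally show ?thesis by (simp add: power_mult_distrib mult.assoc)
 qed
 have "norm (cnj w * exp (\<i> * complex_of_real b)) = 1" using r3(1) by (simp add: norm_mult)
 with fin show ?thesis by blast
qed


section \<open>Elimination by finite differences\<close>

lemma difference_add: "difference h (%y. f y + g y) = (%y. difference h f y + difference h g y)"
 by (simp add: difference_def fun_eq_iff)

lemma difference_sum: "difference h (%y. \<Sum>i\<in>A. f i y) = (%y. \<Sum>i\<in>A. difference h (f i) y)"
 by (simp add: difference_def fun_eq_iff sum_subtractf)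

lemma difference_commute: "difference h (difference k f) = difference k (difference h f)"
 by (simp add: difference_def fun_eq_iff algebra_simps)

lemma difference_comp:
 assumes "\<And>y. H (y + h) = H y + H h"
 shows "difference h (%y. f (H y)) = (%y. difference (H h) f (H y))"
 by (simp add: difference_def fun_eq_iff assms)

definition differences :: "'g::ab_group_add list => ('g => complex) => 'g => complex" where
 "differences hs f = foldr difference hs f"

lemma differences_simps [simp]: "differences [] f = f" "differences (h # hs) f = difference h (differences hs f)"
 by (simp_all add: differences_def)

lemma differences_append: "differences (xs @ ys) f = differences xs (differences ys f)"
 by (simp add: differences_def)

lemma differences_replicate: "differences (replicate n h) f = (difference h ^^ n) f"
 by (induction n) auto

lemma differences_commute: "differences hs (difference h f) = difference h (differences hs f)"
 by (induction hs) (auto simp: difference_commute)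

lemma differences_zero: "differences hs (%y. 0) = (%y. 0)"
 by (induction hs) (auto simp: difference_def)

lemma differences_add: "differences hs (%y. f y + g y) = (%y. differences hs f y + differences hs g y)"
 by (induction hs) (auto simp: difference_add)

lemma differences_sum: "differences hs (%y. \<Sum>i\<in>A. f i y) = (%y. \<Sum>i\<in>A. differences hs (f i) y)"
 by (induction hs) (auto simp: difference_sum)

lemma differences_comp:
 assumes "\<And>y z. H (y + z) = H y + H z"
 shows "differences hs (%y. f (H y)) = (%y. differences (map H hs) f (H y))"
 by (induction hs) (auto simp: difference_comp assms)

lemma differences_killed:
 assumes "h \<in> set hs" "difference h f = (%y. 0)" shows "differences hs f = (%y. 0)"
 using assms(1)
proof (induction hs)
 case (Cons k hs)
 show ?case
 proof (cases "h = k")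
  case True
  have "differences (k # hs) f = differences hs (difference h f)" by (simp add: True differences_commute)
  thus ?thesis by (simp only: assms(2) differences_zero)
 next
  case False
  hence "differences hs f = (%y. 0)" using Cons by simp
  thus ?thesis by (simp add: difference_def)
 qed
qed simp

lemma difference_zmult_killed:
 assumes "difference h f = (%y. 0)" shows "difference (zmult k h) f = (%y. 0)"
proof -
 have p: "f (y + h) = f y" for y using fun_cong[OF assms, of y] by (simp add: difference_def)
 have "f (y + zmult k h) = f y" for y
 proof (induction k rule: int_induct[of _ 0])
  case base show ?case by simp
 next
  case (step1 i) thus ?case using p[of "y + zmult i h"] by (simp add: zmult_succ add.assoc)
 next
  case (step2 i) thus ?case using p[of "y + zmult (i - 1) h"] zmult_succ[of "i - 1" h] by (simp add: add.assoc)
 qed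
 thus ?thesis by (simp add: difference_def)
qed

text \<open>A function killed by a difference with step h has period h, hence also every period c h.\<close>
lemma differences_zmult:
 assumes "list_all2 (%h k. \<exists>c. k = zmult c h) hs ks" "differences hs f = (%y. 0)"
 shows "differences ks f = (%y. 0)"
 using assms
proof (induction arbitrary: f rule: list_all2_induct)
 case Nil thus ?case by simp
next
 case (Cons h hs k ks)
 obtain c where c: "k = zmult c h" using Cons by blast
 have "differences ks (difference h f) = (%y. 0)"
  by (rule Cons.IH) (use Cons.prems in \<open>simp add: differences_commute\<close>)
 hence "difference h (differences ks f) = (%y. 0)" by (simp add: differences_commute)
 thus ?case using difference_zmult_killed[of h _ c] by (simp add: c)
qed

text \<open>The step (a_j0 b_D h, - a_j0 a_D h) is in the kernel of a_D u + b_D v and removes \<psi>_D; vertical and horizontal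
steps remove p and q, and m + 1 equal steps remove R. On the surviving terms each step becomes a
multiple of a_j h with a factor dividing L and independent of j, so passing to steps L h makes all of
them equal. The modulus P is 0 for torsion-free groups and the exponent p otherwise.\<close>
lemma elimination:
 fixes \<psi> :: "'i => 'g::ab_group_add => complex" and a b :: "'i => int" and P :: int
 assumes J: "finite J" "j0 \<in> J"
  and eq: "\<And>u v. (\<Sum>j\<in>J. \<psi> j (zmult (a j) u + zmult (b j) v)) = p u + q v + R (u, v)"
  and R: "\<And>h z. (difference h ^^ Suc m) R z = 0"
  and P: "\<And>y::'g. zmult P y = 0" "\<And>x y. P dvd x * y ==> P dvd x \<or> P dvd y"
  and nd: "\<not> P dvd b j0" "\<not> P dvd 1"
 shows "\<exists>C\<subseteq>J. \<exists>r L. j0 \<in> C \<and> \<not> P dvd L \<and>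
  (\<forall>h z. (difference h ^^ r) (%z. \<Sum>j\<in>C. \<psi> j (zmult (a j * L) z)) z = 0)"
proof -
 define C where "C = {j\<in>J. P dvd a j0 * b j - a j * b j0}"
 obtain Ds where Ds: "set Ds = J - C" using finite_list J(1) by (metis finite_Diff)
 define nn where "nn D = a j0 * b D - b j0 * a D" for D
 define L where "L = b j0 * prod_list (map nn Ds)"
 define F where "F u = (\<Sum>j\<in>C. \<psi> j (zmult (a j) u))" for u
 define S where "S h = (0, zmult (a j0) h) # replicate (Suc m) (h, 0) @
  map (%D. (zmult (a j0 * b D) h, zmult (- (a j0 * a D)) h)) Ds" for h :: 'g
 define T where "T h = zmult (b j0) h # replicate (Suc m) h @ map (%D. zmult (nn D) h) Ds" for h :: 'g
 define lin where "lin j z = zmult (a j) (fst z) + zmult (b j) (snd z)" for j and z :: "'g \<times> 'g"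
 have lin_add: "lin j (y + z) = lin j y + lin j z" for j y z
  by (simp add: lin_def zmult_add_right algebra_simps)
 have cong: "zmult x y = zmult x' y" if d: "P dvd x - x'" for x x' and y :: 'g
 proof -
  obtain c where "x - x' = P * c" using d unfolding dvd_def by blast
  hence "x = x' + P * c" by simp
  thus ?thesis by (simp add: zmult_add_left zmult_mult P(1))
 qed
 have key: "differences (T h) F = (%u. 0)" for h
 proof
  fix u
  have e: "(%z. \<Sum>j\<in>J. \<psi> j (lin j z)) = (%z. p (fst z) + (q (snd z) + R z))"
   using eq by (auto simp: lin_def fun_eq_iff)
  have k1: "differences (S h) (%z. p (fst z)) = (%z. 0)"
   by (rule differences_killed[of "(0, zmult (a j0) h)"]) (auto simp: S_def difference_def)
  have k2: "differences (S h) (%z. q (snd z)) = (%z. 0)"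
   by (rule differences_killed[of "(h, 0)"]) (auto simp: S_def difference_def)
  have k3: "differences (S h) R = (%z. 0)"
  proof -
   have R0: "(difference (h, 0) ^^ Suc m) R = (%z. 0)" using R by blast
   have comm: "differences (x # xs @ ys) f = differences (x # ys) (differences xs f)" for x xs ys and f :: "'g \<times> 'g => complex"
   proof -
    have "differences xs (differences ys f) = differences ys (differences xs f)"
     by (induction xs) (auto simp: differences_commute)
    thus ?thesis by (simp add: differences_append)
   qed
   show ?thesis
    unfolding S_def comm differences_replicate R0 by (rule differences_zero)
  qed
  have "0 = differences (S h) (%z. \<Sum>j\<in>J. \<psi> j (lin j z)) (u, 0)"
   unfolding e differences_add k1 k2 k3 by simp
  also have "... = (\<Sum>j\<in>J. differences (S h) (%z. \<psi> j (lin j z)) (u, 0))"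
   by (simp add: differences_sum)
  also have "... = (\<Sum>j\<in>C. differences (S h) (%z. \<psi> j (lin j z)) (u, 0))"
  proof (rule sum.mono_neutral_right[OF J(1)])
   show "C \<subseteq> J" by (auto simp: C_def)
   show "\<forall>j\<in>J - C. differences (S h) (%z. \<psi> j (lin j z)) (u, 0) = 0"
   proof
    fix D assume D: "D \<in> J - C"
    let ?d = "(zmult (a j0 * b D) h, zmult (- (a j0 * a D)) h)"
    have "lin D ?d = zmult (a D * (a j0 * b D) + b D * (- (a j0 * a D))) h"
     by (simp only: lin_def fst_conv snd_conv zmult_mult[symmetric] zmult_add_left[symmetric])
    hence l0: "lin D ?d = 0" by (simp add: mult.left_commute mult.commute)
    have "differences (S h) (%z. \<psi> D (lin D z)) = (%z. 0)"
     by (rule differences_killed[of ?d])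
      (use D Ds in \<open>auto simp: S_def difference_def lin_add l0\<close>)
    thus "differences (S h) (%z. \<psi> D (lin D z)) (u, 0) = 0" by simp
   qed
  qed
  also have "... = (\<Sum>j\<in>C. differences (T h) (%u. \<psi> j (zmult (a j) u)) u)"
  proof (rule sum.cong[OF refl])
   fix j assume "j \<in> C"
   hence jC: "P dvd a j0 * b j - a j * b j0" by (simp add: C_def)
   have s1: "lin j (0, zmult (a j0) h) = zmult (a j) (zmult (b j0) h)"
   proof -
    have "zmult (b j * a j0) h = zmult (a j * b j0) h" using cong[OF jC] by (simp add: mult.commute)
    thus ?thesis by (simp add: lin_def zmult_mult)
   qed
   have s2: "lin j (h, 0) = zmult (a j) h" by (simp add: lin_def)
   have s3: "lin j (zmult (a j0 * b D) h, zmult (- (a j0 * a D)) h) = zmult (a j) (zmult (nn D) h)" for D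
   proof -
    have "lin j (zmult (a j0 * b D) h, zmult (- (a j0 * a D)) h) = zmult (a j * (a j0 * b D) + b j * (- (a j0 * a D))) h"
     by (simp only: lin_def fst_conv snd_conv zmult_mult[symmetric] zmult_add_left[symmetric])
    also have "... = zmult (a j * nn D) h"
    proof (rule cong)
     have "a j * (a j0 * b D) + b j * (- (a j0 * a D)) - a j * nn D = - a D * (a j0 * b j - a j * b j0)"
      by (simp add: nn_def algebra_simps)
     thus "P dvd a j * (a j0 * b D) + b j * (- (a j0 * a D)) - a j * nn D" using jC by simp
    qed
    finally show ?thesis by (simp add: zmult_mult)
   qed
   have "map (lin j) (S h) = map (zmult (a j)) (T h)"
    by (simp add: S_def T_def s1 s2 s3)
   thus "differences (S h) (%z. \<psi> j (lin j z)) (u, 0) = differences (T h) (%u. \<psi> j (zmult (a j) u)) u"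
    by (simp add: differences_comp[of "lin j", OF lin_add] differences_comp[of "zmult (a j)", OF zmult_add_right])
     (simp add: lin_def)
  qed
  also have "... = differences (T h) F u" by (simp add: F_def[abs_def] differences_sum)
  finally show "differences (T h) F u = 0" by simp
 qed
 have dvdL: "x dvd L" if "x = b j0 \<or> x = 1 \<or> (\<exists>D\<in>set Ds. x = nn D)" for x
 proof -
  have "nn D dvd prod_list (map nn Ds)" if "D \<in> set Ds" for D using that by (induction Ds) auto
  thus ?thesis using that unfolding L_def by auto
 qed
 have L: "\<not> P dvd L"
 proof
  assume "P dvd L"
  hence "P dvd prod_list (map nn Ds)" using P(2) nd(1) unfolding L_def by blast
  hence "\<exists>D\<in>set Ds. P dvd nn D"
   by (induction Ds) (use P(2) nd(2) in auto)
  then obtain D where D: "D \<in> J - C" "P dvd nn D" using Ds by blast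
  thus False by (simp add: C_def nn_def mult.commute)
 qed
 have fin: "(difference h ^^ length (T h)) (%z. \<Sum>j\<in>C. \<psi> j (zmult (a j * L) z)) z = 0" for h z
 proof -
  have "list_all2 (%h k. \<exists>c. k = zmult c h) (T h) (replicate (length (T h)) (zmult L h))"
   unfolding list_all2_conv_all_nth
  proof (intro conjI allI impI)
   show "length (T h) = length (replicate (length (T h)) (zmult L h))" by simp
   fix i assume i: "i < length (T h)"
   have "\<exists>x. x dvd L \<and> t = zmult x h" if "t \<in> set (T h)" for t
   proof -
    have "t = zmult (b j0) h \<or> t = zmult 1 h \<or> (\<exists>D\<in>set Ds. t = zmult (nn D) h)"
     using that by (auto simp: T_def)
    thus ?thesis using dvdL by blast
   qed
   then obtain x where x: "x dvd L" "T h ! i = zmult x h" using i nth_mem by blast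
   then obtain c where "L = x * c" by blast
   hence "zmult L h = zmult c (T h ! i)" by (simp add: x zmult_mult[symmetric] mult.commute)
   thus "\<exists>c. replicate (length (T h)) (zmult L h) ! i = zmult c (T h ! i)" using i by auto
  qed
  from differences_zmult[OF this key]
  have z: "differences (replicate (length (T h)) (zmult L h)) F = (%u. 0)" .
  have "(%z. \<Sum>j\<in>C. \<psi> j (zmult (a j * L) z)) = (%z. F (zmult L z))"
   by (simp add: F_def zmult_mult)
  moreover have "(difference h ^^ length (T h)) (%z. F (zmult L z)) z = differences (replicate (length (T h)) (zmult L h)) F (zmult L z)"
   by (simp only: differences_replicate[symmetric] differences_comp[of "zmult L", OF zmult_add_right] map_replicate)
  ultimately show ?thesis by (simp only: z)
 qed
 have len: "length (T h) = length Ds + m + 2" for h by (simp add: T_def)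
 have "j0 \<in> C" using J(2) by (simp add: C_def)
 moreover have "C \<subseteq> J" by (auto simp: C_def)
 moreover have "\<forall>h z. (difference h ^^ (length Ds + m + 2)) (%z. \<Sum>j\<in>C. \<psi> j (zmult (a j * L) z)) z = 0"
  using fin unfolding len by blast
 ultimately show ?thesis using L by blast
qed


section \<open>From Q-independence to a polynomial identity\<close>

lemma funpow_difference_comp:
 assumes "\<And>y z. H (y + z) = H y + H z"
 shows "(difference h ^^ n) (%y. f (H y)) z = (difference (H h) ^^ n) f (H z)"
 using differences_comp[of H "replicate n h" f, OF assms] by (simp add: differences_replicate map_replicate)

lemma funpow_difference_zero_mono:
 assumes "\<And>z. (difference h ^^ m) f z = 0" "m <= n"
 shows "(difference h ^^ n) f z = 0"
proof -
 have "(difference h ^^ n) f = (difference h ^^ (n - m)) ((difference h ^^ m) f)"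
  using assms(2) by (metis comp_apply funpow_add le_add_diff_inverse2)
 also have "(difference h ^^ m) f = (%z. 0)" using assms(1) by blast
 finally show ?thesis using differences_zero[of "replicate (n - m) h"] by (simp add: differences_replicate)
qed

lemma polynomial_comp:
 assumes "polynomial_on G q" "\<And>y z. H (y + z) = H y + H z" "\<And>z. H z \<in> G"
 shows "polynomial_on UNIV (%z. q (H z))"
 using assms(1,3) unfolding polynomial_on_def funpow_difference_comp[of H, OF assms(2)] by blast

lemma polynomial_add:
 assumes "polynomial_on UNIV f" "polynomial_on UNIV g"
 shows "polynomial_on UNIV (%z. f z + g z)"
proof -
 obtain m k where m: "\<forall>z h. (difference h ^^ (m + 1)) f z = 0" and k: "\<forall>z h. (difference h ^^ (k + 1)) g z = 0"
  using assms unfolding polynomial_on_def ball_UNIV by blast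
 have "(difference h ^^ (max m k + 1)) (%z. f z + g z) z = 0" for h z
  using differences_add[of "replicate (max m k + 1) h" f g]
   funpow_difference_zero_mono[where h = h and f = f and m = "m + 1" and n = "max m k + 1", OF m[rule_format]]
   funpow_difference_zero_mono[where h = h and f = g and m = "k + 1" and n = "max m k + 1", OF k[rule_format]]
  unfolding differences_replicate by simp
 thus ?thesis unfolding polynomial_on_def by blast
qed

lemma funpow_difference_additive:
 assumes "\<And>w w'. A (w - w') = A w - A w'"
 shows "(difference h ^^ n) (%z. A (f z)) z = A ((difference h ^^ n) f z)"
 by (induction n arbitrary: z) (simp_all add: difference_def assms)

lemma polynomial_additive:
 assumes "polynomial_on UNIV f" "\<And>w w'. A (w - w') = A w - A w'"
 shows "polynomial_on UNIV (%z. A (f z))"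
proof -
 have "A 0 = 0" using assms(2)[of 0 0] by simp
 thus ?thesis
  using assms(1) unfolding polynomial_on_def funpow_difference_additive[of A, OF assms(2)] by metis
qed

lemma zmult_character_eq_0:
 assumes "\<And>x::'a::topological_ab_group_add. zmult P x = 0"
 shows "zmult P (y :: 'a character) = 0"
 by (rule char_eqI) (simp add: char_zmult_left char_zmult_right[symmetric] assms)

text \<open>Evaluate the joint characteristic function of the forms at (u,v), (u,0) and (0,v) by both hypotheses and
take logarithms of absolute values; p and q absorb the terms that depend on one variable.\<close>
lemma Q_independent_forms_log_equation:
 fixes \<xi> :: "nat => 'w => 'a::topological_ab_group_add"
 assumes Q: "Q_independent_forms M n a b \<xi>"
 defines "\<psi> \<equiv> %j y. of_real (- ln (norm (char_fun (distr M borel (\<xi> j)) y)))"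
 shows "\<exists>p q R. polynomial_on UNIV R \<and>
  (\<forall>u v. (\<Sum>j\<in>{1..n}. \<psi> j (zmult (a j) u + zmult (b j) v)) = p u + q v + R (u, v))"
proof -
 interpret prob_space M using Q by (simp add: Q_independent_forms_def)
 let ?L1 = "linear_form {1..n} a \<xi>" and ?L2 = "linear_form {1..n} b \<xi>"
 let ?mu = "%j. char_fun (distr M borel (\<xi> j))"
 define E where "E y = (LINT \<omega>|M. (\<Prod>j\<in>{1..n}. char_app (y j) (\<xi> j \<omega>)))" for y
 define H where "H z = (%j. if j \<in> {1..n} then zmult (a j) (fst z) + zmult (b j) (snd z) else 0)"
  for z :: "'a character \<times> 'a character"
 have H_add: "H (y + z) = H y + H z" for y z
  by (auto simp: H_def fun_eq_iff zmult_add_right algebra_simps)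
 have H_in: "H z \<in> dual_power {1..n}" for z by (simp add: H_def dual_power_def)
 have nz: "?mu j y \<noteq> 0" if "j \<in> {1..n}" for j y
  using Q that by (simp add: Q_independent_forms_def)
 obtain q1 where q1: "polynomial_on (dual_power {1..n}) q1"
  "\<And>y. y \<in> dual_power {1..n} ==> E y = (\<Prod>j\<in>{1..n}. ?mu j (y j)) * exp (q1 y)"
  using Q unfolding Q_independent_forms_def Q_independent_def E_def by auto
 have Q2: "Q_independent M UNIV (case_bool ?L1 ?L2)" using Q by (simp add: Q_independent_forms_def)
 have "case_bool ?L1 ?L2 i \<in> M \<rightarrow>\<^sub>M borel" for i using Q2 unfolding Q_independent_def by blast
 from this[of True] this[of False] have mL: "?L1 \<in> M \<rightarrow>\<^sub>M borel" "?L2 \<in> M \<rightarrow>\<^sub>M borel" by simp_all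
 have bm: "char_app u \<in> borel_measurable borel" for u :: "'a character"
  by (rule borel_measurable_continuous_onI) (rule char_cont)
 obtain q2 where q2: "polynomial_on (dual_power (UNIV :: bool set)) q2"
  "\<And>y. y \<in> dual_power UNIV ==> (LINT \<omega>|M. (\<Prod>i\<in>UNIV. char_app (y i) (case_bool ?L1 ?L2 i \<omega>))) =
   (\<Prod>i\<in>UNIV. char_fun (distr M borel (case_bool ?L1 ?L2 i)) (y i)) * exp (q2 y)"
  using Q2 unfolding Q_independent_def by auto
 have prodH: "char_app u (?L1 \<omega>) * char_app v (?L2 \<omega>) = (\<Prod>j\<in>{1..n}. char_app (H (u, v) j) (\<xi> j \<omega>))" for u v \<omega>
 proof -
  have "(\<Prod>j\<in>{1..n}. char_app (H (u, v) j) (\<xi> j \<omega>)) =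
   (\<Prod>j\<in>{1..n}. char_app u (zmult (a j) (\<xi> j \<omega>)) * char_app v (zmult (b j) (\<xi> j \<omega>)))"
   by (rule prod.cong) (simp_all add: H_def char_plus_left char_zmult_left char_zmult_right)
  thus ?thesis by (simp add: linear_form_def char_sum_right prod.distrib)
 qed
 have c1: "char_fun (distr M borel ?L1) u = E (H (u, 0))" for u
  unfolding char_fun_def E_def prodH[symmetric] integral_distr[OF mL(1) bm] by simp
 have c2: "char_fun (distr M borel ?L2) v = E (H (0, v))" for v
  unfolding char_fun_def E_def prodH[symmetric] integral_distr[OF mL(2) bm] by simp
 define K where "K z = case_bool (fst z) (snd z)" for z :: "'a character \<times> 'a character"
 have K_add: "K (y + z) = K y + K z" for y z by (auto simp: K_def fun_eq_iff split: bool.split)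
 have split: "E (H (u, v)) = E (H (u, 0)) * E (H (0, v)) * exp (q2 (K (u, v)))" for u v
 proof -
  have "K (u, v) \<in> dual_power UNIV" by (simp add: dual_power_def)
  note q2(2)[OF this]
  moreover have "(LINT \<omega>|M. (\<Prod>i\<in>UNIV. char_app (K (u, v) i) (case_bool ?L1 ?L2 i \<omega>))) = E (H (u, v))"
   unfolding E_def prodH[symmetric] by (simp add: UNIV_bool K_def mult.commute)
  moreover have "(\<Prod>i\<in>UNIV. char_fun (distr M borel (case_bool ?L1 ?L2 i)) (K (u, v) i)) = E (H (u, 0)) * E (H (0, v))"
   unfolding c1[symmetric] c2[symmetric] by (simp add: UNIV_bool K_def mult.commute)
  ultimately show ?thesis by simp
 qed
 define S where "S z = (\<Sum>j\<in>{1..n}. ln (norm (?mu j (H z j))))" for z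
 have lnE: "ln (norm (E (H z))) = S z + Re (q1 (H z))" and Epos: "0 < norm (E (H z))" for z
 proof -
  have "0 < (\<Prod>j\<in>{1..n}. norm (?mu j (H z j)))" using nz by (intro prod_pos) auto
  moreover have "norm (E (H z)) = (\<Prod>j\<in>{1..n}. norm (?mu j (H z j))) * exp (Re (q1 (H z)))"
   unfolding q1(2)[OF H_in] by (simp add: norm_mult prod_norm)
  moreover have "ln (\<Prod>j\<in>{1..n}. norm (?mu j (H z j))) = S z"
   unfolding S_def using nz by (intro ln_prod) auto
  ultimately show "ln (norm (E (H z))) = S z + Re (q1 (H z))" "0 < norm (E (H z))"
   by (simp_all add: ln_mult_pos)
 qed
 define R where "R z = Re (q1 (H z) - q1 (H (fst z, 0)) - q1 (H (0, snd z)) - q2 (K z))" for z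
 have SS: "S (u, v) = S (u, 0) + S (0, v) - R (u, v)" for u v
 proof -
  have "ln (norm (E (H (u, v)))) = ln (norm (E (H (u, 0)))) + ln (norm (E (H (0, v)))) + Re (q2 (K (u, v)))"
   unfolding split[of u v] using Epos by (simp add: norm_mult ln_mult_pos)
  thus ?thesis unfolding lnE by (simp add: R_def)
 qed
 have A1: "(\<Sum>j\<in>{1..n}. \<psi> j (zmult (a j) u + zmult (b j) v)) = of_real (- S (u, v))" for u v
  by (simp add: \<psi>_def S_def H_def sum_negf)
 have A2: "of_real (- S (u, v)) = of_real (- S (u, 0)) + of_real (- S (0, v)) + of_real (R (u, v))" for u v
  using SS[of u v] by (simp only: of_real_add[symmetric] of_real_eq_iff)
 have "(\<Sum>j\<in>{1..n}. \<psi> j (zmult (a j) u + zmult (b j) v)) =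
  of_real (- S (u, 0)) + of_real (- S (0, v)) + of_real (R (u, v))" for u v
  by (rule trans[OF A1[of u v] A2[of u v]])
 moreover have "polynomial_on UNIV (%z. of_real (R z))"
 proof -
  have neg: "polynomial_on UNIV (%z. - f z)" if "polynomial_on UNIV f" for f :: "'a character \<times> 'a character => complex"
   by (rule polynomial_additive[OF that]) simp
  have p1: "polynomial_on UNIV (%z. q1 (H z))"
   by (rule polynomial_comp[OF q1(1) H_add H_in])
  have p2: "polynomial_on UNIV (%z::'a character \<times> 'a character. - q1 (H (fst z, 0)))"
  proof (rule neg, rule polynomial_comp[where H = "%z. H (fst z, 0)", OF q1(1) _ H_in])
   show "H (fst (y + z), 0) = H (fst y, 0) + H (fst z, 0)" for y z :: "'a character \<times> 'a character"
    using H_add[of "(fst y, 0)" "(fst z, 0)"] by simp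
  qed
  have p3: "polynomial_on UNIV (%z::'a character \<times> 'a character. - q1 (H (0, snd z)))"
  proof (rule neg, rule polynomial_comp[where H = "%z. H (0, snd z)", OF q1(1) _ H_in])
   show "H (0, snd (y + z)) = H (0, snd y) + H (0, snd z)" for y z :: "'a character \<times> 'a character"
    using H_add[of "(0, snd y)" "(0, snd z)"] by simp
  qed
  have p4: "polynomial_on UNIV (%z. - q2 (K z))"
   by (rule neg, rule polynomial_comp[OF q2(1) K_add]) (simp add: dual_power_def)
  have "polynomial_on UNIV (%z. q1 (H z) + - q1 (H (fst z, 0)) + - q1 (H (0, snd z)) + - q2 (K z))"
   by (intro polynomial_add p1 p2 p3 p4)
  hence "polynomial_on UNIV (%z. q1 (H z) - q1 (H (fst z, 0)) - q1 (H (0, snd z)) - q2 (K z))" by simp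
  from polynomial_additive[OF this, of "%w. of_real (Re w)"]
  show ?thesis unfolding R_def by simp
 qed
 ultimately show ?thesis
  by (intro exI[of _ "%u. of_real (- S (u, 0))"] exI[of _ "%v. of_real (- S (0, v))"]
    exI[of _ "%z. of_real (R z)"] conjI allI)
qed

lemma Q_independent_forms_elimination:
 fixes \<xi> :: "nat => 'w => 'a::topological_ab_group_add"
 assumes Q: "Q_independent_forms M n a b \<xi>" and j0: "j0 \<in> {1..n}"
  and P: "\<And>x::'a. zmult P x = 0" "\<And>x y. P dvd x * y ==> P dvd x \<or> P dvd y" and "\<not> P dvd 1"
 shows "\<exists>C\<subseteq>{1..n}. \<exists>r L. j0 \<in> C \<and> \<not> P dvd L \<and> (\<forall>j\<in>{1..n}. \<not> P dvd a j) \<and>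
  (\<forall>h z. (difference h ^^ r) (%z. \<Sum>j\<in>C. of_real (- ln (norm (char_fun (distr M borel (\<xi> j)) (zmult (a j * L) z))))) z = 0)"
proof -
 have PY: "zmult P (y :: 'a character) = 0" for y by (rule zmult_character_eq_0) (rule P(1))
 have adm: "\<not> P dvd c" if "multiples c \<noteq> {0::'a}" for c
 proof
  assume "P dvd c"
  then obtain d where d: "c = d * P" by (metis dvdE mult.commute)
  have "multiples c = {0::'a}" by (auto simp: multiples_def d zmult_mult P(1))
  thus False using that by simp
 qed
 have nd: "\<not> P dvd a j" "\<not> P dvd b j" if "j \<in> {1..n}" for j
  using Q that adm by (auto simp: Q_independent_forms_def admissible_def)
 obtain p q R where eq: "polynomial_on UNIV R"
  "\<And>u v. (\<Sum>j\<in>{1..n}. of_real (- ln (norm (char_fun (distr M borel (\<xi> j)) (zmult (a j) u + zmult (b j) v))))) = p u + q v + R (u, v)"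
  using Q_independent_forms_log_equation[OF Q] by blast
 obtain m where m0: "\<forall>z h. (difference h ^^ (m + 1)) R z = 0"
  using eq(1) unfolding polynomial_on_def ball_UNIV by blast
 have m: "(difference h ^^ Suc m) R z = 0" for h z using m0[rule_format, where z = z and h = h] by simp
 have "\<exists>C\<subseteq>{1..n}. \<exists>r L. j0 \<in> C \<and> \<not> P dvd L \<and>
  (\<forall>h z. (difference h ^^ r) (%z. \<Sum>j\<in>C. of_real (- ln (norm (char_fun (distr M borel (\<xi> j)) (zmult (a j * L) z))))) z = 0)"
  by (rule elimination[of "{1..n}" j0 "%j y. of_real (- ln (norm (char_fun (distr M borel (\<xi> j)) y)))" a b p q R m P])
   (use eq m PY P nd j0 `\<not> P dvd 1` in auto)
 thus ?thesis using nd by blast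
qed


section \<open>Groups of prime exponent\<close>

text \<open>Along the multiples of y a polynomial with infinitely many zeros.\<close>
lemma polynomial_periodic_zero:
 fixes G :: "'g::ab_group_add => complex" and p :: int
 assumes D: "\<And>h z. (difference h ^^ r) G z = 0" and "p \<noteq> 0" "\<And>y::'g. zmult p y = 0" and G0: "G 0 = 0"
 shows "G y = 0"
proof -
 obtain P where P: "\<And>k. poly P (of_int k) = G (zmult k y)"
  using polynomial_along_multiples[where h = y and r = r and G = G, OF D] by blast
 have "poly P (of_int (i * p)) = 0" for i unfolding P by (simp add: zmult_mult assms(3) G0)
 hence sub: "range (%i. of_int (i * p)) \<subseteq> {x. poly P x = 0}" by blast
 have "inj (%i. of_int (i * p) :: complex)" using `p \<noteq> 0` by (auto simp: inj_def)
 hence "infinite (range (%i. of_int (i * p) :: complex))" using finite_imageD[OF _ `inj _`] infinite_UNIV_int by blast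
 hence "P = 0" using poly_roots_finite[of P] finite_subset[OF sub] by blast
 thus ?thesis using P[of 1] by simp
qed

text \<open>Every character y is almost surely equal to \<mu>^(y). The exceptional sets are open, so by Lindeloef their
union is null; characters separate points, so its complement is a single point.\<close>
lemma unimodular_char_fun_degenerate:
 fixes \<mu> :: "'a::{topological_ab_group_add,t2_space,second_countable_topology} measure"
 assumes lc: "locally_compact_space (euclidean :: 'a topology)"
  and mu: "\<mu> \<in> distributions" and uni: "\<And>y. norm (char_fun \<mu> y) = 1"
 shows "\<mu> \<in> degenerate"
proof -
 interpret prob_space \<mu> by (rule distributionsD(1)[OF mu])
 note sets_mu = distributionsD(2)[OF mu] and space_mu = distributionsD(3)[OF mu]
 define U where "U y = {x. char_app y x \<noteq> char_fun \<mu> y}" for y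
 have oU: "open (U y)" for y
  unfolding U_def by (intro open_Collect_neq char_cont continuous_on_const)
 have nU: "emeasure \<mu> (U y) = 0" for y
 proof -
  have "(LINT x|\<mu>. (norm (char_app y x - char_fun \<mu> y))^2) = 0"
  proof -
   have "cnj (char_fun \<mu> y) * char_fun \<mu> y = 1"
    using complex_norm_square[of "char_fun \<mu> y"] uni[of y] by (simp add: mult.commute)
   thus ?thesis unfolding integral_char_minus_const[OF mu uni] by simp
  qed
  moreover have "integrable \<mu> (%x. (norm (char_app y x - char_fun \<mu> y))^2)"
   by (rule char_dist2_integrable[OF mu]) (use uni in auto)
  ultimately have "AE x in \<mu>. (norm (char_app y x - char_fun \<mu> y))^2 = 0"
   by (subst (asm) integral_nonneg_eq_0_iff_AE) auto
  hence "AE x in \<mu>. x \<notin> U y" by (auto simp: U_def elim: AE_mp)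
  thus ?thesis using oU[of y] sets_mu by (simp add: AE_iff_measurable[OF _ refl] space_mu)
 qed
 obtain F where F: "F \<subseteq> range U" "countable F" "\<Union>F = \<Union>(range U)"
  using Lindelof[of "range U"] oU by auto
 have "(\<Union>i\<in>F. i) \<in> null_sets \<mu>"
  using F(1) nU oU sets_mu by (intro null_sets_UN'[OF F(2)] null_setsI) auto
 hence "emeasure \<mu> (\<Union>F) = 0" by (auto dest: null_setsD1)
 hence m: "measure \<mu> (\<Union>(range U)) = 0" by (simp add: F(3) measure_def)
 have oN: "\<Union>(range U) \<in> sets \<mu>" unfolding sets_mu by (intro borel_open open_Union) (use oU in auto)
 hence m1: "measure \<mu> (- \<Union>(range U)) = 1"
  using prob_compl[OF oN] m by (simp add: space_mu Compl_eq_Diff_UNIV)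
 then obtain x1 where x1: "x1 \<in> - \<Union>(range U)" by (metis equals0I measure_empty zero_neq_one)
 have "x = x1" if "x \<in> - \<Union>(range U)" for x
 proof (rule ccontr)
  assume "x \<noteq> x1"
  hence "x - x1 \<noteq> 0" by simp
  from characters_separate[OF lc this] obtain y where y: "char_app y (x - x1) \<noteq> 1" .
  have "char_app y x = char_app y x1" using that x1 by (simp add: U_def)
  hence "char_app y (x - x1) = 1" by (simp add: char_diff_right)
  thus False using y by simp
 qed
 hence "- \<Union>(range U) = {x1}" using x1 by blast
 thus ?thesis using m1 mu by (auto simp: degenerate_def)
qed

lemma degenerate_gaussian:
 fixes \<mu> :: "'a::{topological_ab_group_add,t2_space} measure"
 assumes "\<mu> \<in> degenerate" shows "\<mu> \<in> gaussian"
proof -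
 obtain x where mu: "\<mu> \<in> distributions" and x: "measure \<mu> {x} = 1" using assms by (auto simp: degenerate_def)
 interpret prob_space \<mu> by (rule distributionsD(1)[OF mu])
 have "AE z in \<mu>. z \<in> {x}" using x distributionsD(2)[OF mu] by (subst AE_in_set_eq_1) auto
 hence ae: "AE z in \<mu>. z = x" by simp
 have "char_fun \<mu> y = char_app y x" for y
 proof -
  have "char_fun \<mu> y = (LINT z|\<mu>. char_app y x)"
   unfolding char_fun_def
   by (rule integral_cong_AE) (use ae in \<open>auto intro: char_measurable'[OF mu] elim: AE_mp\<close>)
  thus ?thesis by (simp add: prob_space)
 qed
 thus ?thesis using mu
  by (auto simp: gaussian_def intro!: exI[of _ x] exI[of _ "%_. 0::real"])
qed

lemma distr_in_distributions:
 assumes "prob_space M" "X \<in> M \<rightarrow>\<^sub>M borel" shows "distr M borel X \<in> distributions"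
 using prob_space.prob_space_distr[OF assms] by (simp add: distributions_def)

lemma Q_independent_forms_distributions:
 assumes "Q_independent_forms M n a b \<xi>" "j \<in> {1..n}"
 shows "distr M borel (\<xi> j) \<in> distributions" "char_fun (distr M borel (\<xi> j)) y \<noteq> 0"
 using assms by (auto simp: Q_independent_forms_def Q_independent_def intro!: distr_in_distributions)

lemma neg_ln_char_fun_nonneg:
 assumes "\<mu> \<in> distributions" shows "0 <= - ln (norm (char_fun \<mu> y))"
 using char_fun_norm_le[OF assms, of y] by (cases "char_fun \<mu> y = 0") auto

text \<open>Multiplication by a_j L is invertible modulo p, so the vanishing of the polynomial on its range suffices.\<close>
theorem prime_exponent_degenerate:
 fixes \<xi> :: "nat => 'w => 'a::{topological_ab_group_add,t2_space,second_countable_topology}"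
 assumes lc: "locally_compact_space (euclidean :: 'a topology)"
  and Q: "Q_independent_forms M n a b \<xi>" and j: "j \<in> {1..n}"
  and p: "prime (p::nat)" "multiples (int p) = {0::'a}"
 shows "distr M borel (\<xi> j) \<in> degenerate"
proof (rule unimodular_char_fun_degenerate[OF lc Q_independent_forms_distributions(1)[OF Q j]])
 fix y :: "'a character"
 let ?mu = "%j. distr M borel (\<xi> j)"
 note d = Q_independent_forms_distributions[OF Q]
 have px: "zmult (int p) x = 0" for x :: 'a using p(2) by (auto simp: multiples_def)
 have py: "zmult (int p) (y :: 'a character) = 0" for y
  by (rule zmult_character_eq_0) (rule px)
 have pp: "prime (int p)" using p(1) by simp
 obtain C r L where C: "C \<subseteq> {1..n}" "j \<in> C" "\<not> int p dvd L" "\<forall>j\<in>{1..n}. \<not> int p dvd a j"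
  "\<forall>h z. (difference h ^^ r) (%z. \<Sum>j\<in>C. complex_of_real (- ln (norm (char_fun (?mu j) (zmult (a j * L) z))))) z = 0"
 proof -
  have "\<not> int p dvd 1" using pp not_prime_unit by blast
  thus ?thesis
   using Q_independent_forms_elimination[OF Q j, of "int p", OF px] prime_dvd_multD[OF pp] that by blast
 qed
 have one: "norm (char_fun (?mu j) (zmult (a j * L) z)) = 1" for z
 proof -
  have "(\<Sum>j\<in>C. complex_of_real (- ln (norm (char_fun (?mu j) (zmult (a j * L) z))))) = 0"
  proof (rule polynomial_periodic_zero[OF _ _ py, where r = r])
   show "(\<Sum>j\<in>C. complex_of_real (- ln (norm (char_fun (?mu j) (zmult (a j * L) 0))))) = 0"
    using C(1) d(1) by (intro sum.neutral) (auto simp: char_fun_0)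
  qed (use C(5) p(1) in auto)
  hence "(\<Sum>j\<in>C. - ln (norm (char_fun (?mu j) (zmult (a j * L) z)))) = 0"
   by (simp only: of_real_sum[symmetric] of_real_eq_0_iff)
  moreover have "finite C" using C(1) finite_subset by blast
  ultimately have "- ln (norm (char_fun (?mu j) (zmult (a j * L) z))) = 0"
   using C(1,2) neg_ln_char_fun_nonneg[OF d(1)] by (subst (asm) sum_nonneg_eq_0_iff) auto
  moreover have "norm (char_fun (?mu j) (zmult (a j * L) z)) > 0" using d(2)[OF j] by simp
  ultimately show ?thesis by (simp add: ln_eq_zero_iff)
 qed
 have "\<not> int p dvd a j * L" using C(3,4) j pp by (simp add: prime_dvd_mult_iff)
 hence "coprime (a j * L) (int p)" using pp prime_imp_coprime coprime_commute by blast
 then obtain c k where "c * (a j * L) + k * int p = 1"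
  using bezout_int[of "a j * L" "int p"] by (auto simp: coprime_iff_gcd_eq_1)
 hence "zmult (a j * L * c + k * int p) y = y" by (simp add: mult.commute)
 hence "zmult (a j * L) (zmult c y) = y" by (simp add: zmult_add_left zmult_mult py)
 thus "norm (char_fun (?mu j) y) = 1" using one[of "zmult c y"] by simp
qed


section \<open>Torsion-free groups: characteristic functions on multiples\<close>

lemma sgn_mult_norm: "sgn w * of_real (norm w) = (w :: complex)"
 by (cases "w = 0") (auto simp: sgn_div_norm scaleR_conv_of_real)

lemma convolution_square_modulus:
 fixes \<mu> :: "'a::{topological_ab_group_add,second_countable_topology} measure"
 assumes "\<mu> \<in> distributions"
 shows "\<exists>\<nu>\<in>distributions. \<forall>y. char_fun \<nu> y = of_real ((norm (char_fun \<mu> y))^2)"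
proof -
 obtain \<mu>' where m: "\<mu>' \<in> distributions" "\<forall>y. char_fun \<mu>' y = cnj (char_fun \<mu> y)"
  using distr_uminus[OF assms] by blast
 show ?thesis using convolution_distribution[OF assms m(1)] m(2) unfolding complex_norm_square by simp
qed

lemma convolution_square_modulus_zmult:
 fixes \<mu> :: "'a::{topological_ab_group_add,second_countable_topology} measure"
 assumes "\<mu> \<in> distributions"
 shows "\<exists>\<nu>\<in>distributions. \<forall>y. char_fun \<nu> y = of_real ((norm (char_fun \<mu> (zmult k y)))^2)"
 using convolution_square_modulus[OF distr_zmult(1)[OF assms, of k]] distr_zmult(2)[OF assms, of k] by simp

text \<open>What remains of the linear forms: along multiples of y the modulus of \<mu>^ is Gaussian and its direction
is a power.\<close>
locale quadratic_char_fun =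
 fixes \<mu> :: "'a::{topological_ab_group_add,t2_space,second_countable_topology} measure"
 assumes lc: "locally_compact_space (euclidean :: 'a topology)" and tf: "torsion_free TYPE('a)"
  and mu: "\<mu> \<in> distributions" and nz: "\<And>y. char_fun \<mu> y \<noteq> 0"
  and mult: "\<And>(m::nat) y. char_fun \<mu> (zmult (int m) y) =
   of_real (norm (char_fun \<mu> y) ^ m^2) * sgn (char_fun \<mu> y) ^ m"

text \<open>The law of N \<xi>_j0 is a convolution factor to which \<open>gaussian_on_multiples\<close> applies; the other factor
collects its conjugate and the squared moduli of the remaining terms. Density of the range of
multiplication by N removes N.\<close>
lemma Q_independent_forms_quadratic:
 fixes \<xi> :: "nat => 'w => 'a::{topological_ab_group_add,t2_space,second_countable_topology}"
 assumes lc: "locally_compact_space (euclidean :: 'a topology)" and tf: "torsion_free TYPE('a)"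
  and Q: "Q_independent_forms M n a b \<xi>" and j0: "j0 \<in> {1..n}"
 shows "quadratic_char_fun (distr M borel (\<xi> j0))"
proof
 let ?mu = "%j. distr M borel (\<xi> j)"
 note d = Q_independent_forms_distributions[OF Q]
 show "locally_compact_space (euclidean :: 'a topology)" "torsion_free TYPE('a)" by fact+
 show "?mu j0 \<in> distributions" "char_fun (?mu j0) y \<noteq> 0" for y using d[OF j0] by auto
 obtain C r L where C: "C \<subseteq> {1..n}" "j0 \<in> C" "\<not> 0 dvd L" "\<forall>j\<in>{1..n}. \<not> 0 dvd a j"
  "\<forall>h z. (difference h ^^ r) (%z. \<Sum>j\<in>C. of_real (- ln (norm (char_fun (?mu j) (zmult (a j * L) z))))) z = 0"
  using Q_independent_forms_elimination[OF Q j0, of 0] by auto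
 have finC: "finite C" using C(1) finite_subset by blast
 define N where "N = a j0 * L"
 have N0: "N \<noteq> 0" using C(3,4) j0 by (auto simp: N_def)
 define g where "g z = 2 * (\<Sum>j\<in>C. - ln (norm (char_fun (?mu j) (zmult (a j * L) z))))" for z
 have gD: "(difference h ^^ r) (%z. of_real (g z)) z = 0" for h z
  using funpow_difference_additive[where A = "%w. 2 * w" and h = h and n = r and f = "%z. \<Sum>j\<in>C. of_real (- ln (norm (char_fun (?mu j) (zmult (a j * L) z))))" and z = z] C(5)
  by (simp add: g_def algebra_simps)
 let ?A = "distr (?mu j0) borel (zmult N)"
 have A: "?A \<in> distributions" "\<And>z. char_fun ?A z = char_fun (?mu j0) (zmult N z)"
  using distr_zmult[OF d(1)[OF j0]] by auto
 have "\<exists>\<nu>\<in>distributions. \<forall>z. char_fun \<nu> z = cnj (char_fun ?A z) *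
  (\<Prod>i\<in>C - {j0}. of_real ((norm (char_fun (?mu i) (zmult (a i * L) z)))^2))"
 proof (rule convolution_distribution_family)
  show "finite (C - {j0})" using finC by simp
  fix i assume "i \<in> C - {j0}"
  hence "i \<in> {1..n}" using C(1) by blast
  from convolution_square_modulus_zmult[OF d(1)[OF this], of "a i * L"]
  show "\<exists>\<nu>\<in>distributions. \<forall>z. char_fun \<nu> z = of_real ((norm (char_fun (?mu i) (zmult (a i * L) z)))^2)" .
 qed (rule distr_uminus[OF A(1)])
 then obtain B where B: "B \<in> distributions" "\<And>z. char_fun B z = cnj (char_fun ?A z) *
  (\<Prod>i\<in>C - {j0}. of_real ((norm (char_fun (?mu i) (zmult (a i * L) z)))^2))" by blast
 have prod: "char_fun ?A z * char_fun B z = exp (- of_real (g z))" for z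
 proof -
  have "char_fun ?A z * char_fun B z = of_real ((norm (char_fun (?mu j0) (zmult (a j0 * L) z)))^2) *
   (\<Prod>i\<in>C - {j0}. of_real ((norm (char_fun (?mu i) (zmult (a i * L) z)))^2))"
   unfolding B(2) A(2) complex_norm_square by (simp add: N_def mult.assoc)
  also have "... = of_real (\<Prod>i\<in>C. (norm (char_fun (?mu i) (zmult (a i * L) z)))^2)"
   by (simp add: prod.remove[OF finC C(2)])
  also have "(\<Prod>i\<in>C. (norm (char_fun (?mu i) (zmult (a i * L) z)))^2) = exp (- g z)"
  proof -
   have "exp (- g z) = exp (\<Sum>i\<in>C. 2 * ln (norm (char_fun (?mu i) (zmult (a i * L) z))))"
    by (simp add: g_def sum_distrib_left sum_negf)
   also have "... = (\<Prod>i\<in>C. (norm (char_fun (?mu i) (zmult (a i * L) z)))^2)"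
   proof (subst exp_sum[OF finC], rule prod.cong[OF refl])
    fix i assume "i \<in> C"
    hence "0 < norm (char_fun (?mu i) (zmult (a i * L) z))" using d(2) C(1) by auto
    thus "exp (2 * ln (norm (char_fun (?mu i) (zmult (a i * L) z)))) = (norm (char_fun (?mu i) (zmult (a i * L) z)))^2"
     by (simp add: exp_double)
   qed
   finally show ?thesis by simp
  qed
  finally show ?thesis by (simp flip: exp_of_real)
 qed
 define F where "F = char_fun (?mu j0)"
 have onN: "F (zmult (int m) (zmult N z)) = of_real (norm (F (zmult N z)) ^ m^2) * sgn (F (zmult N z)) ^ m" for m z
 proof -
  obtain l s where ls: "norm l = 1"
   "\<forall>m::nat. char_fun ?A (zmult (int m) z) = l ^ m * exp (- of_real (s * (real m)^2))"
   using gaussian_on_multiples[OF lc tf A(1) B(1) prod gD] by blast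
  have e: "F (zmult (int m) (zmult N z)) = l ^ m * of_real (exp (- s) ^ m^2)" for m
  proof -
   have c: "zmult N (zmult (int m) z) = zmult (int m) (zmult N z)"
    by (simp only: zmult_mult[symmetric] mult.commute)
   hence "F (zmult (int m) (zmult N z)) = l ^ m * exp (- of_real (s * (real m)^2))"
    using ls(2)[rule_format, of m] unfolding F_def A(2) c by blast
   also have "exp (- of_real (s * (real m)^2)) = of_real (exp (real (m^2) * (- s)))"
    by (simp add: exp_of_real[symmetric] mult.commute)
   finally show ?thesis unfolding exp_of_nat_mult .
  qed
  have e1: "F (zmult N z) = l * of_real (exp (- s))" using e[of 1] by simp
  hence "norm (F (zmult N z)) = exp (- s)" "sgn (F (zmult N z)) = l"
   using ls(1) by (simp_all add: norm_mult sgn_div_norm scaleR_conv_of_real)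
  thus ?thesis by (simp add: e)
 qed
 show "char_fun (?mu j0) (zmult (int m) y) =
   of_real (norm (char_fun (?mu j0) y) ^ m^2) * sgn (char_fun (?mu j0) y) ^ m" for m y
 proof -
  obtain z where z: "(%n. char_dist2 (?mu j0) (zmult N (z n)) y) \<longlonglongrightarrow> 0"
   using dense_L2_sequence[OF lc tf d(1)[OF j0], of "%_. N"] N0 by blast
  have l1: "(%n. F (zmult N (z n))) \<longlonglongrightarrow> F y" unfolding F_def by (rule L2_limit[OF d(1)[OF j0] z])
  have l2: "(%n. F (zmult (int m) (zmult N (z n)))) \<longlonglongrightarrow> F (zmult (int m) y)"
   unfolding F_def by (rule L2_limit_zmult[OF d(1)[OF j0] z])
  have "F y \<noteq> 0" using d(2)[OF j0] by (simp add: F_def)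
  hence "(%n. of_real (norm (F (zmult N (z n))) ^ m^2) * sgn (F (zmult N (z n))) ^ m) \<longlonglongrightarrow>
   of_real (norm (F y) ^ m^2) * sgn (F y) ^ m"
   by (intro tendsto_intros l1 tendsto_sgn)
  thus ?thesis using LIMSEQ_unique[OF l2[unfolded onN]] unfolding F_def by blast
 qed
qed


section \<open>Torsion-free groups: the direction is multiplicative\<close>

context quadratic_char_fun
begin

definition phi :: "'a character => real" where "phi y = - ln (norm (char_fun \<mu> y))"
definition dirn :: "'a character => complex" where "dirn y = sgn (char_fun \<mu> y)"

lemma norm_char_fun: "norm (char_fun \<mu> y) = exp (- phi y)"
 using nz[of y] by (simp add: phi_def)

lemma char_fun_polar: "char_fun \<mu> y = dirn y * of_real (exp (- phi y))"
 unfolding norm_char_fun[symmetric] dirn_def by (rule sgn_mult_norm[symmetric])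

lemma norm_dirn [simp]: "norm (dirn y) = 1"
 using nz[of y] by (simp add: dirn_def norm_sgn)

lemma phi_nonneg: "0 <= phi y"
 unfolding phi_def by (rule neg_ln_char_fun_nonneg[OF mu])

lemma phi_minus: "phi (- y) = phi y"
 by (simp add: phi_def char_fun_minus)

lemma dirn_minus: "dirn (- y) = cnj (dirn y)"
 by (simp add: dirn_def char_fun_minus sgn_div_norm scaleR_conv_of_real)

lemma phi_zmult: "phi (zmult (int m) y) = (real m)^2 * phi y"
proof -
 have "norm (char_fun \<mu> (zmult (int m) y)) = norm (char_fun \<mu> y) ^ m^2"
  unfolding mult using nz[of y] by (simp add: norm_mult norm_power norm_sgn)
 thus ?thesis using nz[of y] by (simp add: phi_def ln_realpow)
qed

lemma dirn_zmult: "dirn (zmult (int m) y) = dirn y ^ m"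
proof -
 have "norm (char_fun \<mu> y) ^ m^2 > 0" using nz[of y] by simp
 hence "sgn (complex_of_real (norm (char_fun \<mu> y) ^ m^2)) = 1"
  by (simp only: sgn_of_real sgn_pos of_real_1)
 moreover have "norm (sgn (char_fun \<mu> y) ^ m) = 1" using nz[of y] by (simp add: norm_power norm_sgn)
 hence "sgn (sgn (char_fun \<mu> y) ^ m) = sgn (char_fun \<mu> y) ^ m" by (simp add: sgn_div_norm)
 ultimately show ?thesis unfolding dirn_def mult sgn_mult by simp
qed

lemma char_dist2_dirn: "(LINT x|\<mu>. (norm (char_app y x - dirn y))^2) <= 2 * phi y"
proof -
 have "cnj (dirn y) * dirn y = 1" using complex_norm_square[of "dirn y"] by (simp add: mult.commute)
 hence "cnj (dirn y) * char_fun \<mu> y = of_real (exp (- phi y))"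
  unfolding char_fun_polar by (simp add: mult.assoc[symmetric])
 hence "(LINT x|\<mu>. (norm (char_app y x - dirn y))^2) = 2 - 2 * exp (- phi y)"
  by (simp add: integral_char_minus_const[OF mu])
 thus ?thesis using exp_ge_add_one_self[of "- phi y"] by simp
qed

text \<open>Approximate division by n + 1; starting from 1 keeps the divisor nonzero.\<close>
definition root_seq :: "(nat => 'a character) => 'a character => bool" where
 "root_seq z y \<longleftrightarrow> (%n. char_dist2 \<mu> (zmult (int (Suc n)) (z n)) y) \<longlonglongrightarrow> 0"

lemma ex_root_seq: "\<exists>z. root_seq z y"
 unfolding root_seq_def by (rule dense_L2_sequence[OF lc tf mu]) simp

lemma root_seq_add: assumes "root_seq z y" "root_seq w v" shows "root_seq (%n. z n + w n) (y + v)"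
 unfolding root_seq_def
proof (rule tendsto_sandwich[OF _ _ tendsto_const])
 show "\<forall>\<^sub>F n in sequentially. char_dist2 \<mu> (zmult (int (Suc n)) (z n + w n)) (y + v) <=
  2 * char_dist2 \<mu> (zmult (int (Suc n)) (z n)) y + 2 * char_dist2 \<mu> (zmult (int (Suc n)) (w n)) v"
  unfolding zmult_add_right by (intro always_eventually allI char_dist2_add_le mu)
 show "(%n. 2 * char_dist2 \<mu> (zmult (int (Suc n)) (z n)) y + 2 * char_dist2 \<mu> (zmult (int (Suc n)) (w n)) v) \<longlonglongrightarrow> 0"
  using tendsto_add[OF tendsto_mult_right_zero[OF assms(1)[unfolded root_seq_def]] tendsto_mult_right_zero[OF assms(2)[unfolded root_seq_def]], of 2 2] by simp
qed (simp add: char_dist2_nonneg)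

lemma root_seq_minus: assumes "root_seq z y" shows "root_seq (%n. - z n) (- y)"
 using assms unfolding root_seq_def zmult_minus_right char_dist2_minus .

lemma root_seq_diff: assumes "root_seq z y" "root_seq w v" shows "root_seq (%n. z n - w n) (y - v)"
 using root_seq_add[OF assms(1) root_seq_minus[OF assms(2)]] by simp

lemma root_seq_char_fun: assumes "root_seq z y" shows "(%n. char_fun \<mu> (zmult (int (Suc n)) (z n))) \<longlonglongrightarrow> char_fun \<mu> y"
 using assms unfolding root_seq_def by (rule L2_limit[OF mu])

lemma root_seq_phi: assumes "root_seq z y" shows "(%n. (real (Suc n))^2 * phi (z n)) \<longlonglongrightarrow> phi y"
proof -
 have "(%n. phi (zmult (int (Suc n)) (z n))) \<longlonglongrightarrow> phi y"
  unfolding phi_def using nz[of y] by (intro tendsto_intros root_seq_char_fun assms) auto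
 thus ?thesis unfolding phi_zmult .
qed

lemma root_seq_dirn: assumes "root_seq z y" shows "(%n. dirn (z n) ^ Suc n) \<longlonglongrightarrow> dirn y"
proof -
 have "(%n. dirn (zmult (int (Suc n)) (z n))) \<longlonglongrightarrow> dirn y"
  unfolding dirn_def using nz[of y] by (intro tendsto_sgn root_seq_char_fun assms)
 thus ?thesis unfolding dirn_zmult .
qed

lemma root_seq_phi_0: assumes "root_seq z y" shows "(%n. real (Suc n) * phi (z n)) \<longlonglongrightarrow> 0"
proof -
 have "(%n. 1 / real (Suc n) * ((real (Suc n))^2 * phi (z n))) \<longlonglongrightarrow> 0 * phi y"
  by (intro tendsto_mult root_seq_phi[OF assms] LIMSEQ_Suc[OF lim_1_over_n])
 moreover have "1 / real (Suc n) * ((real (Suc n))^2 * phi (z n)) = real (Suc n) * phi (z n)" for n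
  by (simp add: power2_eq_square del: of_nat_Suc)
 ultimately show ?thesis by simp
qed

lemma integral_product_le:
 fixes f g :: "'a => complex"
 assumes m: "f \<in> borel_measurable borel" "g \<in> borel_measurable borel"
  and b: "\<And>x. norm (f x) <= 2" "\<And>x. norm (g x) <= 2"
 shows "norm (LINT x|\<mu>. f x * g x) <= ((LINT x|\<mu>. (norm (f x))^2) + (LINT x|\<mu>. (norm (g x))^2)) / 2"
proof -
 have sq: "integrable \<mu> (%x. (norm (f x))^2)" if "f \<in> borel_measurable borel" "\<And>x. norm (f x) <= 2" for f :: "'a => complex"
 proof (rule integrable_bounded_by[OF mu, where B = 4])
  show "(%x. (norm (f x))^2) \<in> borel_measurable borel" using that(1) by measurable
  show "norm ((norm (f x))^2) <= 4" for x using power_mono[OF that(2)[of x], of 2] by simp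
 qed
 have "norm (LINT x|\<mu>. f x * g x) <= (LINT x|\<mu>. ((norm (f x))^2 + (norm (g x))^2) / 2)"
 proof (rule order_trans[OF integral_norm_bound], rule integral_mono)
  show "integrable \<mu> (%x. norm (f x * g x))"
  proof (rule integrable_norm)
   show "integrable \<mu> (%x. f x * g x)"
  proof (rule integrable_bounded_by[OF mu, where B = 4])
   show "(%x. f x * g x) \<in> borel_measurable borel" using m by measurable
   show "norm (f x * g x) <= 4" for x
    using mult_mono[OF b(1)[of x] b(2)[of x]] by (simp add: norm_mult)
  qed
  qed
  show "integrable \<mu> (%x. ((norm (f x))^2 + (norm (g x))^2) / 2)"
   by (intro integrable_divide Bochner_Integration.integrable_add sq m b)
  show "norm (f x * g x) <= ((norm (f x))^2 + (norm (g x))^2) / 2" for x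
   using sum_squares_bound[of "norm (f x)" "norm (g x)"] by (simp add: norm_mult)
 qed
 also have "... = ((LINT x|\<mu>. (norm (f x))^2) + (LINT x|\<mu>. (norm (g x))^2)) / 2"
  by (simp add: sq m b)
 finally show ?thesis .
qed

text \<open>The mean of (u - l(u)) (v - l(v)), with l the direction, is of second order by Cauchy-Schwarz.\<close>
lemma dirn_almost_additive:
 "norm (dirn (u + v) - dirn u * dirn v) <= phi (u + v) + 2 * phi u + 2 * phi v"
proof -
 interpret prob_space \<mu> by (rule distributionsD(1)[OF mu])
 let ?f = "%x. char_app u x - dirn u" and ?g = "%x. char_app v x - dirn v"
 have b: "norm (char_app y x - dirn y) <= 2" for y x
  using norm_triangle_ineq4[of "char_app y x" "dirn y"] by simp
 have "norm (LINT x|\<mu>. ?f x * ?g x) <= ((LINT x|\<mu>. (norm (?f x))^2) + (LINT x|\<mu>. (norm (?g x))^2)) / 2"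
  by (rule integral_product_le) (use b in auto)
 hence le: "norm (LINT x|\<mu>. ?f x * ?g x) <= phi u + phi v"
  using char_dist2_dirn[of u] char_dist2_dirn[of v] by simp
 have i: "integrable \<mu> (char_app y)" for y by (rule char_integrable[OF mu])
 have "(LINT x|\<mu>. ?f x * ?g x) = (LINT x|\<mu>. char_app (u + v) x - dirn v * char_app u x - dirn u * char_app v x + dirn u * dirn v)"
  by (simp add: char_plus_left algebra_simps)
 also have "... = char_fun \<mu> (u + v) - dirn v * char_fun \<mu> u - dirn u * char_fun \<mu> v + dirn u * dirn v"
  unfolding char_fun_def by (simp add: i prob_space)
 finally have e: "dirn (u + v) - dirn u * dirn v = (LINT x|\<mu>. ?f x * ?g x) + dirn (u + v) * complex_of_real (1 - exp (- phi (u + v)))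
   - dirn u * dirn v * complex_of_real (1 - exp (- phi u)) - dirn u * dirn v * complex_of_real (1 - exp (- phi v))"
  by (simp add: char_fun_polar algebra_simps)
 have s: "norm (c * complex_of_real (1 - exp (- phi y))) <= phi y" if "norm c = 1" for c y
 proof -
  have "norm (c * complex_of_real (1 - exp (- phi y))) = \<bar>1 - exp (- phi y)\<bar>"
   using that by (simp only: norm_mult norm_of_real mult_1)
  thus ?thesis using exp_ge_add_one_self[of "- phi y"] phi_nonneg[of y] by simp
 qed
 have n1: "norm (dirn u * dirn v) = 1" by (simp add: norm_mult)
 show ?thesis unfolding e
  using s[OF norm_dirn, of "u + v" "u + v"] s[OF n1, of u] s[OF n1, of v] le
   norm_triangle_ineq[of "\<integral>x. ?f x * ?g x \<partial>\<mu>" "dirn (u + v) * complex_of_real (1 - exp (- phi (u + v)))"]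
   norm_triangle_ineq4[of "(LINT x|\<mu>. ?f x * ?g x) + dirn (u + v) * complex_of_real (1 - exp (- phi (u + v)))" "dirn u * dirn v * complex_of_real (1 - exp (- phi u))"]
   norm_triangle_ineq4[of "(LINT x|\<mu>. ?f x * ?g x) + dirn (u + v) * complex_of_real (1 - exp (- phi (u + v))) - dirn u * dirn v * complex_of_real (1 - exp (- phi u))" "dirn u * dirn v * complex_of_real (1 - exp (- phi v))"]
  by linarith
qed

text \<open>The error for n-th parts is O(1/n^2), so raising to the n-th power leaves O(1/n).\<close>
lemma dirn_add: "dirn (u + v) = dirn u * dirn v"
proof -
 obtain z w where zw: "root_seq z u" "root_seq w v" using ex_root_seq by metis
 let ?e = "%n. phi (z n + w n) + 2 * phi (z n) + 2 * phi (w n)"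
 have lim: "(%n. dirn (z n + w n) ^ Suc n - dirn (z n) ^ Suc n * dirn (w n) ^ Suc n) \<longlonglongrightarrow> dirn (u + v) - dirn u * dirn v"
  by (intro tendsto_intros root_seq_dirn root_seq_add zw)
 have bd: "norm (dirn (z n + w n) ^ Suc n - dirn (z n) ^ Suc n * dirn (w n) ^ Suc n) <= real (Suc n) * ?e n" for n
 proof -
  have "norm (dirn (z n + w n) ^ Suc n - (dirn (z n) * dirn (w n)) ^ Suc n) <= real (Suc n) * norm (dirn (z n + w n) - dirn (z n) * dirn (w n))"
   by (rule norm_power_diff) (simp_all add: norm_mult)
  also have "... <= real (Suc n) * ?e n" by (intro mult_left_mono dirn_almost_additive) simp
  finally show ?thesis by (simp only: power_mult_distrib)
 qed
 have e0: "(%n. real (Suc n) * ?e n) \<longlonglongrightarrow> 0"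
 proof -
  have "(%n. real (Suc n) * phi (z n + w n) + 2 * (real (Suc n) * phi (z n)) + 2 * (real (Suc n) * phi (w n))) \<longlonglongrightarrow> 0 + 2 * 0 + 2 * 0"
   by (intro tendsto_intros root_seq_phi_0[OF root_seq_add[OF zw]] root_seq_phi_0[OF zw(1)] root_seq_phi_0[OF zw(2)])
  thus ?thesis by (simp add: algebra_simps)
 qed
 have "(%n. dirn (z n + w n) ^ Suc n - dirn (z n) ^ Suc n * dirn (w n) ^ Suc n) \<longlonglongrightarrow> 0"
  by (rule Lim_null_comparison[OF always_eventually e0]) (intro allI bd)
 from LIMSEQ_unique[OF lim this] show ?thesis by (simp only: right_minus_eq)
qed

end


section \<open>Torsion-free groups: the parallelogram law\<close>

lemma exp_minus_le_quadratic:
 assumes "0 <= (x::real)" shows "exp (- x) <= 1 - x + x^2 / 2"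
proof -
 have e: "1 + x + x^2 / 2 <= exp x" by (rule exp_lower_Taylor_quadratic[OF assms])
 have "0 <= x ^ 4" by simp
 hence "1 <= (1 - x + x^2 / 2) * (1 + x + x^2 / 2)"
  by (simp add: algebra_simps power2_eq_square power4_eq_xxxx)
 also have "... <= (1 - x + x^2 / 2) * exp x"
 proof (rule mult_left_mono[OF e])
  have "1 - x + x^2 / 2 = ((1 - x)^2 + 1) / 2" by (simp add: power2_eq_square algebra_simps)
  thus "0 <= 1 - x + x^2 / 2" by (simp only:) simp
 qed
 finally show ?thesis by (simp add: exp_minus field_simps)
qed

lemma compact_open_uniform_nbhd:
 fixes y0 :: "'a::{topological_ab_group_add,t2_space} character"
 assumes K: "compact K" and "0 < e"
 shows "\<exists>W. open W \<and> y0 \<in> W \<and> (\<forall>y\<in>W. \<forall>x\<in>K. norm (char_app y x - char_app y0 x) < e)"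
proof -
 define Kx where "Kx x = K \<inter> {z. dist (char_app y0 z) (char_app y0 x) <= e / 4}" for x
 define Ox where "Ox x = {z. dist (char_app y0 z) (char_app y0 x) < e / 4}" for x
 have cK: "compact (Kx x)" for x
  unfolding Kx_def by (intro compact_Int_closed K closed_Collect_le continuous_intros char_cont)
 have oO: "open (Ox x)" for x
  unfolding Ox_def by (intro open_Collect_less continuous_intros char_cont)
 have "K \<subseteq> \<Union>(Ox ` K)" using `0 < e` by (auto simp: Ox_def)
 then obtain F where F: "F \<subseteq> K" "finite F" "K \<subseteq> (\<Union>x\<in>F. Ox x)"
  using compactE_image[OF K, of K Ox] oO by auto
 define W where "W = (\<Inter>x\<in>F. {y. char_app y ` Kx x \<subseteq> ball (char_app y0 x) (e / 2)})"
 have "open {y. char_app y ` Kx x \<subseteq> ball (char_app y0 x) (e / 2)}" for x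
  unfolding open_character_def
  by (rule generate_topology.Basis) (use cK in blast)
 hence "open W" unfolding W_def using F(2) by (intro open_INT) auto
 moreover have "y0 \<in> W"
  unfolding W_def Kx_def using `0 < e` by (auto simp: dist_commute)
 moreover have "norm (char_app y x - char_app y0 x) < e" if "y \<in> W" "x \<in> K" for y x
 proof -
  obtain z where z: "z \<in> F" "x \<in> Ox z" using F(3) `x \<in> K` by blast
  hence xK: "x \<in> Kx z" using `x \<in> K` by (simp add: Kx_def Ox_def)
  have "char_app y ` Kx z \<subseteq> ball (char_app y0 z) (e / 2)" using `y \<in> W` z(1) by (simp add: W_def)
  hence "char_app y x \<in> ball (char_app y0 z) (e / 2)" using xK by (rule subsetD[OF _ imageI])
  hence "dist (char_app y x) (char_app y0 z) < e / 2" by (simp add: dist_commute)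
  moreover have "dist (char_app y0 x) (char_app y0 z) < e / 4" using z(2) by (simp add: Ox_def)
  ultimately have "dist (char_app y x) (char_app y0 x) < e"
   using dist_triangle2[of "char_app y x" "char_app y0 x" "char_app y0 z"] `0 < e` by linarith
  thus ?thesis by (simp add: dist_norm)
 qed
 ultimately show ?thesis by blast
qed

lemma char_fun_continuous:
 fixes \<mu> :: "'a::{topological_ab_group_add,t2_space,second_countable_topology} measure"
 assumes lc: "locally_compact_space (euclidean :: 'a topology)" and mu: "\<mu> \<in> distributions"
 shows "continuous_on UNIV (char_fun \<mu>)"
 unfolding continuous_on_topological
proof (intro ballI allI impI)
 interpret prob_space \<mu> by (rule distributionsD(1)[OF mu])
 note sets_mu = distributionsD(2)[OF mu] and space_mu = distributionsD(3)[OF mu]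
 fix y0 :: "'a character" and B assume "open B" "char_fun \<mu> y0 \<in> B"
 then obtain e where e: "0 < e" "ball (char_fun \<mu> y0) e \<subseteq> B" using open_contains_ball by blast
 obtain K where K: "compact K" "measure \<mu> (- K) <= e / 8"
  using distribution_tight[OF lc mu, of "e / 8"] e(1) by auto
 have "0 < e / 2" using e(1) by simp
 from compact_open_uniform_nbhd[OF K(1) this, of y0] obtain W where
  W: "open W" "y0 \<in> W" "\<And>y x. y \<in> W ==> x \<in> K ==> norm (char_app y x - char_app y0 x) < e / 2" by blast
 have mK: "- K \<in> sets \<mu>" using compact_imp_closed[OF K(1)] sets_mu by (auto intro: borel_open)
 have "char_fun \<mu> y \<in> B" if "y \<in> W" for y
 proof -
  have "char_fun \<mu> y - char_fun \<mu> y0 = (LINT x|\<mu>. char_app y x - char_app y0 x)"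
   unfolding char_fun_def by (simp add: char_integrable[OF mu])
  hence "norm (char_fun \<mu> y - char_fun \<mu> y0) <= (LINT x|\<mu>. norm (char_app y x - char_app y0 x))" by simp
  also have "... <= (LINT x|\<mu>. e / 2 + 2 * indicator (- K) x)"
  proof (rule integral_mono)
   show "integrable \<mu> (%x. norm (char_app y x - char_app y0 x))"
    by (intro integrable_norm Bochner_Integration.integrable_diff char_integrable[OF mu])
   show "integrable \<mu> (%x. e / 2 + 2 * indicator (- K) x)"
    using mK by (intro Bochner_Integration.integrable_add integrable_mult_right integrable_real_indicator) (simp_all add: less_top[symmetric])
   show "norm (char_app y x - char_app y0 x) <= e / 2 + 2 * indicator (- K) x" for x
   proof (cases "x \<in> K")
    case True thus ?thesis using W(3)[OF that True] by simp
   next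
    case False
    thus ?thesis using norm_triangle_ineq4[of "char_app y x" "char_app y0 x"] e(1) by simp
   qed
  qed
  also have "... = e / 2 + 2 * measure \<mu> (- K)"
  proof -
   have "integrable \<mu> (indicator (- K) :: 'a => real)"
    using mK by (intro integrable_real_indicator) (simp_all add: less_top[symmetric])
   moreover have "(LINT x|\<mu>. indicator (- K) x) = measure \<mu> (- K)"
    using Bochner_Integration.integral_indicator[of \<mu> "- K"] by (simp add: space_mu)
   ultimately show ?thesis
    by (subst Bochner_Integration.integral_add) (simp_all add: prob_space)
  qed
  also have "... < e" using K(2) e(1) by simp
  finally show ?thesis using e(2) by (auto simp: dist_norm norm_minus_commute)
 qed
 thus "\<exists>A. open A \<and> y0 \<in> A \<and> (\<forall>y\<in>UNIV. y \<in> A \<longrightarrow> char_fun \<mu> y \<in> B)" using W(1,2) by blast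
qed

context quadratic_char_fun
begin

lemma phi_continuous: "continuous_on UNIV phi"
 unfolding phi_def using nz by (intro continuous_intros char_fun_continuous[OF lc mu]) auto

lemma symmetrization: "\<exists>\<rho>\<in>distributions. \<forall>y. char_fun \<rho> y = of_real (exp (- 2 * phi y))"
proof -
 have "(norm (char_fun \<mu> y))^2 = exp (- 2 * phi y)" for y
  unfolding norm_char_fun using exp_double[of "- phi y"] by simp
 thus ?thesis using convolution_square_modulus[OF mu] by simp
qed

text \<open>For angles s, t: 2 (2 - cos s - cos t) - (2 - cos (s+t) - cos (s-t)) = 2 (1 - cos s) (1 - cos t), and
(1 - cos s)^2 has mean O(\<phi>^2) because \<phi>(2u) = 4 \<phi>(u).\<close>
lemma almost_parallelogram:
 defines "d \<equiv> %y. 1 - exp (- 2 * phi y)"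
 shows "\<bar>2 * (d u + d v) - (d (u + v) + d (u - v))\<bar> <= 16 * ((phi u)^2 + (phi v)^2)"
proof -
 obtain \<rho> where r: "\<rho> \<in> distributions" "\<And>y. char_fun \<rho> y = of_real (exp (- 2 * phi y))"
  using symmetrization by blast
 interpret R: prob_space \<rho> by (rule distributionsD(1)[OF r(1)])
 let ?c = "%y x. Re (char_app y x)"
 have i: "integrable \<rho> (?c y)" for y by (intro integrable_Re char_integrable r(1))
 have R: "(LINT x|\<rho>. ?c y x) = 1 - d y" for y
  using integral_Re[OF char_integrable[OF r(1)], of y] r(2)[of y] by (simp add: d_def char_fun_def)
 have pm: "?c (u + v) x + ?c (u - v) x = 2 * ?c u x * ?c v x" for x
  by (simp add: char_plus_left char_diff_left)
 have dbl: "(1 - ?c y x)^2 = (3 - 4 * ?c y x + ?c (y + y) x) / 2" for y x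
 proof -
  have "(?c y x)^2 + (Im (char_app y x))^2 = 1" by (simp add: cmod_power2[symmetric])
  thus ?thesis by (simp add: char_plus_left power2_eq_square algebra_simps)
 qed
 have sq: "(LINT x|\<rho>. (1 - ?c y x)^2) <= 16 * (phi y)^2" for y
 proof -
  have "(LINT x|\<rho>. (1 - ?c y x)^2) = (3 - 4 * (1 - d y) + (1 - d (y + y))) / 2"
   unfolding dbl by (simp add: i R R.prob_space)
  also have "phi (y + y) = 4 * phi y" using phi_zmult[of 2 y] by (simp add: zmult_2)
  hence "d (y + y) = 1 - exp (- 8 * phi y)" by (simp add: d_def)
  also have "(3 - 4 * (1 - d y) + (1 - (1 - exp (- 8 * phi y)))) / 2 <= 16 * (phi y)^2"
   using exp_minus_le_quadratic[of "8 * phi y"] exp_ge_add_one_self[of "- 2 * phi y"] phi_nonneg[of y]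
   by (simp add: d_def power2_eq_square)
  finally show ?thesis by simp
 qed
 have isq: "integrable \<rho> (%x. (1 - ?c y x)^2)" for y unfolding dbl by (simp add: i)
 have ip: "integrable \<rho> (%x. ?c u x * ?c v x)"
 proof -
  have "integrable \<rho> (%x. (?c (u + v) x + ?c (u - v) x) / 2)" by (simp add: i)
  thus ?thesis unfolding pm by simp
 qed
 have ipp: "integrable \<rho> (%x. 2 * ((1 - ?c u x) * (1 - ?c v x)))"
 proof -
  have "integrable \<rho> (%x. 2 - 2 * ?c u x - 2 * ?c v x + 2 * (?c u x * ?c v x))" using i ip by simp
  thus ?thesis by (simp add: algebra_simps)
 qed
 have "d (u + v) + d (u - v) = (LINT x|\<rho>. 2 - (?c (u + v) x + ?c (u - v) x))"
  by (simp add: i R R.prob_space)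
 moreover have "2 * (d u + d v) = (LINT x|\<rho>. 2 * (2 - ?c u x - ?c v x))"
  by (simp add: i R R.prob_space)
 ultimately have "2 * (d u + d v) - (d (u + v) + d (u - v)) = (LINT x|\<rho>. 2 * (2 - ?c u x - ?c v x) - (2 - (?c (u + v) x + ?c (u - v) x)))"
  by (simp add: i)
 also have "... = (LINT x|\<rho>. 2 * ((1 - ?c u x) * (1 - ?c v x)))"
  unfolding pm by (rule Bochner_Integration.integral_cong) (simp_all add: algebra_simps)
 finally have "\<bar>2 * (d u + d v) - (d (u + v) + d (u - v))\<bar> <= (LINT x|\<rho>. \<bar>2 * ((1 - ?c u x) * (1 - ?c v x))\<bar>)"
  by (simp only: integral_abs_bound)
 also have "... <= (LINT x|\<rho>. (1 - ?c u x)^2 + (1 - ?c v x)^2)"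
 proof (rule integral_mono)
  show "integrable \<rho> (%x. \<bar>2 * ((1 - ?c u x) * (1 - ?c v x))\<bar>)" using ipp by (rule integrable_abs)
  show "integrable \<rho> (%x. (1 - ?c u x)^2 + (1 - ?c v x)^2)" by (intro Bochner_Integration.integrable_add isq)
  show "\<bar>2 * ((1 - ?c u x) * (1 - ?c v x))\<bar> <= (1 - ?c u x)^2 + (1 - ?c v x)^2" for x
   using sum_squares_bound[of "\<bar>1 - ?c u x\<bar>" "\<bar>1 - ?c v x\<bar>"] by (simp add: abs_mult)
 qed
 also have "... <= 16 * (phi u)^2 + 16 * (phi v)^2" using sq[of u] sq[of v] isq by simp
 finally show ?thesis by simp
qed

lemma root_seq_one_minus:
 assumes "root_seq z y"
 shows "(%n. (real (Suc n))^2 * (1 - exp (- 2 * phi (z n)))) \<longlonglongrightarrow> 2 * phi y"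
proof (rule Lim_transform)
 show "(%n. 2 * ((real (Suc n))^2 * phi (z n))) \<longlonglongrightarrow> 2 * phi y"
  by (intro tendsto_intros root_seq_phi assms)
 have bd: "norm ((real (Suc n))^2 * (1 - exp (- 2 * phi (z n))) - 2 * ((real (Suc n))^2 * phi (z n))) <= 2 * (real (Suc n) * phi (z n))^2" for n
 proof -
  let ?h = "2 * phi (z n)"
  have "\<bar>1 - exp (- ?h) - ?h\<bar> <= ?h^2 / 2"
   using exp_minus_le_quadratic[of ?h] exp_ge_add_one_self[of "- ?h"] phi_nonneg[of "z n"] by (simp add: abs_le_iff)
  hence "(real (Suc n))^2 * \<bar>1 - exp (- ?h) - ?h\<bar> <= (real (Suc n))^2 * (?h^2 / 2)" by (rule mult_left_mono) simp
  moreover have "norm ((real (Suc n))^2 * (1 - exp (- ?h)) - 2 * ((real (Suc n))^2 * phi (z n))) = (real (Suc n))^2 * \<bar>1 - exp (- ?h) - ?h\<bar>"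
  proof -
   have "(real (Suc n))^2 * (1 - exp (- ?h)) - 2 * ((real (Suc n))^2 * phi (z n)) = (real (Suc n))^2 * (1 - exp (- ?h) - ?h)"
    by algebra
   thus ?thesis by (simp only: real_norm_def abs_mult abs_power2)
  qed
  ultimately show ?thesis by (simp add: power_mult_distrib del: of_nat_Suc)
 qed
 have "(%n. 2 * (real (Suc n) * phi (z n))^2) \<longlonglongrightarrow> 2 * 0^2"
  by (intro tendsto_intros root_seq_phi_0[OF assms])
 hence lim: "(%n. 2 * (real (Suc n) * phi (z n))^2) \<longlonglongrightarrow> 0" by simp
 show "(%n. (real (Suc n))^2 * (1 - exp (- 2 * phi (z n))) - 2 * ((real (Suc n))^2 * phi (z n))) \<longlonglongrightarrow> 0"
  by (rule Lim_null_comparison[OF always_eventually lim]) (intro allI bd)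
qed

text \<open>At n-th parts n^2 (1 - exp(- 2 \<phi>)) tends to 2 \<phi>, whereas the error is O(1/n^2).\<close>
lemma phi_parallelogram: "phi (u + v) + phi (u - v) = 2 * (phi u + phi v)"
proof -
 obtain z w where zw: "root_seq z u" "root_seq w v" using ex_root_seq by metis
 let ?d = "%y. 1 - exp (- 2 * phi y)"
 let ?N = "%n. (real (Suc n))^2"
 have lim: "(%n. 2 * (?N n * ?d (z n) + ?N n * ?d (w n)) - (?N n * ?d (z n + w n) + ?N n * ?d (z n - w n))) \<longlonglongrightarrow>
  2 * (2 * phi u + 2 * phi v) - (2 * phi (u + v) + 2 * phi (u - v))"
  by (intro tendsto_intros root_seq_one_minus[OF zw(1)] root_seq_one_minus[OF zw(2)]
    root_seq_one_minus[OF root_seq_add[OF zw]] root_seq_one_minus[OF root_seq_diff[OF zw]])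
 have bd: "norm (2 * (?N n * ?d (z n) + ?N n * ?d (w n)) - (?N n * ?d (z n + w n) + ?N n * ?d (z n - w n)))
   <= 16 * ((real (Suc n) * phi (z n))^2 + (real (Suc n) * phi (w n))^2)" for n
 proof -
  have "2 * (?N n * ?d (z n) + ?N n * ?d (w n)) - (?N n * ?d (z n + w n) + ?N n * ?d (z n - w n)) =
   ?N n * (2 * (?d (z n) + ?d (w n)) - (?d (z n + w n) + ?d (z n - w n)))" by algebra
  hence "norm (2 * (?N n * ?d (z n) + ?N n * ?d (w n)) - (?N n * ?d (z n + w n) + ?N n * ?d (z n - w n))) =
   ?N n * \<bar>2 * (?d (z n) + ?d (w n)) - (?d (z n + w n) + ?d (z n - w n))\<bar>"
   by (simp only: real_norm_def abs_mult abs_power2)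
  also have "... <= ?N n * (16 * ((phi (z n))^2 + (phi (w n))^2))"
   by (rule mult_left_mono[OF almost_parallelogram]) simp
  also have "... = 16 * ((real (Suc n) * phi (z n))^2 + (real (Suc n) * phi (w n))^2)"
   by (simp only: power_mult_distrib) algebra
  finally show ?thesis .
 qed
 have "(%n. 16 * ((real (Suc n) * phi (z n))^2 + (real (Suc n) * phi (w n))^2)) \<longlonglongrightarrow> 16 * (0^2 + 0^2)"
  by (intro tendsto_intros root_seq_phi_0[OF zw(1)] root_seq_phi_0[OF zw(2)])
 hence e0: "(%n. 16 * ((real (Suc n) * phi (z n))^2 + (real (Suc n) * phi (w n))^2)) \<longlonglongrightarrow> 0" by simp
 have "(%n. 2 * (?N n * ?d (z n) + ?N n * ?d (w n)) - (?N n * ?d (z n + w n) + ?N n * ?d (z n - w n))) \<longlonglongrightarrow> 0"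
  by (rule Lim_null_comparison[OF always_eventually e0]) (intro allI bd)
 from LIMSEQ_unique[OF lim this] show ?thesis by simp
qed

end


section \<open>Trigonometric polynomials on a torus\<close>

text \<open>Coordinates outside F are frozen at 1, so that points of the torus are determined by those in F.\<close>
definition torus :: "'i set => ('i => complex) set" where
 "torus F = {b. \<forall>i. b i \<in> (if i \<in> F then sphere 0 1 else {1})}"

definition monomial :: "'i set => ('i => int) => ('i => complex) => complex" where
 "monomial F m b = (\<Prod>i\<in>F. b i powi m i)"

lemma compact_torus: "compact (torus F)"
 unfolding torus_def by (rule compact_pointwise_bounded) auto

lemma torus_norm: "b \<in> torus F ==> norm (b i) = 1"
 by (auto simp: torus_def split: if_splits dest!: spec[of _ i])

lemma torus_nonzero: "b \<in> torus F ==> b i \<noteq> 0"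
 using torus_norm[of b F i] by auto

lemma monomial_add: "b \<in> torus F ==> monomial F (%i. m i + k i) b = monomial F m b * monomial F k b"
 by (simp add: monomial_def power_int_add torus_nonzero prod.distrib)

lemma monomial_continuous: "continuous_on (torus F) (monomial F m)"
 unfolding monomial_def
 by (intro continuous_intros continuous_on_subset[OF continuous_on_product_coordinates]) (auto dest: torus_nonzero)

lemma monomial_single:
 assumes "finite F" "i \<in> F"
 shows "monomial F (%j. if j = i then k else 0) b = b i powi k"
proof -
 have "monomial F (%j. if j = i then k else 0) b = (\<Prod>j\<in>F. if j = i then b i powi k else 1)"
  unfolding monomial_def by (rule prod.cong) auto
 thus ?thesis using assms by simp
qed

definition torus_poly :: "'i set => (('i => int) \<times> complex) list => ('i => complex) => complex" where
 "torus_poly F ms b = (\<Sum>p\<leftarrow>ms. snd p * monomial F (fst p) b)"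

lemma torus_poly_append: "torus_poly F (ms @ ns) b = torus_poly F ms b + torus_poly F ns b"
 by (simp add: torus_poly_def)

lemma torus_poly_mult:
 assumes "b \<in> torus F"
 shows "torus_poly F (map (%r. (%i. fst (fst r) i + fst (snd r) i, snd (fst r) * snd (snd r))) (List.product ms ns)) b =
  torus_poly F ms b * torus_poly F ns b"
 unfolding torus_poly_def sum_list_product
 by (simp add: o_def monomial_add[OF assms] mult.assoc mult.left_commute)

lemma torus_poly_continuous: "continuous_on (torus F) (torus_poly F ms)"
proof -
 have "continuous_on (torus F) (%b. \<Sum>p\<leftarrow>ms. snd p * monomial F (fst p) b)"
  by (induction ms) (auto intro!: continuous_intros monomial_continuous)
 thus ?thesis by (simp add: torus_poly_def[abs_def])
qed

text \<open>Stone-Weierstrass. The index type is countable because the product space must be Hausdorff.\<close>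
lemma torus_poly_dense:
 fixes f :: "('i::countable => complex) => real"
 assumes F: "finite F" and f: "continuous_on (torus F) f" and "0 < (e::real)"
 shows "\<exists>ms. \<forall>b\<in>torus F. norm (complex_of_real (f b) - torus_poly F ms b) < e"
proof -
 define R where "R = {f :: ('i => complex) => real. \<exists>ms. \<forall>b\<in>torus F. complex_of_real (f b) = torus_poly F ms b}"
 interpret function_ring_on R "torus F"
 proof
  show "compact (torus F)" by (rule compact_torus)
  show "continuous_on (torus F) f" if "f \<in> R" for f
  proof -
   obtain ms where ms: "\<forall>b\<in>torus F. complex_of_real (f b) = torus_poly F ms b" using `f \<in> R` by (auto simp: R_def)
   have "continuous_on (torus F) (%b. Re (torus_poly F ms b))"
    by (intro continuous_intros torus_poly_continuous)
   thus ?thesis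
    by (rule continuous_on_eq) (metis ms Re_complex_of_real)
  qed
  show "(%x. f x + g x) \<in> R" if fg: "f \<in> R" "g \<in> R" for f g
  proof -
   obtain ms ns where "\<forall>b\<in>torus F. complex_of_real (f b) = torus_poly F ms b"
    "\<forall>b\<in>torus F. complex_of_real (g b) = torus_poly F ns b" using fg unfolding R_def by blast
   thus ?thesis unfolding R_def by (auto intro!: exI[of _ "ms @ ns"] simp: torus_poly_append)
  qed
  show "(%x. f x * g x) \<in> R" if fg: "f \<in> R" "g \<in> R" for f g
  proof -
   obtain ms ns where "\<forall>b\<in>torus F. complex_of_real (f b) = torus_poly F ms b"
    "\<forall>b\<in>torus F. complex_of_real (g b) = torus_poly F ns b" using fg unfolding R_def by blast
   thus ?thesis unfolding R_def
    by (intro CollectI exI[of _ "map (%r. (%i. fst (fst r) i + fst (snd r) i, snd (fst r) * snd (snd r))) (List.product ms ns)"] ballI)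
     (simp only: torus_poly_mult of_real_mult)
  qed
  show "(%_. c) \<in> R" for c
   unfolding R_def by (auto intro!: exI[of _ "[(%_. 0, complex_of_real c)]"] simp: torus_poly_def monomial_def)
  show "\<exists>f\<in>R. f x \<noteq> f y" if xy: "x \<in> torus F" "y \<in> torus F" "x \<noteq> y" for x y
  proof -
   obtain i where i: "x i \<noteq> y i" using xy(3) by blast
   have iF: "i \<in> F"
   proof (rule ccontr)
    assume "i \<notin> F"
    hence "x i = 1" "y i = 1" using that(1,2) by (auto simp: torus_def dest!: spec[of _ i])
    thus False using i by simp
   qed
   have inv: "inverse (b i) = cnj (b i)" if "b \<in> torus F" for b
    using torus_norm[OF that, of i] complex_norm_square[of "b i"] torus_nonzero[OF that, of i]
    by (simp add: inverse_eq_divide divide_eq_eq mult.commute)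
   let ?m = "%k j. if j = i then k else 0 :: int"
   have tp: "torus_poly F [(?m 1, c), (?m (-1), d)] b = c * b i + d * cnj (b i)" if "b \<in> torus F" for b c d
    unfolding torus_poly_def using inv[OF that] by (simp add: monomial_single[OF F iF])
   have "complex_of_real (Re (b i)) = torus_poly F [(?m 1, 1/2), (?m (-1), 1/2)] b" if "b \<in> torus F" for b
    unfolding tp[OF that] by (simp add: complex_eq_iff)
   hence r1: "(%b. Re (b i)) \<in> R" unfolding R_def by blast
   have "complex_of_real (Im (b i)) = torus_poly F [(?m 1, - \<i>/2), (?m (-1), \<i>/2)] b" if "b \<in> torus F" for b
    unfolding tp[OF that] by (simp add: complex_eq_iff)
   hence r2: "(%b. Im (b i)) \<in> R" unfolding R_def by blast
   have "Re (x i) \<noteq> Re (y i) \<or> Im (x i) \<noteq> Im (y i)" using i by (simp add: complex_eq_iff)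
   thus ?thesis using bexI[OF _ r1] bexI[OF _ r2] by (elim disjE)
  qed
 qed
 obtain g where g: "g \<in> R" "\<forall>x\<in>torus F. \<bar>f x - g x\<bar> < e" using Stone_Weierstrass_basic[OF f `0 < e`] by blast
 then obtain ms where ms: "\<forall>b\<in>torus F. complex_of_real (g b) = torus_poly F ms b" by (auto simp: R_def)
 have "norm (complex_of_real (f b) - torus_poly F ms b) < e" if "b \<in> torus F" for b
 proof -
  have "complex_of_real (f b) - torus_poly F ms b = complex_of_real (f b - g b)"
   using ms that by simp
  thus ?thesis using g(2) that by (simp only: norm_of_real)
 qed
 thus ?thesis by blast
qed

lemma integral_pair_mult:
 fixes f :: "'a => complex" and g :: "'b => complex"
 assumes "prob_space A" "prob_space B" "f \<in> borel_measurable A" "g \<in> borel_measurable B"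
  "\<And>x. norm (f x) <= 1" "\<And>x. norm (g x) <= 1"
 shows "(LINT z|(A \<Otimes>\<^sub>M B). f (fst z) * g (snd z)) = (LINT x|A. f x) * (LINT x|B. g x)"
proof -
 interpret A: prob_space A by fact
 interpret B: prob_space B by fact
 interpret pair_prob_space A B ..
 have [measurable]: "f \<in> borel_measurable A" "g \<in> borel_measurable B" by fact+
 have "integrable (A \<Otimes>\<^sub>M B) (%z. f (fst z) * g (snd z))"
  by (rule integrable_const_bound[where B = 1])
   (use assms(5,6) in \<open>auto simp: norm_mult intro!: mult_le_one\<close>)
 from integral_fst'[OF this] show ?thesis by simp
qed


section \<open>Halving characters, and a bump on the torus\<close>

lemma integral_triple_char:
 fixes \<rho> :: "'a::{topological_ab_group_add,second_countable_topology} measure"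
 assumes r: "\<rho> \<in> distributions"
 shows "(LINT t|(\<rho> \<Otimes>\<^sub>M (\<rho> \<Otimes>\<^sub>M \<rho>)). char_app u (fst t) * (char_app v (fst (snd t)) * char_app w (snd (snd t)))) =
  char_fun \<rho> u * (char_fun \<rho> v * char_fun \<rho> w)"
proof -
 interpret prob_space \<rho> by (rule distributionsD(1)[OF r])
 interpret P: pair_prob_space \<rho> \<rho> ..
 note cm = char_measurable'[OF r]
 have m2: "(%s. char_app v (fst s) * char_app w (snd s)) \<in> borel_measurable (\<rho> \<Otimes>\<^sub>M \<rho>)"
  using cm by measurable
 have "(LINT t|(\<rho> \<Otimes>\<^sub>M (\<rho> \<Otimes>\<^sub>M \<rho>)). char_app u (fst t) * (char_app v (fst (snd t)) * char_app w (snd (snd t)))) =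
  (LINT x|\<rho>. char_app u x) * (LINT s|(\<rho> \<Otimes>\<^sub>M \<rho>). char_app v (fst s) * char_app w (snd s))"
  by (rule integral_pair_mult[of \<rho> "\<rho> \<Otimes>\<^sub>M \<rho>" "char_app u" "%s. char_app v (fst s) * char_app w (snd s)"])
   (use cm m2 in \<open>auto simp: norm_mult intro: prob_space_axioms P.prob_space_axioms\<close>)
 also have "(LINT s|(\<rho> \<Otimes>\<^sub>M \<rho>). char_app v (fst s) * char_app w (snd s)) = (LINT x|\<rho>. char_app v x) * (LINT x|\<rho>. char_app w x)"
  by (rule integral_pair_mult) (use cm in \<open>auto intro: prob_space_axioms\<close>)
 finally show ?thesis by (simp add: char_fun_def)
qed

context quadratic_char_fun
begin

lemma dirn_0 [simp]: "dirn 0 = 1"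
 by (simp add: dirn_def char_fun_0[OF mu])

lemma dirn_zmult_int: "dirn (zmult k y) = dirn y powi k"
proof (cases "0 <= k")
 case True
 thus ?thesis using dirn_zmult[of "nat k" y] by (simp add: power_int_def)
next
 case False
 have n: "cnj (dirn y) = inverse (dirn y)"
  using complex_norm_square[of "dirn y"] norm_dirn[of y] by (metis inverse_unique norm_one of_real_1 power_one)
 have "zmult k y = - zmult (int (nat (- k))) y" using False by (simp add: zmult_minus_left[symmetric])
 thus ?thesis using dirn_zmult[of "nat (- k)" y] False by (simp add: dirn_minus n power_int_def)
qed

lemma dirn_sum: "dirn (\<Sum>i\<in>A. f i) = (\<Prod>i\<in>A. dirn (f i))"
 by (induction A rule: infinite_finite_induct) (auto simp: dirn_add)

lemma halves_sum_limit:
 assumes "finite A" "\<And>i. i \<in> A ==> (%n. char_dist2 \<mu> (zmult 2 (z i n)) (y i)) \<longlonglongrightarrow> 0"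
 shows "(%n. char_dist2 \<mu> (zmult 2 (\<Sum>i\<in>A. zmult (m i) (z i n))) (\<Sum>i\<in>A. zmult (m i) (y i))) \<longlonglongrightarrow> 0"
 using assms
proof (induction A rule: finite_induct)
 case empty
 thus ?case by (simp add: char_dist2_def)
next
 case (insert i A)
 let ?d = "%n. char_dist2 \<mu> (zmult 2 (\<Sum>i\<in>A. zmult (m i) (z i n))) (\<Sum>i\<in>A. zmult (m i) (y i))"
 let ?e = "%n. char_dist2 \<mu> (zmult 2 (z i n)) (y i)"
 have bd: "char_dist2 \<mu> (zmult 2 (\<Sum>i\<in>insert i A. zmult (m i) (z i n))) (\<Sum>i\<in>insert i A. zmult (m i) (y i))
  <= 2 * ((real_of_int (m i))^2 * ?e n) + 2 * ?d n" for n
 proof -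
  have c: "zmult 2 (zmult (m i) (z i n)) = zmult (m i) (zmult 2 (z i n))"
   by (simp only: zmult_mult[symmetric] mult.commute)
  have "char_dist2 \<mu> (zmult 2 (\<Sum>i\<in>insert i A. zmult (m i) (z i n))) (\<Sum>i\<in>insert i A. zmult (m i) (y i)) =
   char_dist2 \<mu> (zmult (m i) (zmult 2 (z i n)) + zmult 2 (\<Sum>i\<in>A. zmult (m i) (z i n))) (zmult (m i) (y i) + (\<Sum>i\<in>A. zmult (m i) (y i)))"
   using insert(1,2) by (simp add: zmult_add_right c)
  also have "... <= 2 * char_dist2 \<mu> (zmult (m i) (zmult 2 (z i n))) (zmult (m i) (y i)) + 2 * ?d n"
   by (rule char_dist2_add_le[OF mu])
  also have "... <= 2 * ((real_of_int (m i))^2 * ?e n) + 2 * ?d n"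
   using char_dist2_zmult_le[OF mu, of "m i" "zmult 2 (z i n)" "y i"] by simp
  finally show ?thesis .
 qed
 have "?e \<longlonglongrightarrow> 0" "?d \<longlonglongrightarrow> 0" using insert by auto
 hence "(%n. 2 * ((real_of_int (m i))^2 * ?e n) + 2 * ?d n) \<longlonglongrightarrow> 2 * ((real_of_int (m i))^2 * 0) + 2 * 0"
  by (intro tendsto_intros)
 hence lim: "(%n. 2 * ((real_of_int (m i))^2 * ?e n) + 2 * ?d n) \<longlonglongrightarrow> 0" by simp
 show ?case
  by (rule tendsto_sandwich[OF _ _ tendsto_const lim]) (auto simp: bd char_dist2_nonneg)
qed

text \<open>The characteristic function of the sum of two symmetrised copies at z is exp(- 4 \<phi>(z)) = exp(- \<phi>(2z)).\<close>
lemma halves_exp_limit: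
 assumes "finite A" "\<And>i. i \<in> A ==> (%n. char_dist2 \<mu> (zmult 2 (z i n)) (y i)) \<longlonglongrightarrow> 0"
 shows "(%n. exp (- 4 * phi (\<Sum>i\<in>A. zmult (m i) (z i n)))) \<longlonglongrightarrow> exp (- phi (\<Sum>i\<in>A. zmult (m i) (y i)))"
proof -
 have e: "exp (- 4 * phi w) = norm (char_fun \<mu> (zmult 2 w))" for w
  using phi_zmult[of 2 w] by (simp add: norm_char_fun)
 show ?thesis
  unfolding e norm_char_fun[symmetric]
  by (intro tendsto_norm L2_limit[OF mu] halves_sum_limit[OF assms(1)] assms(2))
qed

text \<open>A finite net of K and products of tent functions; strict positivity of h records closeness to K.\<close>
lemma torus_bump:
 fixes g :: "nat => 'a => complex"
 assumes K: "compact K" and "0 < \<delta>" and g: "\<And>i. continuous_on UNIV (g i)"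
 shows "\<exists>h :: (nat => complex) => real. continuous_on UNIV h \<and> (\<forall>b. 0 <= h b \<and> h b <= 1) \<and>
  (\<forall>k\<in>K. \<forall>b. (\<forall>i<d. b i = g i k) \<longrightarrow> h b = 1) \<and>
  (\<forall>b. 0 < h b \<longrightarrow> (\<exists>k\<in>K. \<forall>i<d. norm (b i - g i k) < 2 * \<delta>))"
proof -
 define O' where "O' k = (\<Inter>i<d. {x. norm (g i x - g i k) < \<delta>})" for k
 have "open (O' k)" for k
  unfolding O'_def by (intro open_INT ballI open_Collect_less continuous_intros g) auto
 moreover have "K \<subseteq> \<Union>(O' ` K)" using `0 < \<delta>` by (auto simp: O'_def)
 ultimately obtain A where A: "A \<subseteq> K" "finite A" "K \<subseteq> (\<Union>k\<in>A. O' k)"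
  using compactE_image[OF K, of K O'] by auto
 define h where "h b = min 1 (\<Sum>k\<in>A. \<Prod>i<d. max 0 (2 - norm (b i - g i k) / \<delta>))" for b :: "nat => complex"
 have nn: "0 <= (\<Prod>i<d. max 0 (2 - norm (b i - g i k) / \<delta>))" for b :: "nat => complex" and k
  by (intro prod_nonneg) simp
 have "continuous_on UNIV h"
  unfolding h_def by (intro continuous_intros continuous_on_product_coordinates) (use `0 < \<delta>` in auto)
 moreover have "0 <= h b" "h b <= 1" for b
  using nn by (auto simp: h_def intro!: sum_nonneg)
 moreover have "h b = 1" if kK: "k \<in> K" "\<forall>i<d. b i = g i k" for k b
 proof -
  obtain k' where k': "k' \<in> A" "k \<in> O' k'" using A(3) kK(1) by blast
  have "1 <= (\<Prod>i<d. max 0 (2 - norm (b i - g i k') / \<delta>))"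
  proof (rule prod_ge_1)
   fix i assume i: "i \<in> {..<d}"
   have "norm (b i - g i k') < \<delta>" using k'(2) kK(2) i by (auto simp: O'_def)
   hence "norm (b i - g i k') / \<delta> <= 1" using `0 < \<delta>` by simp
   thus "1 <= max 0 (2 - norm (b i - g i k') / \<delta>)" by simp
  qed
  also have "... <= (\<Sum>k\<in>A. \<Prod>i<d. max 0 (2 - norm (b i - g i k) / \<delta>))"
   using A(2) k'(1) nn by (intro member_le_sum) auto
  finally show ?thesis by (simp add: h_def)
 qed
 moreover have "\<exists>k\<in>K. \<forall>i<d. norm (b i - g i k) < 2 * \<delta>" if "0 < h b" for b
 proof -
  have pos: "0 < (\<Sum>k\<in>A. \<Prod>i<d. max 0 (2 - norm (b i - g i k) / \<delta>))" using that by (simp add: h_def)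
  have "\<exists>k\<in>A. (\<Prod>i<d. max 0 (2 - norm (b i - g i k) / \<delta>)) \<noteq> 0"
  proof (rule ccontr)
   assume "\<not> ?thesis"
   hence "(\<Sum>k\<in>A. \<Prod>i<d. max 0 (2 - norm (b i - g i k) / \<delta>)) = 0" by (intro sum.neutral) blast
   thus False using pos by simp
  qed
  then obtain k where k: "k \<in> A" "(\<Prod>i<d. max 0 (2 - norm (b i - g i k) / \<delta>)) \<noteq> 0" by blast
  have "norm (b i - g i k) < 2 * \<delta>" if "i < d" for i
  proof (rule ccontr)
   assume "\<not> norm (b i - g i k) < 2 * \<delta>"
   hence "2 <= norm (b i - g i k) / \<delta>" using `0 < \<delta>` by (simp add: le_divide_eq)
   hence "max 0 (2 - norm (b i - g i k) / \<delta>) = 0" by simp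
   hence "(\<Prod>i<d. max 0 (2 - norm (b i - g i k) / \<delta>)) = 0" using that by (intro prod_zero) auto
   thus False using k(2) by simp
  qed
  thus ?thesis using k(1) A(1) by blast
 qed
 ultimately show ?thesis by blast
qed

end


section \<open>The direction is a point of the group\<close>

context quadratic_char_fun
begin

text \<open>Let l be the direction. Take independent s1, s2, s3 with law the symmetrisation of \<mu>, and z with 2z close
to y. Each of z(s1 + s3), z(s2 - s3), z(s1 + s2) has approximately the law of conj(l(y)) y under \<mu>, jointly
in the y_i, and the third is the product of the first two. Each lies near the image of K with
probability above 2/3, so in some outcome all three do, near the images of k1, k2, k3; the product
relation then says that y(k1 + k2 - k3) is close to l(y).\<close>
lemma ex_center_approx:
 fixes y :: "nat => 'a character" and d :: nat
 assumes K: "compact K" "measure \<mu> (- K) <= 1 / 7" and "0 < e"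
 shows "\<exists>k1\<in>K. \<exists>k2\<in>K. \<exists>k3\<in>K. \<forall>i<d. norm (char_app (y i) (k1 + k2 - k3) - dirn (y i)) <= e"
proof -
 interpret prob_space \<mu> by (rule distributionsD(1)[OF mu])
 note sets_mu = distributionsD(2)[OF mu] and space_mu = distributionsD(3)[OF mu]
 define \<delta> where "\<delta> = e / 6"
 have d0: "0 < \<delta>" using `0 < e` by (simp add: \<delta>_def)
 define g where "g i x = cnj (dirn (y i)) * char_app (y i) x" for i x
 have gc: "continuous_on UNIV (g i)" for i
  unfolding g_def by (intro continuous_intros char_cont)
 have gn: "norm (g i x) = 1" for i x by (simp add: g_def norm_mult)
 define F where "F = {..<d}"
 define a where "a x = (%i. if i \<in> F then g i x else 1)" for x
 have at: "a x \<in> torus F" for x by (simp add: a_def torus_def gn)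
 have ac: "continuous_on UNIV a"
  unfolding a_def
 proof (rule continuous_on_coordinatewise_then_product)
  show "continuous_on UNIV (%x. if i \<in> F then g i x else 1)" for i
   by (cases "i \<in> F") (simp_all add: gc)
 qed
 have "\<exists>h :: (nat => complex) => real. continuous_on UNIV h \<and> (\<forall>b. 0 <= h b \<and> h b <= 1) \<and>
  (\<forall>k\<in>K. \<forall>b. (\<forall>i<d. b i = g i k) \<longrightarrow> h b = 1) \<and>
  (\<forall>b. 0 < h b \<longrightarrow> (\<exists>k\<in>K. \<forall>i<d. norm (b i - g i k) < 2 * \<delta>))"
  by (rule torus_bump[OF K(1) d0 gc])
 then obtain h :: "(nat => complex) => real" where h: "continuous_on UNIV h" "\<forall>b. 0 <= h b \<and> h b <= 1"
  "\<forall>k\<in>K. \<forall>b. (\<forall>i<d. b i = g i k) \<longrightarrow> h b = 1"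
  "\<forall>b. 0 < h b \<longrightarrow> (\<exists>k\<in>K. \<forall>i<d. norm (b i - g i k) < 2 * \<delta>)"
  by (elim exE conjE)
 have h0: "0 <= h b" and h1: "h b <= 1" for b using h(2) by auto
 have hK: "h (a k) = 1" if "k \<in> K" for k using h(3) that by (simp add: a_def F_def)
 have "continuous_on (torus F) h" using h(1) continuous_on_subset by blast
 then obtain ms where ms: "\<forall>b\<in>torus F. norm (complex_of_real (h b) - torus_poly F ms b) < 1 / 100"
  using torus_poly_dense[of F h "1/100"] by (auto simp: F_def)
 have "\<forall>i. \<exists>z. (%n. char_dist2 \<mu> (zmult 2 (z n)) (y i)) \<longlonglongrightarrow> 0"
  using dense_L2_sequence[OF lc tf mu, of "%_. 2"] by simp
 then obtain z where z: "\<And>i. (%n. char_dist2 \<mu> (zmult 2 (z i n)) (y i)) \<longlonglongrightarrow> 0" by metis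
 define wz where "wz m n = (\<Sum>i\<in>F. zmult (m i) (z i n))" for m n
 define wy where "wy m = (\<Sum>i\<in>F. zmult (m i) (y i))" for m
 have lim: "(%n. exp (- 4 * phi (wz m n))) \<longlonglongrightarrow> exp (- phi (wy m))" for m
  unfolding wz_def wy_def by (rule halves_exp_limit) (simp_all add: F_def z)
 obtain \<rho> where r: "\<rho> \<in> distributions" "\<And>y. char_fun \<rho> y = complex_of_real (exp (- 2 * phi y))"
  using symmetrization by blast
 let ?T = "\<rho> \<Otimes>\<^sub>M (\<rho> \<Otimes>\<^sub>M \<rho>)"
 have T: "?T \<in> distributions" by (intro pair_distribution r(1))
 interpret T: prob_space ?T using T by (simp add: distributions_def)
 define b where "b c n t = (%i. if i \<in> F then char_app (z i n)
   (if c = (1::nat) then fst t + snd (snd t) else if c = 2 then fst (snd t) - snd (snd t) else fst t + fst (snd t)) else 1)"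
  for c n and t :: "'a \<times> 'a \<times> 'a"
 have bt: "b c n t \<in> torus F" for c n t by (simp add: b_def torus_def)
 have bc: "continuous_on UNIV (b c n)" for c n
  unfolding b_def
 proof (rule continuous_on_coordinatewise_then_product)
  fix i
  show "continuous_on UNIV (%t :: 'a \<times> 'a \<times> 'a. if i \<in> F then char_app (z i n)
   (if c = (1::nat) then fst t + snd (snd t) else if c = 2 then fst (snd t) - snd (snd t) else fst t + fst (snd t)) else 1)"
   by (cases "i \<in> F"; cases "c = 1"; cases "c = 2")
    (auto intro!: continuous_on_compose2[OF char_cont[of UNIV]] continuous_intros)
 qed
 have mb: "monomial F m (b c n t) = char_app (wz m n)
   (if c = (1::nat) then fst t + snd (snd t) else if c = 2 then fst (snd t) - snd (snd t) else fst t + fst (snd t))" for m c n t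
  unfolding monomial_def wz_def char_sum_left char_zmult_left by (rule prod.cong) (simp_all add: b_def)
 have ma: "monomial F m (a x) = cnj (dirn (wy m)) * char_app (wy m) x" for m x
 proof -
  have "monomial F m (a x) = (\<Prod>i\<in>F. cnj (dirn (y i) powi m i) * (char_app (y i) x powi m i))"
   unfolding monomial_def by (rule prod.cong) (simp_all add: a_def g_def power_int_mult_distrib)
  also have "... = cnj (\<Prod>i\<in>F. dirn (y i) powi m i) * (\<Prod>i\<in>F. char_app (y i) x powi m i)"
   by (simp add: prod.distrib)
  finally show ?thesis unfolding wy_def dirn_sum dirn_zmult_int char_sum_left char_zmult_left .
 qed
 have Ea: "(LINT x|\<mu>. monomial F m (a x)) = complex_of_real (exp (- phi (wy m)))" for m
 proof -
  have "cnj (dirn (wy m)) * dirn (wy m) = 1" using complex_norm_square[of "dirn (wy m)"] by (simp add: mult.commute)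
  hence "cnj (dirn (wy m)) * char_fun \<mu> (wy m) = complex_of_real (exp (- phi (wy m)))"
   unfolding char_fun_polar by (simp add: mult.assoc[symmetric])
  thus ?thesis unfolding ma by (simp add: char_fun_def)
 qed
 have Eb: "(LINT t|?T. monomial F m (b c n t)) = complex_of_real (exp (- 4 * phi (wz m n)))" for m c n
 proof -
  let ?w = "wz m n"
  \<comment> \<open>Each sum involves two of the three independent variables; the third gets the trivial character.\<close>
  obtain u v w where uvw: "(u = ?w \<or> u = 0) \<and> (v = ?w \<or> v = 0) \<and> (w = ?w \<or> w = - ?w \<or> w = 0) \<and>
    phi u + phi v + phi w = 2 * phi ?w \<and>
    (\<forall>t. monomial F m (b c n t) = char_app u (fst t) * (char_app v (fst (snd t)) * char_app w (snd (snd t))))"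
  proof (cases "c = 1 \<or> c = 2")
   case True
   thus thesis
   proof
    assume "c = 1"
    thus thesis by (intro that[of ?w 0 ?w]) (simp add: mb char_add phi_def char_fun_0[OF mu])
   next
    assume "c = 2"
    thus thesis by (intro that[of 0 ?w "- ?w"])
     (simp add: mb char_diff_right char_minus_left phi_minus, simp add: phi_def char_fun_0[OF mu])
   qed
  next
   case False
   thus thesis by (intro that[of ?w ?w 0]) (simp add: mb char_add phi_def char_fun_0[OF mu])
  qed
  have me: "monomial F m (b c n t) = char_app u (fst t) * (char_app v (fst (snd t)) * char_app w (snd (snd t)))" for t
   using uvw by blast
  have "(LINT t|?T. monomial F m (b c n t)) = char_fun \<rho> u * (char_fun \<rho> v * char_fun \<rho> w)"
   unfolding me by (rule integral_triple_char[OF r(1)])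
  also have "... = complex_of_real (exp (- 2 * (phi u + phi v + phi w)))"
   unfolding r(2) by (simp only: of_real_mult[symmetric] exp_add[symmetric] of_real_eq_iff) (simp add: algebra_simps)
  also have "... = complex_of_real (exp (- 4 * phi ?w))" using uvw by simp
  finally show ?thesis .
 qed
 have mn: "norm (monomial F m b') <= 1" if "b' \<in> torus F" for m b'
  unfolding monomial_def prod_norm[symmetric] norm_power_int using torus_norm[OF that] by simp
 have mca: "continuous_on UNIV (%x. monomial F m (a x))" for m
  by (rule continuous_on_compose2[OF monomial_continuous[of F m] ac]) (use at in auto)
 have mcb: "continuous_on UNIV (%t. monomial F m (b c n t))" for m c n
  by (rule continuous_on_compose2[OF monomial_continuous[of F m] bc]) (use bt in auto)
 have ima: "integrable \<mu> (%x. monomial F m (a x))" for m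
  by (rule bounded_integrable[OF mu mca]) (rule mn[OF at])
 have imb: "integrable ?T (%t. monomial F m (b c n t))" for m c n
  by (rule bounded_integrable[OF T mcb]) (rule mn[OF bt])
 have Epa: "integrable \<mu> (%x. torus_poly F ms (a x)) \<and> (LINT x|\<mu>. torus_poly F ms (a x)) = (\<Sum>p\<leftarrow>ms. snd p * complex_of_real (exp (- phi (wy (fst p)))))" for ms
  unfolding torus_poly_def by (induction ms) (auto simp: ima Ea)
 have Epb: "integrable ?T (%t. torus_poly F ms (b c n t)) \<and> (LINT t|?T. torus_poly F ms (b c n t)) = (\<Sum>p\<leftarrow>ms. snd p * complex_of_real (exp (- 4 * phi (wz (fst p) n))))" for ms c n
  unfolding torus_poly_def by (induction ms) (auto simp: imb Eb)
 have "(%n. \<Sum>p\<leftarrow>ms. snd p * complex_of_real (exp (- 4 * phi (wz (fst p) n)))) \<longlonglongrightarrow> (\<Sum>p\<leftarrow>ms. snd p * complex_of_real (exp (- phi (wy (fst p)))))" for ms :: "((nat => int) \<times> complex) list"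
  by (induction ms) (auto intro!: tendsto_add tendsto_mult tendsto_const tendsto_of_real lim[simplified])
 hence "\<forall>\<^sub>F n in sequentially. dist (\<Sum>p\<leftarrow>ms. snd p * complex_of_real (exp (- 4 * phi (wz (fst p) n)))) (\<Sum>p\<leftarrow>ms. snd p * complex_of_real (exp (- phi (wy (fst p))))) < 1 / 100"
  by (rule tendstoD) simp
 then obtain n where n: "dist (\<Sum>p\<leftarrow>ms. snd p * complex_of_real (exp (- 4 * phi (wz (fst p) n)))) (\<Sum>p\<leftarrow>ms. snd p * complex_of_real (exp (- phi (wy (fst p))))) < 1 / 100"
  by (auto simp: eventually_sequentially)
 have hca: "continuous_on UNIV (%x. h (a x))" by (rule continuous_on_compose2[OF h(1) ac]) simp
 have hcb: "continuous_on UNIV (%t. h (b c n t))" for c by (rule continuous_on_compose2[OF h(1) bc]) simp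
 have iha: "integrable \<mu> (%x. h (a x))" by (rule bounded_integrable[OF mu hca, where B = 1]) (simp add: h0 h1)
 have ihb: "integrable ?T (%t. h (b c n t))" for c by (rule bounded_integrable[OF T hcb, where B = 1]) (simp add: h0 h1)
 have Eha: "6 / 7 <= (LINT x|\<mu>. h (a x))"
 proof -
  have oK: "- K \<in> sets \<mu>" using compact_imp_closed[OF K(1)] sets_mu by (auto intro: borel_open)
  hence Ks: "K \<in> sets \<mu>" using compact_imp_closed[OF K(1)] sets_mu by (auto intro: borel_closed)
  have "measure \<mu> K = 1 - measure \<mu> (- K)" using prob_compl[OF Ks] by (simp add: space_mu Compl_eq_Diff_UNIV)
  hence "6 / 7 <= measure \<mu> K" using K(2) by simp
  also have "... = (LINT x|\<mu>. indicator K x)" using Bochner_Integration.integral_indicator[of \<mu> K] by (simp add: space_mu)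
  also have "... <= (LINT x|\<mu>. h (a x))"
  proof (rule integral_mono[OF _ iha])
   show "integrable \<mu> (indicator K :: 'a => real)"
    using Ks by (intro integrable_real_indicator) (simp_all add: less_top[symmetric])
   show "indicator K x <= h (a x)" for x using hK h0 by (simp add: indicator_def)
  qed
  finally show ?thesis .
 qed
 have Ehb: "2 / 3 < (LINT t|?T. h (b c n t))" for c
 proof -
  have "norm (LINT x|\<mu>. complex_of_real (h (a x)) - torus_poly F ms (a x)) <= (LINT x|\<mu>. norm (complex_of_real (h (a x)) - torus_poly F ms (a x)))"
   by (rule integral_norm_bound)
  also have "... <= (LINT x|\<mu>. 1 / 100)"
   by (rule integral_mono) (use Epa[of ms] iha ms at in \<open>auto intro!: integrable_norm integrable_of_real less_imp_le\<close>)
  finally have A1: "norm (complex_of_real (LINT x|\<mu>. h (a x)) - (LINT x|\<mu>. torus_poly F ms (a x))) <= 1 / 100"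
   using Epa[of ms] iha by (simp add: prob_space)
  have "norm (LINT x|?T. complex_of_real (h (b c n x)) - torus_poly F ms (b c n x)) <= (LINT x|?T. norm (complex_of_real (h (b c n x)) - torus_poly F ms (b c n x)))"
   by (rule integral_norm_bound)
  also have "... <= (LINT x|?T. 1 / 100)"
   by (rule integral_mono) (use Epb[of ms c n] ihb ms bt in \<open>auto intro!: integrable_norm integrable_of_real less_imp_le\<close>)
  finally have B1: "norm (complex_of_real (LINT x|?T. h (b c n x)) - (LINT x|?T. torus_poly F ms (b c n x))) <= 1 / 100"
   using Epb[of ms c n] ihb by (simp add: T.prob_space)
  have C1: "norm ((LINT x|?T. torus_poly F ms (b c n x)) - (LINT x|\<mu>. torus_poly F ms (a x))) <= 1 / 100"
   using n Epa[of ms] Epb[of ms c n] by (simp add: dist_norm)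
  have "norm (complex_of_real (LINT x|?T. h (b c n x)) - complex_of_real (LINT x|\<mu>. h (a x))) <= 3 / 100"
   using norm_triangle_ineq4[of "complex_of_real (LINT x|?T. h (b c n x)) - (LINT x|\<mu>. torus_poly F ms (a x))" "complex_of_real (LINT x|\<mu>. h (a x)) - (LINT x|\<mu>. torus_poly F ms (a x))"]
    norm_triangle_ineq[of "complex_of_real (LINT x|?T. h (b c n x)) - (LINT x|?T. torus_poly F ms (b c n x))" "(LINT x|?T. torus_poly F ms (b c n x)) - (LINT x|\<mu>. torus_poly F ms (a x))"]
    A1 B1 C1 by simp
  hence "\<bar>(LINT x|?T. h (b c n x)) - (LINT x|\<mu>. h (a x))\<bar> <= 3 / 100"
   by (simp only: of_real_diff[symmetric] norm_of_real)
  thus ?thesis using Eha abs_ge_minus_self[of "(LINT x|?T. h (b c n x)) - (LINT x|\<mu>. h (a x))"] by linarith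
 qed
 \<comment> \<open>Three expectations above 2/3 add up to more than 2.\<close>
 have "\<exists>t. 2 < h (b 1 n t) + h (b 2 n t) + h (b 3 n t)"
 proof (rule ccontr)
  assume "\<not> ?thesis"
  hence "(LINT t|?T. h (b 1 n t) + h (b 2 n t) + h (b 3 n t)) <= (LINT t|?T. 2)"
   by (intro integral_mono) (auto simp: ihb not_less)
  thus False using Ehb[of 1] Ehb[of 2] Ehb[of 3] by (simp add: ihb T.prob_space)
 qed
 then obtain t where t: "2 < h (b 1 n t) + h (b 2 n t) + h (b 3 n t)" by blast
 have "0 < h (b 1 n t)" "0 < h (b 2 n t)" "0 < h (b 3 n t)"
  using t h1[of "b 1 n t"] h1[of "b 2 n t"] h1[of "b 3 n t"] by linarith+
 hence "\<exists>k\<in>K. \<forall>i<d. norm (b 1 n t i - g i k) < 2 * \<delta>" "\<exists>k\<in>K. \<forall>i<d. norm (b 2 n t i - g i k) < 2 * \<delta>"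
  "\<exists>k\<in>K. \<forall>i<d. norm (b 3 n t i - g i k) < 2 * \<delta>" using h(4) by simp_all
 then obtain k1 k2 k3 where k: "k1 \<in> K" "k2 \<in> K" "k3 \<in> K"
  "\<forall>i<d. norm (b 1 n t i - g i k1) < 2 * \<delta>" "\<forall>i<d. norm (b 2 n t i - g i k2) < 2 * \<delta>"
  "\<forall>i<d. norm (b 3 n t i - g i k3) < 2 * \<delta>"
  by (elim bexE)
 have "norm (char_app (y i) (k1 + k2 - k3) - dirn (y i)) <= e" if i: "i < d" for i
 proof -
  let ?b1 = "b 1 n t i" and ?b2 = "b 2 n t i" and ?b3 = "b 3 n t i"
  have b3: "?b3 = ?b1 * ?b2"
   using i by (simp add: b_def F_def char_add char_diff_right mult.assoc[symmetric])
  have nb: "norm ?b1 = 1" "norm ?b2 = 1" by (rule torus_norm[OF bt])+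
  have n1: "norm (dirn (y i)) = 1" by simp
  have dd: "cnj (dirn (y i)) * dirn (y i) = 1" using complex_norm_square[of "dirn (y i)"] by (simp add: mult.commute)
  have "(char_app (y i) (k1 + k2 - k3) - dirn (y i)) * (cnj (dirn (y i)) * g i k3) =
    cnj (dirn (y i)) * cnj (dirn (y i)) * char_app (y i) (k1 + k2 - k3 + k3) - (cnj (dirn (y i)) * dirn (y i)) * g i k3"
   unfolding char_add[of "y i" "k1 + k2 - k3" k3] g_def by (simp add: algebra_simps)
  also have "... = g i k1 * g i k2 - g i k3"
   unfolding dd by (simp add: g_def char_add)
  finally have "norm ((char_app (y i) (k1 + k2 - k3) - dirn (y i)) * (cnj (dirn (y i)) * g i k3)) = norm (g i k1 * g i k2 - g i k3)"
   by simp
  hence "norm (char_app (y i) (k1 + k2 - k3) - dirn (y i)) = norm (g i k1 * g i k2 - g i k3)"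
   by (simp add: norm_mult gn)
  also have "g i k1 * g i k2 - g i k3 = (g i k1 - ?b1) * g i k2 + ?b1 * (g i k2 - ?b2) + (?b3 - g i k3)"
   unfolding b3 by (simp add: algebra_simps)
  also have "norm ... <= norm (g i k1 - ?b1) + norm (g i k2 - ?b2) + norm (?b3 - g i k3)"
   using norm_triangle_ineq[of "(g i k1 - ?b1) * g i k2 + ?b1 * (g i k2 - ?b2)" "?b3 - g i k3"]
    norm_triangle_ineq[of "(g i k1 - ?b1) * g i k2" "?b1 * (g i k2 - ?b2)"] nb gn[of i k2]
   by (simp add: norm_mult)
  also have "... <= e" using k(4-6) i by (auto simp: \<delta>_def norm_minus_commute dest!: spec[of _ i])
  finally show ?thesis .
 qed
 thus ?thesis using k(1-3) by blast
qed

text \<open>The approximate solutions lie in the compact set K + K - K.\<close>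
lemma ex_center: "\<exists>x. \<forall>y. char_app y x = dirn y"
proof -
 obtain K where K: "compact K" "measure \<mu> (- K) <= 1 / 7" using distribution_tight[OF lc mu, of "1/7"] by auto
 define L where "L = (%t. fst t + fst (snd t) - snd (snd t)) ` (K \<times> (K \<times> K))"
 have cL: "compact L"
  unfolding L_def by (intro compact_continuous_image compact_Times K(1) continuous_intros)
 define C where "C p = {x. norm (char_app (fst p) x - dirn (fst p)) <= 1 / real (Suc (snd p))}" for p :: "'a character \<times> nat"
 have "L \<inter> \<Inter>(C ` UNIV) \<noteq> {}"
 proof (rule compact_imp_fip_image[OF cL])
  show "closed (C p)" for p
   unfolding C_def by (intro closed_Collect_le continuous_intros char_cont)
  fix I' assume I': "finite I'" "I' \<subseteq> (UNIV :: ('a character \<times> nat) set)"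
  obtain ps where ps: "set ps = I'" using finite_list[OF I'(1)] by blast
  define N where "N = (\<Sum>p\<in>I'. snd p)"
  have N: "snd p <= N" if "p \<in> I'" for p
   unfolding N_def using I'(1) that by (intro member_le_sum) auto
  obtain k1 k2 k3 where k: "k1 \<in> K" "k2 \<in> K" "k3 \<in> K"
   "\<forall>i<length ps. norm (char_app (fst (ps ! i)) (k1 + k2 - k3) - dirn (fst (ps ! i))) <= 1 / real (Suc N)"
   using ex_center_approx[OF K, of "1 / real (Suc N)" "length ps" "%i. fst (ps ! i)"] by auto
  have "k1 + k2 - k3 \<in> C p" if p: "p \<in> I'" for p
  proof -
   obtain i where i: "i < length ps" "ps ! i = p" using p ps by (metis in_set_conv_nth)
   hence "norm (char_app (fst p) (k1 + k2 - k3) - dirn (fst p)) <= 1 / real (Suc N)" using k(4) by auto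
   also have "... <= 1 / real (Suc (snd p))" using N[OF p] by (intro divide_left_mono) auto
   finally show ?thesis by (simp add: C_def)
  qed
  moreover have "k1 + k2 - k3 \<in> L" using k(1-3) unfolding L_def by (intro image_eqI[of _ _ "(k1, k2, k3)"]) auto
  ultimately show "L \<inter> \<Inter>(C ` I') \<noteq> {}" by blast
 qed
 then obtain x where x: "x \<in> C p" for p by blast
 have "char_app y x = dirn y" for y
 proof -
  have "norm (char_app y x - dirn y) <= 1 / real (Suc n)" for n using x[of "(y, n)"] by (simp add: C_def)
  hence "norm (char_app y x - dirn y) <= 0"
   by (intro LIMSEQ_le_const[OF LIMSEQ_Suc[OF lim_1_over_n]]) auto
  thus ?thesis by simp
 qed
 thus ?thesis by blast
qed

theorem quadratic_gaussian: "\<mu> \<in> gaussian"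
proof -
 obtain x where x: "\<And>y. char_app y x = dirn y" using ex_center by blast
 have "char_fun \<mu> y = char_app y x * exp (- of_real (phi y))" for y
  unfolding x char_fun_polar[of y] by (simp add: exp_of_real[symmetric])
 thus ?thesis
  unfolding gaussian_def using mu phi_continuous phi_nonneg phi_parallelogram
  by (intro CollectI conjI exI[of _ x] exI[of _ phi]) auto
qed

end

theorem torsion_free_gaussian:
 fixes \<xi> :: "nat => 'w => 'a::{topological_ab_group_add,t2_space,second_countable_topology}"
 assumes "locally_compact_space (euclidean :: 'a topology)" "torsion_free TYPE('a)"
  "Q_independent_forms M n a b \<xi>" "j \<in> {1..n}"
 shows "distr M borel (\<xi> j) \<in> gaussian"
 by (rule quadratic_char_fun.quadratic_gaussian[OF Q_independent_forms_quadratic[OF assms]])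


section \<open>Groups with an element of prime order\<close>

text \<open>The least positive order of a nonzero torsion element is prime.\<close>
lemma ex_prime_order_element:
 assumes "\<not> torsion_free TYPE('a::ab_group_add)"
 shows "\<exists>p (x::'a). prime (p::nat) \<and> x \<noteq> 0 \<and> zmult (int p) x = 0"
proof -
 define P where "P n \<longleftrightarrow> 0 < n \<and> (\<exists>x::'a. x \<noteq> 0 \<and> zmult (int n) x = 0)" for n
 obtain m and x :: 'a where m: "m \<noteq> 0" "zmult m x = 0" "x \<noteq> 0"
  using assms unfolding torsion_free_def by blast
 have "zmult (int (nat \<bar>m\<bar>)) x = 0"
  using m by (cases "0 <= m") (simp_all add: zmult_minus_left)
 hence "P (nat \<bar>m\<bar>)" using m by (auto simp: P_def)
 hence PL: "P (LEAST n. P n)" by (rule LeastI)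
 define p where "p = (LEAST n. P n)"
 have "P p" unfolding p_def by (rule PL)
 then obtain x0 :: 'a where x0: "x0 \<noteq> 0" "zmult (int p) x0 = 0" and "0 < p"
  unfolding P_def by (elim conjE exE)
 have min: "\<not> P n" if "n < p" for n using not_less_Least that unfolding p_def by blast
 have "p \<noteq> 1" using x0 by auto
 moreover have "a = 1 \<or> a = p" if adv: "a dvd p" for a
 proof (rule ccontr)
  assume ne: "\<not> (a = 1 \<or> a = p)"
  obtain b where b: "p = a * b" using adv unfolding dvd_def by blast
  have ab: "0 < a" "0 < b" using b `0 < p` by auto
  have "a < p" "b < p" using ab b ne `0 < p` by (auto simp: nat_neq_iff)
  have "zmult (int b) x0 \<noteq> 0" using min[OF `b < p`] x0(1) ab unfolding P_def by blast
  moreover have "zmult (int a) (zmult (int b) x0) = 0" using x0(2) by (simp add: b zmult_mult)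
  ultimately have "P a" using ab unfolding P_def by blast
  thus False using min[OF `a < p`] by simp
 qed
 ultimately have "prime p" using `0 < p` by (auto simp: prime_nat_iff)
 thus ?thesis using x0 by blast
qed

lemma quadratic_function_zmult:
 fixes \<phi> :: "'g::ab_group_add => real"
 assumes "\<And>u v. \<phi> (u + v) + \<phi> (u - v) = 2 * (\<phi> u + \<phi> v)"
 shows "\<phi> (zmult (int n) y) = (real n)^2 * \<phi> y"
proof (induction n rule: less_induct)
 case (less n)
 have z: "\<phi> 0 = 0" using assms[of 0 0] by simp
 consider "n = 0" | "n = 1" | k where "n = k + 2"
  by (metis One_nat_def Suc_1 add_2_eq_Suc' not0_implies_Suc)
 thus ?case
 proof cases
  case (3 k)
  have e: "int (k + 2) = int (k + 1) + 1" "int (k + 1) = int k + 1" by simp_all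
  have "zmult (int (k + 1)) y + y = zmult (int (k + 2)) y" "zmult (int (k + 1)) y - y = zmult (int k) y"
   unfolding e(1) zmult_succ by (simp_all only: e(2) zmult_succ add_diff_cancel_right')
  hence "\<phi> (zmult (int (k + 2)) y) + \<phi> (zmult (int k) y) = 2 * (\<phi> (zmult (int (k + 1)) y) + \<phi> y)"
   using assms[of "zmult (int (k + 1)) y" y] by simp
  thus ?thesis using less[of k] less[of "k + 1"] 3 by (simp add: power2_eq_square algebra_simps)
 qed (simp_all add: z)
qed

definition two_point_pair :: "(bool \<times> bool) pmf" where
 "two_point_pair = pair_pmf (bernoulli_pmf (1/3)) (bernoulli_pmf (1/3))"

definition two_point_space :: "'a::zero => (nat => 'a) measure" where
 "two_point_space x0 = measure_pmf (map_pmf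
   (%b j. if j = 1 \<and> fst b \<or> j = 2 \<and> snd b then x0 else 0) two_point_pair)"

text \<open>Defined through the support, so that its values lie in {0, x0} for every outcome and the linear forms
reduce to the variables themselves, not just almost surely.\<close>
definition two_point_var :: "'a::zero => nat => (nat => 'a) => 'a" where
 "two_point_var x0 j \<omega> = (if \<omega> j = 0 then 0 else x0)"

lemma two_point_integral:
 fixes f :: "'a::zero => 'a => complex"
 assumes "x0 \<noteq> 0"
 shows "(LINT \<omega>|(two_point_space x0). f (two_point_var x0 1 \<omega>) (two_point_var x0 2 \<omega>)) =
  (4 * f 0 0 + 2 * f 0 x0 + 2 * f x0 0 + f x0 x0) / 9"
proof -
 have "(LINT \<omega>|(two_point_space x0). f (two_point_var x0 1 \<omega>) (two_point_var x0 2 \<omega>)) =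
  (\<integral>b. f (if fst b then x0 else 0) (if snd b then x0 else 0) \<partial>measure_pmf two_point_pair)"
  unfolding two_point_space_def integral_map_pmf two_point_var_def using assms
  by (intro Bochner_Integration.integral_cong) auto
 also have "... = (\<Sum>b\<in>{(False,False),(False,True),(True,False),(True,True)}.
   pmf two_point_pair b *\<^sub>R f (if fst b then x0 else 0) (if snd b then x0 else 0))"
  by (rule integral_measure_pmf) auto
 also have "... = (4 * f 0 0 + 2 * f 0 x0 + 2 * f x0 0 + f x0 x0) / 9"
  by (simp add: two_point_pair_def pmf_pair scaleR_conv_of_real add_divide_distrib)
 finally show ?thesis .
qed

lemma two_point_measurable: "two_point_var x0 j \<in> two_point_space x0 \<rightarrow>\<^sub>M borel"
 by (simp add: two_point_space_def)

lemma two_point_char_fun: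
 fixes x0 :: "'a::topological_ab_group_add"
 assumes "x0 \<noteq> 0" "j \<in> {1, 2}"
 shows "char_fun (distr (two_point_space x0) borel (two_point_var x0 j)) y = (2 + char_app y x0) / 3"
proof -
 have "char_fun (distr (two_point_space x0) borel (two_point_var x0 j)) y = (LINT \<omega>|(two_point_space x0). char_app y (two_point_var x0 j \<omega>))"
  unfolding char_fun_def by (rule integral_distr[OF two_point_measurable char_measurable])
 also have "... = (2 + char_app y x0) / 3"
 proof -
  have "(4 * 1 + 2 * 1 + 2 * w + w) / 9 = (2 + w) / 3" "(4 * 1 + 2 * w + 2 * 1 + w) / 9 = (2 + w) / 3" for w :: complex
   by (simp_all add: field_simps)
  thus ?thesis
   using assms(2) two_point_integral[OF assms(1), of "%u v. char_app y u"] two_point_integral[OF assms(1), of "%u v. char_app y v"]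
   by (elim insertE) (simp_all only: char_0_right, simp_all)
 qed
 finally show ?thesis .
qed

lemma two_point_product:
 fixes x0 :: "'a::topological_ab_group_add"
 assumes "x0 \<noteq> 0"
 shows "(LINT \<omega>|(two_point_space x0). char_app u (two_point_var x0 1 \<omega>) * char_app v (two_point_var x0 2 \<omega>)) =
  char_fun (distr (two_point_space x0) borel (two_point_var x0 1)) u * char_fun (distr (two_point_space x0) borel (two_point_var x0 2)) v"
 apply (subst two_point_char_fun[OF assms], simp)
 apply (subst two_point_char_fun[OF assms], simp)
 by (rule trans[OF two_point_integral[OF assms, of "%s t. char_app u s * char_app v t"]]) (simp add: algebra_simps)

lemma Q_independentI_trivial:
 assumes "\<And>j. j \<in> I ==> \<xi> j \<in> M \<rightarrow>\<^sub>M borel"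
  and "\<And>y. (LINT \<omega>|M. (\<Prod>j\<in>I. char_app (y j) (\<xi> j \<omega>))) = (\<Prod>j\<in>I. char_fun (distr M borel (\<xi> j)) (y j))"
 shows "Q_independent M I \<xi>"
 unfolding Q_independent_def
proof (intro conjI ballI exI[of _ "%_. 0"])
 show "polynomial_on (dual_power I) (%_. 0)"
  unfolding polynomial_on_def by (intro exI[of _ 0]) (simp add: difference_def)
qed (use assms in auto)

lemma two_point_forms:
 fixes x0 :: "'a::topological_ab_group_add"
 assumes "x0 \<noteq> 0" "zmult (int p) x0 = 0" "multiples (int p) \<noteq> {0::'a}"
 shows "Q_independent_forms (two_point_space x0) 2 (%j. if j = 1 then 1 else int p) (%j. if j = 1 then int p else 1) (two_point_var x0)"
proof -
 have s: "{1..2::nat} = {1, 2}" by auto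
 have pz: "zmult (int p) (two_point_var x0 j \<omega>) = 0" for j \<omega> using assms(2) by (simp add: two_point_var_def)
 have L1: "linear_form {1..2} (%j. if j = 1 then 1 else int p) (two_point_var x0) = two_point_var x0 1"
  unfolding s by (simp add: linear_form_def fun_eq_iff pz)
 have L2: "linear_form {1..2} (%j. if j = 1 then int p else 1) (two_point_var x0) = two_point_var x0 2"
  unfolding s by (simp add: linear_form_def fun_eq_iff pz)
 have m1: "multiples 1 \<noteq> {0::'a}"
 proof
  assume "multiples 1 = {0::'a}"
  moreover have "zmult 1 x0 \<in> multiples 1" unfolding multiples_def by (rule rangeI)
  ultimately show False using assms(1) by simp
 qed
 have nz: "2 + char_app y x0 \<noteq> 0" for y
 proof
  assume "2 + char_app y x0 = 0"
  hence "norm (char_app y x0) = norm (- 2 :: complex)" by (metis add_eq_0_iff)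
  thus False by simp
 qed
 show ?thesis
  unfolding Q_independent_forms_def
 proof (intro conjI)
  show "prob_space (two_point_space x0)" by (simp add: two_point_space_def prob_space_measure_pmf)
  show "admissible TYPE('a) {1..2} (%j. if j = 1 then 1 else int p)"
   "admissible TYPE('a) {1..2} (%j. if j = 1 then int p else 1)"
   using m1 assms(3) by (auto simp: admissible_def)
  show "Q_independent (two_point_space x0) {1..2} (two_point_var x0)"
   unfolding s by (rule Q_independentI_trivial[OF two_point_measurable]) (simp add: two_point_product[OF assms(1), unfolded One_nat_def])
  show "\<forall>j\<in>{1..2}. \<forall>y. char_fun (distr (two_point_space x0) borel (two_point_var x0 j)) y \<noteq> 0"
   unfolding s
  proof (intro ballI allI)
   fix j y assume "j \<in> {1, 2::nat}"
   from two_point_char_fun[OF assms(1) this, of y]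
   show "char_fun (distr (two_point_space x0) borel (two_point_var x0 j)) y \<noteq> 0" using nz[of y] by auto
  qed
  show "Q_independent (two_point_space x0) UNIV (case_bool (linear_form {1..2} (%j. if j = 1 then 1 else int p) (two_point_var x0))
    (linear_form {1..2} (%j. if j = 1 then int p else 1) (two_point_var x0)))"
   unfolding L1 L2
  proof (rule Q_independentI_trivial)
   show "case_bool (two_point_var x0 1) (two_point_var x0 2) j \<in> two_point_space x0 \<rightarrow>\<^sub>M borel" for j
    by (cases j) (simp_all add: two_point_measurable)
  qed (simp add: UNIV_bool mult.commute two_point_product[OF assms(1), unfolded One_nat_def])
 qed simp
qed

text \<open>For a Gaussian law \<phi>(p y) = p^2 \<phi>(y), and \<phi>(p y) = 0 because (p y)(x0) = 1. So |2 + y(x0)| = 3, that is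
y(x0) = 1, for all y.\<close>
lemma two_point_not_gaussian:
 fixes x0 :: "'a::{topological_ab_group_add,t2_space}"
 assumes lc: "locally_compact_space (euclidean :: 'a topology)"
  and x0: "x0 \<noteq> 0" "zmult (int p) x0 = 0" and "0 < p"
 shows "distr (two_point_space x0) borel (two_point_var x0 1) \<notin> gaussian"
proof
 assume "distr (two_point_space x0) borel (two_point_var x0 1) \<in> gaussian"
 then obtain x and \<phi> :: "'a character => real" where
  par: "\<forall>u v. \<phi> (u + v) + \<phi> (u - v) = 2 * (\<phi> u + \<phi> v)" and
  cf: "\<forall>y. char_fun (distr (two_point_space x0) borel (two_point_var x0 1)) y = char_app y x * exp (- of_real (\<phi> y))"
  unfolding gaussian_def by blast
 have n: "norm ((2 + char_app y x0) / 3) = exp (- \<phi> y)" for y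
 proof -
  have "(2 + char_app y x0) / 3 = char_app y x * exp (- of_real (\<phi> y))"
   using cf two_point_char_fun[OF x0(1), of 1 y] by simp
  thus ?thesis by (simp add: norm_mult)
 qed
 have "char_app y x0 = 1" for y
 proof -
  have "char_app (zmult (int p) y) x0 = 1"
   using x0(2) by (simp only: char_zmult_left char_zmult_right[symmetric] char_0_right)
  hence "exp (- \<phi> (zmult (int p) y)) = 1" using n[of "zmult (int p) y"] by simp
  hence "\<phi> (zmult (int p) y) = 0" by simp
  hence "\<phi> y = 0" using quadratic_function_zmult[of \<phi> p y] par `0 < p` by simp
  hence "norm (2 + char_app y x0) = 3" using n[of y] by (simp add: norm_divide)
  hence "(norm (2 + char_app y x0))^2 = 9" by simp
  moreover have "(norm (char_app y x0 - (- 2)))^2 = (norm (2 + char_app y x0))^2" by (simp add: add.commute)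
  moreover have "(norm (2 + char_app y x0))^2 = 4 + 4 * Re (char_app y x0) + (norm (char_app y x0))^2"
   unfolding cmod_power2 by (simp add: power2_eq_square algebra_simps)
  ultimately have r: "Re (char_app y x0) = 1" by simp
  moreover have "(Re (char_app y x0))^2 + (Im (char_app y x0))^2 = 1" by (simp add: cmod_power2[symmetric])
  ultimately have "Im (char_app y x0) = 0" by simp
  thus ?thesis using r by (simp add: complex_eq_iff)
 qed
 thus False using characters_separate[OF lc x0(1)] by metis
qed


section \<open>The characterisation\<close>

theorem theorem1:
  assumes "locally_compact_space
    (euclidean :: 'a::{topological_ab_group_add, t2_space, second_countable_topology} topology)"
  shows
    "((\<forall>(M :: (nat \<Rightarrow> 'a) measure) n a b (\<xi> :: nat \<Rightarrow> (nat \<Rightarrow> 'a) \<Rightarrow> 'a).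
         Q_independent_forms M n a b \<xi> \<longrightarrow> (\<forall>j\<in>{1..n}. distr M borel (\<xi> j) \<in> gaussian))
      \<longleftrightarrow> torsion_free TYPE('a) \<or> (\<exists>p::nat. prime p \<and> multiples (int p) = {0::'a}))
     \<and> (torsion_free TYPE('a) \<or> (\<exists>p::nat. prime p \<and> multiples (int p) = {0::'a}) \<longrightarrow>
         (\<forall>(M :: 'w measure) n a b (\<xi> :: nat \<Rightarrow> 'w \<Rightarrow> 'a).
           Q_independent_forms M n a b \<xi> \<longrightarrow> (\<forall>j\<in>{1..n}. distr M borel (\<xi> j) \<in> gaussian)))
     \<and> (\<forall>p::nat. prime p \<and> multiples (int p) = {0::'a} \<longrightarrow>
         (\<forall>(M :: 'w measure) n a b (\<xi> :: nat \<Rightarrow> 'w \<Rightarrow> 'a).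
           Q_independent_forms M n a b \<xi> \<longrightarrow> (\<forall>j\<in>{1..n}. distr M borel (\<xi> j) \<in> degenerate)))"
    (is "(?all \<longleftrightarrow> ?cond) \<and> _ \<and> _")
proof (intro conjI)
  show "?cond \<longrightarrow> (\<forall>(M :: 'w measure) n a b (\<xi> :: nat \<Rightarrow> 'w \<Rightarrow> 'a).
      Q_independent_forms M n a b \<xi> \<longrightarrow> (\<forall>j\<in>{1..n}. distr M borel (\<xi> j) \<in> gaussian))"
    using torsion_free_gaussian[OF assms] degenerate_gaussian[OF prime_exponent_degenerate[OF assms]] by blast
  show "\<forall>p::nat. prime p \<and> multiples (int p) = {0::'a} \<longrightarrow>
      (\<forall>(M :: 'w measure) n a b (\<xi> :: nat \<Rightarrow> 'w \<Rightarrow> 'a).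
        Q_independent_forms M n a b \<xi> \<longrightarrow> (\<forall>j\<in>{1..n}. distr M borel (\<xi> j) \<in> degenerate))"
    using prime_exponent_degenerate[OF assms] by blast
  show "?all \<longleftrightarrow> ?cond"
  proof
    show ?all if ?cond
      using that torsion_free_gaussian[OF assms] degenerate_gaussian[OF prime_exponent_degenerate[OF assms]] by blast
    assume all: ?all
    show ?cond
    proof (rule ccontr)
      assume "\<not> ?cond"
      then have tf: "\<not> torsion_free TYPE('a)" and np: "\<And>p::nat. prime p \<Longrightarrow> multiples (int p) \<noteq> {0::'a}" by auto
      obtain p and x0 :: 'a where p: "prime (p::nat)" "x0 \<noteq> 0" "zmult (int p) x0 = 0"
        using ex_prime_order_element[OF tf] by blast
      have "distr (two_point_space x0) borel (two_point_var x0 1) \<in> gaussian"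
        using all two_point_forms[OF p(2,3) np[OF p(1)]] by fastforce
      then show False using two_point_not_gaussian[OF assms p(2,3)] prime_gt_0_nat[OF p(1)] by blast
    qed
  qed
qed


end
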